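(* Let $c_1,c_2\in\mathbb C$. The vacuum module $V_{\mathfrak g}(c_1,c_2)$ of the N=1 BMS superalgebra $\mathfrak g$ has a vertex superalgebra structure, which is uniquely determined by the condition that $\mathbb{1}$ is the vacuum vector, $Dv=L_{-1}v$, and $$Y(L_{-2}\mathbb{1},z)=L(z),\qquad Y(M_{-2}\mathbb{1},z)=M(z),\qquad Y(Q_{-\frac32}\mathbb{1},z)=Q(z).$$ Moreover, there is a one-to-one correspondence between smooth $\mathfrak g$-modules of central charge $(c_1,c_2)$ and $V_{\mathfrak g}(c_1,c_2)$-modules.
   Context: The N=1 BMS superalgebra $\mathfrak g$ is the complex Lie superalgebra with even basis $L_n,M_n$ ($n\in\mathbb Z$), $\mathbf c_1,\mathbf c_2$, odd basis $Q_r$ ($r\in\mathbb Z+\frac12$), and brackets $[L_m,L_n]=(m-n)L_{m+n}+\frac1{12}\delta_{m+n,0}(m^3-m)\mathbf c_1$, $[L_m,M_n]=(m-n)M_{m+n}+\frac1{12}\delta_{m+n,0}(m^3-m)\mathbf c_2$, $[Q_r,Q_s]=2M_{r+s}+\frac13\delta_{r+s,0}(r^2-\frac14)\mathbf c_2$, $[L_m,Q_r]=(\frac m2-r)Q_{m+r}$, $[M_m,M_n]=[M_n,Q_r]=0$, with $\mathbf c_1,\mathbf c_2$ central. A $\mathfrak g$-module $W$ is smooth if for every $w\in W$, $L_iw=M_iw=Q_{i-\frac12}w=0$ for all sufficiently large $i$; it has central charge $(c_1,c_2)$ if $\mathbf c_1,\mathbf c_2$ act as the scalars $c_1,c_2$.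 Let $M_{\mathfrak g}(0,0,c_1,c_2)$ be the Verma module, i.e. the $\mathfrak g$-module induced from the one-dimensional module (spanned by $\mathbf 1$) of the subalgebra spanned by $L_n,M_n$ ($n\ge0$), $Q_r$ ($r>0$), $\mathbf c_1,\mathbf c_2$, on which $L_n,M_n,Q_r$ act as $0$ and $\mathbf c_i$ acts as $c_i$. The vacuum module is $V_{\mathfrak g}(c_1,c_2)=M_{\mathfrak g}(0,0,c_1,c_2)/J$, where $J$ is the submodule generated by $L_{-1}\mathbf 1$, and $\mathbb{1}=\mathbf 1+J$. On it put $L(z)=\sum_{n\in\mathbb Z}L_nz^{-n-2}$, $M(z)=\sum_{n\in\mathbb Z}M_nz^{-n-2}$, $Q(z)=\sum_{r\in\mathbb Z+\frac12}Q_rz^{-r-\frac32}$, elements of $\mathrm{End}(V_{\mathfrak g}(c_1,c_2))[[z,z^{-1}]]$. A vertex superalgebra is a quadruple $(V,\mathbb{1},D,Y)$ with $V=\bigoplus_{n\in\frac12\mathbb Z}V_n=V_{\bar0}\oplus V_{\bar1}$ a $\frac12\mathbb Z$-graded super vector space, $V_{\bar0}=\sum_{n\in\mathbb Z}V_n$, $V_{\bar1}=\sum_{n\in\mathbb Z+\frac12}V_n$, $\mathbb{1}\in V$ (the vacuum vector), $D\in\mathrm{End}\,V$, and a linear map $Y:V\to(\mathrm{End}\,V)[[z,z^{-1}]]$, $v\mapsto Y(v,z)=\sum_{n\in\mathbb Z}v_nz^{-n-1}$ ($v_n$ of the same parity as $v$), such that for $u,v\in V$: $u_nv=0$ for $n$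 sufficiently large; $Y(\mathbb{1},z)=\mathrm{Id}_V$; $Y(v,z)\mathbb{1}\in V[[z]]$ with $\lim_{z\to0}Y(v,z)\mathbb{1}=v$; $\frac d{dz}Y(v,z)=Y(Dv,z)=[D,Y(v,z)]$; and for $\mathbb Z_2$-homogeneous $u,v$ (of parities $|u|,|v|$) the Jacobi identity $$z_0^{-1}\delta\Big(\tfrac{z_1-z_2}{z_0}\Big)Y(u,z_1)Y(v,z_2)-(-1)^{|u||v|}z_0^{-1}\delta\Big(\tfrac{z_2-z_1}{-z_0}\Big)Y(v,z_2)Y(u,z_1)=z_2^{-1}\delta\Big(\tfrac{z_1-z_0}{z_2}\Big)Y(Y(u,z_0)v,z_2)$$ holds, where $\delta(z)=\sum_{n\in\mathbb Z}z^n$ and $(z_i-z_j)^n$ is expanded as a formal power series in $z_j$. A module over a vertex superalgebra $V$ is a triple $(M,d,Y_M)$ with $M$ a $\mathbb Z_2$-graded vector space, $d\in\mathrm{End}\,M$, and a linear map $Y_M:V\to(\mathrm{End}\,M)[[z,z^{-1}]]$, $v\mapsto Y_M(v,z)=\sum_{n\in\mathbb Z}v_nz^{-n-1}$ ($v_n\in\mathrm{End}\,M$), such that for all $u,v\in V$, $w\in M$: $u_nw=0$ for $n$ sufficiently large; $Y_M(\mathbb{1},z)=\mathrm{Id}_M$; $\frac d{dz}Y_M(v,z)=Y_M(Dv,z)=[d,Y_M(v,z)]$; and for $\mathbb Z_2$-homogeneous $u,v$ the Jacobi identity $$z_0^{-1}\delta\Big(\tfrac{z_1-z_2}{z_0}\Big)Y_M(u,z_1)Y_M(v,z_2)-(-1)^{|u||v|}z_0^{-1}\delta\Big(\tfrac{z_2-z_1}{-z_0}\Big)Y_M(v,z_2)Y_M(u,z_1)=z_2^{-1}\delta\Big(\tfrac{z_1-z_0}{z_2}\Big)Y_M(Y(u,z_0)v,z_2)$$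 holds.
   Formalization: V-modules (M,d,Y_M) are counted by Y_M alone, since d is not determined by Y_M (d plus a scalar also works), so the correspondence with literal triples is not one-to-one; it is proved in addition that d = L_{-1} is always a valid choice. *)

theory Defs
  imports Complex_Main "HOL-Library.Poly_Mapping" "HOL-Library.FuncSet"
    "HOL-Algebra.AbelCoset" "HOL-Algebra.Module"
begin

section \<open>Complex vector spaces with explicit carriers\<close>

text \<open>The vacuum module is a quotient depending on the term parameters \<open>c1\<close>, \<open>c2\<close>, so vector
  spaces are \<^locale>\<open>Module.module\<close>s over the ring below rather than types. The fields \<^const>\<open>mult\<close> and
  \<^const>\<open>one\<close> that the record type inherits from rings are irrelevant to \<^locale>\<open>Module.module\<close>.\<close>

definition complex_ring :: "complex ring" where
  "complex_ring = \<lparr>carrier = UNIV, mult = (*), one = 1, zero = 0, add = (+)\<rparr>"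

abbreviation cvspace :: "(complex, 'a) module \<Rightarrow> bool" where
  "cvspace W \<equiv> Module.module complex_ring W"

abbreviation csubspace :: "(complex, 'a) module \<Rightarrow> 'a set \<Rightarrow> bool" where
  "csubspace W U \<equiv> submodule U complex_ring W"

text \<open>Linear endomorphisms are \<^const>\<open>extensional\<close>, so that equality of operators is equality on
  the carrier.\<close>

definition cEnd :: "(complex, 'a) module \<Rightarrow> ('a \<Rightarrow> 'a) set" where
  "cEnd W = {f \<in> carrier W \<rightarrow>\<^sub>E carrier W.
     (\<forall>x\<in>carrier W. \<forall>y\<in>carrier W. f (x \<oplus>\<^bsub>W\<^esub> y) = f x \<oplus>\<^bsub>W\<^esub> f y) \<and>
     (\<forall>a. \<forall>x\<in>carrier W. f (a \<odot>\<^bsub>W\<^esub> x) = a \<odot>\<^bsub>W\<^esub> f x)}"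

definition fsum :: "(complex, 'a) module \<Rightarrow> ('i \<Rightarrow> 'a) \<Rightarrow> 'a" where
  "fsum W f = finsum W f {i. f i \<noteq> \<zero>\<^bsub>W\<^esub>}"

definition direct_sum :: "(complex, 'a) module \<Rightarrow> ('i \<Rightarrow> 'a set) \<Rightarrow> bool" where
  "direct_sum W G \<longleftrightarrow> (\<forall>i. csubspace W (G i)) \<and>
     (\<forall>w\<in>carrier W. \<exists>!f. (\<forall>i. f i \<in> G i) \<and> finite {i. f i \<noteq> \<zero>\<^bsub>W\<^esub>} \<and> w = fsum W f)"

definition quot_space :: "(complex, 'a) module \<Rightarrow> 'a set \<Rightarrow> (complex, 'a set) module" where
  "quot_space W N = \<lparr>carrier = a_rcosets\<^bsub>W\<^esub> N, mult = undefined, one = undefined,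
     zero = N, add = (<+>\<^bsub>W\<^esub>), smult = (\<lambda>a X. \<Union>x\<in>X. N +>\<^bsub>W\<^esub> (a \<odot>\<^bsub>W\<^esub> x))\<rparr>"

text \<open>For \<open>f\<close> with \<open>f ` N \<subseteq> N\<close>, the induced operator on the quotient by \<open>N\<close>.\<close>

definition quot_op :: "(complex, 'a) module \<Rightarrow> 'a set \<Rightarrow> ('a \<Rightarrow> 'a) \<Rightarrow> 'a set \<Rightarrow> 'a set" where
  "quot_op W N f = (\<lambda>X\<in>carrier (quot_space W N). \<Union>x\<in>X. N +>\<^bsub>W\<^esub> f x)"


section \<open>Super vector spaces\<close>

text \<open>Parities are booleans, \<^const>\<open>True\<close> being odd; \<open>P \<noteq> Q\<close> is the sum of two parities.\<close>

definition koszul :: "bool \<Rightarrow> bool \<Rightarrow> complex" where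
  "koszul p q = (if p \<and> q then - 1 else 1)"

definition superspace :: "(complex, 'a) module \<Rightarrow> (bool \<Rightarrow> 'a set) \<Rightarrow> bool" where
  "superspace W P \<longleftrightarrow> cvspace W \<and> direct_sum W P"

text \<open>Gradings by half-integers are indexed by integers: \<open>G k\<close> is the component of degree \<open>k/2\<close>.
  The even (odd) part is the sum of the components of integral (non-integral) degree.\<close>

definition parity_part :: "(complex, 'a) module \<Rightarrow> (int \<Rightarrow> 'a set) \<Rightarrow> bool \<Rightarrow> 'a set" where
  "parity_part V G p = {v. \<exists>f. (\<forall>k. f k \<in> G k \<and> (f k \<noteq> \<zero>\<^bsub>V\<^esub> \<longrightarrow> odd k = p)) \<and>
     finite {k. f k \<noteq> \<zero>\<^bsub>V\<^esub>} \<and> v = fsum V f}"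


section \<open>Vertex superalgebras and their modules\<close>

text \<open>\<open>Y v n\<close> is the mode \<open>v\<^sub>n\<close>, i.e. the coefficient of \<open>z\<^bsup>-n-1\<^esup>\<close> in \<open>Y(v,z)\<close>.\<close>

definition linear_fields ::
  "(complex, 'v) module \<Rightarrow> (complex, 'w) module \<Rightarrow> ('v \<Rightarrow> int \<Rightarrow> 'w \<Rightarrow> 'w) \<Rightarrow> bool" where
  "linear_fields V W Y \<longleftrightarrow> Y \<in> carrier V \<rightarrow>\<^sub>E (UNIV \<rightarrow> cEnd W) \<and>
     (\<forall>u\<in>carrier V. \<forall>v\<in>carrier V. \<forall>n. \<forall>w\<in>carrier W.
        Y (u \<oplus>\<^bsub>V\<^esub> v) n w = Y u n w \<oplus>\<^bsub>W\<^esub> Y v n w) \<and>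
     (\<forall>a. \<forall>v\<in>carrier V. \<forall>n. \<forall>w\<in>carrier W. Y (a \<odot>\<^bsub>V\<^esub> v) n w = a \<odot>\<^bsub>W\<^esub> Y v n w)"

definition truncated ::
  "(complex, 'v) module \<Rightarrow> (complex, 'w) module \<Rightarrow> ('v \<Rightarrow> int \<Rightarrow> 'w \<Rightarrow> 'w) \<Rightarrow> bool" where
  "truncated V W Y \<longleftrightarrow>
     (\<forall>v\<in>carrier V. \<forall>w\<in>carrier W. \<exists>N. \<forall>n\<ge>N. Y v n w = \<zero>\<^bsub>W\<^esub>)"

definition vacuum_identity ::
  "(complex, 'w) module \<Rightarrow> 'v \<Rightarrow> ('v \<Rightarrow> int \<Rightarrow> 'w \<Rightarrow> 'w) \<Rightarrow> bool" where
  "vacuum_identity W vac Y \<longleftrightarrow>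
     (\<forall>n. \<forall>w\<in>carrier W. Y vac n w = (if n = - 1 then w else \<zero>\<^bsub>W\<^esub>))"

text \<open>\<open>d/dz Y(v,z) = Y(Dv,z) = [d, Y(v,z)]\<close>; the coefficient of \<open>z\<^bsup>-n-1\<^esup>\<close> in \<open>d/dz Y(v,z)\<close> is
  \<open>-n v\<^bsub>n-1\<^esub>\<close>.\<close>

definition derivative_property ::
  "(complex, 'v) module \<Rightarrow> ('v \<Rightarrow> 'v) \<Rightarrow> (complex, 'w) module \<Rightarrow> ('w \<Rightarrow> 'w) \<Rightarrow>
   ('v \<Rightarrow> int \<Rightarrow> 'w \<Rightarrow> 'w) \<Rightarrow> bool" where
  "derivative_property V D W d Y \<longleftrightarrow>
     (\<forall>v\<in>carrier V. \<forall>n. \<forall>w\<in>carrier W.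
        Y (D v) n w = (- of_int n) \<odot>\<^bsub>W\<^esub> Y v (n - 1) w \<and>
        Y (D v) n w = d (Y v n w) \<ominus>\<^bsub>W\<^esub> Y v n (d w))"

text \<open>The coefficient of \<open>x\<^sup>p y\<^sup>q\<close> in \<open>(x - y)\<^sup>n\<close>, expanded in nonnegative powers of \<open>y\<close>.\<close>

definition binexp :: "int \<Rightarrow> int \<Rightarrow> int \<Rightarrow> complex" where
  "binexp n p q =
     (if q \<ge> 0 \<and> p + q = n then (- 1) ^ nat q * (of_int n gchoose nat q) else 0)"

text \<open>The coefficients of \<open>z\<^sub>0\<^sup>i z\<^sub>1\<^sup>j z\<^sub>2\<^sup>k\<close> in the three formal delta functions
  \<open>z\<^sub>0\<^bsup>-1\<^esup> \<delta>((z\<^sub>1 - z\<^sub>2)/z\<^sub>0)\<close>, \<open>z\<^sub>0\<^bsup>-1\<^esup> \<delta>((z\<^sub>2 - z\<^sub>1)/(-z\<^sub>0))\<close> and \<open>z\<^sub>2\<^bsup>-1\<^esup> \<delta>((z\<^sub>1 - z\<^sub>0)/z\<^sub>2)\<close>,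
  where \<open>\<delta>(z)\<close> is the sum of all \<open>z\<^sup>n\<close>; e.g. the first is the sum of \<open>z\<^sub>0\<^bsup>-n-1\<^esup> (z\<^sub>1 - z\<^sub>2)\<^sup>n\<close>.\<close>

definition delta1 :: "int \<Rightarrow> int \<Rightarrow> int \<Rightarrow> complex" where
  "delta1 i j k = binexp (- i - 1) j k"

definition delta2 :: "int \<Rightarrow> int \<Rightarrow> int \<Rightarrow> complex" where
  "delta2 i j k = (- 1) powi (- i - 1) * binexp (- i - 1) k j"

definition delta3 :: "int \<Rightarrow> int \<Rightarrow> int \<Rightarrow> complex" where
  "delta3 i j k = binexp (- k - 1) j i"

text \<open>The Jacobi identity, applied to \<open>w\<close> and read off at \<open>z\<^sub>0\<^sup>i z\<^sub>1\<^sup>j z\<^sub>2\<^sup>k\<close>, each side being a Cauchy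
  product of formal series: the coefficient of \<open>z\<^sub>1\<^sup>j z\<^sub>2\<^sup>k\<close> in \<open>Y(u,z\<^sub>1)Y(v,z\<^sub>2)w\<close> is
  \<open>u\<^bsub>-j-1\<^esub>v\<^bsub>-k-1\<^esub>w\<close>. Under \<^const>\<open>truncated\<close> (for \<open>Y\<close> and \<open>Y'\<close>) all three sums have
  finite support. \<open>Y\<close> is the vertex operator map of the algebra, \<open>Y'\<close> that of the module.\<close>

definition jacobi_identity ::
  "('v \<Rightarrow> int \<Rightarrow> 'v \<Rightarrow> 'v) \<Rightarrow> (complex, 'w) module \<Rightarrow> ('v \<Rightarrow> int \<Rightarrow> 'w \<Rightarrow> 'w) \<Rightarrow>
   bool \<Rightarrow> bool \<Rightarrow> 'v \<Rightarrow> 'v \<Rightarrow> bool" where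
  "jacobi_identity Y W Y' pu pv u v \<longleftrightarrow>
     (\<forall>w\<in>carrier W. \<forall>i j k.
        fsum W (\<lambda>(p, q). delta1 i p q \<odot>\<^bsub>W\<^esub> Y' u (- (j - p) - 1) (Y' v (- (k - q) - 1) w))
        \<ominus>\<^bsub>W\<^esub> koszul pu pv \<odot>\<^bsub>W\<^esub>
          fsum W (\<lambda>(p, q). delta2 i p q \<odot>\<^bsub>W\<^esub> Y' v (- (k - q) - 1) (Y' u (- (j - p) - 1) w))
        = fsum W (\<lambda>(p, q). delta3 p j q \<odot>\<^bsub>W\<^esub> Y' (Y u (- (i - p) - 1) v) (- (k - q) - 1) w))"

definition vertex_superalgebra ::
  "(complex, 'v) module \<Rightarrow> (int \<Rightarrow> 'v set) \<Rightarrow> 'v \<Rightarrow> ('v \<Rightarrow> 'v) \<Rightarrow>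
   ('v \<Rightarrow> int \<Rightarrow> 'v \<Rightarrow> 'v) \<Rightarrow> bool" where
  "vertex_superalgebra V G vac D Y \<longleftrightarrow>
     cvspace V \<and> direct_sum V G \<and> vac \<in> carrier V \<and> D \<in> cEnd V \<and>
     linear_fields V V Y \<and>
     (\<forall>p q. \<forall>u\<in>parity_part V G p. \<forall>v\<in>parity_part V G q. \<forall>n.
        Y u n v \<in> parity_part V G (p \<noteq> q)) \<and>
     truncated V V Y \<and>
     vacuum_identity V vac Y \<and>
     (\<forall>v\<in>carrier V. (\<forall>n\<ge>0. Y v n vac = \<zero>\<^bsub>V\<^esub>) \<and> Y v (- 1) vac = v) \<and>
     derivative_property V D V D Y \<and>
     (\<forall>p q. \<forall>u\<in>parity_part V G p. \<forall>v\<in>parity_part V G q. jacobi_identity Y V Y p q u v)"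

definition vertex_module ::
  "(complex, 'v) module \<Rightarrow> (int \<Rightarrow> 'v set) \<Rightarrow> 'v \<Rightarrow> ('v \<Rightarrow> 'v) \<Rightarrow>
   ('v \<Rightarrow> int \<Rightarrow> 'v \<Rightarrow> 'v) \<Rightarrow>
   (complex, 'w) module \<Rightarrow> (bool \<Rightarrow> 'w set) \<Rightarrow> ('w \<Rightarrow> 'w) \<Rightarrow> ('v \<Rightarrow> int \<Rightarrow> 'w \<Rightarrow> 'w) \<Rightarrow> bool" where
  "vertex_module V G vac D Y W P d Y' \<longleftrightarrow>
     superspace W P \<and> d \<in> cEnd W \<and>
     linear_fields V W Y' \<and>
     truncated V W Y' \<and>
     vacuum_identity W vac Y' \<and>
     derivative_property V D W d Y' \<and>
     (\<forall>p q. \<forall>u\<in>parity_part V G p. \<forall>v\<in>parity_part V G q. jacobi_identity Y W Y' p q u v)"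

text \<open>The modes of \<open>v\<close> on a module have the same parity as \<open>v\<close>; not part of \<^const>\<open>vertex_module\<close>.\<close>

definition parity_preserving_fields ::
  "(complex, 'v) module \<Rightarrow> (int \<Rightarrow> 'v set) \<Rightarrow> (bool \<Rightarrow> 'w set) \<Rightarrow> ('v \<Rightarrow> int \<Rightarrow> 'w \<Rightarrow> 'w) \<Rightarrow> bool" where
  "parity_preserving_fields V G P Y' \<longleftrightarrow>
     (\<forall>p q. \<forall>v\<in>parity_part V G p. \<forall>w\<in>P q. \<forall>n. Y' v n w \<in> P (p \<noteq> q))"


section \<open>The N=1 BMS superalgebra and its modules\<close>

text \<open>\<open>Qgen k\<close> stands for \<open>Q\<^sub>r\<close> with \<open>r = k + 1/2\<close>.\<close>

datatype bms_gen = Lgen int | Mgen int | Qgen int | C1gen | C2gen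

type_synonym bms = "bms_gen \<Rightarrow>\<^sub>0 complex"

definition pm_scale :: "complex \<Rightarrow> ('b \<Rightarrow>\<^sub>0 complex) \<Rightarrow> ('b \<Rightarrow>\<^sub>0 complex)" where
  "pm_scale a x = Poly_Mapping.map ((*) a) x"

abbreviation gen :: "bms_gen \<Rightarrow> bms" where
  "gen b \<equiv> Poly_Mapping.single b 1"

definition half_up :: "int \<Rightarrow> complex" where
  "half_up k = of_int k + 1 / 2"

fun gen_bracket :: "bms_gen \<Rightarrow> bms_gen \<Rightarrow> bms" where
  "gen_bracket (Lgen m) (Lgen n) =
     Poly_Mapping.single (Lgen (m + n)) (of_int (m - n)) +
     (if m + n = 0 then Poly_Mapping.single C1gen ((of_int m ^ 3 - of_int m) / 12) else 0)"
| "gen_bracket (Lgen m) (Mgen n) =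
     Poly_Mapping.single (Mgen (m + n)) (of_int (m - n)) +
     (if m + n = 0 then Poly_Mapping.single C2gen ((of_int m ^ 3 - of_int m) / 12) else 0)"
| "gen_bracket (Mgen n) (Lgen m) =
     - (Poly_Mapping.single (Mgen (m + n)) (of_int (m - n)) +
        (if m + n = 0 then Poly_Mapping.single C2gen ((of_int m ^ 3 - of_int m) / 12) else 0))"
| "gen_bracket (Qgen k) (Qgen l) =
     Poly_Mapping.single (Mgen (k + l + 1)) 2 +
     (if k + l + 1 = 0 then Poly_Mapping.single C2gen ((half_up k ^ 2 - 1 / 4) / 3) else 0)"
| "gen_bracket (Lgen m) (Qgen k) =
     Poly_Mapping.single (Qgen (m + k)) (of_int m / 2 - half_up k)"
| "gen_bracket (Qgen k) (Lgen m) =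
     - Poly_Mapping.single (Qgen (m + k)) (of_int m / 2 - half_up k)"
| "gen_bracket _ _ = 0"

definition bms_bracket :: "bms \<Rightarrow> bms \<Rightarrow> bms" where
  "bms_bracket x y = (\<Sum>a\<in>Poly_Mapping.keys x. \<Sum>b\<in>Poly_Mapping.keys y.
     pm_scale (Poly_Mapping.lookup x a * Poly_Mapping.lookup y b) (gen_bracket a b))"

definition gen_odd :: "bms_gen \<Rightarrow> bool" where
  "gen_odd b \<longleftrightarrow> (\<exists>k. b = Qgen k)"

definition bms_part :: "bool \<Rightarrow> bms set" where
  "bms_part p = {x. \<forall>b\<in>Poly_Mapping.keys x. gen_odd b = p}"

definition bms_module :: "(complex, 'w) module \<Rightarrow> (bms \<Rightarrow> 'w \<Rightarrow> 'w) \<Rightarrow> bool" where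
  "bms_module W \<rho> \<longleftrightarrow> cvspace W \<and> (\<forall>x. \<rho> x \<in> cEnd W) \<and>
     (\<forall>x y. \<forall>w\<in>carrier W. \<rho> (x + y) w = \<rho> x w \<oplus>\<^bsub>W\<^esub> \<rho> y w) \<and>
     (\<forall>a x. \<forall>w\<in>carrier W. \<rho> (pm_scale a x) w = a \<odot>\<^bsub>W\<^esub> \<rho> x w) \<and>
     (\<forall>p q. \<forall>x\<in>bms_part p. \<forall>y\<in>bms_part q. \<forall>w\<in>carrier W.
        \<rho> (bms_bracket x y) w = \<rho> x (\<rho> y w) \<ominus>\<^bsub>W\<^esub> koszul p q \<odot>\<^bsub>W\<^esub> \<rho> y (\<rho> x w))"

definition smooth :: "(complex, 'w) module \<Rightarrow> (bms \<Rightarrow> 'w \<Rightarrow> 'w) \<Rightarrow> bool" where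
  "smooth W \<rho> \<longleftrightarrow> (\<forall>w\<in>carrier W. \<exists>N. \<forall>i\<ge>N.
     \<rho> (gen (Lgen i)) w = \<zero>\<^bsub>W\<^esub> \<and> \<rho> (gen (Mgen i)) w = \<zero>\<^bsub>W\<^esub> \<and> \<rho> (gen (Qgen (i - 1))) w = \<zero>\<^bsub>W\<^esub>)"

definition central_charge ::
  "(complex, 'w) module \<Rightarrow> (bms \<Rightarrow> 'w \<Rightarrow> 'w) \<Rightarrow> complex \<Rightarrow> complex \<Rightarrow> bool" where
  "central_charge W \<rho> c1 c2 \<longleftrightarrow> (\<forall>w\<in>carrier W.
     \<rho> (gen C1gen) w = c1 \<odot>\<^bsub>W\<^esub> w \<and> \<rho> (gen C2gen) w = c2 \<odot>\<^bsub>W\<^esub> w)"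

definition parity_preserving_action ::
  "(bool \<Rightarrow> 'w set) \<Rightarrow> (bms \<Rightarrow> 'w \<Rightarrow> 'w) \<Rightarrow> bool" where
  "parity_preserving_action P \<rho> \<longleftrightarrow>
     (\<forall>p q. \<forall>x\<in>bms_part p. \<forall>w\<in>P q. \<rho> x w \<in> P (p \<noteq> q))"


section \<open>The Verma module and the vacuum module\<close>

text \<open>Words form the free monoid under concatenation, so that \<open>bms_gen list \<Rightarrow>\<^sub>0 complex\<close>, with the
  convolution product of \<^theory>\<open>HOL-Library.Poly_Mapping\<close>, is the free associative algebra on
  the basis of the Lie superalgebra, i.e. its tensor algebra.\<close>

instantiation list :: (type) monoid_add
begin

definition zero_list :: "'a list" where "zero_list = []"

definition plus_list :: "'a list \<Rightarrow> 'a list \<Rightarrow> 'a list" where "plus_list xs ys = xs @ ys"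

instance
  by standard (simp_all add: zero_list_def plus_list_def)

end

type_synonym tensor_alg = "bms_gen list \<Rightarrow>\<^sub>0 complex"

definition tensor_space :: "(complex, tensor_alg) module" where
  "tensor_space = \<lparr>carrier = UNIV, mult = (*), one = 1, zero = 0, add = (+), smult = pm_scale\<rparr>"

definition tensor_incl :: "bms \<Rightarrow> tensor_alg" where
  "tensor_incl x = (\<Sum>b\<in>Poly_Mapping.keys x. Poly_Mapping.single [b] (Poly_Mapping.lookup x b))"

definition nonneg_gen :: "bms_gen \<Rightarrow> bool" where
  "nonneg_gen b \<longleftrightarrow> b \<in> Lgen ` {0..} \<union> Mgen ` {0..} \<union> Qgen ` {0..} \<union> {C1gen, C2gen}"

definition verma_char :: "complex \<Rightarrow> complex \<Rightarrow> bms_gen \<Rightarrow> complex" where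
  "verma_char c1 c2 b = (if b = C1gen then c1 else if b = C2gen then c2 else 0)"

text \<open>The universal enveloping algebra \<open>U\<close> is the tensor algebra modulo the two-sided ideal given
  by the supercommutators (\<open>supercomm\<close>); the module induced from the character \<open>\<chi>\<close> of the
  subalgebra spanned by the \<^const>\<open>nonneg_gen\<close>s is \<open>U\<close> modulo the left ideal generated by the
  elements \<open>b - \<chi>(b)\<close> (\<open>character\<close>). The set below is the preimage of that left ideal in the
  tensor algebra.\<close>

inductive_set verma_rel :: "complex \<Rightarrow> complex \<Rightarrow> tensor_alg set" for c1 c2 where
  zero: "0 \<in> verma_rel c1 c2"
| add: "s \<in> verma_rel c1 c2 \<Longrightarrow> t \<in> verma_rel c1 c2 \<Longrightarrow> s + t \<in> verma_rel c1 c2"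
| supercomm: "s * (tensor_incl (gen a) * tensor_incl (gen b)
      - pm_scale (koszul (gen_odd a) (gen_odd b)) (tensor_incl (gen b) * tensor_incl (gen a))
      - tensor_incl (gen_bracket a b)) * t \<in> verma_rel c1 c2"
| character: "nonneg_gen b \<Longrightarrow>
    s * (tensor_incl (gen b) - pm_scale (verma_char c1 c2 b) 1) \<in> verma_rel c1 c2"

definition verma :: "complex \<Rightarrow> complex \<Rightarrow> (complex, tensor_alg set) module" where
  "verma c1 c2 = quot_space tensor_space (verma_rel c1 c2)"

definition verma_act ::
  "complex \<Rightarrow> complex \<Rightarrow> bms \<Rightarrow> tensor_alg set \<Rightarrow> tensor_alg set" where
  "verma_act c1 c2 x = quot_op tensor_space (verma_rel c1 c2) (\<lambda>t. tensor_incl x * t)"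

definition verma_one :: "complex \<Rightarrow> complex \<Rightarrow> tensor_alg set" where
  "verma_one c1 c2 = verma_rel c1 c2 +>\<^bsub>tensor_space\<^esub> 1"

definition vacuum_ideal :: "complex \<Rightarrow> complex \<Rightarrow> tensor_alg set set" where
  "vacuum_ideal c1 c2 = \<Inter>{N. csubspace (verma c1 c2) N \<and>
     (\<forall>x. \<forall>w\<in>N. verma_act c1 c2 x w \<in> N) \<and>
     verma_act c1 c2 (gen (Lgen (- 1))) (verma_one c1 c2) \<in> N}"

type_synonym vacuum_elt = "tensor_alg set set"

definition vacuum :: "complex \<Rightarrow> complex \<Rightarrow> (complex, vacuum_elt) module" where
  "vacuum c1 c2 = quot_space (verma c1 c2) (vacuum_ideal c1 c2)"

definition vacuum_act ::
  "complex \<Rightarrow> complex \<Rightarrow> bms \<Rightarrow> vacuum_elt \<Rightarrow> vacuum_elt" where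
  "vacuum_act c1 c2 x = quot_op (verma c1 c2) (vacuum_ideal c1 c2) (verma_act c1 c2 x)"

definition vacuum_one :: "complex \<Rightarrow> complex \<Rightarrow> vacuum_elt" where
  "vacuum_one c1 c2 = vacuum_ideal c1 c2 +>\<^bsub>verma c1 c2\<^esub> verma_one c1 c2"

text \<open>The conformal-weight grading: degree \<open>k/2\<close> is the corresponding eigenspace of \<open>L\<^sub>0\<close>. A monomial
  in the generators applied to the vacuum has integral weight iff it has an even number of
  factors \<open>Q\<^sub>r\<close>, so this induces the usual parity.\<close>

definition vacuum_grading :: "complex \<Rightarrow> complex \<Rightarrow> int \<Rightarrow> vacuum_elt set" where
  "vacuum_grading c1 c2 k = {v \<in> carrier (vacuum c1 c2).
     vacuum_act c1 c2 (gen (Lgen 0)) v = (of_int k / 2) \<odot>\<^bsub>vacuum c1 c2\<^esub> v}"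

text \<open>\<open>L\<^bsub>-2\<^esub>\<one>\<close>, \<open>M\<^bsub>-2\<^esub>\<one>\<close> and \<open>Q\<^bsub>-3/2\<^esub>\<one>\<close>.\<close>

definition vacuum_L :: "complex \<Rightarrow> complex \<Rightarrow> vacuum_elt" where
  "vacuum_L c1 c2 = vacuum_act c1 c2 (gen (Lgen (- 2))) (vacuum_one c1 c2)"

definition vacuum_M :: "complex \<Rightarrow> complex \<Rightarrow> vacuum_elt" where
  "vacuum_M c1 c2 = vacuum_act c1 c2 (gen (Mgen (- 2))) (vacuum_one c1 c2)"

definition vacuum_Q :: "complex \<Rightarrow> complex \<Rightarrow> vacuum_elt" where
  "vacuum_Q c1 c2 = vacuum_act c1 c2 (gen (Qgen (- 2))) (vacuum_one c1 c2)"

text \<open>\<open>Y(L\<^bsub>-2\<^esub>\<one>,z) = L(z)\<close>, \<open>Y(M\<^bsub>-2\<^esub>\<one>,z) = M(z)\<close> and \<open>Y(Q\<^bsub>-3/2\<^esub>\<one>,z) = Q(z)\<close> as operators on \<open>W\<close>: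
  in \<open>L(z)\<close>, \<open>M(z)\<close>, \<open>Q(z)\<close> the coefficients of \<open>z\<^bsup>-n-1\<^esup>\<close> are \<open>L\<^bsub>n-1\<^esub>\<close>, \<open>M\<^bsub>n-1\<^esub>\<close>, \<open>Q\<^bsub>n-1/2\<^esub>\<close>.\<close>

definition generating_fields ::
  "complex \<Rightarrow> complex \<Rightarrow> (complex, 'w) module \<Rightarrow> (bms \<Rightarrow> 'w \<Rightarrow> 'w) \<Rightarrow>
   (vacuum_elt \<Rightarrow> int \<Rightarrow> 'w \<Rightarrow> 'w) \<Rightarrow> bool" where
  "generating_fields c1 c2 W \<rho> Y \<longleftrightarrow> (\<forall>n. \<forall>w\<in>carrier W.
     Y (vacuum_L c1 c2) n w = \<rho> (gen (Lgen (n - 1))) w \<and>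
     Y (vacuum_M c1 c2) n w = \<rho> (gen (Mgen (n - 1))) w \<and>
     Y (vacuum_Q c1 c2) n w = \<rho> (gen (Qgen (n - 1))) w)"

definition vacuum_vertex_structure ::
  "complex \<Rightarrow> complex \<Rightarrow> (vacuum_elt \<Rightarrow> vacuum_elt) \<Rightarrow>
   (vacuum_elt \<Rightarrow> int \<Rightarrow> vacuum_elt \<Rightarrow> vacuum_elt) \<Rightarrow> bool" where
  "vacuum_vertex_structure c1 c2 D Y \<longleftrightarrow>
     vertex_superalgebra (vacuum c1 c2) (vacuum_grading c1 c2) (vacuum_one c1 c2) D Y \<and>
     (\<forall>v\<in>carrier (vacuum c1 c2). D v = vacuum_act c1 c2 (gen (Lgen (- 1))) v) \<and>
     generating_fields c1 c2 (vacuum c1 c2) (vacuum_act c1 c2) Y"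

definition smooth_structures ::
  "complex \<Rightarrow> complex \<Rightarrow> (complex, 'w) module \<Rightarrow> (bms \<Rightarrow> 'w \<Rightarrow> 'w) set" where
  "smooth_structures c1 c2 W = {\<rho>. bms_module W \<rho> \<and> smooth W \<rho> \<and> central_charge W \<rho> c1 c2}"

text \<open>A module map \<open>Y'\<close> does not determine the operator \<open>d\<close>: adding to \<open>d\<close> any operator commuting
  with all modes (e.g. a scalar) gives another module. Hence module structures are counted by \<open>Y'\<close>.\<close>

definition vertex_module_structures ::
  "complex \<Rightarrow> complex \<Rightarrow> (vacuum_elt \<Rightarrow> vacuum_elt) \<Rightarrow>
   (vacuum_elt \<Rightarrow> int \<Rightarrow> vacuum_elt \<Rightarrow> vacuum_elt) \<Rightarrow>
   (complex, 'w) module \<Rightarrow> (bool \<Rightarrow> 'w set) \<Rightarrow> (vacuum_elt \<Rightarrow> int \<Rightarrow> 'w \<Rightarrow> 'w) set" where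
  "vertex_module_structures c1 c2 D Y W P = {Y'. \<exists>d. vertex_module
     (vacuum c1 c2) (vacuum_grading c1 c2) (vacuum_one c1 c2) D Y W P d Y'}"

end

theory Submission
  imports Defs "HOL-Library.Function_Algebras" "HOL-Computational_Algebra.Formal_Power_Series"
begin

text \<open>On a smooth module the generating series of \<open>L\<close>, \<open>M\<close>, \<open>Q\<close> are fields, mutually local by the
  commutation relations. The Lie superalgebra acts on fields by \<open>n\<close>-th products with them, and this
  action satisfies the defining relations of the vacuum module, the identity field being killed by
  \<open>L\<^bsub>n\<^esub>\<close>, \<open>M\<^bsub>n\<^esub>\<close> (\<open>n \<ge> -1\<close>) and \<open>Q\<^bsub>r\<^esub>\<close> (\<open>r \<ge> -1/2\<close>). So there is a unique equivariant map \<open>Y\<close> from the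
  vacuum module to fields with \<open>Y(\<one>) = id\<close>; no basis of the vacuum module is needed. By Dong's lemma
  its values are mutually local, and by induction on \<open>v\<close> it sends \<open>u\<^sub>n v\<close> to the \<open>n\<close>-th product of \<open>Y(u)\<close> and
  \<open>Y(v)\<close>; with locality this is the Jacobi identity. Conversely the Jacobi identity expresses all vertex
  operators by those of the three generators (uniqueness), and its residue in \<open>z\<^sub>0\<close> is the
  commutator formula, which recovers the brackets of the Lie superalgebra.\<close>

\<comment> \<open>Maps out of the vacuum module are defined on words, and that they respect its
  relations is proved in the algebra of fields; independence of monomials never enters. The one
  decomposition required, the grading, is into eigenvectors of L_0, whose independence is automatic.
  A smooth module need not carry a parity respected by the action, so operators on it have no parity
  of their own. The signs of the super setting are therefore explicit scalars \<open>s\<close>,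
  computed from parities of words on the vacuum side. Formal distributions are coefficient families
  indexed by integers, and powers of x - y enter through their expansions. Since the recursion in
  the exponent is Pascal's rule, the Borcherds identity reduces to its values at p = 0 and at large
  r. The commutator of two products, which makes the fields a representation of the Lie
  superalgebra, is a comparison of finite double sums by Vandermonde's identity.\<close>
alias lookup = Poly_Mapping.lookup
alias keys = Poly_Mapping.keys

text \<open>As a type class, the linear structure passes pointwise to functions, fields and finitely
  supported maps, so coefficient families such as
  \<open>int \<Rightarrow> int \<Rightarrow> 'a\<close> are again vectors.\<close>

class cvec = ab_group_add +
  fixes scaleC :: "complex \<Rightarrow> 'a \<Rightarrow> 'a" (infixr "*\<^sub>C" 75)
  assumes scaleC_add_right: "a *\<^sub>C (x + y) = a *\<^sub>C x + a *\<^sub>C y"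
    and scaleC_add_left: "(a + b) *\<^sub>C x = a *\<^sub>C x + b *\<^sub>C x"
    and scaleC_scaleC: "a *\<^sub>C b *\<^sub>C x = (a * b) *\<^sub>C x"
    and scaleC_one: "1 *\<^sub>C x = x"

interpretation cv: vector_space "scaleC :: complex \<Rightarrow> 'a::cvec \<Rightarrow> 'a"
  by standard (simp_all add: scaleC_add_right scaleC_add_left scaleC_scaleC scaleC_one)

lemmas scaleC_simps = cv.scale_scale cv.scale_right_distrib cv.scale_left_distrib
  cv.scale_right_diff_distrib cv.scale_left_diff_distrib

instantiation complex :: cvec
begin
definition scaleC_complex :: "complex \<Rightarrow> complex \<Rightarrow> complex" where "scaleC_complex = (*)"
instance by standard (simp_all add: scaleC_complex_def algebra_simps)
end

instantiation "fun" :: (type, cvec) cvec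
begin
definition scaleC_fun :: "complex \<Rightarrow> ('a \<Rightarrow> 'b) \<Rightarrow> 'a \<Rightarrow> 'b" where
  "scaleC_fun c f = (\<lambda>x. c *\<^sub>C f x)"
instance
  by standard (simp_all add: scaleC_fun_def fun_eq_iff scaleC_simps)
end

instantiation poly_mapping :: (type, cvec) cvec
begin
definition scaleC_poly_mapping :: "complex \<Rightarrow> ('a \<Rightarrow>\<^sub>0 'b) \<Rightarrow> 'a \<Rightarrow>\<^sub>0 'b" where
  "scaleC_poly_mapping c p = Poly_Mapping.map ((*\<^sub>C) c) p"
instance
proof -
  have *: "lookup (Poly_Mapping.map ((*\<^sub>C) c) p) k = c *\<^sub>C lookup p k"
    for c and p :: "'a \<Rightarrow>\<^sub>0 'b" and k
    by transfer (auto simp: when_def)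
  show "OFCLASS('a \<Rightarrow>\<^sub>0 'b, cvec_class)"
    by standard
      (auto intro!: poly_mapping_eqI simp: scaleC_poly_mapping_def * lookup_add scaleC_simps)
qed
end

lemma scaleC_fun_apply [simp]: "(c *\<^sub>C f) x = c *\<^sub>C f x"
  by (simp add: scaleC_fun_def)

lemma scaleC_complex [simp]: "a *\<^sub>C (b::complex) = a * b"
  by (simp add: scaleC_complex_def)

lemma lookup_scaleC [simp]: "lookup (c *\<^sub>C p) k = c *\<^sub>C lookup p k"
  unfolding scaleC_poly_mapping_def by transfer (auto simp: when_def)

lemma pm_scale_eq_scaleC: "pm_scale a x = a *\<^sub>C x"
  by (rule poly_mapping_eqI) (simp add: pm_scale_def scaleC_poly_mapping_def scaleC_complex_def)

lemma sum_fun_apply: "(\<Sum>i\<in>A. f i) x = (\<Sum>i\<in>A. f i x)"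
  by (induction A rule: infinite_finite_induct) auto

section \<open>Linear maps and finitely supported sums\<close>

definition lin :: "('a::cvec \<Rightarrow> 'b::cvec) \<Rightarrow> bool" where
  "lin f \<longleftrightarrow> (\<forall>x y. f (x + y) = f x + f y) \<and> (\<forall>a x. f (a *\<^sub>C x) = a *\<^sub>C f x)"

lemma linI: "(\<And>x y. f (x + y) = f x + f y) \<Longrightarrow> (\<And>a x. f (a *\<^sub>C x) = a *\<^sub>C f x) \<Longrightarrow> lin f"
  by (simp add: lin_def)

lemma lin_add: "lin f \<Longrightarrow> f (x + y) = f x + f y"
  and lin_scale: "lin f \<Longrightarrow> f (a *\<^sub>C x) = a *\<^sub>C f x"
  by (simp_all add: lin_def)

lemma lin_0: "lin f \<Longrightarrow> f 0 = 0"
  using lin_scale[of f 0 0] by simp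

lemma lin_minus: "lin f \<Longrightarrow> f (- x) = - f x"
  using lin_scale[of f "-1" x] by simp

lemma lin_diff: "lin f \<Longrightarrow> f (x - y) = f x - f y"
  using lin_add[of f x "- y"] by (simp add: lin_minus)

lemma lin_sum: "lin f \<Longrightarrow> f (\<Sum>i\<in>A. g i) = (\<Sum>i\<in>A. f (g i))"
  by (induction A rule: infinite_finite_induct) (auto simp: lin_0 lin_add)

lemmas lin_simps = lin_0 lin_add lin_scale lin_minus lin_diff lin_sum

lemma lin_id: "lin (\<lambda>x. x)" and lin_zero: "lin (\<lambda>x. 0)"
  by (auto intro!: linI)

lemma lin_comp: "lin f \<Longrightarrow> lin g \<Longrightarrow> lin (\<lambda>x. f (g x))"
  by (auto intro!: linI simp: lin_simps)

lemma lin_plus: "lin f \<Longrightarrow> lin g \<Longrightarrow> lin (\<lambda>x. f x + g x)"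
  and lin_minus': "lin f \<Longrightarrow> lin g \<Longrightarrow> lin (\<lambda>x. f x - g x)"
  and lin_scaleC: "lin f \<Longrightarrow> lin (\<lambda>x. c *\<^sub>C f x)"
  by (auto intro!: linI simp: lin_simps algebra_simps scaleC_simps)

lemma Sum_any_bound:
  fixes f :: "nat \<Rightarrow> 'a::comm_monoid_add"
  assumes "\<And>i. i \<ge> N \<Longrightarrow> f i = 0"
  shows "Sum_any f = sum f {..<N}"
proof (rule Sum_any.expand_superset)
  show "{a. f a \<noteq> 0} \<subseteq> {..<N}"
    using assms by (auto simp: not_le[symmetric])
qed simp

lemma finite_supp_bound:
  fixes f :: "nat \<Rightarrow> 'a::zero"
  shows "(\<And>i. i \<ge> N \<Longrightarrow> f i = 0) \<Longrightarrow> finite {i. f i \<noteq> 0}"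
  by (rule finite_subset[of _ "{..<N}"]) (auto simp: not_le[symmetric])

text \<open>The finiteness hypothesis guards against a default: \<open>Sum_any\<close> is 0 on
  infinite support, while h may make the support finite.\<close>

lemma lin_Sum_any:
  assumes "lin h" "finite {i. f i \<noteq> 0}"
  shows "h (Sum_any f) = Sum_any (\<lambda>i. h (f i))"
proof -
  have "Sum_any (\<lambda>i. h (f i)) = (\<Sum>i\<in>{i. f i \<noteq> 0}. h (f i))"
    by (rule Sum_any.expand_superset) (use assms in \<open>auto simp: lin_0\<close>)
  then show ?thesis
    by (simp add: Sum_any.expand_set lin_sum[OF assms(1)])
qed

lemma Sum_any_scaleC:
  fixes f :: "'i \<Rightarrow> 'a::cvec"
  shows "finite {i. f i \<noteq> 0} \<Longrightarrow> c *\<^sub>C Sum_any f = Sum_any (\<lambda>i. c *\<^sub>C f i)"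
  by (rule lin_Sum_any)
    (auto intro!: linI simp: cv.scale_right_distrib cv.scale_left_commute)

section \<open>Binomial expansions of formal distributions\<close>

definition bin :: "int \<Rightarrow> nat \<Rightarrow> complex" where
  "bin k i = (of_int k gchoose i)"

text \<open>The coefficient of x^(k-i) y^i in (x - y)^k, expanded in nonnegative powers of y; the
  exponent k may be negative.\<close>

definition sbin :: "int \<Rightarrow> nat \<Rightarrow> complex" where
  "sbin k i = (- 1) ^ i * bin k i"

lemma bin_0 [simp]: "bin k 0 = 1" and sbin_0 [simp]: "sbin k 0 = 1"
  by (simp_all add: bin_def sbin_def)

lemma bin_0_left: "bin 0 i = (if i = 0 then 1 else 0)"
  by (simp add: bin_def gbinomial_0_left)

lemma sbin_0_left: "sbin 0 i = (if i = 0 then 1 else 0)"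
  by (simp add: sbin_def bin_0_left)

lemma bin_Suc: "bin (k + 1) (Suc i) = bin k i + bin k (Suc i)"
  unfolding bin_def of_int_add of_int_1 by (rule gbinomial_Suc_Suc)

lemma sbin_Suc: "sbin (k + 1) (Suc i) = sbin k (Suc i) - sbin k i"
  unfolding sbin_def bin_Suc by (simp add: algebra_simps)

lemma bin_Vandermonde: "(\<Sum>i\<le>t. bin a i * bin b (t - i)) = bin (a + b) t"
  using gbinomial_Vandermonde[where a = "of_int a :: complex" and b = "of_int b" and n = t]
  by (simp add: bin_def atMost_atLeast0)

lemma bin_nat_revision:
  assumes "i \<le> n"
  shows "bin m n * bin (int n) i = bin m i * bin (m - int i) (n - i)"
  using gbinomial_trinomial_revision[OF assms, of "of_int m :: complex"]
  by (simp add: bin_def)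

text \<open>Both sides equal (m choose i + l) (i + l choose i), which is symmetric in i and
  l.\<close>

lemma bin_revision: "bin m i * bin (m - int i) l = bin m l * bin (m - int l) i"
proof -
  have "bin (int (i + l)) i = bin (int (i + l)) l"
    using gbinomial_of_nat_symmetric[of i "i + l", where ?'a = complex] by (simp add: bin_def)
  then show ?thesis
    using bin_nat_revision[of i "i + l" m] bin_nat_revision[of l "i + l" m]
    by (simp add: add.commute)
qed

text \<open>\<open>bin_revision\<close> pulls \<open>bin m l\<close> out of the sum and leaves a
  Vandermonde convolution. This evaluates the coefficients in \<open>commutator_of_products\<close>
  when the mode of the left operator is m - i; the next lemma serves the case where it is i.\<close>

lemma bin_revision_sum1:
  "(\<Sum>i\<le>t. bin m i * bin (m - int i) l * bin k (t - i)) = bin m l * bin (m + k - int l) t"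
proof -
  have "(\<Sum>i\<le>t. bin m i * bin (m - int i) l * bin k (t - i)) =
      bin m l * (\<Sum>i\<le>t. bin (m - int l) i * bin k (t - i))"
    unfolding sum_distrib_left by (rule sum.cong) (auto simp: bin_revision)
  then show ?thesis
    unfolding bin_Vandermonde by (simp add: algebra_simps)
qed

text \<open>Terms with i < l vanish; in the others \<open>bin_nat_revision\<close> pulls out
  \<open>bin m l\<close>, and shifting i by l gives a Vandermonde convolution.\<close>

lemma bin_revision_sum2:
  "(\<Sum>i\<le>t. bin m i * bin (int i) l * bin k (t - i)) =
    (if l \<le> t then bin m l * bin (m + k - int l) (t - l) else 0)"
proof (cases "l \<le> t")
  case True
  have z: "bin (int i) l = 0" if "i < l" for i
    using that by (simp add: bin_def flip: binomial_gbinomial)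
  have "(\<Sum>i\<le>t. bin m i * bin (int i) l * bin k (t - i)) =
      (\<Sum>i\<in>{l..t}. bin m i * bin (int i) l * bin k (t - i))"
    by (rule sum.mono_neutral_right) (auto simp: z)
  also have "\<dots> = (\<Sum>i\<in>{l..t}. bin m l * (bin (m - int l) (i - l) * bin k (t - i)))"
    by (rule sum.cong) (auto simp: bin_nat_revision)
  also have "\<dots> = (\<Sum>i\<le>t-l. bin m l * (bin (m - int l) i * bin k (t - l - i)))"
    by (rule sum.reindex_bij_witness[of _ "\<lambda>i. i + l" "\<lambda>i. i - l"]) (use True in auto)
  finally show ?thesis
    using True unfolding sum_distrib_left[symmetric] bin_Vandermonde by (simp add: algebra_simps)
next
  case False
  have z: "bin (int i) l = 0" if "i < l" for i
    using that by (simp add: bin_def flip: binomial_gbinomial)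
  show ?thesis using False by (auto simp: z intro!: sum.neutral)
qed

lemma bin_absorption: "of_nat (Suc i) * bin k (Suc i) = of_int k * bin (k - 1) i"
  using gbinomial_absorption[of i "of_int k :: complex"] by (simp add: bin_def)

lemma sbin_absorption: "of_nat (Suc i) * sbin k (Suc i) = - of_int k * sbin (k - 1) i"
proof -
  have "of_nat (Suc i) * sbin k (Suc i) = - ((- 1) ^ i) * (of_nat (Suc i) * bin k (Suc i))"
    by (simp only: sbin_def power_Suc mult.assoc mult.left_commute) simp
  then show ?thesis unfolding bin_absorption by (simp add: sbin_def)
qed

lemma sbin_absorb_comp: "(of_int k - of_nat i) * sbin k i = of_int k * sbin (k - 1) i"
proof -
  have "(of_int k - of_nat i) * sbin k i = (- 1) ^ i * ((of_int k - of_nat i) * bin k i)"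
    by (simp add: sbin_def)
  also have "(of_int k - of_nat i) * bin k i = of_int k * bin (k - 1) i"
    using gbinomial_absorb_comp[of "of_int k :: complex" i] by (simp add: bin_def)
  finally show ?thesis by (simp add: sbin_def)
qed

text \<open>The expansion of 1/(x - y) is a geometric series.\<close>

lemma sbin_minus_one [simp]: "sbin (- 1) i = 1"
proof -
  have "(of_nat i gchoose i :: complex) = 1"
    by (metis binomial_gbinomial binomial_n_n of_nat_1)
  then have "bin (- 1) i = (- 1) ^ i"
    using gbinomial_minus[of "1::complex" i] by (simp add: bin_def)
  then show ?thesis by (simp add: sbin_def left_minus_one_mult_self)
qed

lemmas bin_Suc' = bin_Suc[unfolded add.commute[of _ 1]]
  and sbin_Suc' = sbin_Suc[unfolded add.commute[of _ 1]]

text \<open>Multiplication of a two-variable series by (x - y)^k. \<open>F p q\<close> is the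
  coefficient of x^(-p-1) y^(-q-1), so the factor x^(k-i) y^i moves the indices to p + k - i and q +
  i.\<close>

definition xpd :: "int \<Rightarrow> (int \<Rightarrow> int \<Rightarrow> 'a::cvec) \<Rightarrow> int \<Rightarrow> int \<Rightarrow> 'a" where
  "xpd k F p q = Sum_any (\<lambda>i. sbin k i *\<^sub>C F (p + k - int i) (q + int i))"

text \<open>The bound is uniform in p because in \<open>xpd\<close> the first index runs to minus
  infinity while the second grows; it makes every such sum finite.\<close>

definition tr :: "(int \<Rightarrow> int \<Rightarrow> 'a::cvec) \<Rightarrow> bool" where
  "tr F \<longleftrightarrow> (\<exists>N. \<forall>p q. q \<ge> N \<longrightarrow> F p q = 0)"

lemma tr_finite:
  assumes "tr F"
  shows "finite {i. sbin k i *\<^sub>C F (p - int i) (q + int i) \<noteq> 0}"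
proof -
  from assms obtain N where "\<And>p q. q \<ge> N \<Longrightarrow> F p q = 0" by (auto simp: tr_def)
  then show ?thesis by (intro finite_supp_bound[of "nat (N - q)"]) auto
qed

lemma xpd_bound:
  assumes "\<And>p q. q \<ge> N \<Longrightarrow> F p q = 0" and "int M \<ge> N - q"
  shows "xpd k F p q = (\<Sum>i<M. sbin k i *\<^sub>C F (p + k - int i) (q + int i))"
  unfolding xpd_def by (rule Sum_any_bound) (use assms in auto)

lemma xpd_0 [simp]: "xpd 0 F = F"
proof (intro ext)
  fix p q
  have "xpd 0 F p q = (\<Sum>i<1. sbin 0 i *\<^sub>C F (p + 0 - int i) (q + int i))"
    unfolding xpd_def by (rule Sum_any_bound) (simp add: sbin_0_left)
  then show "xpd 0 F p q = F p q" by simp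
qed

text \<open>Multiplication by one further factor x - y; on coefficients this is Pascal's rule
  \<open>sbin_Suc\<close>.\<close>

lemma xpd_Suc:
  assumes "tr F"
  shows "xpd (k + 1) F p q = xpd k F (p + 1) q - xpd k F p (q + 1)"
proof -
  from assms obtain N where N: "\<And>p q. q \<ge> N \<Longrightarrow> F p q = 0" by (auto simp: tr_def)
  define M where "M = nat (N - q)"
  have M: "int M \<ge> N - q" by (simp add: M_def)
  have "xpd (k + 1) F p q = (\<Sum>i<Suc M. sbin (k + 1) i *\<^sub>C F (p + (k + 1) - int i) (q + int i))"
    by (rule xpd_bound[OF N]) (use M in auto)
  also have "\<dots> = F (p + 1 + k) q +
      (\<Sum>i<M. sbin k (Suc i) *\<^sub>C F (p + k - int i) (q + 1 + int i)) -
      (\<Sum>i<M. sbin k i *\<^sub>C F (p + k - int i) (q + 1 + int i))"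
    unfolding sum.lessThan_Suc_shift
    by (simp add: sbin_Suc sbin_Suc' scaleC_simps sum_subtractf sum.distrib algebra_simps)
  also have "F (p + 1 + k) q + (\<Sum>i<M. sbin k (Suc i) *\<^sub>C F (p + k - int i) (q + 1 + int i)) =
      (\<Sum>i<Suc M. sbin k i *\<^sub>C F (p + 1 + k - int i) (q + int i))"
    unfolding sum.lessThan_Suc_shift by (simp add: algebra_simps)
  also have "\<dots> = xpd k F (p + 1) q"
    by (rule xpd_bound[OF N, symmetric]) (use M in auto)
  also have "(\<Sum>i<M. sbin k i *\<^sub>C F (p + k - int i) (q + 1 + int i)) = xpd k F p (q + 1)"
    by (rule xpd_bound[OF N, symmetric]) (use M in auto)
  finally show ?thesis .
qed

lemma xpd_add:
  assumes "tr F" "tr G"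
  shows "xpd k (\<lambda>p q. F p q + G p q) p q = xpd k F p q + xpd k G p q"
  unfolding xpd_def scaleC_add_right by (rule Sum_any.distrib) (intro tr_finite assms)+

lemma lin_xpd:
  assumes "tr F" "lin h"
  shows "h (xpd k F p q) = xpd k (\<lambda>p q. h (F p q)) p q"
  unfolding xpd_def using lin_Sum_any[OF assms(2) tr_finite[OF assms(1)]] assms(2)
  by (simp add: lin_scale)

lemma xpd_scale:
  assumes "tr F"
  shows "xpd k (\<lambda>p q. c *\<^sub>C F p q) p q = c *\<^sub>C xpd k F p q"
  using lin_xpd[OF assms, of "\<lambda>x. c *\<^sub>C x"] by (simp add: lin_scaleC[OF lin_id])

lemma tr_add: "tr F \<Longrightarrow> tr G \<Longrightarrow> tr (\<lambda>p q. F p q + G p q)"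
proof -
  assume "tr F" "tr G"
  then obtain N M where "\<forall>p q. q \<ge> N \<longrightarrow> F p q = 0" "\<forall>p q. q \<ge> M \<longrightarrow> G p q = 0"
    unfolding tr_def by blast
  then have "\<forall>p q. q \<ge> max N M \<longrightarrow> F p q + G p q = 0" by simp
  then show ?thesis unfolding tr_def by blast
qed

lemma tr_scale: "tr F \<Longrightarrow> tr (\<lambda>p q. c *\<^sub>C F p q)"
  unfolding tr_def by auto

lemma tr_diff: "tr F \<Longrightarrow> tr G \<Longrightarrow> tr (\<lambda>p q. F p q - G p q)"
  using tr_add[of F "\<lambda>p q. (- 1) *\<^sub>C G p q"] tr_scale[of G "- 1"] by simp

lemma xpd_diff:
  assumes "tr F" "tr G"
  shows "xpd k (\<lambda>p q. F p q - G p q) p q = xpd k F p q - xpd k G p q"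
  using xpd_add[OF assms(1) tr_scale[OF assms(2), of "- 1"], of k p q] xpd_scale[OF assms(2), of k "-1" p q]
  by simp

section \<open>Fields and their products\<close>

type_synonym 'u field = "int \<Rightarrow> 'u \<Rightarrow> 'u"

definition fld :: "'u::cvec field \<Rightarrow> bool" where
  "fld a \<longleftrightarrow> (\<forall>n. lin (a n)) \<and> (\<forall>w. \<exists>N. \<forall>n\<ge>N. a n w = 0)"

lemma fldI: "(\<And>n. lin (a n)) \<Longrightarrow> (\<And>w. \<exists>N. \<forall>n\<ge>N. a n w = 0) \<Longrightarrow> fld a"
  by (simp add: fld_def)

lemma fld_lin: "fld a \<Longrightarrow> lin (a n)" by (simp add: fld_def)

lemma fld_trunc: "fld a \<Longrightarrow> \<exists>N. \<forall>n\<ge>N. a n w = 0" by (simp add: fld_def)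

text \<open>The operator acting first supplies the bound, independently of p since w is fixed. This
  is why each product is expanded in powers of the variable of the operator that acts first.\<close>

lemma tr_fld: "(\<And>p. lin (h p)) \<Longrightarrow> fld b \<Longrightarrow> tr (\<lambda>p q. h p (b q w))"
  using fld_trunc[of b w] unfolding tr_def by (metis lin_0)

lemma fld_zero: "fld 0"
  by (rule fldI) (auto simp: zero_fun_def lin_zero)

lemma fld_add:
  assumes "fld a" "fld b"
  shows "fld (a + b)"
proof (rule fldI)
  fix n show "lin ((a + b) n)"
    using assms by (simp add: plus_fun_def lin_plus fld_lin)
next
  fix w
  obtain N M where "\<forall>n\<ge>N. a n w = 0" "\<forall>n\<ge>M. b n w = 0" using assms fld_trunc by metis
  then have "\<forall>n\<ge>max N M. (a + b) n w = 0" by auto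
  then show "\<exists>N. \<forall>n\<ge>N. (a + b) n w = 0" ..
qed

lemma fld_scale:
  assumes "fld a"
  shows "fld (c *\<^sub>C a)"
proof (rule fldI)
  fix n show "lin ((c *\<^sub>C a) n)"
    using assms lin_scaleC[of "a n" c] by (simp add: scaleC_fun_def fld_lin)
next
  fix w show "\<exists>N. \<forall>n\<ge>N. (c *\<^sub>C a) n w = 0" using fld_trunc[OF assms, of w] by auto
qed

lemma fld_sum: "(\<And>i. i \<in> A \<Longrightarrow> fld (f i)) \<Longrightarrow> fld (\<Sum>i\<in>A. f i)"
  by (induction A rule: infinite_finite_induct) (auto simp: fld_zero fld_add)

text \<open>The coefficients of \<open>(x - y)\<^sup>k a(x) b(y) w - s (-y + x)\<^sup>k b(y) a(x) w\<close>, the two powers being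
  expanded in nonnegative powers of \<open>y\<close> and of \<open>x\<close> respectively.\<close>

definition cross :: "complex \<Rightarrow> 'u::cvec field \<Rightarrow> 'u field \<Rightarrow> int \<Rightarrow> int \<Rightarrow> int \<Rightarrow> 'u \<Rightarrow> 'u" where
  "cross s a b k p q w = xpd k (\<lambda>p q. a p (b q w)) p q
     - (s * (- 1) powi k) *\<^sub>C xpd k (\<lambda>q p. b q (a p w)) q p"

text \<open>The k-th product of two fields: p = 0 selects the coefficient of 1/x, so this is the
  residue in x of the series in \<open>cross\<close>.\<close>

definition nprod :: "complex \<Rightarrow> 'u::cvec field \<Rightarrow> int \<Rightarrow> 'u field \<Rightarrow> 'u field" where
  "nprod s a k b n w = cross s a b k 0 n w"

lemma minus_one_powi_Suc: "(- 1 :: complex) powi (k + 1) = - ((- 1) powi k)"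
  by (simp add: power_int_add)

lemma cross_0: "cross s a b 0 p q w = a p (b q w) - s *\<^sub>C b q (a p w)"
  by (simp add: cross_def)

text \<open>The sign \<open>(- 1) powi k\<close> turns the expansion of (y - x)^k into that of (-y +
  x)^k, so both summands obey the same recursion.\<close>

lemma cross_Suc:
  assumes "fld a" "fld b"
  shows "cross s a b (k + 1) p q w = cross s a b k (p + 1) q w - cross s a b k p (q + 1) w"
  using assms unfolding cross_def
  by (simp add: xpd_Suc tr_fld fld_lin minus_one_powi_Suc scaleC_simps)

lemma lin_pointwise_Sum_any:
  assumes "\<And>i. lin (f i)" and fin: "\<And>w. finite {i. f i w \<noteq> 0}"
  shows "lin (\<lambda>w. Sum_any (\<lambda>i. f i w))"
proof (rule linI)
  fix x y show "Sum_any (\<lambda>i. f i (x + y)) = Sum_any (\<lambda>i. f i x) + Sum_any (\<lambda>i. f i y)"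
    using assms by (simp add: lin_add Sum_any.distrib)
next
  fix a x show "Sum_any (\<lambda>i. f i (a *\<^sub>C x)) = a *\<^sub>C Sum_any (\<lambda>i. f i x)"
    using assms by (simp add: lin_scale Sum_any_scaleC)
qed

lemma lin_cross:
  assumes "fld a" "fld b"
  shows "lin (cross s a b k p q)"
proof -
  have "lin (\<lambda>w. xpd k (\<lambda>p q. a p (b q w)) p q)" if "fld a" "fld b" for a b :: "'a field" and p q
    unfolding xpd_def
  proof (rule lin_pointwise_Sum_any)
    show "lin (\<lambda>w. sbin k i *\<^sub>C a (p + k - int i) (b (q + int i) w))" for i
      by (intro lin_scaleC lin_comp[of "a _" "b _"] fld_lin that)
    show "finite {i. sbin k i *\<^sub>C a (p + k - int i) (b (q + int i) w) \<noteq> 0}" for w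
      by (rule tr_finite[OF tr_fld]) (use that in \<open>auto simp: fld_lin\<close>)
  qed
  then show ?thesis
    unfolding cross_def by (intro lin_minus' lin_scaleC) (use assms in auto)
qed

lemma fld_nat: "fld a \<Longrightarrow> \<exists>N::nat. \<forall>n. n \<ge> int N \<longrightarrow> a n w = 0"
proof -
  assume "fld a"
  then obtain N where "\<forall>n\<ge>N. a n w = 0" using fld_trunc by blast
  then have "\<forall>n. n \<ge> int (nat N) \<longrightarrow> a n w = 0" by simp
  then show ?thesis by blast
qed

text \<open>The index of c depends on j, so each j has its own bound. Only the finitely many j < J
  matter, as b vanishes from J on, and adding their bounds gives a common one.\<close>

lemma double_trunc:
  assumes "fld b" "fld c"
  shows "\<exists>M. \<forall>i j. M \<le> i \<or> M \<le> j \<longrightarrow> c (u + int i + e * int j) (b (int j) w) = 0"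
proof -
  obtain J where J: "\<And>j. j \<ge> int J \<Longrightarrow> b j w = 0" using fld_nat[OF assms(1)] by blast
  have "\<exists>N. \<forall>n. n \<ge> int N \<longrightarrow> c n (b (int j) w) = 0" for j
    using fld_nat[OF assms(2)] by blast
  then have "\<exists>I. \<forall>j n. n \<ge> int (I j) \<longrightarrow> c n (b (int j) w) = 0"
    by (intro choice allI)
  then obtain I where I: "\<And>j n. n \<ge> int (I j) \<Longrightarrow> c n (b (int j) w) = 0"
    by blast
  define M where "M = J + (\<Sum>j<J. I j + nat (\<bar>u\<bar> + \<bar>e * int j\<bar>))"
  have "c (u + int i + e * int j) (b (int j) w) = 0" if "M \<le> i \<or> M \<le> j" for i j
  proof (cases "j \<ge> J")
    case True then show ?thesis using J[of "int j"] assms(2) by (simp add: lin_0 fld_lin)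
  next
    case False
    then have "I j + nat (\<bar>u\<bar> + \<bar>e * int j\<bar>) \<le> (\<Sum>j<J. I j + nat (\<bar>u\<bar> + \<bar>e * int j\<bar>))"
      by (intro member_le_sum) auto
    moreover have "M \<le> i" using that False by (auto simp: M_def)
    ultimately show ?thesis by (intro I) (auto simp: M_def)
  qed
  then show ?thesis by blast
qed

lemma fld_nprod:
  assumes "fld a" "fld b"
  shows "fld (nprod s a k b)"
proof (rule fldI)
  fix n show "lin (nprod s a k b n)"
    using lin_cross[OF assms] by (simp add: nprod_def[abs_def])
next
  fix w
  obtain N where N: "\<And>q. q \<ge> N \<Longrightarrow> b q w = 0" using fld_trunc[OF assms(2)] by blast
  \<comment> \<open>In the second summand the index of b falls as that of a grows, hence the factor
    -1.\<close>
  obtain M where M: "\<And>i j. M \<le> i \<or> M \<le> j \<Longrightarrow> b (k + int i + (- 1) * int j) (a (int j) w) = 0"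
    using double_trunc[OF assms] by blast
  have "nprod s a k b n w = 0" if "n \<ge> max N (int M)" for n
  proof -
    have "xpd k (\<lambda>p q. a p (b q w)) 0 n = 0"
      unfolding xpd_def using that assms N by (simp add: lin_0 fld_lin)
    moreover have "b (n + k - int i) (a (0 + int i) w) = 0" for i
      using M[of "nat n" i] that by (simp add: algebra_simps) linarith
    then have "xpd k (\<lambda>q p. b q (a p w)) n 0 = 0"
      unfolding xpd_def by simp
    ultimately show ?thesis by (simp add: nprod_def cross_def)
  qed
  then show "\<exists>N. \<forall>n\<ge>N. nprod s a k b n w = 0" by blast
qed

lemma cross_add_right:
  assumes "fld a" "fld b" "fld c"
  shows "cross s a (b + c) k p q w = cross s a b k p q w + cross s a c k p q w"
  using assms unfolding cross_def
  by (simp add: lin_add fld_lin xpd_add tr_fld scaleC_simps)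

lemma cross_scale_right:
  assumes "fld a" "fld b"
  shows "cross s a (x *\<^sub>C b) k p q w = x *\<^sub>C cross s a b k p q w"
  using assms unfolding cross_def
  by (simp add: lin_scale fld_lin xpd_scale tr_fld scaleC_simps mult.commute)

lemma cross_add_left:
  assumes "fld a" "fld b" "fld c"
  shows "cross s (a + b) c k p q w = cross s a c k p q w + cross s b c k p q w"
  using assms unfolding cross_def
  by (simp add: lin_add fld_lin xpd_add tr_fld scaleC_simps)

lemma cross_scale_left:
  assumes "fld a" "fld b"
  shows "cross s (x *\<^sub>C a) b k p q w = x *\<^sub>C cross s a b k p q w"
  using assms unfolding cross_def
  by (simp add: lin_scale fld_lin xpd_scale tr_fld scaleC_simps mult.commute)

lemma nprod_add_right: "fld a \<Longrightarrow> fld b \<Longrightarrow> fld c \<Longrightarrow> nprod s a k (b + c) = nprod s a k b + nprod s a k c"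
  and nprod_scale_right: "fld a \<Longrightarrow> fld b \<Longrightarrow> nprod s a k (x *\<^sub>C b) = x *\<^sub>C nprod s a k b"
  and nprod_add_left: "fld a \<Longrightarrow> fld b \<Longrightarrow> fld c \<Longrightarrow> nprod s (a + b) k c = nprod s a k c + nprod s b k c"
  and nprod_scale_left: "fld a \<Longrightarrow> fld b \<Longrightarrow> nprod s (x *\<^sub>C a) k b = x *\<^sub>C nprod s a k b"
  by (simp_all add: fun_eq_iff nprod_def cross_add_right cross_scale_right cross_add_left cross_scale_left)

lemma nprod_zero_right: "fld a \<Longrightarrow> nprod s a k 0 = 0"
  using nprod_scale_right[of a 0 s k 0] by (simp add: fld_zero)

section \<open>Locality\<close>

definition local_to :: "complex \<Rightarrow> 'u::cvec field \<Rightarrow> 'u field \<Rightarrow> bool" where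
  "local_to s a b \<longleftrightarrow> (\<exists>N::nat. \<forall>p q w. cross s a b (int N) p q w = 0)"

lemma local_to_ge:
  assumes "fld a" "fld b" "local_to s a b"
  obtains N where "\<And>k p q w. k \<ge> int N \<Longrightarrow> cross s a b k p q w = 0"
proof -
  obtain N where N: "\<And>p q w. cross s a b (int N) p q w = 0"
    using assms by (auto simp: local_to_def)
  have "cross s a b k p q w = 0" if "k \<ge> int N" for k p q w
    using that by (induction k arbitrary: p q rule: int_ge_induct) (simp_all add: N cross_Suc assms)
  then show ?thesis using that by blast
qed

text \<open>Pascal's rule determines f from p = 0 and from large r. Upwards from p = 0 it is a
  direct recursion. Downwards, f (p-1) q r is f p (q-1) r minus f (p-1) (q-1) (r+1), which calls for
  an inner descent in r from the region where f vanishes.\<close>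

lemma pascal_zero:
  fixes f :: "int \<Rightarrow> int \<Rightarrow> int \<Rightarrow> 'a::ab_group_add"
  assumes rec: "\<And>p q r. f (p + 1) q r = f p (q + 1) r + f p q (r + 1)"
    and init: "\<And>q r. f 0 q r = 0" and high: "\<And>p q r. r \<ge> N \<Longrightarrow> f p q r = 0"
  shows "f p q r = 0"
proof (cases "p \<ge> 0")
  case True
  then show ?thesis
    by (induction p arbitrary: q r rule: int_ge_induct) (simp_all add: init rec)
next
  case False
  then have "p \<le> 0" by simp
  then show ?thesis
  proof (induction p arbitrary: q r rule: int_le_induct)
    case base show ?case by (simp add: init)
  next
    case (step p)
    have "r \<le> max N r" by simp
    then show ?case
    proof (induction r arbitrary: q rule: int_le_induct)
      case base show ?case
        using rec[of "p - 1" "q - 1" "max N r"] step high[of "max N r + 1"]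
        by simp
    next
      case (step r')
      show ?case using rec[of "p - 1" "q - 1" "r' - 1"] step \<open>\<And>q r. f p q r = 0\<close> by simp
    qed
  qed
qed

text \<open>Both sides satisfy Pascal's rule in (p, q, r), agree at p = 0 by definition of
  \<open>nprod\<close>, and vanish for large r by locality, so \<open>pascal_zero\<close> applies to
  their difference.\<close>

theorem borcherds_identity:
  assumes a: "fld a" and b: "fld b" and loc: "local_to s a b"
  shows "Sum_any (\<lambda>l. bin p l *\<^sub>C nprod s a (r + int l) b (p + q - int l) w) = cross s a b r p q w"
proof -
  obtain N where N: "\<And>k p q w. k \<ge> int N \<Longrightarrow> cross s a b k p q w = 0"
    using local_to_ge[OF a b loc] by blast
  define L where "L p q r = Sum_any (\<lambda>l. bin p l *\<^sub>C nprod s a (r + int l) b (p + q - int l) w)"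
    for p q r
  have L: "L p q r = (\<Sum>l<M. bin p l *\<^sub>C nprod s a (r + int l) b (p + q - int l) w)"
    if "int M \<ge> int N - r" for p q r and M :: nat
    unfolding L_def by (rule Sum_any_bound) (use that in \<open>simp add: nprod_def N\<close>)
  have rec: "L (p + 1) q r = L p (q + 1) r + L p q (r + 1)" for p q r
  proof -
    define M where "M = nat (int N - r)"
    have "L (p + 1) q r = (\<Sum>l<Suc M. bin (p + 1) l *\<^sub>C nprod s a (r + int l) b (p + 1 + q - int l) w)"
      by (rule L) (simp add: M_def)
    also have "\<dots> = nprod s a r b (p + 1 + q) w +
        (\<Sum>l<M. bin p (Suc l) *\<^sub>C nprod s a (r + 1 + int l) b (p + q - int l) w) +
        (\<Sum>l<M. bin p l *\<^sub>C nprod s a (r + 1 + int l) b (p + q - int l) w)"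
      unfolding sum.lessThan_Suc_shift
      by (simp add: bin_Suc bin_Suc' scaleC_simps sum.distrib algebra_simps)
    also have "nprod s a r b (p + 1 + q) w +
        (\<Sum>l<M. bin p (Suc l) *\<^sub>C nprod s a (r + 1 + int l) b (p + q - int l) w) =
        (\<Sum>l<Suc M. bin p l *\<^sub>C nprod s a (r + int l) b (p + (q + 1) - int l) w)"
      unfolding sum.lessThan_Suc_shift by (simp add: algebra_simps)
    also have "\<dots> = L p (q + 1) r" by (rule L[symmetric]) (simp add: M_def)
    also have "(\<Sum>l<M. bin p l *\<^sub>C nprod s a (r + 1 + int l) b (p + q - int l) w) = L p q (r + 1)"
      by (rule L[symmetric]) (simp add: M_def)
    finally show ?thesis .
  qed
  have "L p q r - cross s a b r p q w = 0"
  proof (rule pascal_zero[where f = "\<lambda>p q r. L p q r - cross s a b r p q w" and N = "int N"])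
    show "L (p + 1) q r - cross s a b r (p + 1) q w =
        L p (q + 1) r - cross s a b r p (q + 1) w + (L p q (r + 1) - cross s a b (r + 1) p q w)"
      for p q r
      by (simp add: rec cross_Suc a b)
    show "L 0 q r - cross s a b r 0 q w = 0" for q r
      using L[where M = "Suc (nat (int N - r))" and p = 0] unfolding sum.lessThan_Suc_shift
      by (simp add: bin_0_left nprod_def)
    show "L p q r - cross s a b r p q w = 0" if "int N \<le> r" for p q r
      using that L[where M = 0] by (simp add: N)
  qed
  then show ?thesis by (simp add: L_def)
qed

corollary commutator_formula:
  assumes "fld a" "fld b" "local_to s a b"
  shows "a m (b n w) - s *\<^sub>C b n (a m w) = Sum_any (\<lambda>l. bin m l *\<^sub>C nprod s a (int l) b (m + n - int l) w)"
  using borcherds_identity[OF assms, of m 0 n w] by (simp add: cross_0)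

text \<open>Exchanging a and b, and with them p and q, multiplies \<open>cross\<close> at exponent N
  by -\<sigma>, where \<sigma> = s (-1)^N; this uses that \<sigma> squares to 1.\<close>

lemma local_to_sym:
  assumes "local_to s a b" "s * s = 1"
  shows "local_to s b a"
proof -
  obtain N where N: "\<And>p q w. cross s a b (int N) p q w = 0"
    using assms by (auto simp: local_to_def)
  define \<sigma> where "\<sigma> = s * (- 1) powi int N"
  have "(- 1 :: complex) ^ N * (- 1) ^ N = 1" by (simp flip: power_add)
  then have "\<sigma> * \<sigma> = (s * s) * 1" unfolding \<sigma>_def power_int_of_nat by (metis mult.assoc mult.left_commute)
  then have \<sigma>: "\<sigma> * \<sigma> = 1" using assms(2) by simp
  have "cross s b a (int N) p q w = - (\<sigma> *\<^sub>C cross s a b (int N) q p w)" for p q w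
    unfolding cross_def \<sigma>_def[symmetric] cv.scale_right_diff_distrib cv.scale_scale \<sigma> by simp
  then show ?thesis using N unfolding local_to_def by auto
qed

lemma lin_funpow:
  fixes f :: "'a::cvec \<Rightarrow> 'a"
  shows "lin f \<Longrightarrow> lin (f ^^ n)"
  by (induction n) (simp_all add: lin_def)

text \<open>Induction on N + M replaces the binomial theorem: X f is killed by X^(N-1) and Y^M, and
  Y f by X^N and Y^(M-1).\<close>

lemma nilpotent_add:
  fixes X Y :: "'a::cvec \<Rightarrow> 'a"
  assumes "lin X" "lin Y" and comm: "\<And>g. X (Y g) = Y (X g)"
    and "(X ^^ N) f = 0" "(Y ^^ M) f = 0"
  shows "((\<lambda>g. X g + Y g) ^^ (N + M)) f = 0"
  using assms(4,5)
proof (induction "N + M" arbitrary: N M f)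
  case 0
  then show ?case by simp
next
  case (Suc n)
  let ?Z = "\<lambda>g. X g + Y g"
  have Z: "lin ?Z" by (rule lin_plus) fact+
  have XY: "(X ^^ k) (Y g) = Y ((X ^^ k) g)" and YX: "(Y ^^ k) (X g) = X ((Y ^^ k) g)" for k g
    by (induction k) (simp_all add: comm)
  show ?case
  proof (cases "N = 0 \<or> M = 0")
    case True
    then have "f = 0" using Suc.prems by auto
    then show ?thesis by (simp add: lin_0 lin_funpow Z)
  next
    case False
    then obtain N' M' where NM: "N = Suc N'" "M = Suc M'" by (meson not0_implies_Suc)
    have "(?Z ^^ (N + M)) f = (?Z ^^ n) (X f) + (?Z ^^ n) (Y f)"
      unfolding Suc.hyps(2)[symmetric] funpow_Suc_right o_apply
      using lin_add[OF lin_funpow[OF Z]] by simp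
    moreover have "(X ^^ N') (X f) = 0" "(Y ^^ M) (X f) = 0" "(X ^^ N) (Y f) = 0" "(Y ^^ M') (Y f) = 0"
      using Suc.prems NM by (simp_all only: XY YX lin_0[OF assms(1)] lin_0[OF assms(2)])
        (simp_all add: funpow_Suc_right del: funpow.simps)
    then have "(?Z ^^ (N' + M)) (X f) = 0" "(?Z ^^ (N + M')) (Y f) = 0"
      using Suc.hyps(1)[of N' M "X f"] Suc.hyps(1)[of N M' "Y f"] Suc.hyps(2) NM by simp_all
    then have "(?Z ^^ n) (X f) = 0" "(?Z ^^ n) (Y f) = 0"
      using Suc.hyps(2) NM by simp_all
    ultimately show ?thesis by simp
  qed
qed

text \<open>Multiplication by \<open>x - y\<close> on coefficient families, and by the differences of three variables.\<close>

definition d1 :: "(int \<Rightarrow> int \<Rightarrow> 'a::cvec) \<Rightarrow> int \<Rightarrow> int \<Rightarrow> 'a" where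
  "d1 F p q = F (p + 1) q - F p (q + 1)"

definition d12 :: "(int \<Rightarrow> int \<Rightarrow> int \<Rightarrow> 'a::cvec) \<Rightarrow> int \<Rightarrow> int \<Rightarrow> int \<Rightarrow> 'a" where
  "d12 G p q r = G (p + 1) q r - G p (q + 1) r"

definition d13 :: "(int \<Rightarrow> int \<Rightarrow> int \<Rightarrow> 'a::cvec) \<Rightarrow> int \<Rightarrow> int \<Rightarrow> int \<Rightarrow> 'a" where
  "d13 G p q r = G (p + 1) q r - G p q (r + 1)"

definition d23 :: "(int \<Rightarrow> int \<Rightarrow> int \<Rightarrow> 'a::cvec) \<Rightarrow> int \<Rightarrow> int \<Rightarrow> int \<Rightarrow> 'a" where
  "d23 G p q r = G p (q + 1) r - G p q (r + 1)"

lemma lin_d1: "lin d1" and lin_d12: "lin d12" and lin_d13: "lin d13" and lin_d23: "lin d23"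
  by (auto intro!: linI simp: fun_eq_iff d1_def d12_def d13_def d23_def scaleC_simps)

lemma d12_d13: "d12 (d13 G) = d13 (d12 G)" and d13_d23: "d13 (d23 G) = d23 (d13 G)"
  and d12_d23: "d12 (d23 G) = d23 (d12 G)"
  by (simp_all add: fun_eq_iff d12_def d13_def d23_def)

lemma d13_eq: "d13 = (\<lambda>G. d12 G + d23 G)"
  by (simp add: fun_eq_iff d12_def d13_def d23_def)

lemma funpow_comm: "(\<And>g. X (Y g) = Y (X g)) \<Longrightarrow> (X ^^ n) ((Y ^^ m) g) = (Y ^^ m) ((X ^^ n) g)"
proof -
  assume *: "\<And>g. X (Y g) = Y (X g)"
  have 1: "(X ^^ n) (Y g) = Y ((X ^^ n) g)" for g by (induction n) (simp_all add: *)
  show ?thesis by (induction m) (simp_all add: 1)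
qed

lemma d13_funpow: "(d13 ^^ n) G p q r = (d1 ^^ n) (\<lambda>p r. G p q r) p r"
  and d12_funpow: "(d12 ^^ n) G p q r = (d1 ^^ n) (\<lambda>p q. G p q r) p q"
proof -
  have "(\<lambda>p r. (d13 ^^ n) G p q r) = (d1 ^^ n) (\<lambda>p r. G p q r)"
    by (induction n) (auto simp: d13_def d1_def fun_eq_iff)
  then show "(d13 ^^ n) G p q r = (d1 ^^ n) (\<lambda>p r. G p q r) p r" by (simp add: fun_eq_iff)
  have "(\<lambda>p q. (d12 ^^ n) G p q r) = (d1 ^^ n) (\<lambda>p q. G p q r)"
    by (induction n) (auto simp: d12_def d1_def fun_eq_iff)
  then show "(d12 ^^ n) G p q r = (d1 ^^ n) (\<lambda>p q. G p q r) p q" by (simp add: fun_eq_iff)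
qed

lemma cross_nat:
  assumes "fld a" "fld b"
  shows "cross s a b (int N) p q w = (d1 ^^ N) (\<lambda>p q. a p (b q w) - s *\<^sub>C b q (a p w)) p q"
proof (induction N arbitrary: p q)
  case (Suc N)
  have "cross s a b (int (Suc N)) p q w = cross s a b (int N) (p + 1) q w - cross s a b (int N) p (q + 1) w"
    using cross_Suc[OF assms, of s "int N"] by (simp add: add.commute)
  then show ?case by (simp add: Suc d1_def)
qed (simp add: cross_0)

lemma local_to_d1:
  assumes "fld a" "fld b" "local_to s a b"
  obtains N where "\<And>w. (d1 ^^ N) (\<lambda>p q. a p (b q w) - s *\<^sub>C b q (a p w)) = 0"
proof -
  obtain N where "\<And>p q w. cross s a b (int N) p q w = 0"
    using assms(3) by (auto simp: local_to_def)
  then have "(d1 ^^ N) (\<lambda>p q. a p (b q w) - s *\<^sub>C b q (a p w)) = 0" for w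
    unfolding cross_nat[OF assms(1,2)] by (simp add: fun_eq_iff)
  then show ?thesis by (rule that)
qed

subsection \<open>Dong's lemma\<close>

text \<open>Multiplication by (y - z)^k, expanded in powers of z, with x as a spectator;
  \<open>xpd32\<close> is (z - y)^k expanded in powers of y.\<close>

definition xpd23 :: "int \<Rightarrow> (int \<Rightarrow> int \<Rightarrow> int \<Rightarrow> 'a::cvec) \<Rightarrow> int \<Rightarrow> int \<Rightarrow> int \<Rightarrow> 'a" where
  "xpd23 k f p q r = xpd k (f p) q r"

definition xpd32 :: "int \<Rightarrow> (int \<Rightarrow> int \<Rightarrow> int \<Rightarrow> 'a::cvec) \<Rightarrow> int \<Rightarrow> int \<Rightarrow> int \<Rightarrow> 'a" where
  "xpd32 k f p q r = xpd k (\<lambda>r q. f p q r) r q"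

lemma tr_shift1: "tr F \<Longrightarrow> tr (\<lambda>p q. F (p + 1) q)" and tr_shift2: "tr F \<Longrightarrow> tr (\<lambda>p q. F p (q + 1))"
proof -
  assume "tr F"
  then obtain N where N: "\<And>p q. q \<ge> N \<Longrightarrow> F p q = 0" by (auto simp: tr_def)
  then show "tr (\<lambda>p q. F (p + 1) q)" by (auto simp: tr_def)
  have "F p (q + 1) = 0" if "q \<ge> N" for p q using that by (intro N) simp
  then show "tr (\<lambda>p q. F p (q + 1))" by (auto simp: tr_def)
qed

lemma xpd_shift1: "xpd k F (p + 1) q = xpd k (\<lambda>p q. F (p + 1) q) p q"
  and xpd_shift2: "xpd k F p (q + 1) = xpd k (\<lambda>p q. F p (q + 1)) p q"
  by (simp_all add: xpd_def algebra_simps)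

text \<open>Multiplication by x - y or x - z consists of index shifts and so commutes with the
  expansion. It also preserves truncation, which allows iteration.\<close>

lemma xpd23_d:
  assumes "\<And>p. tr (f p)"
  shows "d12 (xpd23 k f) = xpd23 k (d12 f)" "d13 (xpd23 k f) = xpd23 k (d13 f)"
    "tr (d12 f p)" "tr (d13 f p)"
proof -
  show "d12 (xpd23 k f) = xpd23 k (d12 f)"
    by (simp add: fun_eq_iff d12_def[abs_def] xpd23_def xpd_shift1 xpd_diff assms tr_shift1)
  show "d13 (xpd23 k f) = xpd23 k (d13 f)"
    by (simp add: fun_eq_iff d13_def[abs_def] xpd23_def xpd_shift2 xpd_diff assms tr_shift2)
  show "tr (d12 f p)" "tr (d13 f p)"
    unfolding d12_def[abs_def] d13_def[abs_def] by (intro tr_diff assms tr_shift1 tr_shift2)+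
qed

lemma xpd32_d:
  assumes "\<And>p. tr (\<lambda>r q. f p q r)"
  shows "d12 (xpd32 k f) = xpd32 k (d12 f)" "d13 (xpd32 k f) = xpd32 k (d13 f)"
    "tr (\<lambda>r q. d12 f p q r)" "tr (\<lambda>r q. d13 f p q r)"
proof -
  show "d12 (xpd32 k f) = xpd32 k (d12 f)"
    unfolding fun_eq_iff d12_def[abs_def] xpd32_def xpd_shift2
    by (intro allI xpd_diff[symmetric] assms tr_shift2[of "\<lambda>r q. f _ q r"])
  show "d13 (xpd32 k f) = xpd32 k (d13 f)"
    unfolding fun_eq_iff d13_def[abs_def] xpd32_def xpd_shift1
    by (intro allI xpd_diff[symmetric] assms tr_shift1[of "\<lambda>r q. f _ q r"])
  show "tr (\<lambda>r q. d12 f p q r)" "tr (\<lambda>r q. d13 f p q r)"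
    unfolding d12_def[abs_def] d13_def[abs_def]
    by (intro tr_diff assms tr_shift1[of "\<lambda>r q. f _ q r"] tr_shift2[of "\<lambda>r q. f _ q r"])+
qed

lemma funpow_commute_on:
  assumes "\<And>f. P f \<Longrightarrow> X (E f) = E (X f)" "\<And>f. P f \<Longrightarrow> P (X f)" "P f"
  shows "(X ^^ n) (E f) = E ((X ^^ n) f) \<and> P ((X ^^ n) f)"
  by (induction n) (simp_all add: assms)

lemma xpd23_funpow:
  assumes "\<And>p. tr (f p)"
  shows "(d12 ^^ n) ((d13 ^^ m) (xpd23 k f)) = xpd23 k ((d12 ^^ n) ((d13 ^^ m) f))"
proof -
  let ?P = "\<lambda>f. \<forall>p. tr (f p)"
  have 1: "(d13 ^^ m) (xpd23 k f) = xpd23 k ((d13 ^^ m) f) \<and> ?P ((d13 ^^ m) f)"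
    by (rule funpow_commute_on[where P = ?P]) (auto simp: xpd23_d assms)
  have 2: "(d12 ^^ n) (xpd23 k g) = xpd23 k ((d12 ^^ n) g) \<and> ?P ((d12 ^^ n) g)" if "?P g" for g
    by (rule funpow_commute_on[where P = ?P]) (use that in \<open>auto simp: xpd23_d\<close>)
  from 2[of "(d13 ^^ m) f"] 1 show ?thesis by auto
qed

lemma xpd32_funpow:
  assumes "\<And>p. tr (\<lambda>r q. f p q r)"
  shows "(d12 ^^ n) ((d13 ^^ m) (xpd32 k f)) = xpd32 k ((d12 ^^ n) ((d13 ^^ m) f))"
proof -
  let ?P = "\<lambda>f. \<forall>p. tr (\<lambda>r q. f p q r)"
  have 1: "(d13 ^^ m) (xpd32 k f) = xpd32 k ((d13 ^^ m) f) \<and> ?P ((d13 ^^ m) f)"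
    by (rule funpow_commute_on[where P = ?P]) (auto simp: xpd32_d assms)
  have 2: "(d12 ^^ n) (xpd32 k g) = xpd32 k ((d12 ^^ n) g) \<and> ?P ((d12 ^^ n) g)" if "?P g" for g
    by (rule funpow_commute_on[where P = ?P]) (use that in \<open>auto simp: xpd32_d\<close>)
  from 2[of "(d13 ^^ m) f"] 1 show ?thesis by auto
qed

lemma d1_lin: "lin h \<Longrightarrow> (d1 ^^ n) (\<lambda>p q. h (F p q)) p q = h ((d1 ^^ n) F p q)"
  by (induction n arbitrary: p q) (simp_all add: d1_def lin_diff)

text \<open>The difference of the commutator families is annihilated by powers of \<open>x - y\<close> and of \<open>y - z\<close>
  after multiplication by a power of \<open>x - z\<close>, hence by a power of \<open>x - z = (x - y) + (y - z)\<close>.\<close>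

theorem Dong_lemma:
  assumes x: "fld x" and y: "fld y" and c: "fld c"
    and xy: "local_to sxy x y" and xc: "local_to sxc x c" and yc: "local_to syc y c"
  shows "local_to (sxy * sxc) x (nprod syc y k c)"
proof -
  let ?s = "sxy * sxc"
  obtain N1 where N1: "\<And>w. (d1 ^^ N1) (\<lambda>p q. x p (y q w) - sxy *\<^sub>C y q (x p w)) = 0"
    using local_to_d1[OF x y xy] by blast
  obtain N2 where N2: "\<And>w. (d1 ^^ N2) (\<lambda>p q. x p (c q w) - sxc *\<^sub>C c q (x p w)) = 0"
    using local_to_d1[OF x c xc] by blast
  obtain N3 where N3: "\<And>k p q w. k \<ge> int N3 \<Longrightarrow> cross syc y c k p q w = 0"
    using local_to_ge[OF y c yc] by blast
  define M where "M = nat (int N3 - k)"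
  have "(d1 ^^ (N1 + M + max N1 N2)) (\<lambda>p r. x p (nprod syc y k c r w) -
      ?s *\<^sub>C nprod syc y k c r (x p w)) p r = 0" for w p r
  proof -
    \<comment> \<open>The commutator before the residue in y is taken; the claim concerns q =
      0.\<close>
    define G where "G p q r = x p (cross syc y c k q r w) - ?s *\<^sub>C cross syc y c k q r (x p w)"
      for p q r
    define f1 where "f1 p q r = x p (y q (c r w)) - ?s *\<^sub>C y q (c r (x p w))" for p q r
    define f2 where "f2 p q r = x p (c r (y q w)) - ?s *\<^sub>C c r (y q (x p w))" for p q r
    have tr1: "tr (f1 p)" for p
      unfolding f1_def by (intro tr_diff tr_scale tr_fld lin_comp[of "x _" "y _"] fld_lin x y c)
    have tr2: "tr (\<lambda>r q. f2 p q r)" for p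
      unfolding f2_def by (intro tr_diff tr_scale tr_fld lin_comp[of "x _" "c _"] fld_lin x y c)
    have tx1: "tr (\<lambda>q r. x p (y q (c r w)))" and tx2: "tr (\<lambda>q r. y q (c r w))" for p w
      by (intro tr_fld lin_comp[of "x _" "y _"] fld_lin x y c)+
    have tx3: "tr (\<lambda>r q. x p (c r (y q w)))" and tx4: "tr (\<lambda>r q. c r (y q w))" for p w
      by (intro tr_fld lin_comp[of "x _" "c _"] fld_lin x y c)+
    have G: "G = xpd23 k f1 - (syc * (- 1) powi k) *\<^sub>C xpd32 k f2"
      unfolding fun_eq_iff G_def cross_def xpd23_def xpd32_def f1_def f2_def
      by (simp add: lin_diff lin_scale fld_lin x lin_xpd[OF tx2] lin_xpd[OF tx4] xpd_diff tx1 tx2 tx3 tx4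
          tr_scale xpd_scale scaleC_simps algebra_simps)
    have f1z: "(d12 ^^ N1) ((d13 ^^ N2) f1) = 0"
    proof -
      define g where "g p q r = x p (y q (c r w)) - sxy *\<^sub>C y q (x p (c r w))" for p q r
      define h where "h p q r = y q (x p (c r w)) - sxc *\<^sub>C y q (c r (x p w))" for p q r
      \<comment> \<open>In g the operator x passes y, in h it passes c; (x - y)^N1 kills the first
        and (x - z)^N2 the second.\<close>
      have f1: "f1 = g + sxy *\<^sub>C h" by (simp add: fun_eq_iff f1_def g_def h_def scaleC_simps)
      have "(d12 ^^ N1) g = 0"
        by (simp add: fun_eq_iff d12_funpow g_def N1)
      moreover have "(d13 ^^ N2) h p q r = 0" for p q r
      proof -
        have "(\<lambda>p r. h p q r) = (\<lambda>p r. y q (x p (c r w) - sxc *\<^sub>C c r (x p w)))"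
          by (simp add: h_def lin_diff lin_scale fld_lin y)
        then show ?thesis by (simp add: d13_funpow d1_lin[of "y q", OF fld_lin[OF y]] N2 lin_0 fld_lin y)
      qed
      then have "(d13 ^^ N2) h = 0" by (simp add: fun_eq_iff)
      ultimately show ?thesis
        unfolding f1 lin_add[OF lin_funpow[OF lin_d13]] lin_scale[OF lin_funpow[OF lin_d13]]
          lin_add[OF lin_funpow[OF lin_d12]] lin_scale[OF lin_funpow[OF lin_d12]]
          funpow_comm[of d12 d13, OF d12_d13]
        by (simp add: lin_0 lin_funpow lin_d13 lin_d12 flip: funpow_comm[of d12 d13, OF d12_d13])
    qed
    have f2z: "(d12 ^^ N1) ((d13 ^^ N2) f2) = 0"
    proof -
      define g where "g p q r = x p (c r (y q w)) - sxc *\<^sub>C c r (x p (y q w))" for p q r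
      define h where "h p q r = c r (x p (y q w)) - sxy *\<^sub>C c r (y q (x p w))" for p q r
      have f2: "f2 = g + sxc *\<^sub>C h"
        by (simp add: fun_eq_iff f2_def g_def h_def scaleC_simps mult.commute)
      have g0: "(d13 ^^ N2) g = 0"
        by (simp add: fun_eq_iff d13_funpow g_def N2)
      have "(d12 ^^ N1) h p q r = 0" for p q r
      proof -
        have "(\<lambda>p q. h p q r) = (\<lambda>p q. c r (x p (y q w) - sxy *\<^sub>C y q (x p w)))"
          by (simp add: h_def lin_diff lin_scale fld_lin c)
        then show ?thesis by (simp add: d12_funpow d1_lin[of "c r", OF fld_lin[OF c]] N1 lin_0 fld_lin c)
      qed
      then have h0: "(d12 ^^ N1) h = 0" by (simp add: fun_eq_iff)
      show ?thesis
        unfolding f2 lin_add[OF lin_funpow[OF lin_d13]] lin_scale[OF lin_funpow[OF lin_d13]]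
          lin_add[OF lin_funpow[OF lin_d12]] lin_scale[OF lin_funpow[OF lin_d12]] g0
        unfolding funpow_comm[of d12 d13, OF d12_d13] h0
        by (simp add: lin_0 lin_funpow lin_d13 lin_d12)
    qed
    have xz: "xpd23 k 0 = 0" "xpd32 k 0 = 0"
      by (simp_all add: fun_eq_iff xpd23_def xpd32_def xpd_def)
    have claim1: "(d12 ^^ N1) ((d13 ^^ N2) G) = 0"
      unfolding G lin_diff[OF lin_funpow[OF lin_d13]] lin_scale[OF lin_funpow[OF lin_d13]]
          lin_diff[OF lin_funpow[OF lin_d12]] lin_scale[OF lin_funpow[OF lin_d12]]
      by (simp add: xpd23_funpow xpd32_funpow tr1 tr2 f1z f2z xz)
    \<comment> \<open>Multiplying by (y - z)^j raises k to k + j, and once k + j \<ge> N3 the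
      locality of y and c makes both terms vanish.\<close>
    have d23: "(d23 ^^ j) G p q r =
        x p (cross syc y c (k + int j) q r w) - ?s *\<^sub>C cross syc y c (k + int j) q r (x p w)" for j p q r
    proof (induction j arbitrary: p q r)
      case (Suc j)
      have "k + int (Suc j) = (k + int j) + 1" by simp
      then have *: "cross syc y c (k + int (Suc j)) q r w =
          cross syc y c (k + int j) (q + 1) r w - cross syc y c (k + int j) q (r + 1) w" for w
        using cross_Suc[OF y c, of syc "k + int j" q r w] by (simp add: algebra_simps)
      have "(d23 ^^ Suc j) G p q r = (d23 ^^ j) G p (q + 1) r - (d23 ^^ j) G p q (r + 1)"
        by (simp add: d23_def)
      then show ?case
        unfolding Suc * by (simp add: lin_diff fld_lin x scaleC_simps)
    qed (simp add: G_def)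
    have "(d23 ^^ M) G = 0"
      unfolding fun_eq_iff d23 by (simp add: N3 M_def lin_0 fld_lin x)
    then have claim2: "(d23 ^^ M) ((d13 ^^ N2) G) = 0"
      unfolding funpow_comm[of d13 d23, OF d13_d23, symmetric] by (simp add: lin_0 lin_funpow lin_d13)
    have "(d13 ^^ (N1 + M)) ((d13 ^^ N2) G) = 0"
      unfolding d13_eq
      by (rule nilpotent_add[OF lin_d12 lin_d23 d12_d23])
        (use claim1 claim2 in \<open>simp_all add: d13_eq\<close>)
    then have z: "(d13 ^^ (N1 + M + N2)) G = 0" by (simp add: funpow_add)
    have "(d13 ^^ (max N1 N2 - N2)) ((d13 ^^ (N1 + M + N2)) G) = 0"
      unfolding z by (simp add: lin_0 lin_funpow lin_d13)
    then have "(d13 ^^ (max N1 N2 - N2 + (N1 + M + N2))) G = 0"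
      unfolding funpow_add[of "max N1 N2 - N2"] by simp
    moreover have "max N1 N2 - N2 + (N1 + M + N2) = N1 + M + max N1 N2" by simp
    ultimately have "(d13 ^^ (N1 + M + max N1 N2)) G p 0 r = 0" by simp
    then show ?thesis unfolding d13_funpow G_def nprod_def .
  qed
  then show ?thesis
    unfolding local_to_def cross_nat[OF x fld_nprod[OF y c]] by blast
qed

section \<open>Commutators of products\<close>

lemma Sum_any_double_bound:
  fixes f :: "nat \<Rightarrow> nat \<Rightarrow> 'a::comm_monoid_add"
  assumes "\<And>i j. M \<le> i \<or> M \<le> j \<Longrightarrow> f i j = 0"
  shows "Sum_any (\<lambda>i. Sum_any (f i)) = (\<Sum>i<M. \<Sum>j<M. f i j)"
proof -
  have "Sum_any (f i) = (\<Sum>j<M. f i j)" for i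
    by (rule Sum_any_bound) (simp add: assms)
  moreover have "Sum_any (\<lambda>i. \<Sum>j<M. f i j) = (\<Sum>i<M. \<Sum>j<M. f i j)"
    by (rule Sum_any_bound) (simp add: assms)
  ultimately show ?thesis by simp
qed

text \<open>The square of side M may be replaced by the triangle i + j < M, because h vanishes on
  the rest; the triangle is then summed along its diagonals.\<close>

lemma Cauchy_sum:
  fixes h :: "nat \<Rightarrow> 'a::cvec"
  assumes "\<And>t. t \<ge> M \<Longrightarrow> h t = 0"
  shows "(\<Sum>i<M. \<Sum>j<M. (\<alpha> i * \<beta> j) *\<^sub>C h (i + j)) = (\<Sum>t<M. (\<Sum>i\<le>t. \<alpha> i * \<beta> (t - i)) *\<^sub>C h t)"
proof -
  have "(\<Sum>i<M. \<Sum>j<M. (\<alpha> i * \<beta> j) *\<^sub>C h (i + j)) =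
      (\<Sum>(i, j)\<in>{..<M} \<times> {..<M}. (\<alpha> i * \<beta> j) *\<^sub>C h (i + j))"
    by (rule sum.cartesian_product)
  also have "\<dots> = (\<Sum>(i, j)\<in>{(i, j). i + j < M}. (\<alpha> i * \<beta> j) *\<^sub>C h (i + j))"
    by (rule sum.mono_neutral_right) (auto, meson assms not_le)
  also have "\<dots> = (\<Sum>t<M. \<Sum>i\<le>t. (\<alpha> i * \<beta> (t - i)) *\<^sub>C h (i + (t - i)))"
    by (rule sum.triangle_reindex)
  also have "\<dots> = (\<Sum>t<M. (\<Sum>i\<le>t. \<alpha> i * \<beta> (t - i)) *\<^sub>C h t)"
    by (rule sum.cong) (auto simp: cv.scale_sum_left)
  finally show ?thesis .
qed

definition msign :: "int \<Rightarrow> complex" where "msign k = (- 1) powi k"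

lemma msign_simps: "msign (a + b) = msign a * msign b" "msign (a - b) = msign a * msign b"
  "msign (int n) = (- 1) ^ n"
  by (simp_all add: msign_def power_int_add power_int_diff power_int_minus_one_mult_self
      divide_inverse flip: power_int_minus) (simp add: power_int_minus_one_minus)

lemma msign_sq: "msign a * msign a = 1"
  by (simp add: msign_def flip: power_int_mult_distrib)

lemma nprod_def': "nprod s a k b n w = xpd k (\<lambda>p q. a p (b q w)) 0 n
     - (s * msign k) *\<^sub>C xpd k (\<lambda>q p. b q (a p w)) n 0"
  by (simp add: nprod_def cross_def msign_def)


text \<open>A common cutoff M turns nested expansions into a finite double sum, whose terms can be
  reordered freely.\<close>

lemma xpd_xpd:
  assumes A: "\<And>p. lin (A p)"
    and z: "\<And>i j. M \<le> i \<or> M \<le> j \<Longrightarrow>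
      F (p + m - int i) (q + int i) (u (p + m - int i) (q + int i) + k - int j) (v (p + m - int i) (q + int i) + int j) = 0"
    and tF: "\<And>p q. tr (F p q)"
  shows "xpd m (\<lambda>p q. A p (xpd k (F p q) (u p q) (v p q))) p q =
      (\<Sum>i<M. \<Sum>j<M. (sbin m i * sbin k j) *\<^sub>C A (p + m - int i)
        (F (p + m - int i) (q + int i) (u (p + m - int i) (q + int i) + k - int j) (v (p + m - int i) (q + int i) + int j)))"
proof -
  let ?F = "\<lambda>i j. F (p + m - int i) (q + int i) (u (p + m - int i) (q + int i) + k - int j)
    (v (p + m - int i) (q + int i) + int j)"
  have "xpd m (\<lambda>p q. A p (xpd k (F p q) (u p q) (v p q))) p q =
    Sum_any (\<lambda>i. Sum_any (\<lambda>j. (sbin m i * sbin k j) *\<^sub>C A (p + m - int i) (?F i j)))"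
    unfolding xpd_def
  proof (rule Sum_any.cong)
    fix i
    have fin: "finite {j. sbin k j *\<^sub>C ?F i j \<noteq> 0}"
      by (rule tr_finite[OF tF])
    show "sbin m i *\<^sub>C A (p + m - int i) (Sum_any (\<lambda>j. sbin k j *\<^sub>C ?F i j)) =
        Sum_any (\<lambda>j. (sbin m i * sbin k j) *\<^sub>C A (p + m - int i) (?F i j))"
      unfolding lin_Sum_any[OF lin_scaleC[OF A] fin] by (simp add: lin_scale[OF A])
  qed
  also have "\<dots> = (\<Sum>i<M. \<Sum>j<M. (sbin m i * sbin k j) *\<^sub>C A (p + m - int i) (?F i j))"
    by (rule Sum_any_double_bound) (simp add: z lin_0[OF A])
  finally show ?thesis .
qed

text \<open>The four sums carry the operator orders abc, acb, bca and cba; the hypotheses provide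
  one cutoff M for all of them.\<close>

lemma nprod_nprod_expand:
  assumes a: "fld a" and b: "fld b" and c: "fld c"
    and t1: "\<And>i. M \<le> i \<Longrightarrow> c (n + int i) w = 0"
    and t2: "\<And>i j. M \<le> i \<or> M \<le> j \<Longrightarrow> c (n + int i + k - int j) (b (int j) w) = 0"
    and t3: "\<And>i j. M \<le> i \<or> M \<le> j \<Longrightarrow> c (n + int i + m - int j) (a (int j) w) = 0"
    and t4: "\<And>i j. M \<le> i \<or> M \<le> j \<Longrightarrow> b (int j) (a (int i) w) = 0"
  shows "nprod s a m (nprod sb b k c) n w =
    (\<Sum>i<M. \<Sum>j<M. (sbin m i * sbin k j) *\<^sub>C a (m - int i) (b (k - int j) (c (n + int (i + j)) w)))
    - (sb * msign k) *\<^sub>C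
      (\<Sum>i<M. \<Sum>j<M. (sbin m i * sbin k j) *\<^sub>C a (m - int i) (c (n + int i + k - int j) (b (int j) w)))
    - (s * msign m) *\<^sub>C
      (\<Sum>i<M. \<Sum>j<M. (sbin m i * sbin k j) *\<^sub>C b (k - int j) (c (n + int j + m - int i) (a (int i) w)))
    + (s * sb * msign m * msign k) *\<^sub>C
      (\<Sum>i<M. \<Sum>j<M. (sbin m i * sbin k j) *\<^sub>C c (n + m + k - int (i + j)) (b (int j) (a (int i) w)))"
proof -
  define X where "X q w = xpd k (\<lambda>p q. b p (c q w)) 0 q" for q w
  define Y where "Y q w = xpd k (\<lambda>q p. c q (b p w)) q 0" for q w
  have bc: "nprod sb b k c q w = X q w - (sb * msign k) *\<^sub>C Y q w" for sb q w
    by (simp add: nprod_def' X_def Y_def)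
  \<comment> \<open>With sign 0 only the first summand of \<open>nprod\<close> remains, and the
    difference of the signs 0 and 1 isolates the second; hence both are fields.\<close>
  have "X = nprod 0 b k c" by (simp add: fun_eq_iff bc)
  then have X: "fld X" by (simp add: fld_nprod b c)
  have "Y = msign k *\<^sub>C (nprod 0 b k c + (- 1) *\<^sub>C nprod 1 b k c)"
    by (simp add: fun_eq_iff bc scaleC_simps msign_sq)
  moreover have "fld (msign k *\<^sub>C (nprod 0 b k c + (- 1) *\<^sub>C nprod 1 b k c))"
    by (intro fld_scale fld_add fld_nprod b c)
  ultimately have Y: "fld Y" by (simp only:)
  have trs: "tr (\<lambda>p q. b p (c q w))" "tr (\<lambda>p q. a p (c q w))" "tr (\<lambda>q p. c q (b p w))"
    "tr (\<lambda>q p. c q (a p w))" "tr (\<lambda>p q. a p (X q w))" "tr (\<lambda>p q. a p (Y q w))"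
    "tr (\<lambda>q p. X q (a p w))" "tr (\<lambda>q p. Y q (a p w))" for w
    by (intro tr_fld fld_lin a b c X Y)+
  have t1': "c (n + (int i + int j)) w = 0" if "M \<le> i \<or> M \<le> j" for i j
    using t1[of "i + j"] that by auto
  have 1: "xpd m (\<lambda>p q. a p (X q w)) 0 n =
    (\<Sum>i<M. \<Sum>j<M. (sbin m i * sbin k j) *\<^sub>C a (m - int i) (b (k - int j) (c (n + int (i + j)) w)))"
    unfolding X_def
    by (subst xpd_xpd[where M = M])
      (use t1' in \<open>auto simp: fld_lin lin_0 trs a b c algebra_simps\<close>)
  have 2: "xpd m (\<lambda>p q. a p (Y q w)) 0 n =
    (\<Sum>i<M. \<Sum>j<M. (sbin m i * sbin k j) *\<^sub>C a (m - int i) (c (n + int i + k - int j) (b (int j) w)))"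
    unfolding Y_def
    by (subst xpd_xpd[where M = M]) (use t2 in \<open>auto simp: fld_lin trs a b c\<close>)
  have 3: "xpd m (\<lambda>q p. X q (a p w)) n 0 =
    (\<Sum>i<M. \<Sum>j<M. (sbin m i * sbin k j) *\<^sub>C b (k - int j) (c (n + int j + m - int i) (a (int i) w)))"
    unfolding X_def
    by (subst xpd_xpd[where M = M and A = "\<lambda>p x. x", OF lin_id])
      (use t3 in \<open>auto simp: fld_lin lin_0 trs a b c algebra_simps\<close>)
  have 4: "xpd m (\<lambda>q p. Y q (a p w)) n 0 =
    (\<Sum>i<M. \<Sum>j<M. (sbin m i * sbin k j) *\<^sub>C c (n + m + k - int (i + j)) (b (int j) (a (int i) w)))"
    unfolding Y_def
    by (subst xpd_xpd[where M = M and A = "\<lambda>p x. x", OF lin_id])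
      (use t4 in \<open>auto simp: fld_lin lin_0 trs a b c algebra_simps\<close>)
  have "nprod s a m (nprod sb b k c) n w =
      xpd m (\<lambda>p q. a p (X q w) - (sb * msign k) *\<^sub>C a p (Y q w)) 0 n -
      (s * msign m) *\<^sub>C xpd m (\<lambda>q p. X q (a p w) - (sb * msign k) *\<^sub>C Y q (a p w)) n 0"
    by (simp add: nprod_def'[of s] bc lin_diff lin_scale fld_lin a)
  also have "\<dots> = xpd m (\<lambda>p q. a p (X q w)) 0 n - (sb * msign k) *\<^sub>C xpd m (\<lambda>p q. a p (Y q w)) 0 n
      - (s * msign m) *\<^sub>C xpd m (\<lambda>q p. X q (a p w)) n 0
      + (s * sb * msign m * msign k) *\<^sub>C xpd m (\<lambda>q p. Y q (a p w)) n 0"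
    by (simp add: xpd_diff xpd_scale tr_scale trs scaleC_simps mult_ac)
  finally show ?thesis unfolding 1 2 3 4 .
qed

text \<open>In the difference of the expansions, the terms with \<open>c\<close> between \<open>a\<close> and \<open>b\<close> cancel.\<close>

theorem commutator_of_products:
  assumes a: "fld a" and b: "fld b" and c: "fld c" and d: "\<And>l. l < L \<Longrightarrow> fld (d l)"
    and s: "s * s = 1"
    and comm: "\<And>m n w. a m (b n w) - s *\<^sub>C b n (a m w) = (\<Sum>l<L. bin m l *\<^sub>C d l (m + n - int l) w)"
  shows "nprod (s * sa) a m (nprod sb b k c) n w - s *\<^sub>C nprod (s * sb) b k (nprod sa a m c) n w =
    (\<Sum>l<L. bin m l *\<^sub>C nprod (sa * sb) (d l) (m + k - int l) c n w)"
proof -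
  obtain N0 where N0: "\<And>q. q \<ge> int N0 \<Longrightarrow> c q w = 0" using fld_nat[OF c] by blast
  obtain M2 where M2: "\<And>i j. M2 \<le> i \<or> M2 \<le> j \<Longrightarrow> c (n + k + int i + (- 1) * int j) (b (int j) w) = 0"
    using double_trunc[OF b c] by blast
  obtain M3 where M3: "\<And>i j. M3 \<le> i \<or> M3 \<le> j \<Longrightarrow> c (n + m + int i + (- 1) * int j) (a (int j) w) = 0"
    using double_trunc[OF a c] by blast
  obtain M4 where M4: "\<And>i j. M4 \<le> i \<or> M4 \<le> j \<Longrightarrow> b (0 + int i + 0 * int j) (a (int j) w) = 0"
    using double_trunc[OF a b] by blast
  obtain M5 where M5: "\<And>i j. M5 \<le> i \<or> M5 \<le> j \<Longrightarrow> a (0 + int i + 0 * int j) (b (int j) w) = 0"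
    using double_trunc[OF b a] by blast
  have "\<exists>N. \<forall>l<L. \<forall>t\<ge>int N. d l t w = 0"
    using d
  proof (induction L)
    case (Suc L)
    then obtain N where N: "\<forall>l<L. \<forall>t\<ge>int N. d l t w = 0" by auto
    obtain N' where N': "\<forall>t. t \<ge> int N' \<longrightarrow> d L t w = 0" using fld_nat Suc.prems by blast
    have "\<forall>l<Suc L. \<forall>t\<ge>int (max N N'). d l t w = 0" using N N' by (auto simp: less_Suc_eq)
    then show ?case by blast
  qed simp
  then obtain N6 where N6: "\<And>l t. l < L \<Longrightarrow> t \<ge> int N6 \<Longrightarrow> d l t w = 0" by blast
  \<comment> \<open>One cutoff for every expansion; the summand L keeps M - l at least N6 for all l
    < L.\<close>
  define M where "M = N0 + nat \<bar>n\<bar> + M2 + M3 + M4 + M5 + N6 + L"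
  have t1: "c (n + int i) w = 0" if "M \<le> i" for i
    by (rule N0) (use that in \<open>simp add: M_def\<close>)
  have t2: "c (n + int i + k - int j) (b (int j) w) = 0" if "M \<le> i \<or> M \<le> j" for i j
  proof -
    have "M2 \<le> i \<or> M2 \<le> j" using that by (auto simp: M_def)
    from M2[OF this] show ?thesis by (simp add: algebra_simps)
  qed
  have t3: "c (n + int i + m - int j) (a (int j) w) = 0" if "M \<le> i \<or> M \<le> j" for i j
  proof -
    have "M3 \<le> i \<or> M3 \<le> j" using that by (auto simp: M_def)
    from M3[OF this] show ?thesis by (simp add: algebra_simps)
  qed
  have t4: "b (int j) (a (int i) w) = 0" if "M \<le> i \<or> M \<le> j" for i j
    using M4[of j i] that by (auto simp: M_def)
  have t5: "a (int i) (b (int j) w) = 0" if "M \<le> j \<or> M \<le> i" for i j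
    using M5[of i j] that by (auto simp: M_def)
  have t6: "d l (int t) w = 0" if "l < L" "M - l \<le> t" for l t
    by (rule N6) (use that in \<open>auto simp: M_def\<close>)
  define S1 where "S1 = (\<Sum>i<M. \<Sum>j<M. (sbin m i * sbin k j) *\<^sub>C
    a (m - int i) (b (k - int j) (c (n + int (i + j)) w)))"
  define S1' where "S1' = (\<Sum>i<M. \<Sum>j<M. (sbin m i * sbin k j) *\<^sub>C
    b (k - int j) (a (m - int i) (c (n + int (i + j)) w)))"
  define S2 where "S2 = (\<Sum>i<M. \<Sum>j<M. (sbin m i * sbin k j) *\<^sub>C
    a (m - int i) (c (n + int i + k - int j) (b (int j) w)))"
  define S3 where "S3 = (\<Sum>i<M. \<Sum>j<M. (sbin m i * sbin k j) *\<^sub>C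
    b (k - int j) (c (n + int j + m - int i) (a (int i) w)))"
  define S4 where "S4 = (\<Sum>i<M. \<Sum>j<M. (sbin m i * sbin k j) *\<^sub>C
    c (n + m + k - int (i + j)) (b (int j) (a (int i) w)))"
  define S4' where "S4' = (\<Sum>i<M. \<Sum>j<M. (sbin m i * sbin k j) *\<^sub>C
    c (n + m + k - int (i + j)) (a (int i) (b (int j) w)))"
  have E1: "nprod (s * sa) a m (nprod sb b k c) n w =
    S1 - (sb * msign k) *\<^sub>C S2 - (s * sa * msign m) *\<^sub>C S3 + (s * sa * sb * msign m * msign k) *\<^sub>C S4"
    unfolding S1_def S2_def S3_def S4_def
    by (rule nprod_nprod_expand[OF a b c t1 t2 t3 t4])
  have E2: "nprod (s * sb) b k (nprod sa a m c) n w =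
    S1' - (sa * msign m) *\<^sub>C S3 - (s * sb * msign k) *\<^sub>C S2 + (s * sb * sa * msign k * msign m) *\<^sub>C S4'"
  proof -
    have sw: "(\<Sum>j<M. \<Sum>i<M. (sbin k j * sbin m i) *\<^sub>C f j i) =
        (\<Sum>i<M. \<Sum>j<M. (sbin m i * sbin k j) *\<^sub>C f j i)" for f :: "nat \<Rightarrow> nat \<Rightarrow> 'a"
      by (subst sum.swap) (simp add: mult.commute)
    have "n + m + k - int (i + j) = n + k + m - int (j + i)" "i + j = j + i" for i j by simp_all
    then show ?thesis
      unfolding S1'_def S2_def S3_def S4'_def
      by (subst nprod_nprod_expand[where M = M, OF b a c t1 t3 t2 t5]) (simp_all only: sw)
  qed
  have K: "a p (b q x) - s *\<^sub>C b q (a p x) = (\<Sum>l<L. bin p l *\<^sub>C d l (p + q - int l) x)" for p q x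
    by (rule comm)
  \<comment> \<open>Here c acts first. The commutator of the modes m - i of a and k - j of b
    produces \<open>bin (m - int i) l\<close>, and the coefficients with i + j = t are summed by
    \<open>bin_revision_sum1\<close>.\<close>
  have A: "S1 - s *\<^sub>C S1' = (\<Sum>l<L. bin m l *\<^sub>C xpd (m + k - int l) (\<lambda>p q. d l p (c q w)) 0 n)"
  proof -
    define h where "h l t = d l (m + k - int l - int t) (c (n + int t) w)" for l t
    have "S1 - s *\<^sub>C S1' = (\<Sum>i<M. \<Sum>j<M. \<Sum>l<L. ((sbin m i * bin (m - int i) l) * sbin k j) *\<^sub>C h l (i + j))"
      unfolding S1_def S1'_def cv.scale_sum_right sum_subtractf[symmetric]
    proof (intro sum.cong refl)
      fix i j
      have "(sbin m i * sbin k j) *\<^sub>C a (m - int i) (b (k - int j) (c (n + int (i + j)) w)) -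
          s *\<^sub>C (sbin m i * sbin k j) *\<^sub>C b (k - int j) (a (m - int i) (c (n + int (i + j)) w)) =
          (sbin m i * sbin k j) *\<^sub>C (a (m - int i) (b (k - int j) (c (n + int (i + j)) w)) -
          s *\<^sub>C b (k - int j) (a (m - int i) (c (n + int (i + j)) w)))"
        by (simp add: scaleC_simps mult_ac)
      also have "\<dots> = (\<Sum>l<L. ((sbin m i * bin (m - int i) l) * sbin k j) *\<^sub>C h l (i + j))"
        unfolding K cv.scale_sum_right h_def by (intro sum.cong refl) (simp add: algebra_simps)
      finally show "(sbin m i * sbin k j) *\<^sub>C a (m - int i) (b (k - int j) (c (n + int (i + j)) w)) -
          s *\<^sub>C (sbin m i * sbin k j) *\<^sub>C b (k - int j) (a (m - int i) (c (n + int (i + j)) w)) =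
          (\<Sum>l<L. ((sbin m i * bin (m - int i) l) * sbin k j) *\<^sub>C h l (i + j))" .
    qed
    also have "\<dots> = (\<Sum>l<L. \<Sum>i<M. \<Sum>j<M. ((sbin m i * bin (m - int i) l) * sbin k j) *\<^sub>C h l (i + j))"
      by (subst sum.swap[of _ "{..<L}"], subst (2) sum.swap) (rule refl)
    also have "\<dots> = (\<Sum>l<L. bin m l *\<^sub>C xpd (m + k - int l) (\<lambda>p q. d l p (c q w)) 0 n)"
    proof (intro sum.cong refl)
      fix l assume "l \<in> {..<L}"
      then have l: "l < L" by simp
      have hz: "h l t = 0" if "t \<ge> M" for t
        using that by (simp add: h_def t1 lin_0 fld_lin d l)
      have Cs: "(\<Sum>i<M. \<Sum>j<M. (sbin m i * bin (m - int i) l * sbin k j) *\<^sub>C h l (i + j)) =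
          (\<Sum>t<M. (\<Sum>i\<le>t. sbin m i * bin (m - int i) l * sbin k (t - i)) *\<^sub>C h l t)"
        by (rule Cauchy_sum) (rule hz)
      have coeff: "(\<Sum>i\<le>t. sbin m i * bin (m - int i) l * sbin k (t - i)) = bin m l * sbin (m + k - int l) t" for t
      proof -
        have "(\<Sum>i\<le>t. sbin m i * bin (m - int i) l * sbin k (t - i)) =
            (\<Sum>i\<le>t. (- 1) ^ t * (bin m i * bin (m - int i) l * bin k (t - i)))"
          by (intro sum.cong refl) (auto simp: sbin_def simp flip: power_add)
        then show ?thesis
          unfolding sum_distrib_left[symmetric] bin_revision_sum1 by (simp add: sbin_def)
      qed
      have "xpd (m + k - int l) (\<lambda>p q. d l p (c q w)) 0 n = (\<Sum>t<M. sbin (m + k - int l) t *\<^sub>C h l t)"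
        unfolding xpd_def h_def
        by (subst Sum_any_bound[of M]) (use d l in \<open>simp_all add: t1 lin_0 fld_lin\<close>)
      then show "(\<Sum>i<M. \<Sum>j<M. ((sbin m i * bin (m - int i) l) * sbin k j) *\<^sub>C h l (i + j)) =
          bin m l *\<^sub>C xpd (m + k - int l) (\<lambda>p q. d l p (c q w)) 0 n"
        unfolding Cs coeff
        by (simp add: cv.scale_sum_right)
    qed
    finally show ?thesis .
  qed
  \<comment> \<open>Here c acts last and the modes of a and b are i and j, so
    \<open>bin (int i) l\<close> occurs and \<open>bin_revision_sum2\<close> applies. The shift of t
    by l leaves the sign (-1)^l.\<close>
  have B: "S4' - s *\<^sub>C S4 = (\<Sum>l<L. bin m l *\<^sub>C (- 1) ^ l *\<^sub>C xpd (m + k - int l) (\<lambda>q p. c q (d l p w)) n 0)"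
  proof -
    define h where "h l t = c (n + m + k - int t) (d l (int t - int l) w)" for l t
    have "S4' - s *\<^sub>C S4 = (\<Sum>i<M. \<Sum>j<M. \<Sum>l<L. ((sbin m i * bin (int i) l) * sbin k j) *\<^sub>C h l (i + j))"
      unfolding S4_def S4'_def cv.scale_sum_right sum_subtractf[symmetric]
    proof (intro sum.cong refl)
      fix i j
      let ?c = "c (n + m + k - int (i + j))"
      have "(sbin m i * sbin k j) *\<^sub>C ?c (a (int i) (b (int j) w)) -
          s *\<^sub>C (sbin m i * sbin k j) *\<^sub>C ?c (b (int j) (a (int i) w)) =
          (sbin m i * sbin k j) *\<^sub>C ?c (a (int i) (b (int j) w) - s *\<^sub>C b (int j) (a (int i) w))"
        by (simp add: scaleC_simps mult_ac lin_diff lin_scale fld_lin c)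
      also have "\<dots> = (\<Sum>l<L. ((sbin m i * bin (int i) l) * sbin k j) *\<^sub>C h l (i + j))"
        unfolding K lin_sum[OF fld_lin[OF c]] cv.scale_sum_right h_def
        by (intro sum.cong refl) (simp add: lin_scale fld_lin c algebra_simps)
      finally show "(sbin m i * sbin k j) *\<^sub>C ?c (a (int i) (b (int j) w)) -
          s *\<^sub>C (sbin m i * sbin k j) *\<^sub>C ?c (b (int j) (a (int i) w)) =
          (\<Sum>l<L. ((sbin m i * bin (int i) l) * sbin k j) *\<^sub>C h l (i + j))" .
    qed
    also have "\<dots> = (\<Sum>l<L. \<Sum>i<M. \<Sum>j<M. ((sbin m i * bin (int i) l) * sbin k j) *\<^sub>C h l (i + j))"
      by (subst sum.swap[of _ "{..<L}"], subst (2) sum.swap) (rule refl)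
    also have "\<dots> = (\<Sum>l<L. bin m l *\<^sub>C (- 1) ^ l *\<^sub>C xpd (m + k - int l) (\<lambda>q p. c q (d l p w)) n 0)"
    proof (intro sum.cong refl)
      fix l assume "l \<in> {..<L}"
      then have l: "l < L" "l \<le> M" by (auto simp: M_def)
      have hz: "h l t = 0" if "t \<ge> M" for t
        using t6[OF l(1), of "t - l"] that l by (simp add: h_def of_nat_diff lin_0 fld_lin c)
      have Cs: "(\<Sum>i<M. \<Sum>j<M. (sbin m i * bin (int i) l * sbin k j) *\<^sub>C h l (i + j)) =
          (\<Sum>t<M. (\<Sum>i\<le>t. sbin m i * bin (int i) l * sbin k (t - i)) *\<^sub>C h l t)"
        by (rule Cauchy_sum) (rule hz)
      have coeff: "(\<Sum>i\<le>t. sbin m i * bin (int i) l * sbin k (t - i)) =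
          (if l \<le> t then (- 1) ^ t * (bin m l * bin (m + k - int l) (t - l)) else 0)" for t
      proof -
        have "(\<Sum>i\<le>t. sbin m i * bin (int i) l * sbin k (t - i)) =
            (\<Sum>i\<le>t. (- 1) ^ t * (bin m i * bin (int i) l * bin k (t - i)))"
          by (intro sum.cong refl) (auto simp: sbin_def simp flip: power_add)
        then show ?thesis
          unfolding sum_distrib_left[symmetric] bin_revision_sum2 by simp
      qed
      have "xpd (m + k - int l) (\<lambda>q p. c q (d l p w)) n 0 =
          (\<Sum>t<M - l. sbin (m + k - int l) t *\<^sub>C h l (t + l))"
        unfolding xpd_def h_def
        by (subst Sum_any_bound[of "M - l"])
          (use l in \<open>auto simp: t6 lin_0 fld_lin c algebra_simps intro!: sum.cong\<close>)
      moreover have "(\<Sum>t<M. (if l \<le> t then (- 1) ^ t * (bin m l * bin (m + k - int l) (t - l)) else 0) *\<^sub>C h l t) =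
          (\<Sum>t\<in>{l..<M}. ((- 1) ^ t * (bin m l * bin (m + k - int l) (t - l))) *\<^sub>C h l t)"
        by (rule sum.mono_neutral_cong_right) auto
      moreover have "\<dots> = (\<Sum>t<M - l. ((- 1) ^ (t + l) * (bin m l * bin (m + k - int l) t)) *\<^sub>C h l (t + l))"
        by (rule sum.reindex_bij_witness[of _ "\<lambda>t. t + l" "\<lambda>t. t - l"]) auto
      ultimately show "(\<Sum>i<M. \<Sum>j<M. ((sbin m i * bin (int i) l) * sbin k j) *\<^sub>C h l (i + j)) =
          bin m l *\<^sub>C (- 1) ^ l *\<^sub>C xpd (m + k - int l) (\<lambda>q p. c q (d l p w)) n 0"
        unfolding Cs coeff
        by (auto simp: cv.scale_sum_right sbin_def power_add mult_ac intro!: sum.cong)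
    qed
    finally show ?thesis .
  qed
  have "nprod (s * sa) a m (nprod sb b k c) n w - s *\<^sub>C nprod (s * sb) b k (nprod sa a m c) n w =
      (S1 - s *\<^sub>C S1') - (sa * sb * msign m * msign k) *\<^sub>C (S4' - s *\<^sub>C S4)"
  proof -
    have s': "s * (s * x) = x" for x using s by (simp add: mult.assoc[symmetric])
    show ?thesis unfolding E1 E2 by (simp add: scaleC_simps s' mult_ac)
  qed
  also have "\<dots> = (\<Sum>l<L. bin m l *\<^sub>C nprod (sa * sb) (d l) (m + k - int l) c n w)"
    unfolding A B cv.scale_sum_right sum_subtractf[symmetric] nprod_def'
    by (intro sum.cong refl) (simp add: scaleC_simps msign_simps mult_ac)
  finally show ?thesis .
qed

section \<open>Derivatives and the identity field\<close>

lemma Sum_any_Suc: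
  fixes f :: "nat \<Rightarrow> 'a::comm_monoid_add"
  assumes "f 0 = 0" and "\<And>i. i \<ge> N \<Longrightarrow> f i = 0"
  shows "Sum_any f = Sum_any (\<lambda>i. f (Suc i))"
proof -
  have "Sum_any f = sum f {..<Suc N}" by (rule Sum_any_bound) (use assms in auto)
  also have "\<dots> = (\<Sum>i<N. f (Suc i))" unfolding sum.lessThan_Suc_shift by (simp add: assms(1))
  also have "\<dots> = Sum_any (\<lambda>i. f (Suc i))"
    by (rule Sum_any_bound[symmetric]) (use assms in auto)
  finally show ?thesis .
qed

definition der :: "'u::cvec field \<Rightarrow> 'u field" where
  "der a n w = (- of_int n) *\<^sub>C a (n - 1) w"

lemma fld_der:
  assumes "fld a"
  shows "fld (der a)"
proof (rule fldI)
  fix n show "lin (der a n)"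
    using assms lin_scaleC[of "a (n - 1)" "- of_int n"] by (simp add: der_def[abs_def] fld_lin)
next
  fix w
  obtain N where "\<forall>n\<ge>N. a n w = 0" using fld_trunc[OF assms] by blast
  then have "\<forall>n\<ge>N+1. der a n w = 0" by (simp add: der_def)
  then show "\<exists>N. \<forall>n\<ge>N. der a n w = 0" by blast
qed

lemma lin_der: "lin der"
  by (rule linI) (simp_all add: fun_eq_iff der_def scaleC_simps mult.commute)

text \<open>Integration by parts in x: the derivative falls on (x - y)^k. On coefficients this is
  \<open>sbin_absorb_comp\<close> in the first summand and \<open>sbin_absorption\<close> in the
  second.\<close>

lemma nprod_der_left:
  assumes a: "fld a" and c: "fld c"
  shows "nprod s (der a) k c n w = - of_int k *\<^sub>C nprod s a (k - 1) c n w"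
proof -
  have 1: "xpd k (\<lambda>p q. der a p (c q w)) 0 n = - of_int k *\<^sub>C xpd (k - 1) (\<lambda>p q. a p (c q w)) 0 n"
  proof -
    have "xpd k (\<lambda>p q. der a p (c q w)) 0 n =
        xpd (k - 1) (\<lambda>p q. - of_int k *\<^sub>C a p (c q w)) 0 n"
      unfolding xpd_def
    proof (rule Sum_any.cong)
      fix i
      have *: "sbin k i * - of_int (0 + k - int i) = sbin (k - 1) i * - of_int k"
        using sbin_absorb_comp[of k i] by (simp add: algebra_simps)
      have "0 + k - int i - 1 = 0 + (k - 1) - int i" by simp
      then show "sbin k i *\<^sub>C der a (0 + k - int i) (c (n + int i) w) =
          sbin (k - 1) i *\<^sub>C - of_int k *\<^sub>C a (0 + (k - 1) - int i) (c (n + int i) w)"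
        by (simp only: der_def cv.scale_scale *)
    qed
    then show ?thesis by (simp only: xpd_scale tr_fld fld_lin a c)
  qed
  have 2: "xpd k (\<lambda>q p. c q (der a p w)) n 0 = of_int k *\<^sub>C xpd (k - 1) (\<lambda>q p. c q (a p w)) n 0"
  proof -
    obtain N where N: "\<And>n. n \<ge> int N \<Longrightarrow> a n w = 0" using fld_nat[OF a] by blast
    have "xpd k (\<lambda>q p. c q (der a p w)) n 0 =
        xpd (k - 1) (\<lambda>q p. of_int k *\<^sub>C c q (a p w)) n 0"
      unfolding xpd_def
    proof (subst Sum_any_Suc[of _ "Suc N"])
      show "sbin k 0 *\<^sub>C c (n + k - int 0) (der a (0 + int 0) w) = 0"
        by (simp add: der_def lin_0 fld_lin c)
      show "sbin k i *\<^sub>C c (n + k - int i) (der a (0 + int i) w) = 0" if "Suc N \<le> i" for i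
        using that by (simp add: der_def N lin_0 fld_lin c)
      show "Sum_any (\<lambda>i. sbin k (Suc i) *\<^sub>C c (n + k - int (Suc i)) (der a (0 + int (Suc i)) w)) =
        Sum_any (\<lambda>i. sbin (k - 1) i *\<^sub>C of_int k *\<^sub>C c (n + (k - 1) - int i) (a (0 + int i) w))"
      proof (rule Sum_any.cong)
        fix i
        have "sbin k (Suc i) * - of_nat (Suc i) = - (of_nat (Suc i) * sbin k (Suc i))"
          by (metis mult.commute mult_minus_right)
        also have "\<dots> = sbin (k - 1) i * of_int k" unfolding sbin_absorption by simp
        finally have *: "sbin k (Suc i) * - of_nat (Suc i) = sbin (k - 1) i * of_int k" .
        have "n + k - int (Suc i) = n + (k - 1) - int i" "0 + int (Suc i) - 1 = 0 + int i"
          "complex_of_int (0 + int (Suc i)) = of_nat (Suc i)" by simp_all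
        with * show "sbin k (Suc i) *\<^sub>C c (n + k - int (Suc i)) (der a (0 + int (Suc i)) w) =
          sbin (k - 1) i *\<^sub>C of_int k *\<^sub>C c (n + (k - 1) - int i) (a (0 + int i) w)"
          by (simp only: der_def lin_scale[OF fld_lin[OF c]] cv.scale_scale)
      qed
    qed
    then show ?thesis by (simp only: xpd_scale tr_fld fld_lin a c)
  qed
  have "msign k = - msign (k - 1)"
    using minus_one_powi_Suc[of "k - 1"] by (simp add: msign_def)
  then show ?thesis unfolding nprod_def' 1 2 by (simp add: scaleC_simps mult_ac)
qed

text \<open>The derivative in y falls on b and on (x - y)^k; the latter gives -k times the (k-1)-st
  product, which by \<open>nprod_der_left\<close> is the product with \<open>der a\<close>.\<close>

lemma der_nprod:
  assumes a: "fld a" and b: "fld b"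
  shows "der (nprod s a k b) n w = nprod s (der a) k b n w + nprod s a k (der b) n w"
proof -
  have tr': "tr (\<lambda>p q. a p (b q w))" "tr (\<lambda>q p. b q (a p w))" for w
    by (intro tr_fld fld_lin a b)+
  have trd: "tr (\<lambda>p q. a p (der b q w))" "tr (\<lambda>q p. der b q (a p w))" for w
    by (intro tr_fld fld_lin fld_der a b)+
  have 1: "- of_int n *\<^sub>C xpd k (\<lambda>p q. a p (b q w)) 0 (n - 1) =
      - of_int k *\<^sub>C xpd (k - 1) (\<lambda>p q. a p (b q w)) 0 n + xpd k (\<lambda>p q. a p (der b q w)) 0 n"
  proof -
    obtain N where N: "\<And>n. n \<ge> int N \<Longrightarrow> b n w = 0" using fld_nat[OF b] by blast
    define M where "M = N + nat \<bar>n\<bar> + 1"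
    have bz: "b (n - 1 + int i) w = 0" if "M \<le> i" for i
      by (rule N) (use that in \<open>simp add: M_def\<close>)
    have "- of_int k *\<^sub>C xpd (k - 1) (\<lambda>p q. a p (b q w)) 0 n =
        Sum_any (\<lambda>i. (of_nat (Suc i) * sbin k (Suc i)) *\<^sub>C a (k - int (Suc i)) (b (n - 1 + int (Suc i)) w))"
      unfolding xpd_scale[OF tr'(1), symmetric] unfolding xpd_def
    proof (intro Sum_any.cong)
      fix i
      have *: "sbin (k - 1) i * - of_int k = of_nat (Suc i) * sbin k (Suc i)"
        by (simp only: sbin_absorption mult.commute)
      have "0 + (k - 1) - int i = k - int (Suc i)" "n + int i = n - 1 + int (Suc i)" by simp_all
      then show "sbin (k - 1) i *\<^sub>C - of_int k *\<^sub>C a (0 + (k - 1) - int i) (b (n + int i) w) =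
          (of_nat (Suc i) * sbin k (Suc i)) *\<^sub>C a (k - int (Suc i)) (b (n - 1 + int (Suc i)) w)"
        by (simp only: cv.scale_scale *)
    qed
    also have "\<dots> = Sum_any (\<lambda>i. (of_nat i * sbin k i) *\<^sub>C a (k - int i) (b (n - 1 + int i) w))"
      by (subst (2) Sum_any_Suc[of _ M]) (simp_all add: bz lin_0 fld_lin a)
    finally have 2: "- of_int k *\<^sub>C xpd (k - 1) (\<lambda>p q. a p (b q w)) 0 n =
      Sum_any (\<lambda>i. (of_nat i * sbin k i) *\<^sub>C a (k - int i) (b (n - 1 + int i) w))" .
    have bz': "b (n + int i - 1) w = 0" if "M \<le> i" for i
      using bz[OF that] by (simp add: algebra_simps)
    have "xpd k (\<lambda>p q. a p (der b q w)) 0 n =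
      Sum_any (\<lambda>i. (- (of_int n + of_nat i) * sbin k i) *\<^sub>C a (k - int i) (b (n - 1 + int i) w))"
      unfolding xpd_def
    proof (intro Sum_any.cong)
      fix i
      have "n + int i - 1 = n - 1 + int i" by simp
      then have "der b (n + int i) w = - (of_int n + of_nat i) *\<^sub>C b (n - 1 + int i) w"
        by (simp only: der_def of_int_add of_int_of_nat_eq)
      then show "sbin k i *\<^sub>C a (0 + k - int i) (der b (n + int i) w) =
          (- (of_int n + of_nat i) * sbin k i) *\<^sub>C a (k - int i) (b (n - 1 + int i) w)"
        by (simp only: lin_scale[OF fld_lin[OF a]] cv.scale_scale mult.commute add_0)
    qed
    note 3 = this
    have "- of_int k *\<^sub>C xpd (k - 1) (\<lambda>p q. a p (b q w)) 0 n + xpd k (\<lambda>p q. a p (der b q w)) 0 n =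
      Sum_any (\<lambda>i. (of_nat i * sbin k i) *\<^sub>C a (k - int i) (b (n - 1 + int i) w) +
        (- (of_int n + of_nat i) * sbin k i) *\<^sub>C a (k - int i) (b (n - 1 + int i) w))"
      unfolding 2 3
      by (rule Sum_any.distrib[symmetric]; rule finite_supp_bound[of M]) (simp_all add: bz lin_0 fld_lin a)
    also have "\<dots> = Sum_any (\<lambda>i. sbin k i *\<^sub>C - of_int n *\<^sub>C a (0 + k - int i) (b (n - 1 + int i) w))"
    proof (intro Sum_any.cong)
      fix i
      have *: "of_nat i * sbin k i + - (of_int n + of_nat i) * sbin k i = sbin k i * - of_int n"
        by (simp add: algebra_simps)
      show "(of_nat i * sbin k i) *\<^sub>C a (k - int i) (b (n - 1 + int i) w) +
          (- (of_int n + of_nat i) * sbin k i) *\<^sub>C a (k - int i) (b (n - 1 + int i) w) =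
          sbin k i *\<^sub>C - of_int n *\<^sub>C a (0 + k - int i) (b (n - 1 + int i) w)"
        unfolding scaleC_add_left[symmetric] * by (simp only: cv.scale_scale add_0)
    qed
    also have "\<dots> = - of_int n *\<^sub>C xpd k (\<lambda>p q. a p (b q w)) 0 (n - 1)"
      unfolding xpd_scale[OF tr'(1), symmetric] unfolding xpd_def ..
    finally show ?thesis ..
  qed
  have 2: "- of_int n *\<^sub>C xpd k (\<lambda>q p. b q (a p w)) (n - 1) 0 =
      of_int k *\<^sub>C xpd (k - 1) (\<lambda>q p. b q (a p w)) n 0 + xpd k (\<lambda>q p. der b q (a p w)) n 0"
  proof -
    obtain N where N: "\<And>n. n \<ge> int N \<Longrightarrow> a n w = 0" using fld_nat[OF a] by blast
    have 3: "of_int k *\<^sub>C xpd (k - 1) (\<lambda>q p. b q (a p w)) n 0 =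
        Sum_any (\<lambda>i. ((of_int k - of_nat i) * sbin k i) *\<^sub>C b (n - 1 + k - int i) (a (int i) w))"
      unfolding xpd_scale[OF tr'(2), symmetric] unfolding xpd_def sbin_absorb_comp
      by (intro Sum_any.cong) (simp add: cv.scale_scale algebra_simps)
    have "xpd k (\<lambda>q p. der b q (a p w)) n 0 =
      Sum_any (\<lambda>i. (- (of_int n + of_int k - of_nat i) * sbin k i) *\<^sub>C b (n - 1 + k - int i) (a (int i) w))"
      unfolding xpd_def
    proof (intro Sum_any.cong)
      fix i
      have "n + k - int i - 1 = n - 1 + k - int i" by simp
      then show "sbin k i *\<^sub>C der b (n + k - int i) (a (0 + int i) w) =
          (- (of_int n + of_int k - of_nat i) * sbin k i) *\<^sub>C b (n - 1 + k - int i) (a (int i) w)"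
        by (simp only: der_def of_int_add of_int_diff of_int_of_nat_eq cv.scale_scale mult.commute add_0)
    qed
    note 4 = this
    have "of_int k *\<^sub>C xpd (k - 1) (\<lambda>q p. b q (a p w)) n 0 + xpd k (\<lambda>q p. der b q (a p w)) n 0 =
      Sum_any (\<lambda>i. ((of_int k - of_nat i) * sbin k i) *\<^sub>C b (n - 1 + k - int i) (a (int i) w) +
        (- (of_int n + of_int k - of_nat i) * sbin k i) *\<^sub>C b (n - 1 + k - int i) (a (int i) w))"
      unfolding 3 4
      by (rule Sum_any.distrib[symmetric]; rule finite_supp_bound[of N]) (simp_all add: N lin_0 fld_lin b)
    also have "\<dots> = Sum_any (\<lambda>i. sbin k i *\<^sub>C - of_int n *\<^sub>C b (n - 1 + k - int i) (a (0 + int i) w))"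
    proof (intro Sum_any.cong)
      fix i
      have *: "(of_int k - of_nat i) * sbin k i + - (of_int n + of_int k - of_nat i) * sbin k i =
          sbin k i * - of_int n"
        by (simp add: algebra_simps)
      show "((of_int k - of_nat i) * sbin k i) *\<^sub>C b (n - 1 + k - int i) (a (int i) w) +
          (- (of_int n + of_int k - of_nat i) * sbin k i) *\<^sub>C b (n - 1 + k - int i) (a (int i) w) =
          sbin k i *\<^sub>C - of_int n *\<^sub>C b (n - 1 + k - int i) (a (0 + int i) w)"
        unfolding scaleC_add_left[symmetric] * by (simp only: cv.scale_scale add_0)
    qed
    also have "\<dots> = - of_int n *\<^sub>C xpd k (\<lambda>q p. b q (a p w)) (n - 1) 0"
      unfolding xpd_scale[OF tr'(2), symmetric] unfolding xpd_def ..
    finally show ?thesis ..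
  qed
  have "msign k = - msign (k - 1)"
    using minus_one_powi_Suc[of "k - 1"] by (simp add: msign_def)
  then have "nprod s (der a) k b n w + nprod s a k (der b) n w =
      (- of_int k *\<^sub>C xpd (k - 1) (\<lambda>p q. a p (b q w)) 0 n + xpd k (\<lambda>p q. a p (der b q w)) 0 n) -
      (s * msign k) *\<^sub>C (of_int k *\<^sub>C xpd (k - 1) (\<lambda>q p. b q (a p w)) n 0 + xpd k (\<lambda>q p. der b q (a p w)) n 0)"
    unfolding nprod_der_left[OF a b] unfolding nprod_def' by (simp add: scaleC_simps mult_ac)
  also have "\<dots> = der (nprod s a k b) n w"
    unfolding 1[symmetric] 2[symmetric] unfolding der_def nprod_def' by (simp add: scaleC_simps mult_ac)
  finally show ?thesis ..
qed

definition idf :: "('u::cvec \<Rightarrow> 'u) \<Rightarrow> 'u field" where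
  "idf e n w = (if n = - 1 then e w else 0)"

text \<open>Absorption of e on both sides: such a field acts through the image of e, on which an
  idempotent e is the identity. Hence \<open>idf e\<close> behaves as a unit for the products of
  these fields.\<close>

definition unital :: "('u::cvec \<Rightarrow> 'u) \<Rightarrow> 'u field \<Rightarrow> bool" where
  "unital e a \<longleftrightarrow> (\<forall>n w. a n (e w) = a n w \<and> e (a n w) = a n w)"

lemma fld_idf:
  assumes "lin e"
  shows "fld (idf e)"
proof (rule fldI)
  fix n show "lin (idf e n)" using assms lin_zero by (cases "n = - 1") (simp_all add: idf_def[abs_def])
next
  fix w have "\<forall>n\<ge>0. idf e n w = 0" by (simp add: idf_def)
  then show "\<exists>N. \<forall>n\<ge>N. idf e n w = 0" by blast
qed

lemma unital_idf: "(\<And>w. e (e w) = e w) \<Longrightarrow> lin e \<Longrightarrow> unital e (idf e)"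
  by (simp add: unital_def idf_def lin_0)

lemma unital_scale: "unital e a \<Longrightarrow> lin e \<Longrightarrow> unital e (c *\<^sub>C a)"
  and unital_add: "unital e a \<Longrightarrow> unital e b \<Longrightarrow> lin e \<Longrightarrow> unital e (a + b)"
  by (auto simp: unital_def lin_simps)

lemma der_idf: "der (idf e) = 0"
  by (simp add: fun_eq_iff der_def idf_def)

lemma unital_nprod:
  assumes "unital e a" "unital e b" "lin e" "fld a" "fld b"
  shows "unital e (nprod s a k b)"
proof -
  have "tr (\<lambda>p q. a p (b q w))" "tr (\<lambda>q p. b q (a p w))" for w
    by (intro tr_fld fld_lin assms)+
  then show ?thesis
    using assms(1-3) unfolding unital_def nprod_def cross_def
    by (simp add: lin_simps lin_xpd)
qed

lemma cross_idf_right: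
  assumes "fld a" "unital e a" "lin e" "k \<ge> 0"
  shows "cross 1 a (idf e) k p q w = 0"
  using assms(4)
proof (induction k arbitrary: p q rule: int_ge_induct)
  case base
  show ?case using assms by (simp add: cross_0 idf_def unital_def lin_0 fld_lin)
next
  case (step k)
  then show ?case by (simp add: cross_Suc assms fld_idf)
qed

lemma local_to_idf: "fld a \<Longrightarrow> unital e a \<Longrightarrow> lin e \<Longrightarrow> local_to 1 a (idf e)"
  unfolding local_to_def by (intro exI[of _ 0]) (simp add: cross_idf_right)

lemma nprod_idf_right: "fld a \<Longrightarrow> unital e a \<Longrightarrow> lin e \<Longrightarrow> k \<ge> 0 \<Longrightarrow> nprod 1 a k (idf e) = 0"
  by (simp add: fun_eq_iff nprod_def cross_idf_right)

text \<open>The two halves of the product split the modes of a: the expansion with a on the left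
  yields those with n \<le> -1, the other one those with n \<ge> 0.\<close>

lemma nprod_idf_minus_one:
  assumes "fld a" "unital e a"
  shows "nprod 1 a (- 1) (idf e) = a"
proof (intro ext)
  fix n w
  have "xpd (- 1) (\<lambda>p q. a p (idf e q w)) 0 n = (if n \<le> - 1 then a n w else 0)"
  proof -
    have "xpd (- 1) (\<lambda>p q. a p (idf e q w)) 0 n =
        Sum_any (\<lambda>i. if i = nat (- 1 - n) then (if n \<le> - 1 then a n w else 0) else 0)"
      unfolding xpd_def
      by (intro Sum_any.cong) (use assms in \<open>auto simp: idf_def unital_def lin_0 fld_lin\<close>)
    then show ?thesis by (simp add: Sum_any.delta)
  qed
  moreover have "xpd (- 1) (\<lambda>q p. idf e q (a p w)) n 0 = (if n \<ge> 0 then a n w else 0)"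
  proof -
    have "xpd (- 1) (\<lambda>q p. idf e q (a p w)) n 0 =
        Sum_any (\<lambda>i. if i = nat n then (if n \<ge> 0 then a n w else 0) else 0)"
      unfolding xpd_def
      by (intro Sum_any.cong) (use assms in \<open>auto simp: idf_def unital_def\<close>)
    then show ?thesis by (simp add: Sum_any.delta)
  qed
  ultimately show "nprod 1 a (- 1) (idf e) n w = a n w"
    by (simp add: nprod_def cross_def)
qed

text \<open>The first summand can be nonzero only at i = k + 1. The coefficient there is 1 for k =
  -1 and vanishes for k \<ge> 0, being (k choose k + 1) up to sign; for k < -1 there is no such i.
  The second summand contains only nonnegative modes of the identity field.\<close>

lemma nprod_idf_left:
  assumes "fld c" "unital e c"
  shows "nprod 1 (idf e) k c = (if k = - 1 then c else 0)"
proof (intro ext)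
  fix n w
  have bz: "sbin k (nat (k + 1)) = 0" if k0: "k \<ge> 0"
  proof -
    obtain j where "k = int j" using zero_le_imp_eq_int[OF k0] by blast
    then have "bin k (nat (k + 1)) = of_nat (j choose (Suc j))"
      by (simp add: bin_def nat_add_distrib flip: binomial_gbinomial)
    then show ?thesis by (simp add: sbin_def)
  qed
  have "xpd k (\<lambda>p q. idf e p (c q w)) 0 n =
      Sum_any (\<lambda>i. if i = nat (k + 1) then (if k = - 1 then c n w else 0) else 0)"
    unfolding xpd_def
  proof (intro Sum_any.cong)
    fix i
    show "sbin k i *\<^sub>C idf e (0 + k - int i) (c (n + int i) w) =
      (if i = nat (k + 1) then (if k = - 1 then c n w else 0) else 0)"
      using bz assms by (cases "k \<ge> 0") (auto simp: idf_def unital_def)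
  qed
  moreover have "xpd k (\<lambda>q p. c q (idf e p w)) n 0 = 0"
    unfolding xpd_def by (simp add: idf_def lin_0 fld_lin assms)
  ultimately show "nprod 1 (idf e) k c n w = (if k = - 1 then c else 0) n w"
    by (simp add: nprod_def cross_def Sum_any.delta)
qed

section \<open>Linear extension from a basis\<close>

definition lc :: "('b \<Rightarrow> 'a::cvec) \<Rightarrow> ('b \<Rightarrow>\<^sub>0 complex) \<Rightarrow> 'a" where
  "lc G x = (\<Sum>b\<in>keys x. lookup x b *\<^sub>C G b)"

lemma lc_superset: "finite A \<Longrightarrow> keys x \<subseteq> A \<Longrightarrow> lc G x = (\<Sum>b\<in>A. lookup x b *\<^sub>C G b)"
  unfolding lc_def by (rule sum.mono_neutral_left) (auto simp: in_keys_iff)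

lemma lin_lc:
  fixes G :: "'b \<Rightarrow> 'a::cvec"
  shows "lin (lc G)"
proof (rule linI)
  fix x y :: "'b \<Rightarrow>\<^sub>0 complex"
  have "keys (x + y) \<subseteq> keys x \<union> keys y" by (rule keys_add)
  then show "lc G (x + y) = lc G x + lc G y"
    by (simp add: lc_superset[of "keys x \<union> keys y"] lookup_add scaleC_add_left sum.distrib)
next
  fix a and x :: "'b \<Rightarrow>\<^sub>0 complex"
  have "keys (a *\<^sub>C x) \<subseteq> keys x" by (auto simp: in_keys_iff)
  then show "lc G (a *\<^sub>C x) = a *\<^sub>C lc G x"
    by (simp add: lc_superset[of "keys x"] cv.scale_sum_right cv.scale_scale)
qed

lemma lc_single [simp]: "lc G (Poly_Mapping.single b z) = z *\<^sub>C G b"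
  by (simp add: lc_superset[of "{b}"])

lemma lin_of_lc: "lin f \<Longrightarrow> f (lc G x) = lc (\<lambda>b. f (G b)) x"
  by (simp add: lc_def lin_simps)

lemma lc_apply: "lc G x y = lc (\<lambda>b. G b y) x"
  by (simp add: lc_def sum_fun_apply)

lemma lc_cong: "(\<And>b. b \<in> keys x \<Longrightarrow> G b = H b) \<Longrightarrow> lc G x = lc H x"
  by (simp add: lc_def)

lemma single_scaleC: "Poly_Mapping.single b z = z *\<^sub>C Poly_Mapping.single b (1::complex)"
  by (rule poly_mapping_eqI) (simp add: lookup_single when_def)

lemma lc_gen: "lc (\<lambda>b. Poly_Mapping.single b 1) x = x"
proof (rule poly_mapping_eqI)
  fix k
  have "lookup (lc (\<lambda>b. Poly_Mapping.single b 1) x) k = (\<Sum>b\<in>keys x. lookup x b * (1 when b = k))"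
    by (simp add: lc_def lookup_sum lookup_single)
  also have "\<dots> = (\<Sum>b\<in>keys x. if b = k then lookup x k else 0)"
    by (intro sum.cong) (auto simp: when_def)
  also have "\<dots> = lookup x k" by (simp add: in_keys_iff)
  finally show "lookup (lc (\<lambda>b. Poly_Mapping.single b 1) x) k = lookup x k" .
qed

section \<open>The brackets of the generators in terms of modes\<close>

datatype kind = KL | KM | KQ

text \<open>\<open>mode k n\<close> is the \<open>n\<close>-th mode of the field, i.e. the coefficient of \<open>z\<^bsup>-n-1\<^esup>\<close> in \<open>L(z)\<close>,
  \<open>M(z)\<close> or \<open>Q(z)\<close>.\<close>

fun mode :: "kind \<Rightarrow> int \<Rightarrow> bms_gen" where
  "mode KL n = Lgen (n - 1)"
| "mode KM n = Mgen (n - 1)"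
| "mode KQ n = Qgen (n - 1)"

lemma gen_cases:
  obtains (mode) k n where "b = mode k n" | (C1) "b = C1gen" | (C2) "b = C2gen"
proof (cases b)
  case (Lgen m) then show ?thesis using mode[of KL "m + 1"] by simp
next
  case (Mgen m) then show ?thesis using mode[of KM "m + 1"] by simp
next
  case (Qgen m) then show ?thesis using mode[of KQ "m + 1"] by simp
qed (use that in blast)+

definition kodd :: "kind \<Rightarrow> bool" where "kodd k \<longleftrightarrow> k = KQ"

lemma gen_odd_mode [simp]: "gen_odd (mode k n) = kodd k"
  by (cases k) (auto simp: gen_odd_def kodd_def)

lemma gen_odd_C [simp]: "\<not> gen_odd C1gen" "\<not> gen_odd C2gen"
  by (auto simp: gen_odd_def)

text \<open>The operator product expansion of the fields \<open>j\<close> and \<open>k\<close> has the coefficients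
  \<open>ca \<partial>F + ck F\<close>, \<open>cb F\<close>, \<open>cg2 C\<close>, \<open>cg3 C\<close>, where \<open>F = tgt j k\<close> and \<open>C = cen j k\<close>.\<close>

definition tgt :: "kind \<Rightarrow> kind \<Rightarrow> kind" where
  "tgt j k = (if j = KL then k else if k = KL then j else if j \<noteq> k then KQ else KM)"

definition ca :: "kind \<Rightarrow> kind \<Rightarrow> complex" where
  "ca j k = (if j = KL then 1 else if k = KL then (if j = KM then 1 else 1 / 2) else 0)"

definition cb :: "kind \<Rightarrow> kind \<Rightarrow> complex" where
  "cb j k = (if j = KL \<or> k = KL then (if j = KQ \<or> k = KQ then 3 / 2 else 2) else 0)"

definition ck :: "kind \<Rightarrow> kind \<Rightarrow> complex" where
  "ck j k = (if j = KQ \<and> k = KQ then 2 else 0)"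

definition cg2 :: "kind \<Rightarrow> kind \<Rightarrow> complex" where
  "cg2 j k = (if j = KQ \<and> k = KQ then 2 / 3 else 0)"

definition cg3 :: "kind \<Rightarrow> kind \<Rightarrow> complex" where
  "cg3 j k = (if j = KL \<and> k \<noteq> KQ \<or> j = KM \<and> k = KL then 1 / 2 else 0)"

definition cen :: "kind \<Rightarrow> kind \<Rightarrow> bms_gen" where
  "cen j k = (if j = KL \<and> k = KL then C1gen else C2gen)"

lemmas ope_defs = tgt_def ca_def cb_def ck_def cg2_def cg3_def cen_def

lemma kodd_tgt: "kodd (tgt j k) = (kodd j \<noteq> kodd k)"
  by (cases j; cases k) (simp_all add: tgt_def kodd_def)

lemma bin_1: "bin m 1 = of_int m" "bin m (Suc 0) = of_int m"
  by (simp_all add: bin_def)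

lemma bin_2: "bin m 2 = of_int m * (of_int m - 1) / 2"
  using bin_absorption[of 1 m] by (simp add: bin_1 numeral_2_eq_2 field_simps)

lemma bin_3: "bin m 3 = of_int m * (of_int m - 1) * (of_int m - 2) / 6"
proof -
  have "bin m 3 = of_int m * bin (m - 1) 2 / 3"
    using bin_absorption[of 2 m] by (simp add: field_simps)
  then show ?thesis unfolding bin_2 by (simp add: field_simps)
qed

lemma lc_add: "lc G (x + y) = lc G x + lc G y" and lc_minus: "lc G (- x) = - lc G x"
  and lc_diff: "lc G (x - y) = lc G x - lc G y" and lc_zero [simp]: "lc G 0 = 0" and lc_scale: "lc G (a *\<^sub>C x) = a *\<^sub>C lc G x"
  by (simp_all add: lin_simps[OF lin_lc])

text \<open>In this indexing the central cocycles become binomials: (r^3 - r)/12 at r = m - 1 is one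
  half of \<open>bin m 3\<close>, and (r^2 - 1/4)/3 at r = m - 1/2 is two thirds of
  \<open>bin m 2\<close>. They occur for m + n = 2 and m + n = 1 respectively, hence the case
  distinction.\<close>

lemma gen_bracket_mode:
  "lc G (gen_bracket (mode j m) (mode k n)) =
    (of_int m * cb j k - of_int (m + n) * ca j k) *\<^sub>C G (mode (tgt j k) (m + n - 1))
    + ck j k *\<^sub>C G (mode (tgt j k) (m + n))
    + (if m + n = 1 then (bin m 2 * cg2 j k) *\<^sub>C G (cen j k) else 0)
    + (if m + n = 2 then (bin m 3 * cg3 j k) *\<^sub>C G (cen j k) else 0)"
proof (cases "m + n = 2")
  case True
  then have n: "n = 2 - m" by simp
  show ?thesis unfolding n
    by (cases j; cases k; simp add: ope_defs lc_add lc_minus lc_diff half_up_def bin_3 field_simps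
        power2_eq_square power3_eq_cube flip: cv.scale_minus_left;
        (simp add: field_simps flip: scaleC_add_left)?)
next
  case False
  show ?thesis
  proof (cases "m + n = 1")
    case True
    then have n: "n = 1 - m" by simp
    show ?thesis unfolding n
      by (cases j; cases k)
        (simp_all add: ope_defs lc_add lc_minus lc_diff half_up_def bin_2 field_simps power2_eq_square
          flip: cv.scale_minus_left)
  next
    case False
    with \<open>m + n \<noteq> 2\<close> show ?thesis
      by (cases j; cases k)
        (simp_all add: ope_defs lc_add lc_minus lc_diff half_up_def field_simps flip: cv.scale_minus_left)
  qed
qed

lemma gen_bracket_C [simp]:
  "gen_bracket C1gen b = 0" "gen_bracket b C1gen = 0" "gen_bracket C2gen b = 0" "gen_bracket b C2gen = 0"
  by (cases b; simp)+

lemma koszul_simps: "koszul p q * koszul p q = 1" "koszul False q = 1" "koszul p False = 1"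
  "koszul p (q \<noteq> r) = koszul p q * koszul p r" "koszul (p \<noteq> q) r = koszul p r * koszul q r"
  "koszul True True = -1"
  by (auto simp: koszul_def)

lemma koszul_sym: "koszul p q = koszul q p"
  by (auto simp: koszul_def)

section \<open>Locality from the commutator formula\<close>

text \<open>\<open>bin p l\<close> times a function of p + q is the coefficient family of a series
  times, up to a factor, an l-th derivative of the delta function. Each factor x - y lowers l by one
  and kills l = 0.\<close>

lemma d1_bin:
  fixes f :: "int \<Rightarrow> 'a::cvec"
  shows "(d1 ^^ N) (\<lambda>p q. bin p l *\<^sub>C f (p + q)) =
    (if l < N then 0 else (\<lambda>p q. bin p (l - N) *\<^sub>C f (p + q + int N)))"
proof (induction N)
  case (Suc N)
  show ?case
  proof (cases "l < N")
    case True
    then have z: "(d1 ^^ N) (\<lambda>p q. bin p l *\<^sub>C f (p + q)) = 0"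
      unfolding Suc by (simp only: if_True)
    show ?thesis
      using True unfolding funpow.simps o_apply z by (simp add: lin_0[OF lin_d1])
  next
    case False
    have "d1 (\<lambda>p q. bin p (l - N) *\<^sub>C f (p + q + int N)) p q =
        (bin (p + 1) (l - N) - bin p (l - N)) *\<^sub>C f (p + q + int (Suc N))" for p q
      by (simp add: d1_def scaleC_simps algebra_simps)
    moreover have "bin (p + 1) (l - N) - bin p (l - N) = (if l < Suc N then 0 else bin p (l - Suc N))" for p
    proof (cases "l = N")
      case neq: False
      then obtain i where "l - N = Suc i" using False by (metis Suc_diff_Suc nat_neq_iff)
      moreover from this have "l - Suc N = i" by simp
      ultimately show ?thesis using neq False by (simp add: bin_Suc)
    qed simp
    ultimately show ?thesis using False by (auto simp: Suc fun_eq_iff)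
  qed
qed simp

lemma local_to_of_commutator:
  assumes "fld a" "fld b"
    and comm: "\<And>m n w. a m (b n w) - s *\<^sub>C b n (a m w) = (\<Sum>l<L. bin m l *\<^sub>C d l (m + n - int l) w)"
  shows "local_to s a b"
proof -
  have "(d1 ^^ L) (\<lambda>p q. a p (b q w) - s *\<^sub>C b q (a p w)) = 0" for w
  proof -
    have "(\<lambda>p q. a p (b q w) - s *\<^sub>C b q (a p w)) =
        (\<Sum>l<L. (\<lambda>p q. bin p l *\<^sub>C (\<lambda>n. d l (n - int l) w) (p + q)))"
      by (simp add: fun_eq_iff sum_fun_apply comm)
    moreover have "(d1 ^^ L) (\<lambda>p q. bin p l *\<^sub>C (\<lambda>n. d l (n - int l) w) (p + q)) = 0" if "l < L" for l
      using d1_bin[of L l "\<lambda>n. d l (n - int l) w"] that by simp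
    ultimately show ?thesis
      by (simp only: lin_sum[OF lin_funpow[OF lin_d1]]) simp
  qed
  then have "cross s a b (int L) p q w = 0" for p q w
    by (simp add: cross_nat[OF assms(1,2)])
  then show ?thesis unfolding local_to_def by blast
qed

section \<open>Smooth representations on a fixed type\<close>

lemma sum4: "(\<Sum>l<4::nat. f l) = f 0 + f 1 + f 2 + (f 3 :: 'a::comm_monoid_add)"
  by (simp add: numeral_eq_Suc add.assoc)

text \<open>Separated from \<open>rep\<close> because the operator product notation is also used for
  the modes of a module over the vertex superalgebra, before their bracket relations are
  known.\<close>

locale modes =
  fixes e :: "'u::cvec \<Rightarrow> 'u" and R :: "bms_gen \<Rightarrow> 'u \<Rightarrow> 'u" and c1 c2 :: complex
  assumes R_C1: "R C1gen w = c1 *\<^sub>C e w" and R_C2: "R C2gen w = c2 *\<^sub>C e w"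
begin

definition X :: "kind \<Rightarrow> 'u field" where "X k n = R (mode k n)"

definition charge :: "bms_gen \<Rightarrow> complex" where
  "charge c = (if c = C1gen then c1 else c2)"

definition ope :: "kind \<Rightarrow> kind \<Rightarrow> nat \<Rightarrow> 'u field" where
  "ope j k l = (if l = 0 then ca j k *\<^sub>C der (X (tgt j k)) + ck j k *\<^sub>C X (tgt j k)
     else if l = 1 then cb j k *\<^sub>C X (tgt j k)
     else if l = 2 then (cg2 j k * charge (cen j k)) *\<^sub>C idf e
     else (cg3 j k * charge (cen j k)) *\<^sub>C idf e)"

lemma R_cen: "R (cen j k) w = charge (cen j k) *\<^sub>C e w"
  by (auto simp: cen_def charge_def R_C1 R_C2)

lemma ope_sum: "lc (\<lambda>g. R g w) (gen_bracket (mode j m) (mode k n)) =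
    (\<Sum>l<4. bin m l *\<^sub>C ope j k l (m + n - int l) w)"
  unfolding gen_bracket_mode sum4
  by (auto simp: ope_def R_cen X_def[symmetric] idf_def der_def bin_1 scaleC_simps algebra_simps)

end

locale rep = modes e R c1 c2
  for e :: "'u::cvec \<Rightarrow> 'u" and R :: "bms_gen \<Rightarrow> 'u \<Rightarrow> 'u" and c1 c2 :: complex +
  assumes lin_e: "lin e" and e_e: "e (e w) = e w"
    and lin_R: "lin (R b)" and R_e: "R b (e w) = R b w" and e_R: "e (R b w) = R b w"
    and R_bracket: "R a (R b w) - koszul (gen_odd a) (gen_odd b) *\<^sub>C R b (R a w) =
      lc (\<lambda>g. R g w) (gen_bracket a b)"
    and R_smooth: "\<exists>N. \<forall>n\<ge>N. \<forall>k. R (mode k n) w = 0"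
begin

lemma fld_X: "fld (X k)"
proof (rule fldI)
  show "lin (X k n)" for n by (simp add: X_def lin_R)
  show "\<exists>N. \<forall>n\<ge>N. X k n w = 0" for w using R_smooth[of w] by (auto simp: X_def)
qed

lemma unital_X: "unital e (X k)"
  by (simp add: unital_def X_def R_e e_R)

lemma fld_ope: "fld (ope j k l)"
  by (auto simp: ope_def intro!: fld_add fld_scale fld_der fld_X fld_idf lin_e)

lemma X_comm: "X j m (X k n w) - koszul (kodd j) (kodd k) *\<^sub>C X k n (X j m w) =
    (\<Sum>l<4. bin m l *\<^sub>C ope j k l (m + n - int l) w)"
  using R_bracket[of "mode j m" "mode k n" w] unfolding ope_sum[symmetric] by (simp add: X_def)

lemma local_X: "local_to (koszul (kodd j) (kodd k)) (X j) (X k)"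
  by (rule local_to_of_commutator[OF fld_X fld_X X_comm])

text \<open>The action of the Lie superalgebra on fields of parity \<open>q\<close> by \<open>n\<close>-th products.\<close>

fun act :: "bool \<Rightarrow> bms_gen \<Rightarrow> 'u field \<Rightarrow> 'u field" where
  "act q (Lgen m) a = nprod 1 (X KL) (m + 1) a"
| "act q (Mgen m) a = nprod 1 (X KM) (m + 1) a"
| "act q (Qgen m) a = nprod (koszul True q) (X KQ) (m + 1) a"
| "act q C1gen a = c1 *\<^sub>C a"
| "act q C2gen a = c2 *\<^sub>C a"

lemma act_mode: "act q (mode k n) a = nprod (koszul (kodd k) q) (X k) n a"
  by (cases k) (simp_all add: kodd_def koszul_simps)

lemma act_cen: "act q (cen j k) a = charge (cen j k) *\<^sub>C a"
  by (auto simp: cen_def charge_def)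

lemma fld_act: "fld a \<Longrightarrow> fld (act q b a)"
  by (cases b rule: gen_cases) (auto simp: act_mode fld_nprod fld_X fld_scale)

lemma unital_act: "fld a \<Longrightarrow> unital e a \<Longrightarrow> unital e (act q b a)"
  by (cases b rule: gen_cases)
    (auto simp: act_mode unital_nprod fld_X unital_X unital_scale lin_e)

lemma act_add: "fld a \<Longrightarrow> fld b \<Longrightarrow> act q g (a + b) = act q g a + act q g b"
  by (cases g rule: gen_cases) (auto simp: act_mode nprod_add_right fld_X scaleC_simps)

lemma act_scale: "fld a \<Longrightarrow> act q g (c *\<^sub>C a) = c *\<^sub>C act q g a"
  by (cases g rule: gen_cases) (auto simp: act_mode nprod_scale_right fld_X scaleC_simps mult.commute)

text \<open>In \<open>commutator_of_products\<close> with the four operator product coefficients,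
  the products with \<open>ope j k l\<close> are actions of the generators occurring in the bracket.
  The outer action takes the parity of the inner result as its argument.\<close>

lemma act_bracket:
  assumes c: "fld c" "unital e c"
  shows "act (gen_odd b \<noteq> q) a (act q b c) - koszul (gen_odd a) (gen_odd b) *\<^sub>C act (gen_odd a \<noteq> q) b (act q a c) =
    lc (\<lambda>g. act q g c) (gen_bracket a b)"
proof (cases a rule: gen_cases)
  case (mode j m)
  note a = this
  show ?thesis
  proof (cases b rule: gen_cases)
    case (mode k n)
    let ?s = "koszul (kodd j) (kodd k)"
    let ?sa = "koszul (kodd j) q" and ?sb = "koszul (kodd k) q"
    have "nprod (?s * ?sa) (X j) m (nprod ?sb (X k) n c) i w -
        ?s *\<^sub>C nprod (?s * ?sb) (X k) n (nprod ?sa (X j) m c) i w =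
        (\<Sum>l<4. bin m l *\<^sub>C nprod (?sa * ?sb) (ope j k l) (m + n - int l) c i w)" for i w
      by (rule commutator_of_products[OF fld_X fld_X c(1) fld_ope _ X_comm]) (simp add: koszul_simps)
    then have "act (gen_odd b \<noteq> q) a (act q b c) - koszul (gen_odd a) (gen_odd b) *\<^sub>C act (gen_odd a \<noteq> q) b (act q a c) =
        (\<Sum>l<4. bin m l *\<^sub>C nprod (?sa * ?sb) (ope j k l) (m + n - int l) c)"
      unfolding a mode act_mode gen_odd_mode koszul_simps(4) koszul_sym[of "kodd k" "kodd j"]
      by (simp add: fun_eq_iff sum_fun_apply)
    also have "\<dots> = lc (\<lambda>g. act q g c) (gen_bracket a b)"
    proof -
      have s: "?sa * ?sb = koszul (kodd (tgt j k)) q" by (simp only: kodd_tgt koszul_simps(5))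
      \<comment> \<open>Central terms arise only between generators of equal parity, so the signs
        cancel and the identity field acts as a left unit.\<close>
      have s': "?sa * ?sb = 1" if "cg2 j k \<noteq> 0 \<or> cg3 j k \<noteq> 0"
        using that by (auto simp: cg2_def cg3_def kodd_def koszul_def split: if_splits)
      have i2: "cg2 j k *\<^sub>C nprod (?sa * ?sb) (idf e) p c = cg2 j k *\<^sub>C (if p = - 1 then c else 0)"
        and i3: "cg3 j k *\<^sub>C nprod (?sa * ?sb) (idf e) p c = cg3 j k *\<^sub>C (if p = - 1 then c else 0)" for p
        using s' by (cases "cg2 j k = 0"; cases "cg3 j k = 0"; simp add: nprod_idf_left[OF c])+
      have n0: "nprod (?sa * ?sb) (ope j k 0) (m + n - int 0) c = (- (of_int (m + n) * ca j k)) *\<^sub>C act q (mode (tgt j k) (m + n - 1)) c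
          + ck j k *\<^sub>C act q (mode (tgt j k) (m + n)) c"
      proof -
        have "nprod \<sigma> (der (X F)) p c = - of_int p *\<^sub>C nprod \<sigma> (X F) (p - 1) c" for \<sigma> F p
          by (simp add: fun_eq_iff nprod_der_left fld_X c)
        then show ?thesis
          unfolding act_mode s
          by (simp add: ope_def nprod_add_left nprod_scale_left fld_add fld_scale fld_der fld_X c cv.scale_scale mult_ac)
      qed
      have n1: "nprod (?sa * ?sb) (ope j k 1) (m + n - int 1) c = cb j k *\<^sub>C act q (mode (tgt j k) (m + n - 1)) c"
        unfolding act_mode s by (simp add: ope_def nprod_scale_left fld_X c)
      have n2: "nprod (?sa * ?sb) (ope j k 2) (m + n - int 2) c =
          (if m + n = 1 then cg2 j k *\<^sub>C act q (cen j k) c else 0)"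
        using i2[of "m + n - 2"]
        by (simp add: ope_def nprod_scale_left fld_idf lin_e c act_cen) (auto split: if_splits)
      have n3: "nprod (?sa * ?sb) (ope j k 3) (m + n - int 3) c =
          (if m + n = 2 then cg3 j k *\<^sub>C act q (cen j k) c else 0)"
        using i3[of "m + n - 3"]
        by (simp add: ope_def nprod_scale_left fld_idf lin_e c act_cen) (auto split: if_splits)
      show ?thesis
        unfolding a mode gen_bracket_mode sum4 n0 n1 n2 n3
        by (simp add: bin_1 scaleC_simps algebra_simps)
    qed
    finally show ?thesis .
  qed (simp_all add: act_scale c koszul_simps fld_act)
next
  case C1 then show ?thesis by (simp add: act_scale c koszul_simps fld_act)
next
  case C2 then show ?thesis by (simp add: act_scale c koszul_simps fld_act)
qed

end

section \<open>Words in the generators and the free associative algebra\<close>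

primrec wodd :: "bms_gen list \<Rightarrow> bool" where
  "wodd [] = False"
| "wodd (b # ws) = (gen_odd b \<noteq> wodd ws)"

lemma wodd_append: "wodd (us @ ws) = (wodd us \<noteq> wodd ws)"
  by (induction us) auto

abbreviation word :: "bms_gen list \<Rightarrow> tensor_alg" where
  "word ws \<equiv> Poly_Mapping.single ws 1"

lemma word_mult: "word us * word ws = word (us @ ws)"
  by (simp add: mult_single plus_list_def)

lemma word_Nil: "word [] = 1"
  using single_one[where ?'a = "bms_gen list" and ?'b = complex] by (simp add: zero_list_def)

lemma tensor_incl_gen: "tensor_incl (gen b) = word [b]"
  by (simp add: tensor_incl_def)

lemma tensor_incl_lc: "tensor_incl x = lc (\<lambda>b. word [b]) x"
  by (simp add: tensor_incl_def lc_def flip: single_scaleC)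

lemma scaleC_tensor: "z *\<^sub>C (t :: tensor_alg) = Poly_Mapping.single [] z * t"
  by (simp add: scaleC_poly_mapping_def scaleC_complex_def mult_map_scale_conv_mult zero_list_def)

text \<open>Scalars sit in the free algebra as multiples of the empty word, and these are
  central.\<close>

lemma lin_mult_left: "lin (\<lambda>t :: tensor_alg. s * t)"
proof (rule linI)
  fix a and t :: tensor_alg
  have "s * Poly_Mapping.single [] a = Poly_Mapping.single [] a * s"
  proof -
    have "lc (\<lambda>ws. word ws * Poly_Mapping.single [] a) s = lc (\<lambda>ws. Poly_Mapping.single [] a * word ws) s"
      by (rule lc_cong) (simp add: mult_single plus_list_def)
    moreover have "lin (\<lambda>t :: tensor_alg. Poly_Mapping.single [] a * t)"
      by (rule linI) (simp_all add: distrib_left scaleC_tensor mult_single plus_list_def mult.commute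
          flip: mult.assoc)
    moreover have "lin (\<lambda>t :: tensor_alg. t * Poly_Mapping.single [] a)"
      by (rule linI) (simp_all add: distrib_right scaleC_tensor mult.assoc)
    ultimately show ?thesis
      using lin_of_lc[of "\<lambda>t. t * Poly_Mapping.single [] a" word s]
        lin_of_lc[of "\<lambda>t. Poly_Mapping.single [] a * t" word s] by (simp add: lc_gen)
  qed
  then show "s * (a *\<^sub>C t) = a *\<^sub>C (s * t)"
    by (simp add: scaleC_tensor flip: mult.assoc)
qed (simp add: distrib_left)

lemma lin_mult_right: "lin (\<lambda>t :: tensor_alg. t * s)"
  by (rule linI) (simp_all add: distrib_right scaleC_tensor mult.assoc)

definition hom_word :: "bool \<Rightarrow> tensor_alg \<Rightarrow> bool" where
  "hom_word q t \<longleftrightarrow> (\<forall>ws\<in>keys t. wodd ws = q)"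

lemma hom_word_add: "hom_word q s \<Longrightarrow> hom_word q t \<Longrightarrow> hom_word q (s + t)"
  unfolding hom_word_def using keys_add[of s t] by blast

lemma hom_word_scale: "hom_word q s \<Longrightarrow> hom_word q (z *\<^sub>C s)"
  by (auto simp: hom_word_def in_keys_iff)

lemma hom_word_diff: "hom_word q s \<Longrightarrow> hom_word q t \<Longrightarrow> hom_word q (s - t)"
  using hom_word_add[of q s "(- 1) *\<^sub>C t"] by (simp add: hom_word_scale del: cv.scale_minus_left)
    (simp add: hom_word_scale)

lemma hom_word_word: "hom_word (wodd ws) (word ws)"
  by (simp add: hom_word_def)

lemma hom_word_zero: "hom_word q 0"
  by (simp add: hom_word_def)

lemma hom_word_sum: "(\<And>b. b \<in> A \<Longrightarrow> hom_word q (f b)) \<Longrightarrow> hom_word q (\<Sum>b\<in>A. f b)"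
  by (induction A rule: infinite_finite_induct) (auto simp: hom_word_zero hom_word_add)

lemma hom_word_lc: "(\<And>b. b \<in> keys x \<Longrightarrow> hom_word q (f b)) \<Longrightarrow> hom_word q (lc f x)"
  unfolding lc_def by (intro hom_word_sum hom_word_scale)

lemma hom_word_mult: "hom_word p s \<Longrightarrow> hom_word q t \<Longrightarrow> hom_word (p \<noteq> q) (s * t)"
  unfolding hom_word_def using keys_mult[of s t] by (fastforce simp: plus_list_def wodd_append)

lemma gen_bracket_parity: "g \<in> keys (gen_bracket a b) \<Longrightarrow> gen_odd g = (gen_odd a \<noteq> gen_odd b)"
  by (cases a; cases b)
    (auto simp: gen_odd_def keys_minus split: if_splits dest!: keys_add[THEN subsetD] keys_diff[THEN subsetD])

lemma local_to_scale_right: "fld a \<Longrightarrow> fld b \<Longrightarrow> local_to s a b \<Longrightarrow> local_to s a (c *\<^sub>C b)"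
  by (auto simp: local_to_def cross_scale_right)

lemma local_to_add_right:
  assumes "fld a" "fld b" "fld c" "local_to s a b" "local_to s a c"
  shows "local_to s a (b + c)"
proof -
  obtain N where N: "\<And>k p q w. k \<ge> int N \<Longrightarrow> cross s a b k p q w = 0"
    using local_to_ge[OF assms(1,2,4)] by blast
  obtain M where M: "\<And>k p q w. k \<ge> int M \<Longrightarrow> cross s a c k p q w = 0"
    using local_to_ge[OF assms(1,3,5)] by blast
  have "cross s a (b + c) (int (max N M)) p q w = 0" for p q w
    by (simp add: cross_add_right assms N M)
  then show ?thesis unfolding local_to_def by blast
qed

context rep
begin

lemma act_zero: "act q b 0 = 0"
  using act_scale[of 0 q b 0] by (simp add: fld_zero)

lemma act_lc:
  assumes "\<And>i. fld (f i)"
  shows "act q b (lc f x) = lc (\<lambda>i. act q b (f i)) x"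
proof -
  have "act q b (\<Sum>i\<in>A. z i *\<^sub>C f i) = (\<Sum>i\<in>A. z i *\<^sub>C act q b (f i))" for A and z :: "_ \<Rightarrow> complex"
  proof (induction A rule: infinite_finite_induct)
    case (insert x F)
    show ?case
      unfolding sum.insert[OF insert.hyps]
      by (subst act_add) (simp_all only: fld_scale fld_sum assms act_scale insert.IH)
  next
    case (infinite A)
    show ?case unfolding sum.infinite[OF infinite] by (rule act_zero)
  next
    case empty
    show ?case unfolding sum.empty by (rule act_zero)
  qed
  then show ?thesis by (simp add: lc_def)
qed

primrec Phi :: "bms_gen list \<Rightarrow> 'u field" where
  "Phi [] = idf e"
| "Phi (b # ws) = act (wodd ws) b (Phi ws)"

lemma fld_Phi: "fld (Phi ws)"
  by (induction ws) (simp_all add: fld_idf lin_e fld_act)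

lemma unital_Phi: "unital e (Phi ws)"
  by (induction ws) (simp_all add: unital_idf lin_e e_e unital_act fld_Phi)

lemma local_act:
  assumes a: "fld a" "unital e a" and c: "fld c" and ac: "local_to (koszul p q) a c"
    and aX: "\<And>k. local_to (koszul p (kodd k)) a (X k)"
    and Xc: "\<And>k. local_to (koszul (kodd k) q) (X k) c"
  shows "local_to (koszul p (gen_odd b \<noteq> q)) a (act q b c)"
proof (cases b rule: gen_cases)
  case (mode k n)
  show ?thesis
    unfolding mode act_mode gen_odd_mode koszul_simps(4)
    by (rule Dong_lemma[OF a(1) fld_X c aX ac Xc])
qed (use assms in \<open>auto simp: local_to_scale_right koszul_simps\<close>)

lemma local_X_Phi: "local_to (koszul (kodd k) (wodd ws)) (X k) (Phi ws)"
proof (induction ws arbitrary: k)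
  case Nil
  then show ?case by (simp add: koszul_simps local_to_idf fld_X unital_X lin_e)
next
  case (Cons b ws)
  show ?case
    unfolding wodd.simps Phi.simps by (rule local_act[OF fld_X unital_X fld_Phi Cons local_X Cons])
qed

lemma local_Phi_X: "local_to (koszul (wodd ws) (kodd k)) (Phi ws) (X k)"
  using local_to_sym[OF local_X_Phi] by (simp add: koszul_sym[of "wodd ws"] koszul_simps)

lemma local_Phi_act:
  assumes "fld c" "local_to (koszul (wodd us) q) (Phi us) c"
    and "\<And>k. local_to (koszul (kodd k) q) (X k) c"
  shows "local_to (koszul (wodd us) (gen_odd b \<noteq> q)) (Phi us) (act q b c)"
  by (rule local_act[OF fld_Phi unital_Phi assms(1,2) local_Phi_X assms(3)])

subsection \<open>The relations of the vacuum module hold for the fields\<close>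

definition PhiT :: "tensor_alg \<Rightarrow> 'u field" where "PhiT = lc Phi"

lemma lin_PhiT: "lin PhiT"
  by (simp add: PhiT_def lin_lc)

lemma PhiT_word [simp]: "PhiT (word ws) = Phi ws"
  unfolding PhiT_def lc_single by (rule scaleC_one)

text \<open>Homogeneity fixes the parity argument of \<open>act\<close>, which otherwise varies from
  word to word.\<close>

lemma PhiT_Cons:
  assumes "hom_word q t"
  shows "PhiT (word [b] * t) = act q b (PhiT t)"
proof -
  have "word [b] * t = lc (\<lambda>ws. word (b # ws)) t"
    using lin_of_lc[OF lin_mult_left, of "word [b]" word t] by (simp only: lc_gen word_mult append.simps)
  then have "PhiT (word [b] * t) = lc (\<lambda>ws. act (wodd ws) b (Phi ws)) t"
    by (simp only: lin_of_lc[OF lin_PhiT] PhiT_word Phi.simps)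
  also have "\<dots> = lc (\<lambda>ws. act q b (Phi ws)) t"
    by (rule lc_cong) (use assms in \<open>simp add: hom_word_def\<close>)
  finally show ?thesis by (simp only: PhiT_def act_lc fld_Phi)
qed

text \<open>Left multiplication by a word keeps t homogeneous, so it acts on \<open>PhiT t\<close>
  by a sequence of \<open>act\<close> steps, each preserving 0. For each relation it thus suffices
  to treat its homogeneous generator.\<close>

lemma PhiT_mult_zero:
  assumes "hom_word q t" "PhiT t = 0"
  shows "PhiT (s * t) = 0"
proof -
  have z: "PhiT (word us * t) = 0" for us
  proof (induction us)
    case Nil
    then show ?case by (simp only: word_Nil mult_1 assms)
  next
    case (Cons b us)
    have "word (b # us) * t = word [b] * (word us * t)"
      by (simp only: word_mult append.simps mult.assoc[symmetric])
    then show ?case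
      by (simp only: PhiT_Cons[OF hom_word_mult[OF hom_word_word assms(1)]] Cons act_zero)
  qed
  have "s * t = lc (\<lambda>us. word us * t) s"
    using lin_of_lc[OF lin_mult_right[of t], of word s] by (simp only: lc_gen)
  then show ?thesis by (simp only: lin_of_lc[OF lin_PhiT] z) (simp add: lc_def)
qed

text \<open>Splitting the right factor into words makes the relation homogeneous; it is then
  \<open>act_bracket\<close> for the field of the word, and \<open>PhiT_mult_zero\<close> supplies
  the left factor.\<close>

lemma PhiT_supercomm:
  "PhiT (s * (tensor_incl (gen a) * tensor_incl (gen b)
      - pm_scale (koszul (gen_odd a) (gen_odd b)) (tensor_incl (gen b) * tensor_incl (gen a))
      - tensor_incl (gen_bracket a b)) * t) = 0" (is "PhiT (s * ?y * t) = 0")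
proof -
  have "PhiT (s * (?y * word vs)) = 0" for vs
  proof (rule PhiT_mult_zero)
    let ?k = "koszul (gen_odd a) (gen_odd b)"
    have y: "?y * word vs = word (a # b # vs) - ?k *\<^sub>C word (b # a # vs) - lc (\<lambda>g. word (g # vs)) (gen_bracket a b)"
      unfolding tensor_incl_gen pm_scale_eq_scaleC lin_diff[OF lin_mult_right] lin_scale[OF lin_mult_right]
        tensor_incl_lc[of "gen_bracket a b"] lin_of_lc[OF lin_mult_right] word_mult by simp
    show "hom_word (gen_odd a \<noteq> (gen_odd b \<noteq> wodd vs)) (?y * word vs)"
      unfolding y
    proof (intro hom_word_diff hom_word_scale hom_word_lc)
      fix g assume "g \<in> keys (gen_bracket a b)"
      from gen_bracket_parity[OF this]
      show "hom_word (gen_odd a \<noteq> (gen_odd b \<noteq> wodd vs)) (word (g # vs))"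
        by (auto simp: hom_word_def)
    qed (auto simp: hom_word_def)
    have "PhiT (?y * word vs) = act (gen_odd b \<noteq> wodd vs) a (act (wodd vs) b (Phi vs)) -
        ?k *\<^sub>C act (gen_odd a \<noteq> wodd vs) b (act (wodd vs) a (Phi vs)) -
        lc (\<lambda>g. act (wodd vs) g (Phi vs)) (gen_bracket a b)"
      unfolding y lin_diff[OF lin_PhiT] lin_scale[OF lin_PhiT] lin_of_lc[OF lin_PhiT] PhiT_word
        Phi.simps wodd.simps ..
    then show "PhiT (?y * word vs) = 0"
      unfolding act_bracket[OF fld_Phi unital_Phi] by simp
  qed
  moreover have "s * ?y * t = lc (\<lambda>vs. s * (?y * word vs)) t"
    using lin_of_lc[OF lin_mult_left[of "s * ?y"], of word t] by (simp only: lc_gen mult.assoc)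
  ultimately show ?thesis by (simp only: lin_of_lc[OF lin_PhiT]) (simp add: lc_def)
qed

lemma act_idf: "n \<ge> 0 \<Longrightarrow> act False (mode k n) (idf e) = 0"
  by (simp add: act_mode koszul_simps nprod_idf_right fld_X unital_X lin_e)

lemma PhiT_character:
  assumes "nonneg_gen b"
  shows "PhiT (s * (tensor_incl (gen b) - pm_scale (verma_char c1 c2 b) 1)) = 0"
proof (rule PhiT_mult_zero)
  have *: "tensor_incl (gen b) - pm_scale (verma_char c1 c2 b) 1 = word [b] - verma_char c1 c2 b *\<^sub>C word []"
    by (simp add: tensor_incl_gen pm_scale_eq_scaleC word_Nil)
  have b: "(\<exists>k n. n > 0 \<and> b = mode k n) \<or> b = C1gen \<or> b = C2gen"
  proof (cases b)
    case (Lgen m)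
    then have "b = mode KL (m + 1)" "m + 1 > 0" using assms by (auto simp: nonneg_gen_def)
    then show ?thesis by blast
  next
    case (Mgen m)
    then have "b = mode KM (m + 1)" "m + 1 > 0" using assms by (auto simp: nonneg_gen_def)
    then show ?thesis by blast
  next
    case (Qgen m)
    then have "b = mode KQ (m + 1)" "m + 1 > 0" using assms by (auto simp: nonneg_gen_def)
    then show ?thesis by blast
  qed auto
  have v: "verma_char c1 c2 (mode k n) = 0" for k n
    by (cases k) (simp_all add: verma_char_def)
  show "hom_word (gen_odd b) (tensor_incl (gen b) - pm_scale (verma_char c1 c2 b) 1)"
    unfolding * using b
  proof (elim disjE exE conjE)
    fix k n assume "b = mode k n"
    then show "hom_word (gen_odd b) (word [b] - verma_char c1 c2 b *\<^sub>C word [])"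
      by (simp add: v hom_word_def)
  qed (auto simp: hom_word_def[of _ "word _"] intro!: hom_word_diff hom_word_scale)
  have "PhiT (word [b] - verma_char c1 c2 b *\<^sub>C word []) = act False b (idf e) - verma_char c1 c2 b *\<^sub>C idf e"
    by (simp only: lin_diff[OF lin_PhiT] lin_scale[OF lin_PhiT] PhiT_word Phi.simps wodd.simps)
  also have "\<dots> = 0" using b by (auto simp: act_idf v verma_char_def)
  finally show "PhiT (tensor_incl (gen b) - pm_scale (verma_char c1 c2 b) 1) = 0" unfolding * .
qed

lemma PhiT_L_minus_one: "PhiT (s * word [Lgen (- 1)]) = 0"
proof (rule PhiT_mult_zero)
  show "PhiT (word [Lgen (- 1)]) = 0"
    using act_idf[of 0 KL] by (simp add: koszul_simps)
qed (rule hom_word_word)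

theorem PhiT_verma_rel: "t \<in> verma_rel c1 c2 \<Longrightarrow> PhiT (s * t) = 0"
proof (induction t rule: verma_rel.induct)
  case zero
  then show ?case by (simp add: lin_0[OF lin_PhiT])
next
  case (add s t)
  then show ?case by (simp only: distrib_left lin_add[OF lin_PhiT]) simp
next
  case (supercomm s' a b t)
  show ?case using PhiT_supercomm[of "s * s'" a b t] by (simp only: mult.assoc)
next
  case (character b s')
  then show ?case using PhiT_character[of b "s * s'"] by (simp only: mult.assoc)
qed

subsection \<open>Translation\<close>

lemma act_translation: "act q (Lgen (- 1)) a n w = X KL 0 (a n w) - a n (X KL 0 w)"
  by (simp add: nprod_def cross_0)

text \<open>Both L_{-1} and \<open>der\<close> obey a Leibniz rule with respect to the action of b:
  the bracket of L_{-1} with \<open>mode k m\<close> is -m times \<open>mode k (m - 1)\<close>,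
  which is exactly the term from \<open>nprod_der_left\<close>.\<close>

lemma translation_step:
  assumes c: "fld c" "unital e c" and t: "act q (Lgen (- 1)) c = der c"
  shows "act (gen_odd b \<noteq> q) (Lgen (- 1)) (act q b c) = der (act q b c)"
proof (cases b rule: gen_cases)
  case (mode k m)
  have "act (gen_odd b \<noteq> q) (Lgen (- 1)) (act q b c) = act q b (act q (Lgen (- 1)) c) +
      lc (\<lambda>g. act q g c) (gen_bracket (mode KL 0) b)"
    using act_bracket[OF c, of b q "Lgen (- 1)"] by (simp add: koszul_simps gen_odd_def[of "Lgen _"] algebra_simps)
  also have "\<dots> = act q b (der c) - of_int m *\<^sub>C act q (mode k (m - 1)) c"
    unfolding t mode gen_bracket_mode
    by (simp add: ope_defs bin_2 bin_3)
  also have "\<dots> = der (act q b c)"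
    by (simp add: fun_eq_iff mode act_mode der_nprod[OF fld_X c(1)] nprod_der_left[OF fld_X[of k] c(1)])
  finally show ?thesis .
qed (use assms in \<open>simp_all add: lin_scale[OF lin_der] nprod_scale_right fld_X flip: t\<close>)

lemma translation_Phi: "act (wodd ws) (Lgen (- 1)) (Phi ws) = der (Phi ws)"
proof (induction ws)
  case Nil
  then show ?case using act_idf[of 0 KL] by (simp add: koszul_simps der_idf)
next
  case (Cons b ws)
  show ?case unfolding Phi.simps wodd.simps by (rule translation_step[OF fld_Phi unital_Phi Cons])
qed

end

section \<open>States generated from a vacuum vector\<close>

locale vac_rep = rep e R c1 c2
  for e :: "'u::cvec \<Rightarrow> 'u" and R :: "bms_gen \<Rightarrow> 'u \<Rightarrow> 'u" and c1 c2 :: complex +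
  fixes vac :: 'u
  assumes e_vac: "e vac = vac" and R_vac: "n \<ge> 0 \<Longrightarrow> R (mode k n) vac = 0"
begin

primrec wv :: "bms_gen list \<Rightarrow> 'u" where
  "wv [] = vac"
| "wv (b # ws) = R b (wv ws)"

text \<open>The span of the words applied to the vacuum, together with a parity. It is a relation
  because parity is read off from a derivation, and a vector such as 0 has both parities.\<close>

inductive vsp :: "bool \<Rightarrow> 'u \<Rightarrow> bool" where
  zero: "vsp q 0"
| vac: "vsp False vac"
| act: "vsp q v \<Longrightarrow> vsp (gen_odd b \<noteq> q) (R b v)"
| add: "vsp q u \<Longrightarrow> vsp q v \<Longrightarrow> vsp q (u + v)"
| scale: "vsp q v \<Longrightarrow> vsp q (c *\<^sub>C v)"

lemma vsp_e: "vsp q v \<Longrightarrow> e v = v"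
  by (induction rule: vsp.induct) (auto simp: lin_simps[OF lin_e] e_vac e_R)

lemma e_wv: "e (wv ws) = wv ws"
  by (cases ws) (simp_all add: e_vac e_R)

lemma vsp_wv: "vsp (wodd ws) (wv ws)"
  by (induction ws) (simp_all add: vsp.vac vsp.act del: not_iff)

lemma vsp_sum: "(\<And>i. i \<in> A \<Longrightarrow> vsp q (f i)) \<Longrightarrow> vsp q (\<Sum>i\<in>A. f i)"
  by (induction A rule: infinite_finite_induct) (auto intro: vsp.intros)

lemma vsp_diff: "vsp q u \<Longrightarrow> vsp q v \<Longrightarrow> vsp q (u - v)"
  using vsp.add[of q u "(- 1) *\<^sub>C v"] vsp.scale[of q v "- 1"] by simp

lemma vsp_xpd: "(\<And>p i. vsp q (F p i)) \<Longrightarrow> vsp q (xpd k F m n)"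
  unfolding xpd_def Sum_any.expand_set by (intro vsp_sum vsp.scale)

lemma vsp_words: "vsp q v \<Longrightarrow> \<exists>t. hom_word q t \<and> v = lc wv t"
proof (induction rule: vsp.induct)
  case (zero q)
  show ?case by (rule exI[of _ 0]) (simp add: hom_word_zero)
next
  case vac
  show ?case by (rule exI[of _ "word []"]) (simp add: hom_word_def scaleC_one)
next
  case (act q v b)
  then obtain t where t: "hom_word q t" "v = lc wv t" by blast
  have "word [b] * t = lc (\<lambda>ws. word (b # ws)) t"
    using lin_of_lc[OF lin_mult_left, of "word [b]" word t] by (simp only: lc_gen word_mult append.simps)
  then have "R b v = lc wv (word [b] * t)"
    by (simp add: t lin_of_lc[OF lin_R] lin_of_lc[OF lin_lc] scaleC_one)
  moreover have "hom_word (gen_odd b \<noteq> q) (word [b] * t)"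
    using hom_word_mult[OF hom_word_word t(1), of "[b]"] by (simp del: not_iff)
  ultimately show ?case by blast
next
  case (add q u v)
  then obtain s t where "hom_word q s" "u = lc wv s" "hom_word q t" "v = lc wv t" by blast
  then show ?case by (intro exI[of _ "s + t"]) (simp add: hom_word_add lc_add)
next
  case (scale q v c)
  then obtain t where "hom_word q t" "v = lc wv t" by blast
  then show ?case by (intro exI[of _ "c *\<^sub>C t"]) (simp add: hom_word_scale lc_scale)
qed

text \<open>In the product with X k, the second summand dies because nonnegative modes kill the
  vacuum; in the first, the inner index n + i equals -1 only for n = -1 and i = 0.\<close>

lemma creation: "n \<ge> - 1 \<Longrightarrow> Phi ws n vac = (if n = - 1 then wv ws else 0)"
proof (induction ws arbitrary: n)
  case Nil
  then show ?case by (simp add: idf_def e_vac)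
next
  case (Cons b ws)
  show ?case
  proof (cases b rule: gen_cases)
    case (mode k m)
    have "xpd m (\<lambda>p q. X k p (Phi ws q vac)) 0 n =
        Sum_any (\<lambda>i::nat. if i = 0 then (if n = - 1 then X k m (wv ws) else 0) else 0)"
      unfolding xpd_def
    proof (rule Sum_any.cong)
      fix i :: nat
      show "sbin m i *\<^sub>C X k (0 + m - int i) (Phi ws (n + int i) vac) =
          (if i = 0 then (if n = - 1 then X k m (wv ws) else 0) else 0)"
        using Cons.IH[of "n + int i"] Cons.prems by (auto simp: lin_0[OF fld_lin[OF fld_X]] scaleC_one)
    qed
    moreover have "xpd m (\<lambda>q p. Phi ws q (X k p vac)) n 0 = 0"
      by (simp add: xpd_def X_def R_vac lin_0[OF fld_lin[OF fld_Phi]])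
    ultimately show ?thesis
      unfolding mode Phi.simps act_mode nprod_def' by (simp add: Sum_any.delta X_def)
  qed (use Cons in \<open>simp_all add: R_C1 R_C2 e_wv\<close>)
qed

lemma vsp_X: "vsp q v \<Longrightarrow> vsp (kodd k \<noteq> q) (X k n v)"
  using vsp.act[of q v "mode k n"] by (simp add: X_def del: not_iff)

lemma vsp_Phi: "vsp q v \<Longrightarrow> vsp (wodd us \<noteq> q) (Phi us n v)"
proof (induction us arbitrary: q v n)
  case Nil
  then show ?case by (simp add: idf_def vsp_e vsp.zero)
next
  case (Cons b us)
  show ?case
  proof (cases b rule: gen_cases)
    case (mode k m)
    have 1: "vsp (wodd (b # us) \<noteq> q) (X k i (Phi us j v))" for i j
    proof -
      have "vsp (kodd k \<noteq> (wodd us \<noteq> q)) (X k i (Phi us j v))"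
        by (intro vsp_X Cons)
      also have "(kodd k \<noteq> (wodd us \<noteq> q)) = (wodd (b # us) \<noteq> q)" by (auto simp: mode)
      finally show ?thesis .
    qed
    have 2: "vsp (wodd (b # us) \<noteq> q) (Phi us i (X k j v))" for i j
    proof -
      have "vsp (wodd us \<noteq> (kodd k \<noteq> q)) (Phi us i (X k j v))"
        by (intro vsp_X Cons)
      also have "(wodd us \<noteq> (kodd k \<noteq> q)) = (wodd (b # us) \<noteq> q)" by (auto simp: mode)
      finally show ?thesis .
    qed
    show ?thesis
      unfolding Phi.simps unfolding mode act_mode nprod_def'
      unfolding mode[symmetric] by (intro vsp_diff vsp.scale vsp_xpd 1 2)
  qed (use Cons in \<open>simp_all add: vsp.scale del: not_iff\<close>)
qed

end

section \<open>Compatibility of the state-field maps of the vacuum module and of a smooth module\<close>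

text \<open>Source V and target W are kept apart: the target V gives the vertex operators of the
  algebra, another smooth W those of a module. Both Jacobi identities thus come from one
  argument.\<close>

locale state_map = V: vac_rep eV RV c1 c2 vac + W: rep eW RW c1 c2
  for eV :: "'v::cvec \<Rightarrow> 'v" and RV c1 c2 vac and eW :: "'w::cvec \<Rightarrow> 'w" and RW +
  fixes \<Psi> :: "'v \<Rightarrow> 'w field"
  assumes lin_\<Psi>: "lin \<Psi>" and fld_\<Psi>: "fld (\<Psi> v)" and unital_\<Psi>: "unital eW (\<Psi> v)"
    and \<Psi>_vac: "\<Psi> vac = idf eW" and \<Psi>_act: "V.vsp q v \<Longrightarrow> \<Psi> (RV b v) = W.act q b (\<Psi> v)"
begin

lemma \<Psi>_wv: "\<Psi> (V.wv ws) = W.Phi ws"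
  by (induction ws) (simp_all add: \<Psi>_vac \<Psi>_act[OF V.vsp_wv])

lemma \<Psi>_translation: "V.vsp q v \<Longrightarrow> W.act q (Lgen (- 1)) (\<Psi> v) = der (\<Psi> v)"
proof (induction rule: V.vsp.induct)
  case (zero q)
  then show ?case by (simp only: lin_0[OF lin_\<Psi>] W.act_zero lin_0[OF lin_der])
next
  case vac
  then show ?case using W.act_idf[of 0 KL] by (simp add: \<Psi>_vac der_idf)
next
  case (act q v b)
  show ?case
    unfolding \<Psi>_act[OF act.hyps] by (rule W.translation_step[OF fld_\<Psi> unital_\<Psi> act.IH])
next
  case (add q u v)
  then show ?case by (simp only: lin_add[OF lin_\<Psi>] W.act_add fld_\<Psi> lin_add[OF lin_der])
next
  case (scale q v c)
  then show ?case by (simp only: lin_scale[OF lin_\<Psi>] W.act_scale fld_\<Psi> lin_scale[OF lin_der])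
qed

lemma \<Psi>_D: "V.vsp q v \<Longrightarrow> \<Psi> (RV (Lgen (- 1)) v) = der (\<Psi> v)"
  by (simp only: \<Psi>_act \<Psi>_translation)

lemma \<Psi>_local:
  assumes "V.vsp q v"
  shows "(\<forall>k. local_to (koszul (kodd k) q) (W.X k) (\<Psi> v)) \<and>
    local_to (koszul (wodd us) q) (W.Phi us) (\<Psi> v)"
  using assms
proof (induction rule: V.vsp.induct)
  case (zero q)
  have "local_to s a 0" if "fld a" for s and a :: "'w field"
    using that cross_scale_right[OF that fld_zero, of s 0] by (auto simp: local_to_def)
  then show ?case by (simp only: lin_0[OF lin_\<Psi>] W.fld_X W.fld_Phi) simp
next
  case vac
  then show ?case
    by (simp add: \<Psi>_vac koszul_simps local_to_idf W.fld_X W.unital_X W.fld_Phi W.unital_Phi W.lin_e)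
next
  case (act q v b)
  then show ?case
    unfolding \<Psi>_act[OF act.hyps]
    by (intro conjI allI W.local_Phi_act W.local_act[OF W.fld_X W.unital_X] fld_\<Psi> W.local_X) blast+
next
  case (add q u v)
  then show ?case
    unfolding lin_add[OF lin_\<Psi>]
    by (intro conjI allI local_to_add_right W.fld_X W.fld_Phi fld_\<Psi>) blast+
next
  case (scale q v c)
  then show ?case
    unfolding lin_scale[OF lin_\<Psi>]
    by (intro conjI allI local_to_scale_right W.fld_X W.fld_Phi fld_\<Psi>) blast+
qed

text \<open>Modes n \<ge> 0 vanish and n = -1 is the creation property. The descent from n to n - 1
  differentiates both sides, which yields the factor -n; it can be cancelled because n \<le>
  -1.\<close>

lemma \<Psi>_Phi_vac: "\<Psi> (V.Phi us n vac) = nprod 1 (W.Phi us) n (idf eW)"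
proof (cases "n \<ge> 0")
  case True
  then show ?thesis
    by (simp add: V.creation lin_0[OF lin_\<Psi>] nprod_idf_right W.fld_Phi W.unital_Phi W.lin_e)
next
  case False
  then have "n \<le> - 1" by simp
  then show ?thesis
  proof (induction n rule: int_le_induct)
    case base
    show ?case by (simp add: V.creation \<Psi>_wv nprod_idf_minus_one W.fld_Phi W.unital_Phi)
  next
    case (step n)
    have vsp: "V.vsp (wodd us) (V.Phi us n vac)"
      using V.vsp_Phi[OF V.vsp.vac, of us n] by simp
    have "RV (Lgen (- 1)) (V.Phi us n vac) = - of_int n *\<^sub>C V.Phi us (n - 1) vac"
    proof -
      have "RV (Lgen (- 1)) vac = 0" using V.R_vac[of 0 KL] by simp
      then show ?thesis
        using V.act_translation[of "wodd us" "V.Phi us" n vac, unfolded V.translation_Phi]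
        by (simp add: der_def V.X_def lin_0[OF fld_lin[OF V.fld_Phi]])
    qed
    then have "- of_int n *\<^sub>C \<Psi> (V.Phi us (n - 1) vac) = der (\<Psi> (V.Phi us n vac))"
      using \<Psi>_D[OF vsp] by (simp only: lin_scale[OF lin_\<Psi>])
    also have "\<dots> = - of_int n *\<^sub>C nprod 1 (W.Phi us) (n - 1) (idf eW)"
      unfolding step.IH
      by (simp add: fun_eq_iff der_nprod[OF W.fld_Phi fld_idf[OF W.lin_e]]
          nprod_der_left[OF W.fld_Phi fld_idf[OF W.lin_e]] der_idf)
        (simp add: nprod_zero_right[OF W.fld_Phi, simplified])
    finally show ?case using step.hyps by (simp add: cv.scale_left_imp_eq)
  qed
qed

text \<open>By induction on \<open>v\<close>: both sides have the same commutators with the generating fields, and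
  they agree on the vacuum.\<close>

theorem \<Psi>_Phi: "V.vsp q v \<Longrightarrow> \<Psi> (V.Phi us n v) = nprod (koszul (wodd us) q) (W.Phi us) n (\<Psi> v)"
proof (induction arbitrary: us n rule: V.vsp.induct)
  case (zero q)
  then show ?case by (simp only: lin_0[OF fld_lin[OF V.fld_Phi]] lin_0[OF lin_\<Psi>] nprod_zero_right[OF W.fld_Phi])
next
  case vac
  then show ?case by (simp add: \<Psi>_Phi_vac \<Psi>_vac koszul_simps)
next
  case (add q u v)
  then show ?case
    by (simp only: lin_add[OF fld_lin[OF V.fld_Phi]] lin_add[OF lin_\<Psi>] nprod_add_right W.fld_Phi fld_\<Psi>)
next
  case (scale q v c)
  then show ?case
    by (simp only: lin_scale[OF fld_lin[OF V.fld_Phi]] lin_scale[OF lin_\<Psi>] nprod_scale_right W.fld_Phi fld_\<Psi>)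
next
  case (act q v b)
  show ?case
  proof (cases b rule: gen_cases)
    case (mode k m)
    let ?s = "koszul (kodd k) (wodd us)"
    let ?sa = "koszul (kodd k) q" and ?sb = "koszul (wodd us) q"
    have ss: "?s * ?s = 1" by (simp add: koszul_simps)
    obtain N1 where N1: "\<And>k' p q w. k' \<ge> int N1 \<Longrightarrow> cross ?s (V.X k) (V.Phi us) k' p q w = 0"
      using local_to_ge[OF V.fld_X V.fld_Phi V.local_X_Phi] by blast
    obtain N2 where N2: "\<And>k' p q w. k' \<ge> int N2 \<Longrightarrow> cross ?s (W.X k) (W.Phi us) k' p q w = 0"
      using local_to_ge[OF W.fld_X W.fld_Phi W.local_X_Phi] by blast
    define L where "L = max N1 N2"
    \<comment> \<open>Commutators with X k produce the longer words \<open>mode k l # us\<close>;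
      this is why the induction on v treats all words at once.\<close>
    have VX: "nprod ?s (V.X k) l (V.Phi us) = V.Phi (mode k l # us)"
      and WX: "nprod ?s (W.X k) l (W.Phi us) = W.Phi (mode k l # us)" for l
      by (simp_all add: V.act_mode W.act_mode)
    have VL: "V.X k m (V.Phi us n v) - ?s *\<^sub>C V.Phi us n (V.X k m v) =
        (\<Sum>l<L. bin m l *\<^sub>C V.Phi (mode k (int l) # us) (m + n - int l) v)"
      unfolding commutator_formula[OF V.fld_X V.fld_Phi V.local_X_Phi] VX[symmetric]
      by (rule Sum_any_bound) (simp add: nprod_def N1 L_def)
    have WL: "W.X k m (W.Phi us n w) - ?s *\<^sub>C W.Phi us n (W.X k m w) =
        (\<Sum>l<L. bin m l *\<^sub>C W.Phi (mode k (int l) # us) (m + n - int l) w)" for m n w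
      unfolding commutator_formula[OF W.fld_X W.fld_Phi W.local_X_Phi] WX[symmetric]
      by (rule Sum_any_bound) (simp add: nprod_def N2 L_def)
    define S where "S = (\<Sum>l<L. bin m l *\<^sub>C nprod (?sa * ?sb) (W.Phi (mode k (int l) # us)) (m + n - int l) (\<Psi> v))"
    have T: "nprod (?s * ?sa) (W.X k) m (nprod ?sb (W.Phi us) n (\<Psi> v)) -
        ?s *\<^sub>C nprod (?s * ?sb) (W.Phi us) n (nprod ?sa (W.X k) m (\<Psi> v)) = S"
      unfolding S_def fun_eq_iff
      using commutator_of_products[OF W.fld_X W.fld_Phi fld_\<Psi> W.fld_Phi ss WL, where sa = ?sa and sb = ?sb and m = m and k = n]
      by (simp add: sum_fun_apply)
    have vsp: "V.vsp (wodd us \<noteq> q) (V.Phi us n v)" by (rule V.vsp_Phi[OF act.hyps])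
    \<comment> \<open>The commutator is solved for the term in which b acts first, using that the
      sign squares to 1; the induction hypothesis then covers every other term.\<close>
    have "V.Phi us n (RV b v) = ?s *\<^sub>C (V.X k m (V.Phi us n v) -
        (\<Sum>l<L. bin m l *\<^sub>C V.Phi (mode k (int l) # us) (m + n - int l) v))"
      unfolding VL[symmetric] mode V.X_def by (simp add: cv.scale_scale ss scaleC_one)
    then have "\<Psi> (V.Phi us n (RV b v)) = ?s *\<^sub>C (\<Psi> (V.X k m (V.Phi us n v)) -
        (\<Sum>l<L. bin m l *\<^sub>C \<Psi> (V.Phi (mode k (int l) # us) (m + n - int l) v)))"
      by (simp only: lin_simps[OF lin_\<Psi>])
    also have "\<Psi> (V.X k m (V.Phi us n v)) = nprod (?s * ?sa) (W.X k) m (nprod ?sb (W.Phi us) n (\<Psi> v))"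
      unfolding V.X_def \<Psi>_act[OF vsp] W.act_mode act.IH koszul_simps(4) ..
    also have "(\<Sum>l<L. bin m l *\<^sub>C \<Psi> (V.Phi (mode k (int l) # us) (m + n - int l) v)) = S"
      unfolding S_def act.IH wodd.simps gen_odd_mode koszul_simps(5) ..
    also have "nprod (?s * ?sa) (W.X k) m (nprod ?sb (W.Phi us) n (\<Psi> v)) - S =
        ?s *\<^sub>C nprod (?s * ?sb) (W.Phi us) n (nprod ?sa (W.X k) m (\<Psi> v))"
      unfolding T[symmetric] by simp
    also have "?s *\<^sub>C \<dots> = nprod (?s * ?sb) (W.Phi us) n (nprod ?sa (W.X k) m (\<Psi> v))"
      by (simp only: cv.scale_scale ss scaleC_one)
    also have "\<dots> = nprod (koszul (wodd us) (gen_odd b \<noteq> q)) (W.Phi us) n (\<Psi> (RV b v))"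
      unfolding mode gen_odd_mode \<Psi>_act[OF act.hyps] W.act_mode koszul_simps(4)
      by (simp only: koszul_sym[of "wodd us" "kodd k"])
    finally show ?thesis .
  next
    case C1
    then show ?thesis
      by (simp only: V.R_C1 V.vsp_e[OF act.hyps] lin_scale[OF fld_lin[OF V.fld_Phi]] lin_scale[OF lin_\<Psi>]
          nprod_scale_right W.fld_Phi fld_\<Psi> act.IH gen_odd_C simp_thms)
  next
    case C2
    then show ?thesis
      by (simp only: V.R_C2 V.vsp_e[OF act.hyps] lin_scale[OF fld_lin[OF V.fld_Phi]] lin_scale[OF lin_\<Psi>]
          nprod_scale_right W.fld_Phi fld_\<Psi> act.IH gen_odd_C simp_thms)
  qed
qed

text \<open>\<Theta> plays the role of the vertex operator map of V. Both sides are linear in u, so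
  u may be taken to be a word, where \<open>\<Psi>_Phi\<close> turns the left side into that of
  \<open>borcherds_identity\<close>.\<close>

theorem \<Psi>_borcherds:
  assumes \<Theta>: "lin \<Theta>" "\<And>u. fld (\<Theta> u)" "\<And>us. \<Theta> (V.wv us) = V.Phi us"
    and u: "V.vsp p u" and v: "V.vsp q v"
  shows "Sum_any (\<lambda>l. bin m l *\<^sub>C \<Psi> (\<Theta> u (r + int l) v) (m + n - int l) w) =
    cross (koszul p q) (\<Psi> u) (\<Psi> v) r m n w"
proof -
  let ?L = "\<lambda>u. Sum_any (\<lambda>l. bin m l *\<^sub>C \<Psi> (\<Theta> u (r + int l) v) (m + n - int l) w)"
  have h: "lin (\<lambda>x. bin m l *\<^sub>C \<Psi> x i w)" for l i
    by (rule linI) (simp_all add: lin_simps[OF lin_\<Psi>] scaleC_simps mult.commute)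
  have "lin ?L"
  proof (rule lin_pointwise_Sum_any)
    fix l
    have "lin (\<lambda>u. \<Theta> u (r + int l) v)"
      by (rule linI) (simp_all add: lin_simps[OF \<Theta>(1)])
    then show "lin (\<lambda>u. bin m l *\<^sub>C \<Psi> (\<Theta> u (r + int l) v) (m + n - int l) w)"
      by (rule lin_comp[OF h])
  next
    fix u
    obtain N where "\<And>n. n \<ge> int N \<Longrightarrow> \<Theta> u n v = 0" using fld_nat[OF \<Theta>(2)] by blast
    then show "finite {l. bin m l *\<^sub>C \<Psi> (\<Theta> u (r + int l) v) (m + n - int l) w \<noteq> 0}"
      by (intro finite_supp_bound[of "N + nat \<bar>r\<bar>"]) (simp add: lin_0[OF h])
  qed
  moreover have "lin (\<lambda>u. cross (koszul p q) (\<Psi> u) (\<Psi> v) r m n w)"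
    by (rule linI) (simp_all add: lin_simps[OF lin_\<Psi>] cross_add_left cross_scale_left fld_\<Psi>)
  moreover obtain t where t: "hom_word p t" "u = lc V.wv t" using V.vsp_words[OF u] by blast
  moreover have "lc (\<lambda>us. ?L (V.wv us)) t = lc (\<lambda>us. cross (koszul p q) (\<Psi> (V.wv us)) (\<Psi> v) r m n w) t"
  proof (rule lc_cong)
    fix us assume "us \<in> keys t"
    then have p: "wodd us = p" using t by (simp add: hom_word_def)
    show "?L (V.wv us) = cross (koszul p q) (\<Psi> (V.wv us)) (\<Psi> v) r m n w"
      unfolding \<Theta>(3) \<Psi>_Phi[OF v] \<Psi>_wv
      using borcherds_identity[OF W.fld_Phi fld_\<Psi> conjunct2[OF \<Psi>_local[where us = us, OF v]]]
      by (simp add: p)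
  qed
  ultimately show ?thesis
    by (simp only: lin_of_lc[of ?L] lin_of_lc[of "\<lambda>u. cross (koszul p q) (\<Psi> u) (\<Psi> v) r m n w"] t)
qed

end

section \<open>Vector spaces with carriers as retracts of types\<close>

text \<open>The formal linear combinations of elements of \<open>W\<close> form a type; \<open>\<iota>\<close> embeds \<open>W\<close> as the image of
  the projection \<open>unit\<close> of this type. The calculus of fields above thus applies to \<open>W\<close>, with
  \<open>e = unit\<close> as the identity.\<close>

lemma complex_ring_simps [simp]:
  "carrier complex_ring = UNIV" "a \<oplus>\<^bsub>complex_ring\<^esub> b = a + b" "a \<otimes>\<^bsub>complex_ring\<^esub> b = a * b"
  "\<one>\<^bsub>complex_ring\<^esub> = 1" "\<zero>\<^bsub>complex_ring\<^esub> = 0"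
  by (simp_all add: complex_ring_def)

lemma cring_complex_ring: "cring complex_ring"
proof (rule cringI)
  show "abelian_group complex_ring"
  proof (rule abelian_groupI)
    show "\<exists>y\<in>carrier complex_ring. y \<oplus>\<^bsub>complex_ring\<^esub> x = \<zero>\<^bsub>complex_ring\<^esub>" for x
      by (rule bexI[of _ "- x"]) simp_all
  qed (simp_all add: algebra_simps)
  show "Group.comm_monoid complex_ring"
    by (rule comm_monoidI) (simp_all add: mult_ac)
qed (simp add: algebra_simps)

locale cvs =
  fixes W :: "(complex, 'w) module"
  assumes cvspace: "cvspace W"
begin

sublocale Module.module complex_ring W
  by (rule cvspace)

lemma smult_closed' [simp, intro]: "x \<in> carrier W \<Longrightarrow> a \<odot>\<^bsub>W\<^esub> x \<in> carrier W"
  by simp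

lemma smult_add_left: "x \<in> carrier W \<Longrightarrow> (a + b) \<odot>\<^bsub>W\<^esub> x = a \<odot>\<^bsub>W\<^esub> x \<oplus>\<^bsub>W\<^esub> b \<odot>\<^bsub>W\<^esub> x"
  using smult_l_distr[of a b x] by simp

lemma smult_add_right:
  "x \<in> carrier W \<Longrightarrow> y \<in> carrier W \<Longrightarrow> a \<odot>\<^bsub>W\<^esub> (x \<oplus>\<^bsub>W\<^esub> y) = a \<odot>\<^bsub>W\<^esub> x \<oplus>\<^bsub>W\<^esub> a \<odot>\<^bsub>W\<^esub> y"
  using smult_r_distr[of a x y] by simp

lemma smult_smult: "x \<in> carrier W \<Longrightarrow> a \<odot>\<^bsub>W\<^esub> (b \<odot>\<^bsub>W\<^esub> x) = (a * b) \<odot>\<^bsub>W\<^esub> x"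
  using smult_assoc1[of a b x] by simp

lemma smult_1: "x \<in> carrier W \<Longrightarrow> 1 \<odot>\<^bsub>W\<^esub> x = x"
  using smult_one[of x] by simp

lemma smult_0: "x \<in> carrier W \<Longrightarrow> 0 \<odot>\<^bsub>W\<^esub> x = \<zero>\<^bsub>W\<^esub>"
  using smult_l_null[of x] by simp

lemma smult_zero: "a \<odot>\<^bsub>W\<^esub> \<zero>\<^bsub>W\<^esub> = \<zero>\<^bsub>W\<^esub>"
  using smult_r_null[of a] by simp

lemma smult_minus_one: "x \<in> carrier W \<Longrightarrow> (- 1) \<odot>\<^bsub>W\<^esub> x = \<ominus>\<^bsub>W\<^esub> x"
proof -
  assume x: "x \<in> carrier W"
  have "(- 1) \<odot>\<^bsub>W\<^esub> x \<oplus>\<^bsub>W\<^esub> x = (- 1 + 1) \<odot>\<^bsub>W\<^esub> x"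
    using x by (simp only: smult_add_left smult_1)
  then have "(- 1) \<odot>\<^bsub>W\<^esub> x \<oplus>\<^bsub>W\<^esub> x = \<zero>\<^bsub>W\<^esub>" using x by (simp add: smult_0)
  then show ?thesis using x by (intro minus_equality[symmetric]) auto
qed

text \<open>Keys outside the carrier are discarded, so that evaluation is total on the type.\<close>

definition ev0 :: "('w \<Rightarrow>\<^sub>0 complex) \<Rightarrow> 'w" where
  "ev0 u = finsum W (\<lambda>w. lookup u w \<odot>\<^bsub>W\<^esub> w) (keys u \<inter> carrier W)"

lemma ev0_closed: "ev0 u \<in> carrier W"
  unfolding ev0_def by (rule finsum_closed) auto

lemma ev0_superset:
  assumes "finite A" "keys u \<subseteq> A"
  shows "ev0 u = finsum W (\<lambda>w. lookup u w \<odot>\<^bsub>W\<^esub> w) (A \<inter> carrier W)"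
  unfolding ev0_def
proof (rule add.finprod_mono_neutral_cong_left)
  show "lookup u i \<odot>\<^bsub>W\<^esub> i = \<zero>\<^bsub>W\<^esub>" if "i \<in> A \<inter> carrier W - keys u \<inter> carrier W" for i
    using that by (auto simp: in_keys_iff smult_0)
qed (use assms in auto)

lemma ev0_add: "ev0 (u + v) = ev0 u \<oplus>\<^bsub>W\<^esub> ev0 v"
proof -
  let ?A = "keys u \<union> keys v"
  have "ev0 (u + v) = finsum W (\<lambda>w. lookup u w \<odot>\<^bsub>W\<^esub> w \<oplus>\<^bsub>W\<^esub> lookup v w \<odot>\<^bsub>W\<^esub> w) (?A \<inter> carrier W)"
    unfolding ev0_superset[OF finite_UnI[OF finite_keys finite_keys] keys_add]
    by (rule finsum_cong) (auto simp: lookup_add smult_add_left simp_implies_def)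
  also have "\<dots> = ev0 u \<oplus>\<^bsub>W\<^esub> ev0 v"
    by (subst finsum_addf) (auto simp: ev0_superset[of ?A])
  finally show ?thesis .
qed

lemma ev0_scale: "ev0 (a *\<^sub>C u) = a \<odot>\<^bsub>W\<^esub> ev0 u"
proof -
  have "keys (a *\<^sub>C u) \<subseteq> keys u" by (auto simp: in_keys_iff)
  then have "ev0 (a *\<^sub>C u) = finsum W (\<lambda>w. a \<odot>\<^bsub>W\<^esub> (lookup u w \<odot>\<^bsub>W\<^esub> w)) (keys u \<inter> carrier W)"
    by (subst ev0_superset[of "keys u"])
      (auto intro!: finsum_cong simp: smult_smult simp_implies_def)
  also have "\<dots> = a \<odot>\<^bsub>W\<^esub> ev0 u"
    unfolding ev0_def by (rule finsum_smult_ldistr[symmetric]) auto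
  finally show ?thesis .
qed

lemma ev0_single: "w \<in> carrier W \<Longrightarrow> ev0 (Poly_Mapping.single w 1) = w"
proof -
  assume w: "w \<in> carrier W"
  have "ev0 (Poly_Mapping.single w 1) = finsum W (\<lambda>x. lookup (Poly_Mapping.single w (1::complex)) x \<odot>\<^bsub>W\<^esub> x) {w}"
    using w by (subst ev0_superset[of "{w}"]) auto
  also have "\<dots> = w" using w by (simp add: smult_1)
  finally show ?thesis .
qed

text \<open>Splitting the evaluation map by a linear projection along its kernel.\<close>

lemma retract_exists:
  "\<exists>(i :: 'w \<Rightarrow> 'w \<Rightarrow>\<^sub>0 complex).
    (\<forall>x\<in>carrier W. \<forall>y\<in>carrier W. i (x \<oplus>\<^bsub>W\<^esub> y) = i x + i y) \<and>
    (\<forall>a. \<forall>x\<in>carrier W. i (a \<odot>\<^bsub>W\<^esub> x) = a *\<^sub>C i x) \<and> (\<forall>x\<in>carrier W. ev0 (i x) = x)"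
proof -
  let ?K = "{u. ev0 u = \<zero>\<^bsub>W\<^esub>}"
  interpret vp: vector_space_pair "(*\<^sub>C) :: complex \<Rightarrow> ('w \<Rightarrow>\<^sub>0 complex) \<Rightarrow> _" "(*\<^sub>C) :: complex \<Rightarrow> ('w \<Rightarrow>\<^sub>0 complex) \<Rightarrow> _"
    by unfold_locales
  have "ev0 0 = \<zero>\<^bsub>W\<^esub>" using ev0_scale[of 0 0] ev0_closed[of 0] by (simp add: smult_0)
  then have "cv.subspace ?K"
    unfolding cv.subspace_def by (auto simp: ev0_add ev0_scale smult_zero)
  moreover have "Vector_Spaces.linear (*\<^sub>C) (*\<^sub>C) (id :: ('w \<Rightarrow>\<^sub>0 complex) \<Rightarrow> _)"
    by (rule cv.linear_id)
  ultimately obtain g :: "('w \<Rightarrow>\<^sub>0 complex) \<Rightarrow> 'w \<Rightarrow>\<^sub>0 complex" where g: "g ` UNIV \<subseteq> ?K" "Vector_Spaces.linear (*\<^sub>C) (*\<^sub>C) g"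
    "\<And>v. v \<in> ?K \<Longrightarrow> g v = v"
    using vp.linear_exists_left_inverse_on[of id ?K] by auto
  have g_add: "g (x + y) = g x + g y" and g_scale: "g (a *\<^sub>C x) = a *\<^sub>C g x" for x y a
    using g(2) by (simp_all add: vp.linear_add vp.linear_scale)
  have lin_g: "lin g" by (rule linI) (simp_all add: g_add g_scale)
  \<comment> \<open>g projects onto the kernel of \<open>ev0\<close>, so p u depends only on
    \<open>ev0 u\<close>; this makes the map from x to p of the point mass at x linear on the
    carrier.\<close>
  define p where "p u = u - g u" for u
  have lin_p: "lin p" unfolding p_def[abs_def] by (intro lin_minus' lin_id lin_g)
  have ev_diff: "ev0 (u - v) = ev0 u \<oplus>\<^bsub>W\<^esub> (- 1) \<odot>\<^bsub>W\<^esub> ev0 v" for u v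
    using ev0_add[of u "(- 1) *\<^sub>C v"] by (simp add: ev0_scale[of "- 1", simplified])
  have evK: "ev0 u = ev0 v \<Longrightarrow> p u = p v" for u v
  proof -
    assume eq: "ev0 u = ev0 v"
    have "ev0 (u - v) = \<zero>\<^bsub>W\<^esub>"
      unfolding ev_diff eq by (simp add: smult_minus_one ev0_closed r_neg)
    then have "p (u - v) = 0" using g(3)[of "u - v"] by (simp add: p_def)
    then show ?thesis by (simp add: lin_diff[OF lin_p])
  qed
  have ev_p: "ev0 (p u) = ev0 u" for u
  proof -
    have "ev0 (g u) = \<zero>\<^bsub>W\<^esub>" using g(1) by auto
    then show ?thesis unfolding p_def ev_diff by (simp add: smult_zero ev0_closed)
  qed
  show ?thesis
    by (rule exI[of _ "\<lambda>x. p (Poly_Mapping.single x 1)"])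
      (auto simp: ev_p ev0_single lin_add[OF lin_p, symmetric] lin_scale[OF lin_p, symmetric] ev0_add ev0_scale
        intro!: evK)
qed

definition \<iota> :: "'w \<Rightarrow> 'w \<Rightarrow>\<^sub>0 complex" where
  "\<iota> = (SOME i. (\<forall>x\<in>carrier W. \<forall>y\<in>carrier W. i (x \<oplus>\<^bsub>W\<^esub> y) = i x + i y) \<and>
    (\<forall>a. \<forall>x\<in>carrier W. i (a \<odot>\<^bsub>W\<^esub> x) = a *\<^sub>C i x) \<and> (\<forall>x\<in>carrier W. ev0 (i x) = x))"

lemma \<iota>_add: "x \<in> carrier W \<Longrightarrow> y \<in> carrier W \<Longrightarrow> \<iota> (x \<oplus>\<^bsub>W\<^esub> y) = \<iota> x + \<iota> y"
  and \<iota>_smult: "x \<in> carrier W \<Longrightarrow> \<iota> (a \<odot>\<^bsub>W\<^esub> x) = a *\<^sub>C \<iota> x"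
  and ev_\<iota>: "x \<in> carrier W \<Longrightarrow> ev0 (\<iota> x) = x"
  using someI_ex[OF retract_exists] unfolding \<iota>_def[symmetric] by blast+

lemma \<iota>_inj: "x \<in> carrier W \<Longrightarrow> y \<in> carrier W \<Longrightarrow> \<iota> x = \<iota> y \<longleftrightarrow> x = y"
  using ev_\<iota> by metis

lemma \<iota>_zero [simp]: "\<iota> \<zero>\<^bsub>W\<^esub> = 0"
  using \<iota>_smult[of "\<zero>\<^bsub>W\<^esub>" 0] by (simp add: smult_0)

lemma \<iota>_minus: "x \<in> carrier W \<Longrightarrow> \<iota> (\<ominus>\<^bsub>W\<^esub> x) = - \<iota> x"
  using \<iota>_smult[of x "- 1"] by (simp add: smult_minus_one)

lemma \<iota>_diff: "x \<in> carrier W \<Longrightarrow> y \<in> carrier W \<Longrightarrow> \<iota> (x \<ominus>\<^bsub>W\<^esub> y) = \<iota> x - \<iota> y"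
  by (simp add: a_minus_def \<iota>_add \<iota>_minus)

lemma \<iota>_eq_0: "x \<in> carrier W \<Longrightarrow> \<iota> x = 0 \<longleftrightarrow> x = \<zero>\<^bsub>W\<^esub>"
  using \<iota>_inj[of x "\<zero>\<^bsub>W\<^esub>"] by simp

lemma ev_zero [simp]: "ev0 0 = \<zero>\<^bsub>W\<^esub>"
  using ev0_scale[of 0 0] ev0_closed[of 0] by (simp add: smult_0)

lemma \<iota>_finsum: "f \<in> A \<rightarrow> carrier W \<Longrightarrow> \<iota> (finsum W f A) = (\<Sum>i\<in>A. \<iota> (f i))"
proof (induction A rule: infinite_finite_induct)
  case (insert x F)
  then show ?case by (subst finsum_insert) (auto simp: \<iota>_add finsum_closed)
qed (simp_all add: finsum_infinite)

lemma \<iota>_fsum: "(\<And>i. f i \<in> carrier W) \<Longrightarrow> \<iota> (fsum W f) = Sum_any (\<lambda>i. \<iota> (f i))"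
  unfolding fsum_def Sum_any.expand_set by (subst \<iota>_finsum) (auto simp: \<iota>_eq_0)

lemma fsum_closed: "(\<And>i. f i \<in> carrier W) \<Longrightarrow> fsum W f \<in> carrier W"
  unfolding fsum_def by (rule finsum_closed) auto

definition unit :: "('w \<Rightarrow>\<^sub>0 complex) \<Rightarrow> ('w \<Rightarrow>\<^sub>0 complex)" where
  "unit u = \<iota> (ev0 u)"

definition lft :: "('w \<Rightarrow> 'w) \<Rightarrow> ('w \<Rightarrow>\<^sub>0 complex) \<Rightarrow> ('w \<Rightarrow>\<^sub>0 complex)" where
  "lft f u = \<iota> (f (ev0 u))"

lemma unit_\<iota>: "x \<in> carrier W \<Longrightarrow> unit (\<iota> x) = \<iota> x"
  by (simp add: unit_def ev_\<iota>)

lemma lft_\<iota>: "x \<in> carrier W \<Longrightarrow> lft f (\<iota> x) = \<iota> (f x)"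
  by (simp add: lft_def ev_\<iota>)

lemma cEnd_closed: "f \<in> cEnd W \<Longrightarrow> x \<in> carrier W \<Longrightarrow> f x \<in> carrier W"
  and cEnd_add: "f \<in> cEnd W \<Longrightarrow> x \<in> carrier W \<Longrightarrow> y \<in> carrier W \<Longrightarrow> f (x \<oplus>\<^bsub>W\<^esub> y) = f x \<oplus>\<^bsub>W\<^esub> f y"
  and cEnd_smult: "f \<in> cEnd W \<Longrightarrow> x \<in> carrier W \<Longrightarrow> f (a \<odot>\<^bsub>W\<^esub> x) = a \<odot>\<^bsub>W\<^esub> f x"
  by (auto simp: cEnd_def)

lemma cEnd_zero: "f \<in> cEnd W \<Longrightarrow> f \<zero>\<^bsub>W\<^esub> = \<zero>\<^bsub>W\<^esub>"
  using cEnd_smult[of f "\<zero>\<^bsub>W\<^esub>" 0] by (simp add: smult_0 cEnd_closed)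

lemma lin_unit: "lin unit"
  by (rule linI) (simp_all add: unit_def ev0_add ev0_scale ev0_closed \<iota>_add \<iota>_smult)

lemma unit_unit: "unit (unit u) = unit u"
  by (simp add: unit_def ev_\<iota> ev0_closed)

lemma lin_lft: "f \<in> cEnd W \<Longrightarrow> lin (lft f)"
  by (rule linI) (simp_all add: lft_def ev0_add ev0_scale ev0_closed \<iota>_add \<iota>_smult cEnd_add cEnd_smult cEnd_closed)

lemma lft_unit: "lft f (unit u) = lft f u"
  by (simp add: lft_def unit_def ev_\<iota> ev0_closed)

lemma unit_lft: "f \<in> cEnd W \<Longrightarrow> unit (lft f u) = lft f u"
  by (simp add: lft_def unit_def ev_\<iota> ev0_closed cEnd_closed)

lemma cEndI:
  assumes "\<And>x. x \<in> carrier W \<Longrightarrow> f x \<in> carrier W" "\<And>x. x \<notin> carrier W \<Longrightarrow> f x = undefined"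
    and "\<And>x y. x \<in> carrier W \<Longrightarrow> y \<in> carrier W \<Longrightarrow> \<iota> (f (x \<oplus>\<^bsub>W\<^esub> y)) = \<iota> (f x) + \<iota> (f y)"
    and "\<And>a x. x \<in> carrier W \<Longrightarrow> \<iota> (f (a \<odot>\<^bsub>W\<^esub> x)) = a *\<^sub>C \<iota> (f x)"
  shows "f \<in> cEnd W"
proof -
  have "f (x \<oplus>\<^bsub>W\<^esub> y) = f x \<oplus>\<^bsub>W\<^esub> f y" if "x \<in> carrier W" "y \<in> carrier W" for x y
    using assms(3)[OF that] that by (simp add: \<iota>_add[symmetric] assms(1) \<iota>_inj)
  moreover have "f (a \<odot>\<^bsub>W\<^esub> x) = a \<odot>\<^bsub>W\<^esub> f x" if "x \<in> carrier W" for a x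
    using assms(4)[OF that] that by (simp add: \<iota>_smult[symmetric] assms(1) \<iota>_inj)
  ultimately show ?thesis using assms(1,2) unfolding cEnd_def PiE_def extensional_def by auto
qed

lemma cEnd_eqI:
  assumes "f \<in> cEnd W" "g \<in> cEnd W" "\<And>x. x \<in> carrier W \<Longrightarrow> f x = g x"
  shows "f = g"
  using assms unfolding cEnd_def by (auto intro: PiE_ext)

definition op_of :: "(('w \<Rightarrow>\<^sub>0 complex) \<Rightarrow> ('w \<Rightarrow>\<^sub>0 complex)) \<Rightarrow> 'w \<Rightarrow> 'w" where
  "op_of h = (\<lambda>x\<in>carrier W. ev0 (h (\<iota> x)))"

lemma \<iota>_op_of:
  assumes "\<And>u. unit (h u) = h u" "x \<in> carrier W"
  shows "\<iota> (op_of h x) = h (\<iota> x)"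
  using assms(2) assms(1)[of "\<iota> x"] unfolding op_of_def unit_def by simp

lemma op_of_closed: "x \<in> carrier W \<Longrightarrow> op_of h x \<in> carrier W"
  by (simp add: op_of_def ev0_closed)

lemma op_of_cEnd:
  assumes h: "lin h" "\<And>u. unit (h u) = h u"
  shows "op_of h \<in> cEnd W"
proof (rule cEndI)
  fix x y assume x: "x \<in> carrier W" "y \<in> carrier W"
  show "\<iota> (op_of h (x \<oplus>\<^bsub>W\<^esub> y)) = \<iota> (op_of h x) + \<iota> (op_of h y)"
    by (simp only: \<iota>_op_of[of h, OF h(2)] \<iota>_add x a_closed lin_add[OF h(1)])
next
  fix a x assume x: "x \<in> carrier W"
  show "\<iota> (op_of h (a \<odot>\<^bsub>W\<^esub> x)) = a *\<^sub>C \<iota> (op_of h x)"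
    by (simp only: \<iota>_op_of[of h, OF h(2)] \<iota>_smult x smult_closed' lin_scale[OF h(1)])
next
  fix x assume "x \<notin> carrier W"
  then show "op_of h x = undefined" by (simp add: op_of_def)
qed (rule op_of_closed)

lemma lft_op_of:
  assumes h: "\<And>u. unit (h u) = h u" "\<And>u. h (unit u) = h u"
  shows "lft (op_of h) = h"
proof
  fix u
  have "lft (op_of h) u = h (unit u)"
    unfolding lft_def by (simp only: \<iota>_op_of[of h, OF h(1)] ev0_closed unit_def)
  then show "lft (op_of h) u = h u" by (simp only: h(2))
qed

lemma csubspaceI:
  assumes "H \<subseteq> carrier W" "\<zero>\<^bsub>W\<^esub> \<in> H" "\<And>a b. a \<in> H \<Longrightarrow> b \<in> H \<Longrightarrow> a \<oplus>\<^bsub>W\<^esub> b \<in> H"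
    "\<And>a x. x \<in> H \<Longrightarrow> a \<odot>\<^bsub>W\<^esub> x \<in> H"
  shows "csubspace W H"
proof (rule submoduleI)
  show "\<ominus>\<^bsub>W\<^esub> a \<in> H" if "a \<in> H" for a
    using assms(4)[OF that, of "- 1"] assms(1) that by (simp add: smult_minus_one subsetD)
qed (use assms in auto)

lemma csubspace_zero: "csubspace W H \<Longrightarrow> \<zero>\<^bsub>W\<^esub> \<in> H"
proof -
  assume H: "csubspace W H"
  obtain x where x: "x \<in> H" using submoduleE(2)[OF H] by blast
  then have "0 \<odot>\<^bsub>W\<^esub> x \<in> H" using submoduleE(4)[OF H, of 0 x] by simp
  moreover have "x \<in> carrier W" using submoduleE(1)[OF H] x by blast
  ultimately show ?thesis by (simp add: smult_0)
qed

lemma csubspace_subset: "csubspace W H \<Longrightarrow> x \<in> H \<Longrightarrow> x \<in> carrier W"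
  and csubspace_add: "csubspace W H \<Longrightarrow> x \<in> H \<Longrightarrow> y \<in> H \<Longrightarrow> x \<oplus>\<^bsub>W\<^esub> y \<in> H"
  and csubspace_smult: "csubspace W H \<Longrightarrow> x \<in> H \<Longrightarrow> a \<odot>\<^bsub>W\<^esub> x \<in> H"
  using submoduleE[of H] by auto

end

section \<open>Quotients\<close>

locale quot = cvs W for W :: "(complex, 'w) module" +
  fixes N assumes csub: "csubspace W N"
begin

definition q :: "'w \<Rightarrow> 'w set" where "q w = N +>\<^bsub>W\<^esub> w"

sublocale Q: abelian_subgroup N W
proof (rule abelian_subgroupI3)
  show "additive_subgroup N W"
    using csub by (simp add: additive_subgroup_def submodule_def)
  show "abelian_group W" ..
qed

lemma q_add: "x \<in> carrier W \<Longrightarrow> y \<in> carrier W \<Longrightarrow> q x <+>\<^bsub>W\<^esub> q y = q (x \<oplus>\<^bsub>W\<^esub> y)"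
  unfolding q_def by (rule Q.a_rcos_sum)

lemma q_eqI: "x \<in> carrier W \<Longrightarrow> y \<in> carrier W \<Longrightarrow> x \<ominus>\<^bsub>W\<^esub> y \<in> N \<Longrightarrow> q x = q y"
  unfolding q_def a_minus_def by (metis Q.a_rcos_module_rev Q.a_repr_independence')

lemma q_eqD: "x \<in> carrier W \<Longrightarrow> y \<in> carrier W \<Longrightarrow> q x = q y \<Longrightarrow> x \<ominus>\<^bsub>W\<^esub> y \<in> N"
  unfolding q_def a_minus_def by (metis Q.a_rcos_module_imp Q.a_rcos_self)

lemma q_self: "x \<in> carrier W \<Longrightarrow> x \<in> q x"
  unfolding q_def by (rule Q.a_rcos_self)

lemma q_mem: "x \<in> carrier W \<Longrightarrow> y \<in> q x \<Longrightarrow> y \<in> carrier W \<and> q y = q x"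
  unfolding q_def by (metis Q.a_elemrcos_carrier Q.a_repr_independence')

text \<open>All sets in the union are the same coset, so operations on the quotient that are defined
  by unions over representatives take the expected value.\<close>

lemma UN_q:
  assumes "x \<in> carrier W" "\<And>y. y \<in> carrier W \<Longrightarrow> q y = q x \<Longrightarrow> q (f y) = q (f x)"
  shows "(\<Union>y\<in>q x. N +>\<^bsub>W\<^esub> f y) = q (f x)"
proof -
  have "N +>\<^bsub>W\<^esub> f y = q (f x)" if "y \<in> q x" for y
    using assms(2)[of y] q_mem[OF assms(1) that] by (simp add: q_def)
  then show ?thesis using q_self[OF assms(1)] by auto
qed

abbreviation Quot where "Quot \<equiv> quot_space W N"

lemma carrier_Quot: "carrier Quot = q ` carrier W"
  by (auto simp: quot_space_def A_RCOSETS_def' q_def)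

lemma q_closed [simp]: "x \<in> carrier W \<Longrightarrow> q x \<in> carrier Quot"
  by (simp add: carrier_Quot)

lemma zero_Quot: "\<zero>\<^bsub>Quot\<^esub> = q \<zero>\<^bsub>W\<^esub>"
  using Q.a_subset by (simp add: quot_space_def q_def)

lemma add_Quot: "x \<in> carrier W \<Longrightarrow> y \<in> carrier W \<Longrightarrow> q x \<oplus>\<^bsub>Quot\<^esub> q y = q (x \<oplus>\<^bsub>W\<^esub> y)"
  by (simp add: quot_space_def q_add)

lemma smult_diff: "x \<in> carrier W \<Longrightarrow> y \<in> carrier W \<Longrightarrow> a \<odot>\<^bsub>W\<^esub> (x \<ominus>\<^bsub>W\<^esub> y) = a \<odot>\<^bsub>W\<^esub> x \<ominus>\<^bsub>W\<^esub> a \<odot>\<^bsub>W\<^esub> y"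
  by (simp add: a_minus_def smult_add_right smult_r_minus)

lemma smult_Quot: "x \<in> carrier W \<Longrightarrow> a \<odot>\<^bsub>Quot\<^esub> q x = q (a \<odot>\<^bsub>W\<^esub> x)"
proof -
  assume x: "x \<in> carrier W"
  have "q (a \<odot>\<^bsub>W\<^esub> y) = q (a \<odot>\<^bsub>W\<^esub> x)" if y: "y \<in> carrier W" "q y = q x" for y
    using csubspace_smult[OF csub q_eqD[OF y(1) x y(2)], of a] x y(1)
    by (intro q_eqI) (simp_all add: smult_diff)
  from UN_q[where f = "\<lambda>y. a \<odot>\<^bsub>W\<^esub> y", OF x this] show ?thesis by (simp add: quot_space_def)
qed

lemma cvs_Quot: "cvs Quot"
proof (rule cvs.intro, rule moduleI)
  show "abelian_group Quot"
  proof (rule abelian_groupI)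
    fix X assume "X \<in> carrier Quot"
    then obtain x where x: "x \<in> carrier W" "X = q x" by (auto simp: carrier_Quot)
    then show "\<exists>Y\<in>carrier Quot. Y \<oplus>\<^bsub>Quot\<^esub> X = \<zero>\<^bsub>Quot\<^esub>"
      by (intro bexI[of _ "q (\<ominus>\<^bsub>W\<^esub> x)"]) (simp_all add: add_Quot zero_Quot l_neg)
  qed (auto simp: carrier_Quot add_Quot zero_Quot a_ac)
qed (auto simp: carrier_Quot add_Quot smult_Quot cring_complex_ring smult_add_left smult_add_right smult_smult smult_1)

lemma quot_op_q:
  assumes "x \<in> carrier W" "\<And>x. x \<in> carrier W \<Longrightarrow> f x \<in> carrier W"
    and "\<And>x y. x \<in> carrier W \<Longrightarrow> y \<in> carrier W \<Longrightarrow> x \<ominus>\<^bsub>W\<^esub> y \<in> N \<Longrightarrow> f x \<ominus>\<^bsub>W\<^esub> f y \<in> N"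
  shows "quot_op W N f (q x) = q (f x)"
proof -
  have "(\<Union>y\<in>q x. N +>\<^bsub>W\<^esub> f y) = q (f x)"
    using assms q_eqD by (intro UN_q q_eqI) auto
  then show ?thesis using assms(1) by (simp add: quot_op_def)
qed

end

section \<open>The vacuum module\<close>

lemma tensor_space_simps [simp]:
  "carrier tensor_space = UNIV" "s \<oplus>\<^bsub>tensor_space\<^esub> t = s + t" "\<zero>\<^bsub>tensor_space\<^esub> = 0"
  "a \<odot>\<^bsub>tensor_space\<^esub> t = a *\<^sub>C t"
  by (simp_all add: tensor_space_def pm_scale_eq_scaleC)

lemma cvs_tensor_space: "cvs tensor_space"
proof (rule cvs.intro, rule moduleI)
  show "abelian_group tensor_space"
  proof (rule abelian_groupI)
    show "\<exists>y\<in>carrier tensor_space. y \<oplus>\<^bsub>tensor_space\<^esub> x = \<zero>\<^bsub>tensor_space\<^esub>" for x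
      by (rule bexI[of _ "- x"]) simp_all
  qed (simp_all add: add_ac)
qed (simp_all add: cring_complex_ring scaleC_simps scaleC_one)

interpretation tensor: cvs tensor_space
  by (rule cvs_tensor_space)

lemma tensor_minus: "s \<ominus>\<^bsub>tensor_space\<^esub> t = s - t"
  using tensor.smult_minus_one[of t] by (simp add: a_minus_def scaleC_one)

lemma verma_rel_scale: "t \<in> verma_rel c1 c2 \<Longrightarrow> z *\<^sub>C t \<in> verma_rel c1 c2"
proof (induction rule: verma_rel.induct)
  case (supercomm s a b t)
  show ?case
    using verma_rel.supercomm[of "z *\<^sub>C s" a b t c1 c2]
    by (simp only: lin_scale[OF lin_mult_right])
next
  case (character b s)
  then show ?case
    using verma_rel.character[of b "z *\<^sub>C s" c1 c2] by (simp only: lin_scale[OF lin_mult_right])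
qed (simp_all add: verma_rel.zero scaleC_add_right verma_rel.add)

lemma verma_rel_mult: "t \<in> verma_rel c1 c2 \<Longrightarrow> s * t \<in> verma_rel c1 c2"
proof (induction rule: verma_rel.induct)
  case (supercomm s' a b t)
  show ?case using verma_rel.supercomm[of "s * s'" a b t c1 c2] by (simp only: mult.assoc)
next
  case (character b s')
  then show ?case using verma_rel.character[of b "s * s'" c1 c2] by (simp only: mult.assoc)
qed (simp_all add: verma_rel.zero distrib_left verma_rel.add)

lemma verma_rel_csubspace: "csubspace tensor_space (verma_rel c1 c2)"
  by (rule tensor.csubspaceI) (auto intro: verma_rel.intros verma_rel_scale)

context
  fixes c1 c2 :: complex
begin

interpretation V1: quot tensor_space "verma_rel c1 c2"
  by (intro quot.intro quot_axioms.intro cvs_tensor_space verma_rel_csubspace)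

interpretation V: cvs "verma c1 c2"
  unfolding verma_def by (rule V1.cvs_Quot)

lemma verma_act_q: "verma_act c1 c2 x (V1.q t) = V1.q (tensor_incl x * t)"
  unfolding verma_act_def
  by (rule V1.quot_op_q)
    (auto simp: tensor_minus verma_rel_mult simp flip: right_diff_distrib)

lemma verma_cases:
  assumes "X \<in> carrier (verma c1 c2)"
  obtains t where "X = V1.q t"
  using assms by (auto simp: verma_def V1.carrier_Quot)

lemma verma_q_add: "V1.q s \<oplus>\<^bsub>verma c1 c2\<^esub> V1.q t = V1.q (s + t)"
  and verma_q_smult: "a \<odot>\<^bsub>verma c1 c2\<^esub> V1.q t = V1.q (a *\<^sub>C t)"
  and verma_q_closed: "V1.q t \<in> carrier (verma c1 c2)"
  by (simp_all add: verma_def V1.add_Quot V1.smult_Quot)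

lemma verma_q_diff: "V1.q s \<ominus>\<^bsub>verma c1 c2\<^esub> V1.q t = V1.q (s - t)"
proof -
  have "V1.q s \<ominus>\<^bsub>verma c1 c2\<^esub> V1.q t = V1.q s \<oplus>\<^bsub>verma c1 c2\<^esub> (- 1) \<odot>\<^bsub>verma c1 c2\<^esub> V1.q t"
    by (simp only: a_minus_def V.smult_minus_one verma_q_closed)
  then show ?thesis by (simp add: verma_q_add verma_q_smult scaleC_one)
qed

lemma verma_one_q: "verma_one c1 c2 = V1.q 1"
  by (simp add: verma_one_def V1.q_def)

definition vac_ideal_like :: "tensor_alg set set \<Rightarrow> bool" where
  "vac_ideal_like N \<longleftrightarrow> csubspace (verma c1 c2) N \<and> (\<forall>x. \<forall>w\<in>N. verma_act c1 c2 x w \<in> N) \<and>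
     verma_act c1 c2 (gen (Lgen (- 1))) (verma_one c1 c2) \<in> N"

lemma vacuum_ideal_Inter: "vacuum_ideal c1 c2 = \<Inter> {N. vac_ideal_like N}"
  by (simp add: vacuum_ideal_def vac_ideal_like_def)

lemma vac_ideal_like_carrier: "vac_ideal_like (carrier (verma c1 c2))"
proof -
  have "csubspace (verma c1 c2) (carrier (verma c1 c2))" by (rule V.carrier_is_submodule)
  moreover have "verma_act c1 c2 x w \<in> carrier (verma c1 c2)" if "w \<in> carrier (verma c1 c2)" for x w
    using that by (elim verma_cases) (simp add: verma_act_q verma_q_closed)
  ultimately show ?thesis
    unfolding vac_ideal_like_def by (auto simp: verma_one_q verma_q_closed)
qed

lemma vac_ideal_like_vacuum_ideal: "vac_ideal_like (vacuum_ideal c1 c2)"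
  unfolding vac_ideal_like_def
proof (intro conjI)
  show "csubspace (verma c1 c2) (vacuum_ideal c1 c2)"
  proof (rule V.csubspaceI)
    show "vacuum_ideal c1 c2 \<subseteq> carrier (verma c1 c2)"
      using vac_ideal_like_carrier by (auto simp: vacuum_ideal_Inter)
  qed (auto simp: vacuum_ideal_Inter vac_ideal_like_def intro: V.csubspace_zero V.csubspace_add V.csubspace_smult)
qed (auto simp: vacuum_ideal_Inter vac_ideal_like_def)

interpretation V2: quot "verma c1 c2" "vacuum_ideal c1 c2"
  using vac_ideal_like_vacuum_ideal
  by (intro quot.intro quot_axioms.intro V.cvs_axioms) (simp add: vac_ideal_like_def)

lemma cvs_vacuum: "cvs (vacuum c1 c2)"
  unfolding vacuum_def by (rule V2.cvs_Quot)

definition proj :: "tensor_alg \<Rightarrow> vacuum_elt" where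
  "proj t = V2.q (V1.q t)"

lemma proj_closed [simp]: "proj t \<in> carrier (vacuum c1 c2)"
  by (simp add: proj_def vacuum_def verma_q_closed)

lemma vacuum_cases:
  assumes "v \<in> carrier (vacuum c1 c2)"
  obtains t where "v = proj t"
  using assms by (auto simp: vacuum_def V2.carrier_Quot proj_def elim!: verma_cases)

lemma proj_add: "proj (s + t) = proj s \<oplus>\<^bsub>vacuum c1 c2\<^esub> proj t"
  and proj_smult: "proj (a *\<^sub>C t) = a \<odot>\<^bsub>vacuum c1 c2\<^esub> proj t"
  by (simp_all add: proj_def vacuum_def V2.add_Quot V2.smult_Quot verma_q_add verma_q_smult verma_q_closed)

lemma vacuum_act_proj: "vacuum_act c1 c2 x (proj t) = proj (tensor_incl x * t)"
proof -
  have "verma_act c1 c2 x w \<in> carrier (verma c1 c2)" if "w \<in> carrier (verma c1 c2)" for w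
    using that by (elim verma_cases) (simp add: verma_act_q verma_q_closed)
  moreover have "verma_act c1 c2 x X \<ominus>\<^bsub>verma c1 c2\<^esub> verma_act c1 c2 x Y \<in> vacuum_ideal c1 c2"
    if XY: "X \<in> carrier (verma c1 c2)" "Y \<in> carrier (verma c1 c2)" "X \<ominus>\<^bsub>verma c1 c2\<^esub> Y \<in> vacuum_ideal c1 c2" for X Y
  proof -
    obtain s t where st: "X = V1.q s" "Y = V1.q t" using XY(1,2) by (elim verma_cases) auto
    have "verma_act c1 c2 x (X \<ominus>\<^bsub>verma c1 c2\<^esub> Y) \<in> vacuum_ideal c1 c2"
      using vac_ideal_like_vacuum_ideal XY(3) by (simp add: vac_ideal_like_def)
    then show ?thesis by (simp add: st verma_q_diff verma_act_q right_diff_distrib)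
  qed
  ultimately show ?thesis
    unfolding vacuum_act_def proj_def by (simp add: V2.quot_op_q verma_q_closed verma_act_q)
qed

lemma vacuum_one_proj: "vacuum_one c1 c2 = proj 1"
  by (simp add: vacuum_one_def proj_def V2.q_def verma_one_q)

lemma proj_eqD: "proj s = proj t \<Longrightarrow> V1.q (s - t) \<in> vacuum_ideal c1 c2"
  using V2.q_eqD[of "V1.q s" "V1.q t"] by (simp add: proj_def verma_q_closed verma_q_diff)

lemma proj_eqI: "V1.q (s - t) \<in> vacuum_ideal c1 c2 \<Longrightarrow> proj s = proj t"
  using V2.q_eqI[of "V1.q s" "V1.q t"] by (simp add: proj_def verma_q_closed verma_q_diff)

lemma proj_verma_rel: "s - t \<in> verma_rel c1 c2 \<Longrightarrow> proj s = proj t"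
  using V1.q_eqI[of s t] by (simp add: proj_def tensor_minus)

lemma proj_0: "proj 0 = \<zero>\<^bsub>vacuum c1 c2\<^esub>"
  by (simp add: proj_def vacuum_def V2.zero_Quot) (simp add: verma_def V1.zero_Quot)

lemma proj_L_minus_one: "proj (word [Lgen (- 1)]) = \<zero>\<^bsub>vacuum c1 c2\<^esub>"
proof -
  have "verma_act c1 c2 (gen (Lgen (- 1))) (verma_one c1 c2) \<in> vacuum_ideal c1 c2"
    using vac_ideal_like_vacuum_ideal by (simp add: vac_ideal_like_def)
  then have "V1.q (word [Lgen (- 1)] - 0) \<in> vacuum_ideal c1 c2"
    by (simp add: verma_one_q verma_act_q tensor_incl_gen)
  then show ?thesis unfolding proj_0[symmetric] by (rule proj_eqI)
qed

text \<open>The universal property: a left ideal containing the relations and \<open>L\<^bsub>-1\<^esub>\<close> contains the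
  annihilator of the vacuum vector.\<close>

lemma proj_universal:
  assumes rel: "verma_rel c1 c2 \<subseteq> K" and add: "\<And>s t. s \<in> K \<Longrightarrow> t \<in> K \<Longrightarrow> s + t \<in> K"
    and scale: "\<And>a t. t \<in> K \<Longrightarrow> a *\<^sub>C t \<in> K" and mult: "\<And>s t. t \<in> K \<Longrightarrow> s * t \<in> K"
    and L: "word [Lgen (- 1)] \<in> K" and eq: "proj s = proj t"
  shows "s - t \<in> K"
proof -
  have zero: "0 \<in> K" using rel verma_rel.zero by blast
  have diff: "s - t \<in> K" if "s \<in> K" "t \<in> K" for s t
    using add[OF that(1) scale[OF that(2), of "- 1"]] by (simp add: scaleC_one)
  \<comment> \<open>K contains the relations, so membership in K depends only on the class in the
    Verma module.\<close>
  have q_K: "V1.q s = V1.q t \<Longrightarrow> s \<in> K \<Longrightarrow> t \<in> K" for s t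
    using V1.q_eqD[of s t] rel diff[of s "s - t"] by (auto simp: tensor_minus)
  have "vac_ideal_like (V1.q ` K)"
    unfolding vac_ideal_like_def
  proof (intro conjI)
    show "csubspace (verma c1 c2) (V1.q ` K)"
    proof (rule V.csubspaceI)
      have "\<zero>\<^bsub>verma c1 c2\<^esub> = V1.q 0" by (simp add: verma_def V1.zero_Quot)
      then show "\<zero>\<^bsub>verma c1 c2\<^esub> \<in> V1.q ` K" using zero by blast
    qed (auto simp: verma_q_closed verma_q_add verma_q_smult intro!: imageI add scale)
    show "\<forall>x. \<forall>w\<in>V1.q ` K. verma_act c1 c2 x w \<in> V1.q ` K"
      by (auto simp: verma_act_q intro!: imageI mult)
    show "verma_act c1 c2 (gen (Lgen (- 1))) (verma_one c1 c2) \<in> V1.q ` K"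
      using L by (simp add: verma_one_q verma_act_q tensor_incl_gen)
  qed
  then have "V1.q (s - t) \<in> V1.q ` K"
    using proj_eqD[OF eq] by (auto simp: vacuum_ideal_Inter)
  then show ?thesis using q_K by auto
qed

end

section \<open>Representations of the Lie superalgebra in terms of its generators\<close>

lemma lc_diff_fun: "lc (\<lambda>b. F b - G b) x = lc F x - lc G x"
  and lc_scale_fun: "lc (\<lambda>b. c *\<^sub>C F b) x = c *\<^sub>C lc F x"
  by (simp_all add: lc_def scaleC_simps sum_subtractf cv.scale_sum_right mult.commute)

lemma lc_swap: "lc (\<lambda>a. lc (F a) y) x = lc (\<lambda>b. lc (\<lambda>a. F a b) x) y"
  unfolding lc_def cv.scale_sum_right by (subst sum.swap) (simp add: mult.commute)

lemma bms_bracket_lc: "bms_bracket x y = lc (\<lambda>a. lc (\<lambda>b. gen_bracket a b) y) x"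
  by (simp add: bms_bracket_def lc_def pm_scale_eq_scaleC cv.scale_sum_right cv.scale_scale)

lemma gen_in_part: "gen b \<in> bms_part (gen_odd b)"
  by (simp add: bms_part_def)

context cvs
begin

text \<open>Both sides of the bracket relation are bilinear, so generators suffice;
  \<open>lc_swap\<close> aligns the two orders of summation.\<close>

lemma bms_moduleI:
  assumes cEnd: "\<And>x. \<rho> x \<in> cEnd W"
    and lc: "\<And>x w. w \<in> carrier W \<Longrightarrow> \<iota> (\<rho> x w) = lc (\<lambda>b. \<iota> (\<rho> (gen b) w)) x"
    and br: "\<And>a b w. w \<in> carrier W \<Longrightarrow> \<iota> (\<rho> (gen a) (\<rho> (gen b) w)) -
      koszul (gen_odd a) (gen_odd b) *\<^sub>C \<iota> (\<rho> (gen b) (\<rho> (gen a) w)) =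
      lc (\<lambda>g. \<iota> (\<rho> (gen g) w)) (gen_bracket a b)"
  shows "bms_module W \<rho>"
proof -
  note cl = cEnd_closed[OF cEnd]
  have "\<rho> (x + y) w = \<rho> x w \<oplus>\<^bsub>W\<^esub> \<rho> y w" if w: "w \<in> carrier W" for x y w
  proof -
    have "\<iota> (\<rho> (x + y) w) = \<iota> (\<rho> x w \<oplus>\<^bsub>W\<^esub> \<rho> y w)"
      unfolding \<iota>_add[OF cl[OF w] cl[OF w]] lc[OF w, of "x + y"] lc[OF w, of x] lc[OF w, of y] by (rule lc_add)
    then show ?thesis using w by (simp add: cl \<iota>_inj)
  qed
  moreover have "\<rho> (pm_scale a x) w = a \<odot>\<^bsub>W\<^esub> \<rho> x w" if w: "w \<in> carrier W" for a x w
  proof -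
    have "\<iota> (\<rho> (pm_scale a x) w) = \<iota> (a \<odot>\<^bsub>W\<^esub> \<rho> x w)"
      unfolding pm_scale_eq_scaleC unfolding \<iota>_smult[OF cl[OF w]] lc[OF w, of "a *\<^sub>C x"] lc[OF w, of x]
      by (rule lc_scale)
    then show ?thesis using w by (simp add: cl \<iota>_inj)
  qed
  moreover have "\<rho> (bms_bracket x y) w = \<rho> x (\<rho> y w) \<ominus>\<^bsub>W\<^esub> koszul p q \<odot>\<^bsub>W\<^esub> \<rho> y (\<rho> x w)"
    if x: "x \<in> bms_part p" and y: "y \<in> bms_part q" and w: "w \<in> carrier W" for p q x y w
  proof -
    have comp: "\<iota> (\<rho> x (\<rho> y w)) = lc (\<lambda>a. lc (\<lambda>b. \<iota> (\<rho> (gen a) (\<rho> (gen b) w))) y) x" for x y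
    proof -
      have "\<iota> (\<rho> (gen a) (\<rho> y w)) = lc (\<lambda>b. \<iota> (\<rho> (gen a) (\<rho> (gen b) w))) y" for a
      proof -
        have "\<iota> (\<rho> (gen a) (\<rho> y w)) = lft (\<rho> (gen a)) (\<iota> (\<rho> y w))"
          by (simp add: lft_\<iota> cl w)
        also have "\<dots> = lc (\<lambda>b. lft (\<rho> (gen a)) (\<iota> (\<rho> (gen b) w))) y"
          unfolding lc[OF w, of y] by (rule lin_of_lc[OF lin_lft[OF cEnd]])
        finally show ?thesis by (simp add: lft_\<iota> cl w)
      qed
      then show ?thesis by (subst lc) (simp_all add: cl w)
    qed
    have "\<iota> (\<rho> (bms_bracket x y) w) =
        lc (\<lambda>a. lc (\<lambda>b. lc (\<lambda>g. \<iota> (\<rho> (gen g) w)) (gen_bracket a b)) y) x"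
      unfolding lc[OF w, of "bms_bracket x y"] unfolding bms_bracket_lc lin_of_lc[OF lin_lc] ..
    also have "\<dots> = lc (\<lambda>a. lc (\<lambda>b. \<iota> (\<rho> (gen a) (\<rho> (gen b) w)) -
        koszul p q *\<^sub>C \<iota> (\<rho> (gen b) (\<rho> (gen a) w))) y) x"
      by (intro lc_cong) (use x y in \<open>simp add: br[OF w, symmetric] bms_part_def\<close>)
    also have "\<dots> = \<iota> (\<rho> x (\<rho> y w)) - koszul p q *\<^sub>C \<iota> (\<rho> y (\<rho> x w))"
      unfolding lc_diff_fun lc_scale_fun comp[of x y] comp[of y x]
        lc_swap[of "\<lambda>a b. \<iota> (\<rho> (gen b) (\<rho> (gen a) w))" y x] ..
    finally show ?thesis
      using w by (subst \<iota>_inj[symmetric]) (simp_all add: cl \<iota>_diff \<iota>_smult)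
  qed
  ultimately show ?thesis unfolding bms_module_def
    by (intro conjI allI ballI cvspace cEnd) simp_all
qed

end

locale bms_mod = cvs W for W :: "(complex, 'w) module" +
  fixes \<rho> :: "bms \<Rightarrow> 'w \<Rightarrow> 'w"
  assumes bms_module: "bms_module W \<rho>"
begin

lemma \<rho>_cEnd: "\<rho> x \<in> cEnd W"
  using bms_module by (simp add: bms_module_def)

lemma \<rho>_closed: "w \<in> carrier W \<Longrightarrow> \<rho> x w \<in> carrier W"
  by (rule cEnd_closed[OF \<rho>_cEnd])

lemma \<iota>_\<rho>:
  assumes w: "w \<in> carrier W"
  shows "\<iota> (\<rho> x w) = lc (\<lambda>b. \<iota> (\<rho> (gen b) w)) x"
proof -
  have "lin (\<lambda>x. \<iota> (\<rho> x w))"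
  proof (rule linI)
    have add: "\<rho> (x + y) w = \<rho> x w \<oplus>\<^bsub>W\<^esub> \<rho> y w" and smult: "\<rho> (pm_scale a x) w = a \<odot>\<^bsub>W\<^esub> \<rho> x w" for a x y
      using bms_module w unfolding bms_module_def by blast+
    show "\<iota> (\<rho> (x + y) w) = \<iota> (\<rho> x w) + \<iota> (\<rho> y w)" for x y
      unfolding add by (intro \<iota>_add \<rho>_closed w)
    show "\<iota> (\<rho> (a *\<^sub>C x) w) = a *\<^sub>C \<iota> (\<rho> x w)" for a x
      unfolding pm_scale_eq_scaleC[symmetric] smult by (simp add: \<iota>_smult \<rho>_closed w pm_scale_eq_scaleC)
  qed
  from lin_of_lc[OF this, of gen x] show ?thesis by (simp only: lc_gen)
qed

lemma \<rho>_bracket: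
  assumes w: "w \<in> carrier W"
  shows "\<iota> (\<rho> (gen a) (\<rho> (gen b) w)) - koszul (gen_odd a) (gen_odd b) *\<^sub>C \<iota> (\<rho> (gen b) (\<rho> (gen a) w)) =
    lc (\<lambda>g. \<iota> (\<rho> (gen g) w)) (gen_bracket a b)"
proof -
  have "bms_bracket (gen a) (gen b) = gen_bracket a b"
    by (simp add: bms_bracket_lc scaleC_one)
  moreover have "\<rho> (bms_bracket (gen a) (gen b)) w = \<rho> (gen a) (\<rho> (gen b) w) \<ominus>\<^bsub>W\<^esub>
      koszul (gen_odd a) (gen_odd b) \<odot>\<^bsub>W\<^esub> \<rho> (gen b) (\<rho> (gen a) w)"
  proof -
    have "\<forall>p q. \<forall>x\<in>bms_part p. \<forall>y\<in>bms_part q. \<forall>w\<in>carrier W.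
        \<rho> (bms_bracket x y) w = \<rho> x (\<rho> y w) \<ominus>\<^bsub>W\<^esub> koszul p q \<odot>\<^bsub>W\<^esub> \<rho> y (\<rho> x w)"
      using bms_module unfolding bms_module_def by (elim conjE)
    from this[rule_format, OF gen_in_part gen_in_part w] show ?thesis .
  qed
  ultimately show ?thesis
    using \<iota>_\<rho>[OF w, of "gen_bracket a b"] w by (simp add: \<iota>_diff \<iota>_smult \<rho>_closed)
qed

end

section \<open>The vacuum module is smooth\<close>

context
  fixes c1 c2 :: complex
begin

interpretation V: cvs "vacuum c1 c2"
  by (rule cvs_vacuum)

definition vproj :: "tensor_alg \<Rightarrow> vacuum_elt \<Rightarrow>\<^sub>0 complex" where
  "vproj t = V.\<iota> (proj c1 c2 t)"

lemma lin_vproj: "lin vproj"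
  by (rule linI) (simp_all add: vproj_def proj_add proj_smult V.\<iota>_add V.\<iota>_smult)

lemma vproj_verma_rel: "s - t \<in> verma_rel c1 c2 \<Longrightarrow> vproj s = vproj t"
  unfolding vproj_def by (simp only: proj_verma_rel)

lemma vacuum_act_gen: "vacuum_act c1 c2 (gen b) (proj c1 c2 t) = proj c1 c2 (word [b] * t)"
  by (simp add: vacuum_act_proj tensor_incl_gen)

lemma vacuum_act_cEnd: "vacuum_act c1 c2 x \<in> cEnd (vacuum c1 c2)"
proof (rule V.cEndI)
  fix v assume "v \<in> carrier (vacuum c1 c2)"
  then show "vacuum_act c1 c2 x v \<in> carrier (vacuum c1 c2)"
    by (elim vacuum_cases) (simp add: vacuum_act_proj)
next
  fix v assume "v \<notin> carrier (vacuum c1 c2)"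
  then show "vacuum_act c1 c2 x v = undefined"
    by (simp add: vacuum_act_def quot_op_def vacuum_def)
next
  fix u v assume "u \<in> carrier (vacuum c1 c2)" "v \<in> carrier (vacuum c1 c2)"
  then show "V.\<iota> (vacuum_act c1 c2 x (u \<oplus>\<^bsub>vacuum c1 c2\<^esub> v)) = V.\<iota> (vacuum_act c1 c2 x u) + V.\<iota> (vacuum_act c1 c2 x v)"
    by (elim vacuum_cases) (simp add: vacuum_act_proj distrib_left V.\<iota>_add flip: proj_add, simp add: proj_add V.\<iota>_add)
next
  fix a v assume "v \<in> carrier (vacuum c1 c2)"
  then show "V.\<iota> (vacuum_act c1 c2 x (a \<odot>\<^bsub>vacuum c1 c2\<^esub> v)) = a *\<^sub>C V.\<iota> (vacuum_act c1 c2 x v)"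
    by (elim vacuum_cases) (simp add: vacuum_act_proj lin_scale[OF lin_mult_left] flip: proj_smult,
      simp add: proj_smult V.\<iota>_smult)
qed

lemma bms_module_vacuum: "bms_module (vacuum c1 c2) (vacuum_act c1 c2)"
proof (rule V.bms_moduleI[OF vacuum_act_cEnd])
  fix x v assume "v \<in> carrier (vacuum c1 c2)"
  then obtain t where v: "v = proj c1 c2 t" by (rule vacuum_cases)
  have "V.\<iota> (vacuum_act c1 c2 x v) = vproj (lc (\<lambda>b. word [b]) x * t)"
    by (simp add: v vacuum_act_proj tensor_incl_lc vproj_def)
  also have "\<dots> = lc (\<lambda>b. vproj (word [b] * t)) x"
    by (simp only: lin_of_lc[OF lin_mult_right] lin_of_lc[OF lin_vproj])
  finally show "V.\<iota> (vacuum_act c1 c2 x v) = lc (\<lambda>b. V.\<iota> (vacuum_act c1 c2 (gen b) v)) x"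
    by (simp add: v vacuum_act_gen vproj_def)
next
  fix a b v assume "v \<in> carrier (vacuum c1 c2)"
  then obtain t where v: "v = proj c1 c2 t" by (rule vacuum_cases)
  let ?k = "koszul (gen_odd a) (gen_odd b)"
  have "vproj (word [a] * (word [b] * t) - ?k *\<^sub>C (word [b] * (word [a] * t))) = vproj (lc (\<lambda>g. word [g]) (gen_bracket a b) * t)"
  proof (rule vproj_verma_rel)
    have "1 * (tensor_incl (gen a) * tensor_incl (gen b)
        - pm_scale ?k (tensor_incl (gen b) * tensor_incl (gen a)) - tensor_incl (gen_bracket a b)) * t \<in> verma_rel c1 c2"
      by (rule verma_rel.supercomm)
    then show "word [a] * (word [b] * t) - ?k *\<^sub>C (word [b] * (word [a] * t)) - lc (\<lambda>g. word [g]) (gen_bracket a b) * t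
        \<in> verma_rel c1 c2"
      unfolding tensor_incl_gen pm_scale_eq_scaleC tensor_incl_lc[of "gen_bracket a b"]
      by (simp only: mult_1 left_diff_distrib lin_scale[OF lin_mult_right] mult.assoc)
  qed
  then have "vproj (word [a] * (word [b] * t)) - ?k *\<^sub>C vproj (word [b] * (word [a] * t)) =
      lc (\<lambda>g. vproj (word [g] * t)) (gen_bracket a b)"
    by (simp only: lin_diff[OF lin_vproj] lin_scale[OF lin_vproj] lin_of_lc[OF lin_mult_right] lin_of_lc[OF lin_vproj])
  then show "V.\<iota> (vacuum_act c1 c2 (gen a) (vacuum_act c1 c2 (gen b) v)) -
      ?k *\<^sub>C V.\<iota> (vacuum_act c1 c2 (gen b) (vacuum_act c1 c2 (gen a) v)) =
      lc (\<lambda>g. V.\<iota> (vacuum_act c1 c2 (gen g) v)) (gen_bracket a b)"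
    by (simp only: v vacuum_act_gen vproj_def)
qed

interpretation V: bms_mod "vacuum c1 c2" "vacuum_act c1 c2"
  by unfold_locales (rule bms_module_vacuum)

lemma vproj_bracket: "vproj (word [a] * (word [b] * t)) =
    koszul (gen_odd a) (gen_odd b) *\<^sub>C vproj (word [b] * (word [a] * t)) +
    lc (\<lambda>g. vproj (word [g] * t)) (gen_bracket a b)"
  using V.\<rho>_bracket[of "proj c1 c2 t" a b]
  by (simp add: vacuum_act_gen algebra_simps flip: vproj_def)

lemma vproj_mult_zero: "vproj t = 0 \<Longrightarrow> vproj (word [b] * t) = 0"
  using V.cEnd_zero[OF vacuum_act_cEnd, of "gen b"] vacuum_act_gen[of b t]
  by (simp add: vproj_def V.\<iota>_eq_0)

lemma vproj_character: "nonneg_gen b \<Longrightarrow> vproj (word [b]) = verma_char c1 c2 b *\<^sub>C vproj 1"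
  using verma_rel.character[of b 1 c1 c2] vproj_verma_rel[of "word [b]" "verma_char c1 c2 b *\<^sub>C 1"]
  by (simp only: mult_1 tensor_incl_gen pm_scale_eq_scaleC lin_scale[OF lin_vproj])

text \<open>The relations fix the value of a central element only next to 1; as its brackets vanish,
  it can be moved through any word to that place.\<close>

lemma vproj_C1: "vproj (word [C1gen] * t) = c1 *\<^sub>C vproj t"
  and vproj_C2: "vproj (word [C2gen] * t) = c2 *\<^sub>C vproj t"
proof -
  have "vproj (word [b] * word ws) = verma_char c1 c2 b *\<^sub>C vproj (word ws)" if b: "b = C1gen \<or> b = C2gen" for b ws
  proof (induction ws)
    case Nil
    show ?case using vproj_character[of b] b by (auto simp: word_Nil nonneg_gen_def)
  next
    case (Cons g ws)
    have w: "word (g # ws) = word [g] * word ws" by (simp only: word_mult append.simps)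
    have "vproj (word [b] * word ws - verma_char c1 c2 b *\<^sub>C word ws) = 0"
      by (simp only: lin_diff[OF lin_vproj] lin_scale[OF lin_vproj] Cons) simp
    then have "vproj (word [g] * (word [b] * word ws - verma_char c1 c2 b *\<^sub>C word ws)) = 0"
      by (rule vproj_mult_zero)
    then have "vproj (word [g] * (word [b] * word ws)) = verma_char c1 c2 b *\<^sub>C vproj (word [g] * word ws)"
      by (simp only: lin_diff[OF lin_mult_left] lin_scale[OF lin_mult_left] lin_diff[OF lin_vproj] lin_scale[OF lin_vproj]) simp
    moreover have "vproj (word [b] * (word [g] * word ws)) = vproj (word [g] * (word [b] * word ws))"
      using vproj_bracket[of b g "word ws"] b by (auto simp: koszul_simps scaleC_one)
    ultimately show ?case by (simp only: w)
  qed
  then have "vproj (word [b] * lc word t) = verma_char c1 c2 b *\<^sub>C vproj (lc word t)" if "b = C1gen \<or> b = C2gen" for b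
    using that by (simp only: lin_of_lc[OF lin_mult_left] lin_of_lc[OF lin_vproj] lc_scale_fun)
  from this[of C1gen] this[of C2gen]
  show "vproj (word [C1gen] * t) = c1 *\<^sub>C vproj t" "vproj (word [C2gen] * t) = c2 *\<^sub>C vproj t"
    by (simp_all add: lc_gen verma_char_def)
qed

text \<open>For n > 0 this is a relation of the Verma module. For n = 0 the quotient kills L_{-1} on
  the vacuum, and then M_{-1} = [M_0, L_{-1}] and Q_{-1/2} = [Q_{1/2}, L_{-1}] kill it too.\<close>

lemma vproj_annihilated:
  assumes "n \<ge> 0"
  shows "vproj (word [mode k n]) = 0"
proof (cases "n = 0")
  case False
  then have "nonneg_gen (mode k n)" "verma_char c1 c2 (mode k n) = 0"
    using assms by (cases k; simp add: nonneg_gen_def verma_char_def)+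
  then show ?thesis by (simp add: vproj_character)
next
  case True
  have L: "vproj (word [Lgen (- 1)]) = 0" by (simp add: vproj_def proj_L_minus_one)
  have *: "vproj (word [a] * (word [Lgen (- 1)] * 1)) = 0" for a
    using vproj_mult_zero[OF L, of a] by simp
  have ann: "vproj (word [a]) = 0" if "nonneg_gen a" "verma_char c1 c2 a = 0" for a
    using vproj_character[OF that(1)] that(2) by simp
  have ann': "vproj (word [Lgen (- 1)] * (word [a] * 1)) = 0" if "nonneg_gen a" "verma_char c1 c2 a = 0" for a
    using vproj_mult_zero[OF ann[OF that], of "Lgen (- 1)"] by simp
  have M: "vproj (word [Mgen (- 1)]) = 0"
    using vproj_bracket[of "Mgen 0" "Lgen (- 1)" 1] *[of "Mgen 0"] ann'[of "Mgen 0"]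
    by (simp add: nonneg_gen_def verma_char_def lc_minus)
  have Q: "vproj (word [Qgen (- 1)]) = 0"
    using vproj_bracket[of "Qgen 0" "Lgen (- 1)" 1] *[of "Qgen 0"] ann'[of "Qgen 0"]
    by (simp add: nonneg_gen_def verma_char_def lc_minus half_up_def)
  show ?thesis using True L M Q by (cases k) simp_all
qed

text \<open>A high mode is moved through the word letter by letter: each bracket shifts its index by
  a fixed amount, so the bound only has to grow with the word.\<close>

lemma vproj_smooth: "\<exists>N. \<forall>n\<ge>N. \<forall>k. vproj (word [mode k n] * t) = 0"
proof -
  have word: "\<exists>N. \<forall>n\<ge>N. \<forall>k. vproj (word [mode k n] * word ws) = 0" for ws
  proof (induction ws)
    case Nil
    show ?case by (rule exI[of _ 0]) (simp add: word_Nil vproj_annihilated)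
  next
    case (Cons b ws)
    then obtain N where N: "\<And>n k. n \<ge> N \<Longrightarrow> vproj (word [mode k n] * word ws) = 0" by blast
    have w: "word (b # ws) = word [b] * word ws" by (simp only: word_mult append.simps)
    show ?case
    proof (cases b rule: gen_cases)
      case (mode j m)
      \<comment> \<open>The entry N - m + 1 keeps the shifted indices n + m - 1 and n + m at least
        N; 3 - m forces m + n \<ge> 3, where no central term occurs.\<close>
      have "vproj (word [mode k n] * (word [b] * word ws)) = 0" if n: "n \<ge> max (max N (N - m + 1)) (3 - m)" for n k
      proof -
        have 1: "vproj (word [b] * (word [mode k n] * word ws)) = 0"
          by (rule vproj_mult_zero, rule N) (use n in simp)
        have 2: "vproj (word [mode i (n + m - 1)] * word ws) = 0" "vproj (word [mode i (n + m)] * word ws) = 0" for i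
          by (rule N; use n in simp)+
        show ?thesis
          unfolding vproj_bracket[of "mode k n" b] 1 unfolding mode gen_bracket_mode 2
          using n by simp
      qed
      then show ?thesis unfolding w by blast
    next
      case C1
      show ?thesis
        unfolding w unfolding C1 vproj_bracket[of _ C1gen]
        by (rule exI[of _ N]) (simp add: vproj_C1 N)
    next
      case C2
      show ?thesis
        unfolding w unfolding C2 vproj_bracket[of _ C2gen]
        by (rule exI[of _ N]) (simp add: vproj_C2 N)
    qed
  qed
  have "\<exists>N. \<forall>n\<ge>N. \<forall>k. vproj (word [mode k n] * (\<Sum>ws\<in>A. z ws *\<^sub>C word ws)) = 0" for A z
  proof (induction A rule: infinite_finite_induct)
    case (insert ws A)
    obtain N where N: "\<forall>n\<ge>N. \<forall>k. vproj (word [mode k n] * (\<Sum>ws\<in>A. z ws *\<^sub>C word ws)) = 0"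
      using insert.IH by blast
    obtain M where M: "\<forall>n\<ge>M. \<forall>k. vproj (word [mode k n] * word ws) = 0" using word by blast
    have "\<forall>n\<ge>max N M. \<forall>k. vproj (word [mode k n] * (\<Sum>ws\<in>insert ws A. z ws *\<^sub>C word ws)) = 0"
      unfolding sum.insert[OF insert.hyps] distrib_left lin_scale[OF lin_mult_left] lin_add[OF lin_vproj]
        lin_scale[OF lin_vproj]
      using N M by simp
    then show ?case by blast
  qed (simp_all add: lin_0[OF lin_vproj])
  from this[of "lookup t" "keys t"] show ?thesis by (simp only: lc_def[symmetric] lc_gen)
qed

theorem vacuum_smooth_structure: "vacuum_act c1 c2 \<in> smooth_structures c1 c2 (vacuum c1 c2)"
  unfolding smooth_structures_def
proof (intro CollectI conjI bms_module_vacuum)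
  show "smooth (vacuum c1 c2) (vacuum_act c1 c2)"
    unfolding smooth_def
  proof
    fix v assume "v \<in> carrier (vacuum c1 c2)"
    then obtain t where v: "v = proj c1 c2 t" by (rule vacuum_cases)
    obtain N where N: "\<And>n k. n \<ge> N \<Longrightarrow> vproj (word [mode k n] * t) = 0" using vproj_smooth by blast
    have "vacuum_act c1 c2 (gen (mode k n)) v = \<zero>\<^bsub>vacuum c1 c2\<^esub>" if "n \<ge> N" for k n
      using N[OF that, of k] by (simp add: v vacuum_act_gen vproj_def V.\<iota>_eq_0)
    note z = this[of _ KL] this[of _ KM] this[of _ KQ]
    show "\<exists>N. \<forall>i\<ge>N. vacuum_act c1 c2 (gen (Lgen i)) v = \<zero>\<^bsub>vacuum c1 c2\<^esub> \<and>
        vacuum_act c1 c2 (gen (Mgen i)) v = \<zero>\<^bsub>vacuum c1 c2\<^esub> \<and>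
        vacuum_act c1 c2 (gen (Qgen (i - 1))) v = \<zero>\<^bsub>vacuum c1 c2\<^esub>"
    proof (intro exI[of _ N] allI impI)
      fix i assume "N \<le> i"
      then show "vacuum_act c1 c2 (gen (Lgen i)) v = \<zero>\<^bsub>vacuum c1 c2\<^esub> \<and>
        vacuum_act c1 c2 (gen (Mgen i)) v = \<zero>\<^bsub>vacuum c1 c2\<^esub> \<and>
        vacuum_act c1 c2 (gen (Qgen (i - 1))) v = \<zero>\<^bsub>vacuum c1 c2\<^esub>"
        using z(1)[of "i + 1"] z(2)[of "i + 1"] z(3)[of i] by simp
    qed
  qed
  show "central_charge (vacuum c1 c2) (vacuum_act c1 c2) c1 c2"
    unfolding central_charge_def
  proof
    fix v assume "v \<in> carrier (vacuum c1 c2)"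
    then obtain t where v: "v = proj c1 c2 t" by (rule vacuum_cases)
    show "vacuum_act c1 c2 (gen C1gen) v = c1 \<odot>\<^bsub>vacuum c1 c2\<^esub> v \<and> vacuum_act c1 c2 (gen C2gen) v = c2 \<odot>\<^bsub>vacuum c1 c2\<^esub> v"
      using vproj_C1[of t] vproj_C2[of t]
      by (simp add: v vacuum_act_gen vproj_def V.\<iota>_inj flip: V.\<iota>_smult)
  qed
qed

end

section \<open>Vertex operators on a smooth module\<close>

lemma unital_sum: "lin e \<Longrightarrow> (\<And>i. i \<in> A \<Longrightarrow> unital e (f i)) \<Longrightarrow> unital e (\<Sum>i\<in>A. f i)"
proof (induction A rule: infinite_finite_induct)
  case (insert i A)
  then show ?case unfolding sum.insert[OF insert.hyps] by (intro unital_add) auto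
qed (simp_all add: unital_def lin_0)

context rep
begin

lemma fld_PhiT: "fld (PhiT t)"
  unfolding PhiT_def lc_def by (intro fld_sum fld_scale fld_Phi)

lemma unital_PhiT: "unital e (PhiT t)"
  unfolding PhiT_def lc_def by (intro unital_sum unital_scale unital_Phi lin_e)

end

locale smooth_mod =
  fixes W :: "(complex, 'w) module" and \<rho> :: "bms \<Rightarrow> 'w \<Rightarrow> 'w" and c1 c2 :: complex
  assumes smooth_structure: "\<rho> \<in> smooth_structures c1 c2 W"
begin

sublocale bms_mod W \<rho>
proof (intro bms_mod.intro cvs.intro bms_mod_axioms.intro)
  show "bms_module W \<rho>" using smooth_structure by (simp add: smooth_structures_def)
  then show "cvspace W" unfolding bms_module_def by (elim conjE)
qed

abbreviation R where "R \<equiv> \<lambda>b. lft (\<rho> (gen b))"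

lemma R_\<iota>: "w \<in> carrier W \<Longrightarrow> R b (\<iota> w) = \<iota> (\<rho> (gen b) w)"
  by (rule lft_\<iota>)

sublocale rep unit R c1 c2
proof
  fix w
  have cc: "\<rho> (gen C1gen) (ev0 w) = c1 \<odot>\<^bsub>W\<^esub> ev0 w" "\<rho> (gen C2gen) (ev0 w) = c2 \<odot>\<^bsub>W\<^esub> ev0 w"
    using smooth_structure ev0_closed[of w] by (auto simp: smooth_structures_def central_charge_def)
  show "R C1gen w = c1 *\<^sub>C unit w" "R C2gen w = c2 *\<^sub>C unit w"
    by (simp_all add: lft_def unit_def cc \<iota>_smult ev0_closed)
  show "unit (unit w) = unit w" by (rule unit_unit)
  show "R b (unit w) = R b w" "unit (R b w) = R b w" for b
    by (simp_all add: lft_unit unit_lft \<rho>_cEnd)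
  show "R a (R b w) - koszul (gen_odd a) (gen_odd b) *\<^sub>C R b (R a w) = lc (\<lambda>g. R g w) (gen_bracket a b)" for a b
    using \<rho>_bracket[where a = a and b = b, OF ev0_closed[of w]] by (simp add: lft_def ev_\<iota> \<rho>_closed ev0_closed)
  have "smooth W \<rho>" using smooth_structure by (simp add: smooth_structures_def)
  then obtain N where N: "\<And>i. i \<ge> N \<Longrightarrow> \<rho> (gen (Lgen i)) (ev0 w) = \<zero>\<^bsub>W\<^esub> \<and>
      \<rho> (gen (Mgen i)) (ev0 w) = \<zero>\<^bsub>W\<^esub> \<and> \<rho> (gen (Qgen (i - 1))) (ev0 w) = \<zero>\<^bsub>W\<^esub>"
    using ev0_closed[of w] unfolding smooth_def by blast
  \<comment> \<open>Mode n of L or M is L_{n-1} or M_{n-1}, hence the bound N + 1; for Q the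
    smoothness condition already speaks of \<open>Qgen (i - 1)\<close>, which is mode i.\<close>
  have "R (mode k n) w = 0" if "n \<ge> N + 1" for k n
    using N[of "n - 1"] N[of n] that by (cases k) (simp_all add: lft_def)
  then show "\<exists>N. \<forall>n\<ge>N. \<forall>k. R (mode k n) w = 0" by blast
qed (rule lin_unit, rule lin_lft[OF \<rho>_cEnd])

text \<open>The universal property asks for a left ideal; K is the largest one inside the kernel of
  \<open>PhiT\<close>, and s = 1 leads back to the kernel.\<close>

lemma PhiT_proj_cong:
  assumes "proj c1 c2 s = proj c1 c2 t"
  shows "PhiT s = PhiT t"
proof -
  let ?K = "{t. \<forall>s. PhiT (s * t) = 0}"
  have "s - t \<in> ?K"
  proof (rule proj_universal[OF _ _ _ _ _ assms])
    show "verma_rel c1 c2 \<subseteq> ?K" by (auto simp: PhiT_verma_rel)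
    show "word [Lgen (- 1)] \<in> ?K" by (simp add: PhiT_L_minus_one)
  qed (simp_all add: distrib_left lin_add[OF lin_PhiT] lin_scale[OF lin_mult_left] lin_scale[OF lin_PhiT]
      flip: mult.assoc)
  then have "PhiT (1 * (s - t)) = 0" by blast
  then show ?thesis by (simp add: lin_diff[OF lin_PhiT])
qed

definition Yt :: "vacuum_elt \<Rightarrow> ('w \<Rightarrow>\<^sub>0 complex) field" where
  "Yt v = PhiT (SOME t. proj c1 c2 t = v)"

lemma Yt_proj: "Yt (proj c1 c2 t) = PhiT t"
  unfolding Yt_def by (rule PhiT_proj_cong) (rule someI[of _ t], rule refl)

definition Y :: "vacuum_elt \<Rightarrow> int \<Rightarrow> 'w \<Rightarrow> 'w" where
  "Y = (\<lambda>v\<in>carrier (vacuum c1 c2). \<lambda>n. op_of (Yt v n))"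

lemma unit_PhiT: "unit (PhiT t n w) = PhiT t n w" and PhiT_unit: "PhiT t n (unit w) = PhiT t n w"
  using unital_PhiT[of t] by (simp_all add: unital_def)

lemma Y_proj: "Y (proj c1 c2 t) n = op_of (PhiT t n)"
  by (simp add: Y_def Yt_proj)

lemma \<iota>_Y: "w \<in> carrier W \<Longrightarrow> \<iota> (Y (proj c1 c2 t) n w) = PhiT t n (\<iota> w)"
  unfolding Y_proj by (rule \<iota>_op_of) (rule unit_PhiT)

lemma lft_Y: "lft (Y (proj c1 c2 t) n) = PhiT t n"
  unfolding Y_proj by (rule lft_op_of) (rule unit_PhiT, rule PhiT_unit)

lemma Y_cEnd: "v \<in> carrier (vacuum c1 c2) \<Longrightarrow> Y v n \<in> cEnd W"
  by (elim vacuum_cases) (simp add: Y_proj op_of_cEnd fld_lin fld_PhiT unit_PhiT)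

lemma Y_closed: "v \<in> carrier (vacuum c1 c2) \<Longrightarrow> w \<in> carrier W \<Longrightarrow> Y v n w \<in> carrier W"
  by (rule cEnd_closed[OF Y_cEnd])

definition \<Psi> :: "(vacuum_elt \<Rightarrow>\<^sub>0 complex) \<Rightarrow> ('w \<Rightarrow>\<^sub>0 complex) field" where
  "\<Psi> u = Yt (cvs.ev0 (vacuum c1 c2) u)"

end

text \<open>Through this instance the vertex operators of the algebra are a special case of those on
  smooth modules.\<close>

lemma smooth_mod_vacuum: "smooth_mod (vacuum c1 c2) (vacuum_act c1 c2) c1 c2"
  by (rule smooth_mod.intro) (rule vacuum_smooth_structure)

context
  fixes c1 c2 :: complex
begin

interpretation V: smooth_mod "vacuum c1 c2" "vacuum_act c1 c2" c1 c2
  by (rule smooth_mod_vacuum)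

lemma vproj_\<iota>: "V.\<iota> (proj c1 c2 t) = vproj c1 c2 t"
  by (simp add: vproj_def)

lemma ev0_vproj: "V.ev0 (vproj c1 c2 t) = proj c1 c2 t"
  by (simp add: vproj_def V.ev_\<iota>)

lemma R_vproj: "V.R b (vproj c1 c2 t) = vproj c1 c2 (word [b] * t)"
  by (simp add: vproj_def V.R_\<iota> vacuum_act_gen)

lemma vac_rep_vacuum: "vac_rep V.unit V.R c1 c2 (vproj c1 c2 1)"
proof (intro vac_rep.intro vac_rep_axioms.intro V.rep_axioms)
  show "V.unit (vproj c1 c2 1) = vproj c1 c2 1" by (simp add: vproj_def V.unit_\<iota>)
  show "V.R (mode k n) (vproj c1 c2 1) = 0" if "n \<ge> 0" for k n
    using vproj_annihilated[OF that, of c1 c2 k] by (simp add: R_vproj)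
qed

interpretation V: vac_rep V.unit V.R c1 c2 "vproj c1 c2 1"
  by (rule vac_rep_vacuum)

lemma wv_vproj: "V.wv ws = vproj c1 c2 (word ws)"
proof (induction ws)
  case (Cons b ws)
  have "word (b # ws) = word [b] * word ws" by (simp only: word_mult append.simps)
  then show ?case by (simp only: V.wv.simps Cons R_vproj)
qed (simp add: word_Nil)

lemma lc_wv: "lc V.wv t = vproj c1 c2 t"
  using lin_of_lc[OF lin_vproj, of c1 c2 word t] by (simp add: wv_vproj[abs_def] lc_gen)

lemma vsp_vproj: "hom_word q t \<Longrightarrow> V.vsp q (vproj c1 c2 t)"
proof -
  assume t: "hom_word q t"
  have "V.vsp q (V.wv ws)" if "ws \<in> keys t" for ws
  proof -
    have "q = wodd ws" using t that by (simp add: hom_word_def)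
    then show ?thesis using V.vsp_wv[of ws] by (simp only:)
  qed
  then have "V.vsp q (lc V.wv t)"
    unfolding lc_def by (intro V.vsp_sum V.vsp.scale)
  then show ?thesis unfolding lc_wv .
qed

lemma vspE:
  assumes "V.vsp q v"
  obtains t where "hom_word q t" "v = vproj c1 c2 t"
proof -
  obtain t where t: "hom_word q t" "v = lc V.wv t" using V.vsp_words[OF assms] by blast
  from t(2) have "v = vproj c1 c2 t" unfolding lc_wv .
  with t(1) show ?thesis by (rule that)
qed

end

context smooth_mod
begin

interpretation V: smooth_mod "vacuum c1 c2" "vacuum_act c1 c2" c1 c2
  by (rule smooth_mod_vacuum)

lemma \<Psi>_vproj: "\<Psi> (vproj c1 c2 t) = PhiT t"
  by (simp add: \<Psi>_def ev0_vproj Yt_proj)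

lemma \<Psi>_cases:
  obtains t where "V.ev0 u = proj c1 c2 t" "\<Psi> u = PhiT t"
proof -
  obtain t where t: "V.ev0 u = proj c1 c2 t" by (rule vacuum_cases[OF V.ev0_closed[of u]])
  then have "\<Psi> u = PhiT t" by (simp only: \<Psi>_def Yt_proj)
  with t show ?thesis by (rule that)
qed

lemma state_map_\<Psi>: "state_map V.unit V.R c1 c2 (vproj c1 c2 1) unit R \<Psi>"
proof (intro state_map.intro state_map_axioms.intro vac_rep_vacuum rep_axioms)
  show "lin \<Psi>"
  proof (rule linI)
    fix u v
    obtain s where s: "V.ev0 u = proj c1 c2 s" "\<Psi> u = PhiT s" by (rule \<Psi>_cases)
    obtain t where t: "V.ev0 v = proj c1 c2 t" "\<Psi> v = PhiT t" by (rule \<Psi>_cases)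
    note st = s t
    have "V.ev0 (u + v) = proj c1 c2 (s + t)" by (simp only: V.ev0_add st proj_add)
    then show "\<Psi> (u + v) = \<Psi> u + \<Psi> v"
      by (simp only: st \<Psi>_def[of "u + v"] Yt_proj lin_add[OF lin_PhiT])
  next
    fix a u
    obtain s where st: "V.ev0 u = proj c1 c2 s" "\<Psi> u = PhiT s" by (rule \<Psi>_cases)
    have "V.ev0 (a *\<^sub>C u) = proj c1 c2 (a *\<^sub>C s)" by (simp only: V.ev0_scale st proj_smult)
    then show "\<Psi> (a *\<^sub>C u) = a *\<^sub>C \<Psi> u"
      by (simp only: st \<Psi>_def[of "a *\<^sub>C u"] Yt_proj lin_scale[OF lin_PhiT])
  qed
  show "fld (\<Psi> v)" "unital unit (\<Psi> v)" for v
  proof -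
    obtain t where "\<Psi> v = PhiT t" by (rule \<Psi>_cases[of v])
    then show "fld (\<Psi> v)" "unital unit (\<Psi> v)" by (simp_all only: fld_PhiT unital_PhiT)
  qed
  show "\<Psi> (vproj c1 c2 1) = idf unit"
    using PhiT_word[of "[]"] by (simp only: \<Psi>_vproj word_Nil Phi.simps)
  show "\<Psi> (V.R b v) = act q b (\<Psi> v)" if "vac_rep.vsp V.R (vproj c1 c2 1) q v" for q v b
    using that by (elim vspE) (simp only: R_vproj \<Psi>_vproj PhiT_Cons)
qed

end

context smooth_mod
begin

interpretation V: smooth_mod "vacuum c1 c2" "vacuum_act c1 c2" c1 c2
  by (rule smooth_mod_vacuum)

interpretation S: state_map V.unit V.R c1 c2 "vproj c1 c2 1" unit R \<Psi>
  by (rule state_map_\<Psi>)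

lemma PhiT_borcherds:
  assumes "hom_word p s" "hom_word q t"
  shows "Sum_any (\<lambda>l. bin m l *\<^sub>C \<Psi> (V.PhiT s (r + int l) (vproj c1 c2 t)) (m + n - int l) w) =
    cross (koszul p q) (PhiT s) (PhiT t) r m n w"
proof -
  \<comment> \<open>The vacuum module as its own target: its state-field map is the \<Theta>
    required by \<open>S.\<Psi>_borcherds\<close>.\<close>
  interpret SV: state_map V.unit V.R c1 c2 "vproj c1 c2 1" V.unit V.R V.\<Psi>
    by (rule V.state_map_\<Psi>)
  have "V.\<Psi> (S.V.wv us) = V.Phi us" for us
    by (simp only: wv_vproj V.\<Psi>_vproj V.PhiT_word)
  from S.\<Psi>_borcherds[OF SV.lin_\<Psi> SV.fld_\<Psi> this vsp_vproj[OF assms(1)] vsp_vproj[OF assms(2)]]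
  show ?thesis by (simp only: \<Psi>_vproj V.\<Psi>_vproj)
qed

lemma V_Y_proj: "V.Y (proj c1 c2 s) n (proj c1 c2 t) = V.ev0 (V.PhiT s n (vproj c1 c2 t))"
  using V.\<iota>_Y[of "proj c1 c2 t" s n] V.ev_\<iota>[OF V.Y_closed[of "proj c1 c2 s" "proj c1 c2 t" n]]
  by (simp add: vproj_\<iota>)

lemma lft_Y_carrier: "v \<in> carrier (vacuum c1 c2) \<Longrightarrow> lft (Y v n) = Yt v n"
  by (elim vacuum_cases) (simp add: lft_Y Yt_proj)

theorem Y_borcherds:
  assumes "hom_word p s" "hom_word q t"
  shows "Sum_any (\<lambda>l. bin m l *\<^sub>C
      lft (Y (V.Y (proj c1 c2 s) (r + int l) (proj c1 c2 t)) (m + n - int l)) w) =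
    cross (koszul p q) (\<lambda>n. lft (Y (proj c1 c2 s) n)) (\<lambda>n. lft (Y (proj c1 c2 t) n)) r m n w"
proof -
  have "lft (Y (V.Y (proj c1 c2 s) j (proj c1 c2 t)) i) = \<Psi> (V.PhiT s j (vproj c1 c2 t)) i" for i j
    unfolding V_Y_proj \<Psi>_def by (rule lft_Y_carrier) (rule V.ev0_closed)
  then show ?thesis using PhiT_borcherds[OF assms] by (simp only: lft_Y)
qed

lemma Y_vac: "w \<in> carrier W \<Longrightarrow> Y (vacuum_one c1 c2) n w = (if n = - 1 then w else \<zero>\<^bsub>W\<^esub>)"
proof -
  assume w: "w \<in> carrier W"
  have "PhiT 1 = idf unit" using PhiT_word[of "[]"] by (simp only: word_Nil Phi.simps)
  then have "\<iota> (Y (proj c1 c2 1) n w) = \<iota> (if n = - 1 then w else \<zero>\<^bsub>W\<^esub>)"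
    using w by (simp add: \<iota>_Y idf_def unit_\<iota>)
  then show ?thesis using w by (subst (asm) \<iota>_inj) (auto simp: Y_closed vacuum_one_proj)
qed

text \<open>Both forms of the translation axiom come from \<open>translation_Phi\<close>: the action
  of L_{-1} on a field is \<open>der\<close>, and, being the zeroth product with L(z), it is also a
  commutator.\<close>

lemma der_PhiT: "PhiT (word [Lgen (- 1)] * t) = der (PhiT t)"
  and translation_PhiT: "der (PhiT t) n w = R (Lgen (- 1)) (PhiT t n w) - PhiT t n (R (Lgen (- 1)) w)"
proof -
  have w: "PhiT (word [Lgen (- 1)] * word ws) = der (Phi ws)" for ws
    by (simp only: PhiT_Cons[OF hom_word_word] PhiT_word translation_Phi)
  have "PhiT (word [Lgen (- 1)] * lc word t) = der (PhiT (lc word t))"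
    by (simp only: lin_of_lc[OF lin_mult_left] lin_of_lc[OF lin_PhiT] lin_of_lc[OF lin_der] w PhiT_word)
  then show "PhiT (word [Lgen (- 1)] * t) = der (PhiT t)" by (simp only: lc_gen)
  have X: "X KL 0 = R (Lgen (- 1))" by (simp add: X_def)
  have "der (Phi ws) n w = X KL 0 (Phi ws n w) - Phi ws n (X KL 0 w)" for ws
    using act_translation[of "wodd ws" "Phi ws" n w] by (simp only: translation_Phi)
  then have "lc (\<lambda>ws. der (Phi ws)) t n w = lc (\<lambda>ws. X KL 0 (Phi ws n w) - Phi ws n (X KL 0 w)) t"
    unfolding lc_apply by (simp only:)
  also have "\<dots> = X KL 0 (PhiT t n w) - PhiT t n (X KL 0 w)"
    unfolding lc_diff_fun PhiT_def lc_apply lin_of_lc[OF fld_lin[OF fld_X]] ..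
  also have "lc (\<lambda>ws. der (Phi ws)) t = der (PhiT t)"
    unfolding PhiT_def by (rule lin_of_lc[OF lin_der, symmetric])
  finally show "der (PhiT t) n w = R (Lgen (- 1)) (PhiT t n w) - PhiT t n (R (Lgen (- 1)) w)"
    by (simp only: X)
qed

lemma Y_generator:
  assumes "w \<in> carrier W"
  shows "Y (proj c1 c2 (word [mode k (- 1)])) n w = \<rho> (gen (mode k n)) w"
proof -
  have "Phi [mode k (- 1)] = X k"
    by (simp add: act_mode koszul_simps nprod_idf_minus_one fld_X unital_X)
  then have "\<iota> (Y (proj c1 c2 (word [mode k (- 1)])) n w) = \<iota> (\<rho> (gen (mode k n)) w)"
    using assms by (simp only: \<iota>_Y PhiT_word X_def R_\<iota>)
  then show ?thesis using assms by (subst (asm) \<iota>_inj) (auto simp: Y_closed \<rho>_closed)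
qed

lemma Y_truncated: "w \<in> carrier W \<Longrightarrow> \<exists>N. \<forall>n\<ge>N. Y (proj c1 c2 t) n w = \<zero>\<^bsub>W\<^esub>"
proof -
  assume w: "w \<in> carrier W"
  obtain N where N: "\<forall>n\<ge>N. PhiT t n (\<iota> w) = 0" using fld_trunc[OF fld_PhiT] by blast
  have "Y (proj c1 c2 t) n w = \<zero>\<^bsub>W\<^esub>" if "n \<ge> N" for n
    using \<iota>_Y[OF w, of t n] N that w by (simp add: \<iota>_eq_0 Y_closed)
  then show ?thesis by blast
qed

lemma linear_fields_Y: "linear_fields (vacuum c1 c2) W Y"
proof -
  have "Y (u \<oplus>\<^bsub>vacuum c1 c2\<^esub> v) n w = Y u n w \<oplus>\<^bsub>W\<^esub> Y v n w"
    if uv: "u \<in> carrier (vacuum c1 c2)" "v \<in> carrier (vacuum c1 c2)" and w: "w \<in> carrier W" for u v n w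
  proof -
    obtain s t where st: "u = proj c1 c2 s" "v = proj c1 c2 t" using uv by (elim vacuum_cases)
    have "\<iota> (Y (proj c1 c2 (s + t)) n w) = \<iota> (Y u n w \<oplus>\<^bsub>W\<^esub> Y v n w)"
      using uv w by (simp add: \<iota>_Y \<iota>_add Y_closed st lin_add[OF lin_PhiT])
    then show ?thesis using uv w by (subst (asm) \<iota>_inj) (auto simp: Y_closed st proj_add)
  qed
  moreover have "Y (a \<odot>\<^bsub>vacuum c1 c2\<^esub> v) n w = a \<odot>\<^bsub>W\<^esub> Y v n w"
    if v: "v \<in> carrier (vacuum c1 c2)" and w: "w \<in> carrier W" for a v n w
  proof -
    obtain t where t: "v = proj c1 c2 t" using v by (elim vacuum_cases)
    have "\<iota> (Y (proj c1 c2 (a *\<^sub>C t)) n w) = \<iota> (a \<odot>\<^bsub>W\<^esub> Y v n w)"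
      using v w by (simp add: \<iota>_Y \<iota>_smult Y_closed t lin_scale[OF lin_PhiT])
    then show ?thesis using v w by (subst (asm) \<iota>_inj) (auto simp: Y_closed t proj_smult)
  qed
  moreover have "Y \<in> carrier (vacuum c1 c2) \<rightarrow>\<^sub>E (UNIV \<rightarrow> cEnd W)"
    using Y_cEnd by (auto simp: Y_def)
  ultimately show ?thesis unfolding linear_fields_def by blast
qed

lemma Y_derivative: "derivative_property (vacuum c1 c2) (vacuum_act c1 c2 (gen (Lgen (- 1)))) W (\<rho> (gen (Lgen (- 1)))) Y"
proof -
  have "Y (vacuum_act c1 c2 (gen (Lgen (- 1))) v) n w = (- of_int n) \<odot>\<^bsub>W\<^esub> Y v (n - 1) w \<and>
      Y (vacuum_act c1 c2 (gen (Lgen (- 1))) v) n w =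
        \<rho> (gen (Lgen (- 1))) (Y v n w) \<ominus>\<^bsub>W\<^esub> Y v n (\<rho> (gen (Lgen (- 1))) w)"
    if v: "v \<in> carrier (vacuum c1 c2)" and w: "w \<in> carrier W" for v n w
  proof -
    let ?d = "\<rho> (gen (Lgen (- 1)))"
    obtain t where t: "v = proj c1 c2 t" using v by (elim vacuum_cases)
    have D: "vacuum_act c1 c2 (gen (Lgen (- 1))) v = proj c1 c2 (word [Lgen (- 1)] * t)"
      by (simp only: t vacuum_act_gen)
    have "\<iota> (Y (proj c1 c2 (word [Lgen (- 1)] * t)) n w) = \<iota> ((- of_int n) \<odot>\<^bsub>W\<^esub> Y v (n - 1) w)"
      using v w by (simp only: \<iota>_Y der_PhiT \<iota>_smult Y_closed t der_def)
    moreover have "\<iota> (Y (proj c1 c2 (word [Lgen (- 1)] * t)) n w) = \<iota> (?d (Y v n w) \<ominus>\<^bsub>W\<^esub> Y v n (?d w))"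
      using v w by (simp only: \<iota>_Y der_PhiT translation_PhiT \<iota>_diff Y_closed \<rho>_closed t R_\<iota>[symmetric])
    ultimately show ?thesis
      unfolding D using v w by (subst (asm) (1 2) \<iota>_inj) (auto simp: Y_closed \<rho>_closed)
  qed
  then show ?thesis unfolding derivative_property_def by blast
qed

lemma generating_Y: "generating_fields c1 c2 W \<rho> Y"
  unfolding generating_fields_def vacuum_L_def vacuum_M_def vacuum_Q_def
  using Y_generator[of _ KL] Y_generator[of _ KM] Y_generator[of _ KQ]
  by (simp add: vacuum_one_proj vacuum_act_gen)

end

context
  fixes c1 c2 :: complex
begin

interpretation V: smooth_mod "vacuum c1 c2" "vacuum_act c1 c2" c1 c2
  by (rule smooth_mod_vacuum)

interpretation V: vac_rep V.unit V.R c1 c2 "vproj c1 c2 1"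
  by (rule vac_rep_vacuum)

lemma vacuum_Y_parity:
  assumes "hom_word p s" "hom_word q t"
  shows "\<exists>t'. hom_word (p \<noteq> q) t' \<and> V.Y (proj c1 c2 s) n (proj c1 c2 t) = proj c1 c2 t'"
proof -
  have "V.vsp (p \<noteq> q) (V.PhiT s n (vproj c1 c2 t))"
    unfolding V.PhiT_def lc_apply unfolding lc_def
  proof (intro V.vsp_sum V.vsp.scale)
    fix ws assume "ws \<in> keys s"
    then have "p = wodd ws" using assms(1) by (simp add: hom_word_def)
    then show "V.vsp (p \<noteq> q) (V.Phi ws n (vproj c1 c2 t))"
      using V.vsp_Phi[OF vsp_vproj[OF assms(2)]] by (simp only:)
  qed
  then obtain t' where t': "hom_word (p \<noteq> q) t'" "V.PhiT s n (vproj c1 c2 t) = vproj c1 c2 t'"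
    by (rule vspE)
  then show ?thesis by (intro exI[of _ t']) (simp add: V.V_Y_proj ev0_vproj)
qed

lemma vacuum_Y_creation:
  "n \<ge> 0 \<Longrightarrow> V.Y (proj c1 c2 t) n (vacuum_one c1 c2) = \<zero>\<^bsub>vacuum c1 c2\<^esub>"
  "V.Y (proj c1 c2 t) (- 1) (vacuum_one c1 c2) = proj c1 c2 t"
proof -
  have "V.PhiT t n (vproj c1 c2 1) = (if n = - 1 then vproj c1 c2 t else 0)" if "n \<ge> - 1" for n
  proof -
    have "V.PhiT t n (vproj c1 c2 1) = lc (\<lambda>ws. if n = - 1 then V.wv ws else 0) t"
      unfolding V.PhiT_def lc_apply by (simp only: V.creation[OF that])
    then show ?thesis using lc_wv[of c1 c2 t] by (simp add: lc_def)
  qed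
  then show "n \<ge> 0 \<Longrightarrow> V.Y (proj c1 c2 t) n (vacuum_one c1 c2) = \<zero>\<^bsub>vacuum c1 c2\<^esub>"
    "V.Y (proj c1 c2 t) (- 1) (vacuum_one c1 c2) = proj c1 c2 t"
    by (simp_all add: vacuum_one_proj V.V_Y_proj ev0_vproj)
qed

end

section \<open>The grading of the vacuum module\<close>

text \<open>Twice the L_0-weight, matching the integer index of the half-integer grading;
  \<open>Qgen k\<close> is Q_{k+1/2}, of weight -(k + 1/2).\<close>

fun gwt :: "bms_gen \<Rightarrow> int" where
  "gwt (Lgen n) = - (2 * n)"
| "gwt (Mgen n) = - (2 * n)"
| "gwt (Qgen k) = - (2 * k + 1)"
| "gwt C1gen = 0"
| "gwt C2gen = 0"

primrec weight :: "bms_gen list \<Rightarrow> int" where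
  "weight [] = 0"
| "weight (b # ws) = gwt b + weight ws"

lemma odd_gwt: "odd (gwt b) = gen_odd b"
  by (cases b) (auto simp: gen_odd_def)

lemma odd_weight: "odd (weight ws) = wodd ws"
  by (induction ws) (auto simp flip: odd_gwt)

lemma gen_bracket_L0: "lc G (gen_bracket (Lgen 0) b) = (of_int (gwt b) / 2) *\<^sub>C G b"
  by (cases b) (auto simp: lc_add lc_minus half_up_def field_simps simp flip: cv.scale_minus_left)

text \<open>Applying A - \<mu> j0 removes f j0 and rescales the other terms by nonzero factors,
  which leaves a shorter relation.\<close>

lemma eigenvectors_independent:
  assumes "lin A" "finite J" "\<And>j. j \<in> J \<Longrightarrow> A (f j) = \<mu> j *\<^sub>C f j" "inj_on \<mu> J" "(\<Sum>j\<in>J. f j) = 0"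
  shows "\<forall>j\<in>J. f j = 0"
  using assms(2-)
proof (induction J arbitrary: f rule: finite_induct)
  case (insert j0 J)
  have s0: "f j0 + (\<Sum>j\<in>J. f j) = 0" using insert.prems(3) insert.hyps by simp
  have "A (\<Sum>j\<in>insert j0 J. f j) = 0" unfolding insert.prems(3) by (rule lin_0[OF assms(1)])
  then have "\<mu> j0 *\<^sub>C f j0 + (\<Sum>j\<in>J. \<mu> j *\<^sub>C f j) = 0"
    using insert.hyps by (simp add: lin_add[OF assms(1)] lin_sum[OF assms(1)] insert.prems(1))
  moreover have "\<mu> j0 *\<^sub>C (f j0 + (\<Sum>j\<in>J. f j)) = 0" unfolding s0 by simp
  ultimately have "(\<Sum>j\<in>J. \<mu> j *\<^sub>C f j) = (\<Sum>j\<in>J. \<mu> j0 *\<^sub>C f j)"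
    unfolding scaleC_add_right cv.scale_sum_right by (metis add_left_imp_eq)
  then have "(\<Sum>j\<in>J. (\<mu> j - \<mu> j0) *\<^sub>C f j) = 0"
    by (simp add: cv.scale_left_diff_distrib sum_subtractf)
  moreover have "A ((\<mu> j - \<mu> j0) *\<^sub>C f j) = \<mu> j *\<^sub>C (\<mu> j - \<mu> j0) *\<^sub>C f j" if "j \<in> J" for j
    using insert.prems(1)[of j] that by (simp add: lin_scale[OF assms(1)] cv.scale_left_commute)
  moreover have "inj_on \<mu> J" using insert.prems(2) by simp
  ultimately have z: "\<forall>j\<in>J. (\<mu> j - \<mu> j0) *\<^sub>C f j = 0"
    by (intro insert.IH[of "\<lambda>j. (\<mu> j - \<mu> j0) *\<^sub>C f j"])
  have "\<forall>j\<in>J. f j = 0"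
  proof
    fix j assume j: "j \<in> J"
    then have "\<mu> j \<noteq> \<mu> j0" using insert.prems(2) insert.hyps by (auto simp: inj_on_def)
    moreover have "(\<mu> j - \<mu> j0) *\<^sub>C f j = 0" using z j by blast
    ultimately show "f j = 0" by simp
  qed
  then show ?case using s0 by simp
qed simp

definition wcomp :: "int \<Rightarrow> tensor_alg \<Rightarrow> tensor_alg" where
  "wcomp k t = lc (\<lambda>ws. if weight ws = k then word ws else 0) t"

lemma hom_word_wcomp: "hom_word (odd k) (wcomp k t)"
  unfolding wcomp_def
  by (rule hom_word_lc) (auto simp: hom_word_zero hom_word_def odd_weight[symmetric])

lemma wcomp_zero: "k \<notin> weight ` keys t \<Longrightarrow> wcomp k t = 0"
  unfolding wcomp_def lc_def by (rule sum.neutral) auto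

lemma wcomp_zero_parity: "hom_word p t \<Longrightarrow> odd k \<noteq> p \<Longrightarrow> wcomp k t = 0"
  by (rule wcomp_zero) (auto simp: hom_word_def odd_weight[symmetric])

lemma sum_wcomp: "(\<Sum>k\<in>weight ` keys t. wcomp k t) = t"
proof -
  have "(\<Sum>k\<in>weight ` keys t. wcomp k t) =
      (\<Sum>ws\<in>keys t. \<Sum>k\<in>weight ` keys t. lookup t ws *\<^sub>C (if weight ws = k then word ws else 0))"
    unfolding wcomp_def lc_def by (rule sum.swap)
  also have "\<dots> = lc word t"
    unfolding lc_def
  proof (rule sum.cong)
    fix ws assume "ws \<in> keys t"
    then show "(\<Sum>k\<in>weight ` keys t. lookup t ws *\<^sub>C (if weight ws = k then word ws else 0)) = lookup t ws *\<^sub>C word ws"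
      by (subst sum.remove[of _ "weight ws"]) auto
  qed simp
  finally show ?thesis by (simp only: lc_gen)
qed

context
  fixes c1 c2 :: complex
begin

interpretation V: smooth_mod "vacuum c1 c2" "vacuum_act c1 c2" c1 c2
  by (rule smooth_mod_vacuum)

lemma vproj_L0_word: "vproj c1 c2 (word [Lgen 0] * word ws) = (of_int (weight ws) / 2) *\<^sub>C vproj c1 c2 (word ws)"
proof (induction ws)
  case Nil
  show ?case using vproj_annihilated[of 1 c1 c2 KL] by (simp add: word_Nil)
next
  case (Cons b ws)
  let ?z = "of_int (weight ws) / 2 :: complex"
  have "vproj c1 c2 (word [Lgen 0] * word ws - ?z *\<^sub>C word ws) = 0"
    by (simp only: lin_diff[OF lin_vproj] lin_scale[OF lin_vproj] Cons) simp
  then have "vproj c1 c2 (word [b] * (word [Lgen 0] * word ws - ?z *\<^sub>C word ws)) = 0"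
    by (rule vproj_mult_zero)
  then have 1: "vproj c1 c2 (word [b] * (word [Lgen 0] * word ws)) = ?z *\<^sub>C vproj c1 c2 (word [b] * word ws)"
    by (simp only: lin_diff[OF lin_mult_left] lin_scale[OF lin_mult_left] lin_diff[OF lin_vproj] lin_scale[OF lin_vproj]) simp
  have "koszul (gen_odd (Lgen 0)) (gen_odd b) = 1" by (simp add: gen_odd_def koszul_simps)
  then have "vproj c1 c2 (word [Lgen 0] * (word [b] * word ws)) =
      (?z + of_int (gwt b) / 2) *\<^sub>C vproj c1 c2 (word [b] * word ws)"
    unfolding vproj_bracket[of c1 c2 "Lgen 0" b] 1 gen_bracket_L0 scaleC_add_left by (simp add: scaleC_one)
  moreover have "word (b # ws) = word [b] * word ws" by (simp only: word_mult append.simps)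
  moreover have "?z + of_int (gwt b) / 2 = of_int (weight (b # ws)) / 2" by (simp add: field_simps)
  ultimately show ?case by (simp only:)
qed

lemma vproj_L0_wcomp: "vproj c1 c2 (word [Lgen 0] * wcomp k t) = (of_int k / 2) *\<^sub>C vproj c1 c2 (wcomp k t)"
proof -
  have "vproj c1 c2 (word [Lgen 0] * (if weight ws = k then word ws else 0)) =
      (of_int k / 2) *\<^sub>C vproj c1 c2 (if weight ws = k then word ws else 0)" for ws
    using vproj_L0_word[of ws] by (auto simp: lin_0[OF lin_vproj])
  then show ?thesis
    unfolding wcomp_def lin_of_lc[OF lin_mult_left] lin_of_lc[OF lin_vproj] lc_scale_fun[symmetric] by simp
qed

lemma grading_iff: "v \<in> vacuum_grading c1 c2 k \<longleftrightarrow> v \<in> carrier (vacuum c1 c2) \<and>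
    V.R (Lgen 0) (V.\<iota> v) = (of_int k / 2) *\<^sub>C V.\<iota> v"
proof (cases "v \<in> carrier (vacuum c1 c2)")
  case True
  then show ?thesis
    unfolding vacuum_grading_def
    by (simp add: V.R_\<iota> V.\<iota>_inj V.\<rho>_closed flip: V.\<iota>_smult)
qed (simp add: vacuum_grading_def)

lemma wcomp_in_grading: "proj c1 c2 (wcomp k t) \<in> vacuum_grading c1 c2 k"
  by (simp add: grading_iff vproj_\<iota> R_vproj vproj_L0_wcomp)

lemma grading_csubspace: "csubspace (vacuum c1 c2) (vacuum_grading c1 c2 k)"
proof (rule V.csubspaceI)
  show "vacuum_grading c1 c2 k \<subseteq> carrier (vacuum c1 c2)" by (auto simp: vacuum_grading_def)
qed (simp_all add: grading_iff V.\<iota>_add V.\<iota>_smult lin_simps[OF V.lin_R] scaleC_simps mult.commute)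

lemma wcomp_decomposition:
  "finite {k. proj c1 c2 (wcomp k t) \<noteq> \<zero>\<^bsub>vacuum c1 c2\<^esub>}"
  "proj c1 c2 t = fsum (vacuum c1 c2) (\<lambda>k. proj c1 c2 (wcomp k t))"
proof -
  have z: "proj c1 c2 (wcomp k t) = \<zero>\<^bsub>vacuum c1 c2\<^esub>" if "k \<notin> weight ` keys t" for k
    by (simp only: wcomp_zero[OF that] proj_0)
  have "{k. proj c1 c2 (wcomp k t) \<noteq> \<zero>\<^bsub>vacuum c1 c2\<^esub>} \<subseteq> weight ` keys t"
  proof
    fix k assume "k \<in> {k. proj c1 c2 (wcomp k t) \<noteq> \<zero>\<^bsub>vacuum c1 c2\<^esub>}"
    then have "proj c1 c2 (wcomp k t) \<noteq> \<zero>\<^bsub>vacuum c1 c2\<^esub>" by (rule CollectD)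
    then show "k \<in> weight ` keys t" by (rule contrapos_np) (rule z)
  qed
  then show "finite {k. proj c1 c2 (wcomp k t) \<noteq> \<zero>\<^bsub>vacuum c1 c2\<^esub>}"
    by (rule finite_subset) simp
  have "V.\<iota> (fsum (vacuum c1 c2) (\<lambda>k. proj c1 c2 (wcomp k t))) = Sum_any (\<lambda>k. vproj c1 c2 (wcomp k t))"
    by (subst V.\<iota>_fsum) (simp_all add: vproj_\<iota>)
  also have "\<dots> = (\<Sum>k\<in>weight ` keys t. vproj c1 c2 (wcomp k t))"
  proof (rule Sum_any.expand_superset)
    show "{k. vproj c1 c2 (wcomp k t) \<noteq> 0} \<subseteq> weight ` keys t"
    proof
      fix k assume "k \<in> {k. vproj c1 c2 (wcomp k t) \<noteq> 0}"
      then have "vproj c1 c2 (wcomp k t) \<noteq> 0" by (rule CollectD)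
      then show "k \<in> weight ` keys t"
        by (rule contrapos_np) (simp only: wcomp_zero lin_0[OF lin_vproj] not_False_eq_True)
    qed
  qed simp
  also have "\<dots> = V.\<iota> (proj c1 c2 t)"
    by (simp only: lin_sum[OF lin_vproj, symmetric] sum_wcomp vproj_\<iota>)
  finally show "proj c1 c2 t = fsum (vacuum c1 c2) (\<lambda>k. proj c1 c2 (wcomp k t))"
    by (subst (asm) V.\<iota>_inj) (simp_all add: V.fsum_closed)
qed

lemma grading_unique:
  assumes f: "\<And>k. f k \<in> vacuum_grading c1 c2 k" "finite {k. f k \<noteq> \<zero>\<^bsub>vacuum c1 c2\<^esub>}"
    and g: "\<And>k. g k \<in> vacuum_grading c1 c2 k" "finite {k. g k \<noteq> \<zero>\<^bsub>vacuum c1 c2\<^esub>}"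
    and eq: "fsum (vacuum c1 c2) f = fsum (vacuum c1 c2) g"
  shows "f = g"
proof
  fix k
  have fc: "f k \<in> carrier (vacuum c1 c2)" and gc: "g k \<in> carrier (vacuum c1 c2)" for k
    using f(1) g(1) by (simp_all add: grading_iff)
  let ?J = "{k. f k \<noteq> \<zero>\<^bsub>vacuum c1 c2\<^esub>} \<union> {k. g k \<noteq> \<zero>\<^bsub>vacuum c1 c2\<^esub>}"
  have "V.\<iota> (fsum (vacuum c1 c2) f) = (\<Sum>k\<in>?J. V.\<iota> (f k))"
    unfolding V.\<iota>_fsum[of f, OF fc]
    by (rule Sum_any.expand_superset) (use f(2) g(2) fc in \<open>auto simp: V.\<iota>_eq_0\<close>)
  moreover have "V.\<iota> (fsum (vacuum c1 c2) g) = (\<Sum>k\<in>?J. V.\<iota> (g k))"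
    unfolding V.\<iota>_fsum[of g, OF gc]
    by (rule Sum_any.expand_superset) (use f(2) g(2) gc in \<open>auto simp: V.\<iota>_eq_0\<close>)
  ultimately have "(\<Sum>k\<in>?J. V.\<iota> (f k) - V.\<iota> (g k)) = 0"
    using eq by (simp add: sum_subtractf)
  moreover have "V.R (Lgen 0) (V.\<iota> (f k) - V.\<iota> (g k)) = (of_int k / 2) *\<^sub>C (V.\<iota> (f k) - V.\<iota> (g k))" for k
    using f(1)[of k] g(1)[of k] unfolding grading_iff lin_diff[OF V.lin_R] cv.scale_right_diff_distrib by (elim conjE) (simp only:)
  moreover have "inj_on (\<lambda>k. of_int k / 2 :: complex) ?J" by (rule inj_onI) simp
  moreover have "finite ?J" using f(2) g(2) by (rule finite_UnI)
  ultimately have *: "\<forall>k\<in>?J. V.\<iota> (f k) - V.\<iota> (g k) = 0"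
    by (intro eigenvectors_independent[OF V.lin_R[of "Lgen 0"], where \<mu> = "\<lambda>k. of_int k / 2"])
  show "f k = g k"
  proof (cases "k \<in> ?J")
    case True
    with * have "V.\<iota> (f k) - V.\<iota> (g k) = 0" by (rule bspec)
    then show ?thesis using V.\<iota>_inj[OF fc[of k] gc[of k]] by (simp only: right_minus_eq)
  next
    case False
    then have "f k = \<zero>\<^bsub>vacuum c1 c2\<^esub>" "g k = \<zero>\<^bsub>vacuum c1 c2\<^esub>" by blast+
    then show ?thesis by (simp only:)
  qed
qed

lemma direct_sum_grading: "direct_sum (vacuum c1 c2) (vacuum_grading c1 c2)"
  unfolding direct_sum_def
proof (intro conjI allI ballI grading_csubspace ex_ex1I)
  fix v assume "v \<in> carrier (vacuum c1 c2)"
  then obtain t where t: "v = proj c1 c2 t" by (rule vacuum_cases)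
  show "\<exists>f. (\<forall>i. f i \<in> vacuum_grading c1 c2 i) \<and> finite {i. f i \<noteq> \<zero>\<^bsub>vacuum c1 c2\<^esub>} \<and> v = fsum (vacuum c1 c2) f"
    unfolding t
    by (intro exI[of _ "\<lambda>k. proj c1 c2 (wcomp k t)"] conjI allI wcomp_in_grading wcomp_decomposition)
next
  fix v f g
  assume "(\<forall>i. f i \<in> vacuum_grading c1 c2 i) \<and> finite {i. f i \<noteq> \<zero>\<^bsub>vacuum c1 c2\<^esub>} \<and> v = fsum (vacuum c1 c2) f"
    "(\<forall>i. g i \<in> vacuum_grading c1 c2 i) \<and> finite {i. g i \<noteq> \<zero>\<^bsub>vacuum c1 c2\<^esub>} \<and> v = fsum (vacuum c1 c2) g"
  then show "f = g" by (intro grading_unique) auto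
qed

text \<open>Two decompositions of v are compared: v alone in degree k, and the weight components of
  any representative. Uniqueness identifies them, so a homogeneous vector has a homogeneous
  representative.\<close>

lemma grading_wcomp:
  assumes "v \<in> vacuum_grading c1 c2 k"
  shows "\<exists>t. v = proj c1 c2 (wcomp k t)"
proof -
  have v: "v \<in> carrier (vacuum c1 c2)" using assms by (simp add: grading_iff)
  then obtain t where t: "v = proj c1 c2 t" by (rule vacuum_cases)
  let ?f = "\<lambda>j. if j = k then v else \<zero>\<^bsub>vacuum c1 c2\<^esub>"
  have "?f = (\<lambda>j. proj c1 c2 (wcomp j t))"
  proof (rule grading_unique)
    show "?f j \<in> vacuum_grading c1 c2 j" for j
      using assms V.csubspace_zero[OF grading_csubspace] by simp
    show "finite {j. ?f j \<noteq> \<zero>\<^bsub>vacuum c1 c2\<^esub>}" by (rule finite_subset[of _ "{k}"]) auto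
    have "V.\<iota> (fsum (vacuum c1 c2) ?f) = Sum_any (\<lambda>j. V.\<iota> (?f j))"
      by (rule V.\<iota>_fsum) (use v in auto)
    also have "\<dots> = Sum_any (\<lambda>j. if j = k then V.\<iota> v else 0)"
      by (rule Sum_any.cong) auto
    finally have "V.\<iota> (fsum (vacuum c1 c2) ?f) = V.\<iota> v" by (simp add: Sum_any.delta)
    then have "fsum (vacuum c1 c2) ?f = v"
      using v by (subst (asm) V.\<iota>_inj) (auto intro!: V.fsum_closed)
    then show "fsum (vacuum c1 c2) ?f = fsum (vacuum c1 c2) (\<lambda>j. proj c1 c2 (wcomp j t))"
      using wcomp_decomposition(2)[of t] t by simp
  qed (rule wcomp_in_grading wcomp_decomposition)+
  then have "?f k = proj c1 c2 (wcomp k t)" by (rule fun_cong)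
  then show ?thesis by auto
qed

text \<open>The bridge from the L_0-grading to words: by \<open>odd_weight\<close>, the weight of a
  word is half-integral exactly when it has an odd number of letters Q. Parity arguments can then be
  carried out on tensors.\<close>

lemma parity_part_vacuum:
  "parity_part (vacuum c1 c2) (vacuum_grading c1 c2) p = {proj c1 c2 t | t. hom_word p t}"
proof (intro equalityI subsetI)
  fix v assume "v \<in> parity_part (vacuum c1 c2) (vacuum_grading c1 c2) p"
  then obtain f where f: "\<And>k. f k \<in> vacuum_grading c1 c2 k"
      "\<And>k. f k \<noteq> \<zero>\<^bsub>vacuum c1 c2\<^esub> \<Longrightarrow> odd k = p" "finite {k. f k \<noteq> \<zero>\<^bsub>vacuum c1 c2\<^esub>}"
      and v: "v = fsum (vacuum c1 c2) f"
    unfolding parity_part_def by blast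
  have fc: "f k \<in> carrier (vacuum c1 c2)" for k using f(1) by (simp add: grading_iff)
  have "\<forall>k. \<exists>t. hom_word p t \<and> f k = proj c1 c2 t"
  proof
    fix k
    show "\<exists>t. hom_word p t \<and> f k = proj c1 c2 t"
    proof (cases "f k = \<zero>\<^bsub>vacuum c1 c2\<^esub>")
      case True
      then show ?thesis by (intro exI[of _ 0]) (simp add: hom_word_zero proj_0)
    next
      case False
      then show ?thesis using f(2)[OF False] grading_wcomp[OF f(1)[of k]] hom_word_wcomp[of k] by auto
    qed
  qed
  then obtain t where t: "\<And>k. hom_word p (t k)" "\<And>k. f k = proj c1 c2 (t k)" by metis
  let ?J = "{k. f k \<noteq> \<zero>\<^bsub>vacuum c1 c2\<^esub>}"
  have "V.\<iota> v = (\<Sum>k\<in>?J. V.\<iota> (f k))"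
    unfolding v V.\<iota>_fsum[of f, OF fc]
    by (rule Sum_any.expand_superset) (use f(3) fc in \<open>auto simp: V.\<iota>_eq_0\<close>)
  also have "\<dots> = V.\<iota> (proj c1 c2 (\<Sum>k\<in>?J. t k))"
    by (simp add: t(2) vproj_\<iota> lin_sum[OF lin_vproj])
  finally have "v = proj c1 c2 (\<Sum>k\<in>?J. t k)"
    using V.fsum_closed[of f, OF fc] by (subst (asm) V.\<iota>_inj) (auto simp: v)
  moreover have "hom_word p (\<Sum>k\<in>?J. t k)" by (rule hom_word_sum) (rule t(1))
  ultimately show "v \<in> {proj c1 c2 t | t. hom_word p t}" by blast
next
  fix v assume "v \<in> {proj c1 c2 t | t. hom_word p t}"
  then obtain t where t: "v = proj c1 c2 t" "hom_word p t" by blast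
  have "odd k = p" if "proj c1 c2 (wcomp k t) \<noteq> \<zero>\<^bsub>vacuum c1 c2\<^esub>" for k
    using that wcomp_zero_parity[OF t(2), of k] proj_0[of c1 c2] by (cases "odd k = p") auto
  then show "v \<in> parity_part (vacuum c1 c2) (vacuum_grading c1 c2) p"
    unfolding parity_part_def t(1)
    by (intro CollectI exI[of _ "\<lambda>k. proj c1 c2 (wcomp k t)"] conjI allI impI wcomp_in_grading wcomp_decomposition)
qed

end

section \<open>The Jacobi identity in terms of modes\<close>

lemma Sum_any_inj:
  assumes "inj h" "\<And>x. x \<notin> Set.range h \<Longrightarrow> f x = 0"
  shows "Sum_any f = Sum_any (\<lambda>j. f (h j))"
proof -
  have "x \<in> h ` {j. f (h j) \<noteq> 0}" if "f x \<noteq> 0" for x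
    using assms(2)[of x] that by (cases "x \<in> Set.range h") auto
  then have "{x. f x \<noteq> 0} = h ` {j. f (h j) \<noteq> 0}" by auto
  then show ?thesis
    unfolding Sum_any.expand_set using assms(1) by (simp add: sum.reindex inj_on_def)
qed

text \<open>The delta function is supported on the ray p + q = -i - 1 with q \<ge> 0; parametrizing
  it by l = q turns the double sum into a binomial expansion.\<close>

lemma Sum_any_delta1:
  fixes F :: "int \<Rightarrow> int \<Rightarrow> 'a::cvec"
  shows "Sum_any (\<lambda>(p, q). delta1 i p q *\<^sub>C F p q) =
    Sum_any (\<lambda>l. sbin (- i - 1) l *\<^sub>C F (- i - 1 - int l) (int l))"
proof (subst Sum_any_inj[of "\<lambda>l. (- i - 1 - int l, int l)"])
  fix x :: "int \<times> int"
  obtain p q where x: "x = (p, q)" by (cases x)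
  assume nin: "x \<notin> Set.range (\<lambda>l. (- i - 1 - int l, int l))"
  have "\<not> (q \<ge> 0 \<and> p + q = - i - 1)"
  proof
    assume "q \<ge> 0 \<and> p + q = - i - 1"
    then have "x = (\<lambda>l. (- i - 1 - int l, int l)) (nat q)" by (simp add: x)
    then have "x \<in> Set.range (\<lambda>l. (- i - 1 - int l, int l))" by (rule range_eqI)
    with nin show False by contradiction
  qed
  then show "(case x of (p, q) \<Rightarrow> delta1 i p q *\<^sub>C F p q) = 0"
    by (auto simp: x delta1_def binexp_def)
qed (auto simp: inj_def delta1_def binexp_def sbin_def bin_def)

lemma Sum_any_delta2:
  fixes F :: "int \<Rightarrow> int \<Rightarrow> 'a::cvec"
  shows "Sum_any (\<lambda>(p, q). delta2 i p q *\<^sub>C F p q) =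
    Sum_any (\<lambda>l. ((- 1) powi (- i - 1) * sbin (- i - 1) l) *\<^sub>C F (int l) (- i - 1 - int l))"
proof (subst Sum_any_inj[of "\<lambda>l. (int l, - i - 1 - int l)"])
  fix x :: "int \<times> int"
  obtain p q where x: "x = (p, q)" by (cases x)
  assume nin: "x \<notin> Set.range (\<lambda>l. (int l, - i - 1 - int l))"
  have "\<not> (p \<ge> 0 \<and> q + p = - i - 1)"
  proof
    assume "p \<ge> 0 \<and> q + p = - i - 1"
    then have "x = (\<lambda>l. (int l, - i - 1 - int l)) (nat p)" by (simp add: x)
    then have "x \<in> Set.range (\<lambda>l. (int l, - i - 1 - int l))" by (rule range_eqI)
    with nin show False by contradiction
  qed
  then show "(case x of (p, q) \<Rightarrow> delta2 i p q *\<^sub>C F p q) = 0"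
    by (auto simp: x delta2_def binexp_def)
qed (auto simp: inj_def delta2_def binexp_def sbin_def bin_def)

lemma Sum_any_delta3:
  fixes F :: "int \<Rightarrow> int \<Rightarrow> 'a::cvec"
  shows "Sum_any (\<lambda>(p, q). delta3 p j q *\<^sub>C F p q) =
    Sum_any (\<lambda>l. bin (- j - 1) l *\<^sub>C F (int l) (- j - 1 - int l))"
proof (subst Sum_any_inj[of "\<lambda>l. (int l, - j - 1 - int l)"])
  fix x :: "int \<times> int"
  obtain p q where x: "x = (p, q)" by (cases x)
  assume nin: "x \<notin> Set.range (\<lambda>l. (int l, - j - 1 - int l))"
  have "\<not> (p \<ge> 0 \<and> q + p = - j - 1)"
  proof
    assume "p \<ge> 0 \<and> q + p = - j - 1"
    then have "x = (\<lambda>l. (int l, - j - 1 - int l)) (nat p)" by (simp add: x)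
    then have "x \<in> Set.range (\<lambda>l. (int l, - j - 1 - int l))" by (rule range_eqI)
    with nin show False by contradiction
  qed
  then show "(case x of (p, q) \<Rightarrow> delta3 p j q *\<^sub>C F p q) = 0"
    by (auto simp: x delta3_def binexp_def)
next
  \<comment> \<open>Negation of the upper index: (-1)^l (j + l choose l) = (-j - 1 choose
    l).\<close>
  have "delta3 (int l) j (- j - 1 - int l) = bin (- j - 1) l" for l
    using gbinomial_negated_upper[of "of_int (- j - 1) :: complex" l]
    by (simp add: delta3_def binexp_def bin_def algebra_simps)
  then show "Sum_any (\<lambda>l. case (int l, - j - 1 - int l) of (p, q) \<Rightarrow> delta3 p j q *\<^sub>C F p q) =
      Sum_any (\<lambda>l. bin (- j - 1) l *\<^sub>C F (int l) (- j - 1 - int l))"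
    by simp
qed (auto simp: inj_def)

text \<open>A nonzero scalar leaves the support unchanged, so the equation also holds for infinite
  support, where both sums are 0.\<close>

lemma Sum_any_scale_nonzero: "c \<noteq> 0 \<Longrightarrow> Sum_any (\<lambda>l. c *\<^sub>C f l) = c *\<^sub>C Sum_any f"
  unfolding Sum_any.expand_set by (simp add: cv.scale_sum_right)

context cvs
begin

text \<open>Reading off z_0^i z_1^j z_2^k with r = -i - 1, m = -j - 1, n = -k - 1 turns the first
  two delta terms into \<open>cross\<close> and the third into the left side of
  \<open>borcherds_identity\<close>. Equations move between W and the type because \<iota> is
  injective on the carrier.\<close>

theorem jacobi_identity_iff:
  assumes u: "\<And>n. Y' u n \<in> cEnd W" and v: "\<And>n. Y' v n \<in> cEnd W"
    and uv: "\<And>j n. Y' (Y u j v) n \<in> cEnd W"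
  shows "jacobi_identity Y W Y' p q u v \<longleftrightarrow> (\<forall>w\<in>carrier W. \<forall>m n r.
    Sum_any (\<lambda>l. bin m l *\<^sub>C \<iota> (Y' (Y u (r + int l) v) (m + n - int l) w)) =
    cross (koszul p q) (\<lambda>n. lft (Y' u n)) (\<lambda>n. lft (Y' v n)) r m n (\<iota> w))"
proof -
  note cl = cEnd_closed[OF u] cEnd_closed[OF v] cEnd_closed[OF uv]
  have eq: "(fsum W (\<lambda>(p, q). delta1 i p q \<odot>\<^bsub>W\<^esub> Y' u (- (j - p) - 1) (Y' v (- (k - q) - 1) w))
        \<ominus>\<^bsub>W\<^esub> koszul p q \<odot>\<^bsub>W\<^esub>
          fsum W (\<lambda>(p, q). delta2 i p q \<odot>\<^bsub>W\<^esub> Y' v (- (k - q) - 1) (Y' u (- (j - p) - 1) w))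
        = fsum W (\<lambda>(p, q). delta3 p j q \<odot>\<^bsub>W\<^esub> Y' (Y u (- (i - p) - 1) v) (- (k - q) - 1) w)) \<longleftrightarrow>
      Sum_any (\<lambda>l. bin (- j - 1) l *\<^sub>C \<iota> (Y' (Y u (- i - 1 + int l) v) (- j - 1 + (- k - 1) - int l) w)) =
      cross (koszul p q) (\<lambda>n. lft (Y' u n)) (\<lambda>n. lft (Y' v n)) (- i - 1) (- j - 1) (- k - 1) (\<iota> w)"
    if w: "w \<in> carrier W" for i j k w
  proof -
    let ?A = "\<lambda>(p, q). delta1 i p q \<odot>\<^bsub>W\<^esub> Y' u (- (j - p) - 1) (Y' v (- (k - q) - 1) w)"
    let ?B = "\<lambda>(p, q). delta2 i p q \<odot>\<^bsub>W\<^esub> Y' v (- (k - q) - 1) (Y' u (- (j - p) - 1) w)"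
    let ?C = "\<lambda>(p, q). delta3 p j q \<odot>\<^bsub>W\<^esub> Y' (Y u (- (i - p) - 1) v) (- (k - q) - 1) w"
    have A: "?A x \<in> carrier W" and B: "?B x \<in> carrier W" and C: "?C x \<in> carrier W" for x
      by (cases x; simp add: cl w)+
    have iA: "\<iota> (fsum W ?A) = xpd (- i - 1) (\<lambda>p q. lft (Y' u p) (lft (Y' v q) (\<iota> w))) (- j - 1) (- k - 1)"
    proof -
      have "\<iota> (fsum W ?A) = Sum_any (\<lambda>x. \<iota> (?A x))" by (rule \<iota>_fsum) (rule A)
      also have "(\<lambda>x. \<iota> (?A x)) = (\<lambda>(p, q). delta1 i p q *\<^sub>C \<iota> (Y' u (- (j - p) - 1) (Y' v (- (k - q) - 1) w)))"
        by (auto simp: fun_eq_iff \<iota>_smult cl w)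
      finally show ?thesis
        unfolding Sum_any_delta1 xpd_def by (simp add: lft_\<iota> cl w algebra_simps)
    qed
    have iB: "\<iota> (fsum W ?B) = (- 1) powi (- i - 1) *\<^sub>C
        xpd (- i - 1) (\<lambda>q p. lft (Y' v q) (lft (Y' u p) (\<iota> w))) (- k - 1) (- j - 1)"
    proof -
      have "\<iota> (fsum W ?B) = Sum_any (\<lambda>x. \<iota> (?B x))" by (rule \<iota>_fsum) (rule B)
      also have "(\<lambda>x. \<iota> (?B x)) = (\<lambda>(p, q). delta2 i p q *\<^sub>C \<iota> (Y' v (- (k - q) - 1) (Y' u (- (j - p) - 1) w)))"
        by (auto simp: fun_eq_iff \<iota>_smult cl w)
      finally have "\<iota> (fsum W ?B) = Sum_any (\<lambda>l. (- 1) powi (- i - 1) *\<^sub>C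
          (sbin (- i - 1) l *\<^sub>C \<iota> (Y' v (- k - 1 + (- i - 1) - int l) (Y' u (- j - 1 + int l) w))))"
        unfolding Sum_any_delta2 by (simp add: cv.scale_scale algebra_simps)
      also have "\<dots> = (- 1) powi (- i - 1) *\<^sub>C Sum_any (\<lambda>l.
          sbin (- i - 1) l *\<^sub>C \<iota> (Y' v (- k - 1 + (- i - 1) - int l) (Y' u (- j - 1 + int l) w)))"
        by (rule Sum_any_scale_nonzero) simp
      finally show ?thesis
        unfolding xpd_def by (simp only: lft_\<iota> cl w)
    qed
    have iC: "\<iota> (fsum W ?C) =
        Sum_any (\<lambda>l. bin (- j - 1) l *\<^sub>C \<iota> (Y' (Y u (- i - 1 + int l) v) (- j - 1 + (- k - 1) - int l) w))"
    proof -
      have "\<iota> (fsum W ?C) = Sum_any (\<lambda>x. \<iota> (?C x))" by (rule \<iota>_fsum) (rule C)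
      also have "(\<lambda>x. \<iota> (?C x)) = (\<lambda>(p, q). delta3 p j q *\<^sub>C \<iota> (Y' (Y u (- (i - p) - 1) v) (- (k - q) - 1) w))"
        by (auto simp: fun_eq_iff \<iota>_smult cl w)
      finally show ?thesis
        unfolding Sum_any_delta3 by (simp add: algebra_simps)
    qed
    note fA = fsum_closed[of ?A, OF A] and fB = fsum_closed[of ?B, OF B] and fC = fsum_closed[of ?C, OF C]
    have "fsum W ?A \<ominus>\<^bsub>W\<^esub> koszul p q \<odot>\<^bsub>W\<^esub> fsum W ?B = fsum W ?C \<longleftrightarrow>
        \<iota> (fsum W ?A) - koszul p q *\<^sub>C \<iota> (fsum W ?B) = \<iota> (fsum W ?C)"
      by (subst \<iota>_inj[symmetric]) (use fA fB fC in \<open>simp_all only: \<iota>_diff \<iota>_smult smult_closed' minus_closed\<close>)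
    then show ?thesis
      unfolding iA iB iC cross_def scaleC_scaleC by (simp only: eq_commute)
  qed
  let ?Q = "\<lambda>r m n w. Sum_any (\<lambda>l. bin m l *\<^sub>C \<iota> (Y' (Y u (r + int l) v) (m + n - int l) w)) =
    cross (koszul p q) (\<lambda>n. lft (Y' u n)) (\<lambda>n. lft (Y' v n)) r m n (\<iota> w)"
  have "(\<forall>i j k. ?Q (- i - 1) (- j - 1) (- k - 1) w) \<longleftrightarrow> (\<forall>m n r. ?Q r m n w)" for w
  proof (intro iffI allI)
    fix m n r
    assume "\<forall>i j k. ?Q (- i - 1) (- j - 1) (- k - 1) w"
    then have "?Q (- (- r - 1) - 1) (- (- m - 1) - 1) (- (- n - 1) - 1) w" by blast
    moreover have "- (- x - 1) - 1 = x" for x :: int by simp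
    ultimately show "?Q r m n w" by (simp only:)
  qed blast
  then show ?thesis unfolding jacobi_identity_def by (simp only: eq cong: ball_cong)
qed

end

section \<open>The vertex superalgebra and its modules\<close>

context cvs
begin

abbreviation modes_of :: "('v \<Rightarrow> int \<Rightarrow> 'w \<Rightarrow> 'w) \<Rightarrow> 'v \<Rightarrow> ('w \<Rightarrow>\<^sub>0 complex) field" where
  "modes_of Y' v \<equiv> \<lambda>n. lft (Y' v n)"

lemma linear_fields_cEnd: "linear_fields V W Y' \<Longrightarrow> v \<in> carrier V \<Longrightarrow> Y' v n \<in> cEnd W"
  unfolding linear_fields_def by blast

end

context smooth_mod
begin

interpretation V: smooth_mod "vacuum c1 c2" "vacuum_act c1 c2" c1 c2
  by (rule smooth_mod_vacuum)

lemma jacobi_identity_Y: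
  assumes "u \<in> parity_part (vacuum c1 c2) (vacuum_grading c1 c2) p"
    and "v \<in> parity_part (vacuum c1 c2) (vacuum_grading c1 c2) q"
  shows "jacobi_identity V.Y W Y p q u v"
proof -
  obtain s t where s: "u = proj c1 c2 s" "hom_word p s" and t: "v = proj c1 c2 t" "hom_word q t"
    using assms unfolding parity_part_vacuum by blast
  have uv: "u \<in> carrier (vacuum c1 c2)" "v \<in> carrier (vacuum c1 c2)" by (simp_all add: s t)
  have "Sum_any (\<lambda>l. bin m l *\<^sub>C \<iota> (Y (V.Y u (r + int l) v) (m + n - int l) w)) =
      cross (koszul p q) (\<lambda>n. lft (Y u n)) (\<lambda>n. lft (Y v n)) r m n (\<iota> w)"
    if w: "w \<in> carrier W" for m n r w
    using Y_borcherds[OF s(2) t(2), of m r n "\<iota> w"] unfolding s(1)[symmetric] t(1)[symmetric] lft_\<iota>[OF w] .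
  moreover have "\<And>n. Y u n \<in> cEnd W" "\<And>n. Y v n \<in> cEnd W" "\<And>j n. Y (V.Y u j v) n \<in> cEnd W"
    by (intro Y_cEnd V.Y_closed uv)+
  ultimately show ?thesis by (subst jacobi_identity_iff) blast+
qed

lemma truncated_Y: "truncated (vacuum c1 c2) W Y"
  unfolding truncated_def
proof (intro ballI)
  fix v w assume v: "v \<in> carrier (vacuum c1 c2)" and w: "w \<in> carrier W"
  from v obtain t where "v = proj c1 c2 t" by (rule vacuum_cases)
  then show "\<exists>N. \<forall>n\<ge>N. Y v n w = \<zero>\<^bsub>W\<^esub>" using Y_truncated[OF w, of t] by (simp only:)
qed

lemma vacuum_identity_Y: "vacuum_identity W (vacuum_one c1 c2) Y"
  unfolding vacuum_identity_def by (intro allI ballI Y_vac)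

theorem vertex_module_Y:
  "superspace W P \<Longrightarrow> vertex_module (vacuum c1 c2) (vacuum_grading c1 c2) (vacuum_one c1 c2)
    (vacuum_act c1 c2 (gen (Lgen (- 1)))) V.Y W P (\<rho> (gen (Lgen (- 1)))) Y"
  unfolding vertex_module_def
  by (intro conjI allI ballI \<rho>_cEnd linear_fields_Y truncated_Y vacuum_identity_Y Y_derivative jacobi_identity_Y)

end

context
  fixes c1 c2 :: complex
begin

interpretation V: smooth_mod "vacuum c1 c2" "vacuum_act c1 c2" c1 c2
  by (rule smooth_mod_vacuum)

theorem vacuum_vertex_structure_Y:
  "vacuum_vertex_structure c1 c2 (vacuum_act c1 c2 (gen (Lgen (- 1)))) V.Y"
proof -
  have "V.Y u n v \<in> parity_part (vacuum c1 c2) (vacuum_grading c1 c2) (p \<noteq> q)"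
    if uv: "u \<in> parity_part (vacuum c1 c2) (vacuum_grading c1 c2) p"
      "v \<in> parity_part (vacuum c1 c2) (vacuum_grading c1 c2) q" for p q u v n
  proof -
    obtain s t where s: "u = proj c1 c2 s" "hom_word p s" and t: "v = proj c1 c2 t" "hom_word q t"
      using uv unfolding parity_part_vacuum by blast
    show ?thesis
      using vacuum_Y_parity[OF s(2) t(2), of c1 c2 n] unfolding parity_part_vacuum s(1) t(1) by blast
  qed
  moreover have "(\<forall>n\<ge>0. V.Y v n (vacuum_one c1 c2) = \<zero>\<^bsub>vacuum c1 c2\<^esub>) \<and> V.Y v (- 1) (vacuum_one c1 c2) = v"
    if "v \<in> carrier (vacuum c1 c2)" for v
    using that by (elim vacuum_cases) (simp add: vacuum_Y_creation)
  moreover have "vacuum_one c1 c2 \<in> carrier (vacuum c1 c2)" by (simp add: vacuum_one_proj)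
  ultimately show ?thesis
    unfolding vacuum_vertex_structure_def vertex_superalgebra_def
    by (intro conjI allI ballI V.cvspace direct_sum_grading V.\<rho>_cEnd V.linear_fields_Y V.truncated_Y
        V.vacuum_identity_Y V.Y_derivative V.jacobi_identity_Y V.generating_Y refl) blast+
qed

lemma proj_C: "proj c1 c2 (word (C1gen # ws)) = c1 \<odot>\<^bsub>vacuum c1 c2\<^esub> proj c1 c2 (word ws)"
  "proj c1 c2 (word (C2gen # ws)) = c2 \<odot>\<^bsub>vacuum c1 c2\<^esub> proj c1 c2 (word ws)"
proof -
  have w: "word (b # ws) = word [b] * word ws" for b by (simp only: word_mult append.simps)
  have "V.ev0 (vproj c1 c2 (word (C1gen # ws))) = V.ev0 (c1 *\<^sub>C vproj c1 c2 (word ws))"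
    "V.ev0 (vproj c1 c2 (word (C2gen # ws))) = V.ev0 (c2 *\<^sub>C vproj c1 c2 (word ws))"
    by (simp_all only: w vproj_C1 vproj_C2)
  then show "proj c1 c2 (word (C1gen # ws)) = c1 \<odot>\<^bsub>vacuum c1 c2\<^esub> proj c1 c2 (word ws)"
    "proj c1 c2 (word (C2gen # ws)) = c2 \<odot>\<^bsub>vacuum c1 c2\<^esub> proj c1 c2 (word ws)"
    by (simp_all only: ev0_vproj V.ev0_scale)
qed

lemma generating_fields_mode:
  assumes "generating_fields c1 c2 W \<rho> Y'" "w \<in> carrier W"
  shows "Y' (proj c1 c2 (word [mode k (- 1)])) n w = \<rho> (gen (mode k n)) w"
  using assms unfolding generating_fields_def vacuum_L_def vacuum_M_def vacuum_Q_def
  by (cases k) (simp_all add: vacuum_one_proj vacuum_act_gen)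

end

section \<open>Uniqueness of vertex operator maps with given generating fields\<close>

context cvs
begin

lemma lin_modes_of:
  assumes lf: "linear_fields (vacuum c1 c2) W Y'"
  shows "lin (\<lambda>t. modes_of Y' (proj c1 c2 t))"
proof (rule linI)
  note cl = cEnd_closed[OF linear_fields_cEnd[OF lf]]
  have add: "Y' (u \<oplus>\<^bsub>vacuum c1 c2\<^esub> v) n w = Y' u n w \<oplus>\<^bsub>W\<^esub> Y' v n w"
    and smult: "Y' (a \<odot>\<^bsub>vacuum c1 c2\<^esub> v) n w = a \<odot>\<^bsub>W\<^esub> Y' v n w"
    if "u \<in> carrier (vacuum c1 c2)" "v \<in> carrier (vacuum c1 c2)" "w \<in> carrier W" for u v n w a
    using lf that unfolding linear_fields_def by blast+
  show "modes_of Y' (proj c1 c2 (s + t)) = modes_of Y' (proj c1 c2 s) + modes_of Y' (proj c1 c2 t)" for s t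
    by (intro ext) (simp add: lft_def proj_add add \<iota>_add cl ev0_closed)
  show "modes_of Y' (proj c1 c2 (a *\<^sub>C t)) = a *\<^sub>C modes_of Y' (proj c1 c2 t)" for a t
    by (intro ext) (simp add: lft_def proj_smult smult[of "proj c1 c2 t"] \<iota>_smult cl ev0_closed)
qed

lemma field_eqI:
  assumes "unital unit a" "unital unit b" "\<And>n w. w \<in> carrier W \<Longrightarrow> a n (\<iota> w) = b n (\<iota> w)"
  shows "a = b"
proof (intro ext)
  fix n u
  have "a n u = a n (unit u)" "b n u = b n (unit u)" using assms(1,2) by (simp_all add: unital_def)
  then show "a n u = b n u" using assms(3)[OF ev0_closed] by (simp only: unit_def)
qed

lemma unital_modes_of: "(\<And>n. Y' v n \<in> cEnd W) \<Longrightarrow> unital unit (modes_of Y' v)"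
  by (simp add: unital_def lft_unit unit_lft)

text \<open>The Jacobi identity at \<open>z\<^sub>1\<^bsup>-1\<^esup>\<close> is the iterate formula.\<close>

lemma modes_of_iterate:
  assumes jac: "jacobi_identity Y W Y' p q u v"
    and u: "\<And>n. Y' u n \<in> cEnd W" and v: "\<And>n. Y' v n \<in> cEnd W" and uv: "\<And>j n. Y' (Y u j v) n \<in> cEnd W"
    and fld: "fld (modes_of Y' u)" "fld (modes_of Y' v)"
  shows "modes_of Y' (Y u r v) = nprod (koszul p q) (modes_of Y' u) r (modes_of Y' v)"
proof (rule field_eqI)
  show "unital unit (modes_of Y' (Y u r v))" by (rule unital_modes_of) (rule uv)
  show "unital unit (nprod (koszul p q) (modes_of Y' u) r (modes_of Y' v))"
    by (intro unital_nprod lin_unit unital_modes_of u v fld)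
  fix n w assume w: "w \<in> carrier W"
  have "Sum_any (\<lambda>l. bin 0 l *\<^sub>C \<iota> (Y' (Y u (r + int l) v) (0 + n - int l) w)) =
      cross (koszul p q) (modes_of Y' u) (modes_of Y' v) r 0 n (\<iota> w)"
    using jac jacobi_identity_iff[of Y' u v Y p q, OF u v uv] w by blast
  moreover have "Sum_any (\<lambda>l. bin 0 l *\<^sub>C \<iota> (Y' (Y u (r + int l) v) (0 + n - int l) w)) =
      (\<Sum>l<1. bin 0 l *\<^sub>C \<iota> (Y' (Y u (r + int l) v) (0 + n - int l) w))"
    by (rule Sum_any_bound) (simp add: bin_0_left)
  ultimately show "lft (Y' (Y u r v) n) (\<iota> w) = nprod (koszul p q) (modes_of Y' u) r (modes_of Y' v) n (\<iota> w)"
    by (simp add: nprod_def lft_\<iota> w)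
qed

end

context smooth_mod
begin

interpretation V: smooth_mod "vacuum c1 c2" "vacuum_act c1 c2" c1 c2
  by (rule smooth_mod_vacuum)

text \<open>By \<open>genv\<close>, prefixing \<open>mode k m\<close> to a word is taking the m-th
  product of a generating state with it; the iterate formula expresses its field by
  \<open>nprod\<close>, so induction on words forces the value \<open>Phi\<close>. Uniqueness of the
  algebra structure itself is the case where Y' and Yv coincide.\<close>

theorem Y_unique:
  assumes lf: "linear_fields (vacuum c1 c2) W Y'" and vac: "vacuum_identity W (vacuum_one c1 c2) Y'"
    and gen: "generating_fields c1 c2 W \<rho> Y'"
    and lfv: "linear_fields (vacuum c1 c2) (vacuum c1 c2) Yv"
    and genv: "generating_fields c1 c2 (vacuum c1 c2) (vacuum_act c1 c2) Yv"
    and jac: "\<And>p q u v. u \<in> parity_part (vacuum c1 c2) (vacuum_grading c1 c2) p \<Longrightarrow>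
      v \<in> parity_part (vacuum c1 c2) (vacuum_grading c1 c2) q \<Longrightarrow> jacobi_identity Yv W Y' p q u v"
  shows "Y' = Y"
proof -
  note cE = linear_fields_cEnd[OF lf]
  let ?H = "\<lambda>t. modes_of Y' (proj c1 c2 t)"
  have X: "?H (word [mode k (- 1)]) = X k" for k
    by (intro ext) (simp only: lft_def X_def generating_fields_mode[OF gen] ev0_closed)
  have word: "?H (word ws) = Phi ws" for ws
  proof (induction ws)
    case Nil
    have "vacuum_one c1 c2 = proj c1 c2 (word [])" by (simp only: vacuum_one_proj word_Nil)
    then have "Y' (proj c1 c2 (word [])) n w = (if n = - 1 then w else \<zero>\<^bsub>W\<^esub>)" if "w \<in> carrier W" for n w
      using vac that by (simp add: vacuum_identity_def)
    then show ?case unfolding Phi.simps by (intro ext) (simp add: lft_def idf_def unit_def ev0_closed)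
  next
    case (Cons b ws)
    show ?case
    proof (cases b rule: gen_cases)
      case (mode k m)
      let ?u = "proj c1 c2 (word [mode k (- 1)])" and ?v = "proj c1 c2 (word ws)"
      have uvp: "?u \<in> parity_part (vacuum c1 c2) (vacuum_grading c1 c2) (kodd k)"
        "?v \<in> parity_part (vacuum c1 c2) (vacuum_grading c1 c2) (wodd ws)"
        using hom_word_word[of "[mode k (- 1)]"] hom_word_word[of ws]
        unfolding parity_part_vacuum by auto
      have "proj c1 c2 (word (b # ws)) = proj c1 c2 (word [mode k m] * word ws)"
        by (simp only: mode word_mult append.simps)
      also have "\<dots> = Yv ?u m ?v"
        by (simp only: generating_fields_mode[OF genv] vacuum_act_gen proj_closed)
      finally have "?H (word (b # ws)) = modes_of Y' (Yv ?u m ?v)" by (simp only:)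
      also have "\<dots> = nprod (koszul (kodd k) (wodd ws)) (?H (word [mode k (- 1)])) m (?H (word ws))"
      proof (rule modes_of_iterate[OF jac[OF uvp]])
        show "Y' (Yv ?u j ?v) n \<in> cEnd W" for j n
          by (intro cE V.cEnd_closed[OF V.linear_fields_cEnd[OF lfv]] proj_closed)
        show "fld (?H (word [mode k (- 1)]))" "fld (?H (word ws))"
          unfolding X Cons by (rule fld_X fld_Phi)+
      qed (intro cE proj_closed)+
      finally show ?thesis unfolding X Cons mode Phi.simps act_mode .
    next
      case C1
      have "?H (word (C1gen # ws)) = c1 *\<^sub>C ?H (word ws)"
        unfolding proj_C proj_smult[symmetric] by (rule lin_scale[OF lin_modes_of[OF lf]])
      then show ?thesis unfolding C1 Cons Phi.simps act.simps .
    next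
      case C2
      have "?H (word (C2gen # ws)) = c2 *\<^sub>C ?H (word ws)"
        unfolding proj_C proj_smult[symmetric] by (rule lin_scale[OF lin_modes_of[OF lf]])
      then show ?thesis unfolding C2 Cons Phi.simps act.simps .
    qed
  qed
  have H: "?H t = PhiT t" for t
    using lin_of_lc[OF lin_modes_of[OF lf], of word t] unfolding word PhiT_def lc_gen .
  show ?thesis
  proof (rule PiE_ext)
    show "Y' \<in> carrier (vacuum c1 c2) \<rightarrow>\<^sub>E (UNIV \<rightarrow> cEnd W)" "Y \<in> carrier (vacuum c1 c2) \<rightarrow>\<^sub>E (UNIV \<rightarrow> cEnd W)"
      using lf linear_fields_Y by (simp_all add: linear_fields_def)
    fix v assume v: "v \<in> carrier (vacuum c1 c2)"
    then obtain t where t: "v = proj c1 c2 t" by (rule vacuum_cases)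
    show "Y' v = Y v"
    proof
      fix n
      show "Y' v n = Y v n"
      proof (rule cEnd_eqI[OF cE[OF v] Y_cEnd[OF v]])
        fix w assume w: "w \<in> carrier W"
        have "\<iota> (Y' v n w) = \<iota> (Y v n w)"
          using fun_cong[OF fun_cong[OF H[of t]], of n "\<iota> w"] by (simp only: t \<iota>_Y w lft_\<iota>)
        then show "Y' v n w = Y v n w"
          using w v by (simp only: \<iota>_inj cEnd_closed[OF cE] Y_closed)
      qed
    qed
  qed
qed

end

context
  fixes c1 c2 :: complex
begin

interpretation V: smooth_mod "vacuum c1 c2" "vacuum_act c1 c2" c1 c2
  by (rule smooth_mod_vacuum)

theorem vacuum_vertex_structure_unique:
  assumes "vacuum_vertex_structure c1 c2 D Y'"
  shows "D = vacuum_act c1 c2 (gen (Lgen (- 1)))" "Y' = V.Y"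
proof -
  show "D = vacuum_act c1 c2 (gen (Lgen (- 1)))"
    using assms unfolding vacuum_vertex_structure_def vertex_superalgebra_def
    by (intro V.cEnd_eqI V.\<rho>_cEnd) blast+
  show "Y' = V.Y"
    using assms unfolding vacuum_vertex_structure_def vertex_superalgebra_def
    by (intro V.Y_unique[of Y' Y']) blast+
qed

end

section \<open>From modules over the vertex superalgebra to smooth modules\<close>

lemma lc_add_fun: "lc (\<lambda>b. F b + G b) x = lc F x + lc G x"
  by (simp add: lc_def scaleC_simps sum.distrib)

lemma lin_lc_fun: "(\<And>b. lin (F b)) \<Longrightarrow> lin (\<lambda>u. lc (\<lambda>b. F b u) x)"
  by (rule linI) (simp_all add: lin_add lin_scale lc_add_fun lc_scale_fun)

locale vertex_mod = cvs W for W :: "(complex, 'w) module" +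
  fixes Y' :: "vacuum_elt \<Rightarrow> int \<Rightarrow> 'w \<Rightarrow> 'w" and c1 c2 :: complex
  assumes linear_fields: "linear_fields (vacuum c1 c2) W Y'"
    and truncated: "truncated (vacuum c1 c2) W Y'"
    and vacuum_identity: "vacuum_identity W (vacuum_one c1 c2) Y'"
    and derivative: "v \<in> carrier (vacuum c1 c2) \<Longrightarrow> w \<in> carrier W \<Longrightarrow>
      Y' (vacuum_act c1 c2 (gen (Lgen (- 1))) v) n w = (- of_int n) \<odot>\<^bsub>W\<^esub> Y' v (n - 1) w"
    and jacobi: "u \<in> parity_part (vacuum c1 c2) (vacuum_grading c1 c2) p \<Longrightarrow>
      v \<in> parity_part (vacuum c1 c2) (vacuum_grading c1 c2) q \<Longrightarrow>
      jacobi_identity (smooth_mod.Y (vacuum c1 c2) (vacuum_act c1 c2) c1 c2) W Y' p q u v"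
begin

interpretation V: smooth_mod "vacuum c1 c2" "vacuum_act c1 c2" c1 c2
  by (rule smooth_mod_vacuum)

lemmas Y_cEnd = linear_fields_cEnd[OF linear_fields]
lemmas Y_closed = cEnd_closed[OF Y_cEnd]

definition H :: "tensor_alg \<Rightarrow> ('w \<Rightarrow>\<^sub>0 complex) field" where
  "H t = modes_of Y' (proj c1 c2 t)"

lemma lin_H: "lin H"
  unfolding H_def[abs_def] by (rule lin_modes_of[OF linear_fields])

lemma H_cong: "vproj c1 c2 s = vproj c1 c2 t \<Longrightarrow> H s = H t"
  unfolding H_def by (metis ev0_vproj)

definition vec :: "kind \<Rightarrow> vacuum_elt" where
  "vec k = proj c1 c2 (word [mode k (- 1)])"

lemma vec_closed: "vec k \<in> carrier (vacuum c1 c2)"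
  by (simp add: vec_def)

fun act_of :: "bms_gen \<Rightarrow> ('w \<Rightarrow>\<^sub>0 complex) \<Rightarrow> ('w \<Rightarrow>\<^sub>0 complex)" where
  "act_of (Lgen m) = lft (Y' (vec KL) (m + 1))"
| "act_of (Mgen m) = lft (Y' (vec KM) (m + 1))"
| "act_of (Qgen m) = lft (Y' (vec KQ) (m + 1))"
| "act_of C1gen = (\<lambda>u. c1 *\<^sub>C unit u)"
| "act_of C2gen = (\<lambda>u. c2 *\<^sub>C unit u)"

lemma act_of_mode: "act_of (mode k n) = lft (Y' (vec k) n)"
  by (cases k) simp_all

sublocale modes unit act_of c1 c2
  by unfold_locales simp_all

lemma X_eq: "X k n = lft (Y' (vec k) n)"
  by (simp add: X_def act_of_mode)

lemma H_vec: "H (word [mode k (- 1)]) = X k"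
  by (intro ext) (simp only: H_def X_eq vec_def)

lemma H_one: "H 1 = idf unit"
  using vacuum_identity by (intro ext) (simp add: H_def vacuum_identity_def lft_def idf_def unit_def ev0_closed vacuum_one_proj)

lemma H_annihilated: "n \<ge> 0 \<Longrightarrow> H (word [mode k n]) = 0"
  using H_cong[of "word [mode k n]" 0] by (simp only: vproj_annihilated lin_0[OF lin_vproj] lin_0[OF lin_H])

text \<open>\<open>mode j l\<close> with l \<ge> 0 kills the vacuum, so of the product of the two
  letters only the bracket survives.\<close>

lemma H_bracket:
  assumes "l \<ge> 0"
  shows "H (word [mode j l] * word [b]) = lc (\<lambda>g. H (word [g])) (gen_bracket (mode j l) b)"
proof -
  have "vproj c1 c2 (word [b] * word [mode j l]) = 0"
    by (rule vproj_mult_zero) (rule vproj_annihilated[OF assms])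
  then have "vproj c1 c2 (word [mode j l] * word [b]) = vproj c1 c2 (lc (\<lambda>g. word [g]) (gen_bracket (mode j l) b))"
    using vproj_bracket[of c1 c2 "mode j l" b 1] by (simp add: lin_of_lc[OF lin_vproj])
  then have "H (word [mode j l] * word [b]) = H (lc (\<lambda>g. word [g]) (gen_bracket (mode j l) b))" by (rule H_cong)
  then show ?thesis by (simp only: lin_of_lc[OF lin_H])
qed

lemma H_derivative: "H (word [Lgen (- 1)] * t) = der (H t)"
  unfolding H_def vacuum_act_gen[symmetric]
  by (intro ext) (simp add: lft_def der_def derivative ev0_closed \<iota>_smult Y_closed)

text \<open>L_{-1} kills the vacuum and its bracket with \<open>mode k (- 1)\<close> is
  \<open>mode k (- 2)\<close>; by the derivative property L_{-1} differentiates fields.\<close>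

lemma H_mode_minus_two: "H (word [mode k (- 2)]) = der (X k)"
proof -
  have "der (X k) = H (word [mode KL 0] * word [mode k (- 1)])"
    unfolding H_vec[symmetric] H_derivative[symmetric] by simp
  also have "\<dots> = H (word [mode k (- 2)])"
    unfolding H_bracket[OF order_refl] gen_bracket_mode by (simp add: ca_def ck_def tgt_def scaleC_one)
  finally show ?thesis ..
qed

lemma H_cen: "H (word [cen j k]) = charge (cen j k) *\<^sub>C idf unit"
proof -
  have "proj c1 c2 (word [cen j k]) = charge (cen j k) \<odot>\<^bsub>vacuum c1 c2\<^esub> proj c1 c2 1"
    using proj_C[of c1 c2 "[]"] by (auto simp: cen_def charge_def word_Nil)
  then have "H (word [cen j k]) = H (charge (cen j k) *\<^sub>C 1)" by (simp only: H_def proj_smult)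
  then show ?thesis by (simp only: lin_scale[OF lin_H] H_one)
qed

text \<open>The l-th product of two generating states is a bracket applied to the vacuum. Mode -2
  gives the derivative and mode -1 the field, modes \<ge> 0 vanish, and the central terms appear at
  l = 2 and l = 3.\<close>

lemma H_ope: "H (word [mode j (int l)] * word [mode k (- 1)]) = (if l < 4 then ope j k l else 0)"
proof -
  consider "l = 0" | "l = 1" | "l = 2" | "l = 3" | "l \<ge> 4" by linarith
  then show ?thesis
  proof cases
    case 1
    have "H (word [mode (tgt j k) (- 1)]) = X (tgt j k)" by (rule H_vec)
    moreover have "H (word [mode (tgt j k) (- 2)]) = der (X (tgt j k))" by (rule H_mode_minus_two)
    ultimately show ?thesis
      unfolding H_bracket[OF of_nat_0_le_iff] gen_bracket_mode unfolding 1 by (simp add: ope_def)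
  next
    case 2
    have "H (word [mode (tgt j k) (- 1)]) = X (tgt j k)" by (rule H_vec)
    moreover have "H (word [mode (tgt j k) 0]) = 0" by (rule H_annihilated) simp
    ultimately show ?thesis
      unfolding H_bracket[OF of_nat_0_le_iff] gen_bracket_mode unfolding 2 by (simp add: ope_def)
  next
    case 3
    have "H (word [mode (tgt j k) 0]) = 0" "H (word [mode (tgt j k) 1]) = 0" by (rule H_annihilated, simp)+
    then show ?thesis
      unfolding H_bracket[OF of_nat_0_le_iff] gen_bracket_mode H_cen unfolding 3
      by (simp add: ope_def bin_2 cv.scale_scale)
  next
    case 4
    have "H (word [mode (tgt j k) 1]) = 0" "H (word [mode (tgt j k) 2]) = 0" by (rule H_annihilated, simp)+
    then show ?thesis
      unfolding H_bracket[OF of_nat_0_le_iff] gen_bracket_mode H_cen unfolding 4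
      by (simp add: ope_def bin_3 cv.scale_scale)
  next
    case 5
    have "H (word [mode (tgt j k) (int l + - 1 - 1)]) = 0" "H (word [mode (tgt j k) (int l + - 1)]) = 0"
      by (rule H_annihilated, use 5 in simp)+
    then show ?thesis
      unfolding H_bracket[OF of_nat_0_le_iff] gen_bracket_mode using 5 by simp
  qed
qed

lemma lin_act_of: "lin (act_of b)"
  by (cases b rule: gen_cases) (simp_all only: act_of_mode lin_lft Y_cEnd vec_closed act_of.simps lin_scaleC lin_unit)

lemma act_of_unit: "act_of b (unit u) = act_of b u" and unit_act_of: "unit (act_of b u) = act_of b u"
  by (cases b rule: gen_cases;
    simp add: act_of_mode lft_unit unit_lft Y_cEnd vec_closed unit_unit lin_scale[OF lin_unit])+

lemma vec_parity: "vec k \<in> parity_part (vacuum c1 c2) (vacuum_grading c1 c2) (kodd k)"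
  using hom_word_word[of "[mode k (- 1)]"] unfolding parity_part_vacuum vec_def by auto

text \<open>At r = 0 the Jacobi identity is the commutator formula; its coefficients are products of
  generating states, evaluated by \<open>H_ope\<close>, and \<open>ope_sum\<close> reassembles them
  into the bracket.\<close>

lemma act_of_bracket:
  assumes w: "w \<in> carrier W"
  shows "act_of a (act_of b (\<iota> w)) - koszul (gen_odd a) (gen_odd b) *\<^sub>C act_of b (act_of a (\<iota> w)) =
    lc (\<lambda>g. act_of g (\<iota> w)) (gen_bracket a b)"
proof (cases a rule: gen_cases)
  case (mode j m)
  note a = this
  show ?thesis
  proof (cases b rule: gen_cases)
    case (mode k n)
    have it: "V.Y (vec j) i (vec k) = proj c1 c2 (word [mode j i] * word [mode k (- 1)])" for i
      unfolding vec_def by (simp only: V.Y_generator proj_closed vacuum_act_gen)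
    have "X j m (X k n (\<iota> w)) - koszul (kodd j) (kodd k) *\<^sub>C X k n (X j m (\<iota> w)) =
        cross (koszul (kodd j) (kodd k)) (modes_of Y' (vec j)) (modes_of Y' (vec k)) 0 m n (\<iota> w)"
      by (simp only: cross_0 X_eq)
    also have "\<dots> = Sum_any (\<lambda>l. bin m l *\<^sub>C \<iota> (Y' (V.Y (vec j) (0 + int l) (vec k)) (m + n - int l) w))"
      by (rule jacobi_identity_iff[THEN iffD1, rule_format, OF _ _ _ jacobi[OF vec_parity vec_parity] w, symmetric])
        (intro Y_cEnd vec_closed V.Y_closed)+
    also have "\<dots> = Sum_any (\<lambda>l. bin m l *\<^sub>C (if l < 4 then ope j k l else 0) (m + n - int l) (\<iota> w))"
      unfolding H_ope[symmetric] H_def by (simp add: it lft_\<iota> w)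
    also have "\<dots> = (\<Sum>l<4. bin m l *\<^sub>C (if l < 4 then ope j k l else 0) (m + n - int l) (\<iota> w))"
      by (rule Sum_any_bound) simp
    also have "\<dots> = (\<Sum>l<4. bin m l *\<^sub>C ope j k l (m + n - int l) (\<iota> w))"
      by (rule sum.cong) simp_all
    finally show ?thesis
      unfolding a mode ope_sum X_def gen_odd_mode .
  next
    case C1 then show ?thesis by (simp add: lin_scale[OF lin_act_of] act_of_unit unit_act_of koszul_simps scaleC_one)
  next
    case C2 then show ?thesis by (simp add: lin_scale[OF lin_act_of] act_of_unit unit_act_of koszul_simps scaleC_one)
  qed
next
  case C1 then show ?thesis by (simp add: lin_scale[OF lin_act_of] act_of_unit unit_act_of koszul_simps scaleC_one)
next
  case C2 then show ?thesis by (simp add: lin_scale[OF lin_act_of] act_of_unit unit_act_of koszul_simps scaleC_one)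
qed

definition \<rho>' :: "bms \<Rightarrow> 'w \<Rightarrow> 'w" where
  "\<rho>' x = op_of (\<lambda>u. lc (\<lambda>b. act_of b u) x)"

theorem smooth_structure_exists: "\<exists>\<rho>. \<rho> \<in> smooth_structures c1 c2 W \<and> generating_fields c1 c2 W \<rho> Y'"
proof -
  have unit': "unit (lc (\<lambda>b. act_of b u) x) = lc (\<lambda>b. act_of b u) x" for u x
    unfolding lin_of_lc[OF lin_unit] unit_act_of ..
  have cE: "\<rho>' x \<in> cEnd W" for x
    unfolding \<rho>'_def by (rule op_of_cEnd) (rule lin_lc_fun[OF lin_act_of], rule unit')
  note cl = cEnd_closed[OF cE]
  have \<iota>': "\<iota> (\<rho>' x w) = lc (\<lambda>b. act_of b (\<iota> w)) x" if "w \<in> carrier W" for x w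
    unfolding \<rho>'_def by (rule \<iota>_op_of[OF unit' that])
  have g: "\<iota> (\<rho>' (gen b) w) = act_of b (\<iota> w)" if "w \<in> carrier W" for b w
    by (simp only: \<iota>'[OF that] lc_single scaleC_one)
  have mode: "\<rho>' (gen (mode k n)) w = Y' (vec k) n w" if w: "w \<in> carrier W" for k n w
  proof -
    have "\<iota> (\<rho>' (gen (mode k n)) w) = \<iota> (Y' (vec k) n w)" by (simp only: g w act_of_mode lft_\<iota>)
    then show ?thesis using w by (simp only: \<iota>_inj cl Y_closed vec_closed)
  qed
  have "bms_module W \<rho>'"
    by (rule bms_moduleI[OF cE]) (simp_all only: \<iota>' g cl act_of_bracket lc_single scaleC_one)
  moreover have "smooth W \<rho>'"
    unfolding smooth_def
  proof
    fix w assume w: "w \<in> carrier W"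
    have "\<exists>N. \<forall>n\<ge>N. Y' (vec k) n w = \<zero>\<^bsub>W\<^esub>" for k
      using truncated w vec_closed[of k] unfolding truncated_def by blast
    then obtain N where N: "\<And>k n. n \<ge> N k \<Longrightarrow> Y' (vec k) n w = \<zero>\<^bsub>W\<^esub>" by metis
    have z: "\<rho>' (gen (mode k n)) w = \<zero>\<^bsub>W\<^esub>" if "n \<ge> max (N KL) (max (N KM) (N KQ))" for k n
      unfolding mode[OF w] by (rule N) (use that in \<open>cases k; simp\<close>)
    show "\<exists>N. \<forall>i\<ge>N. \<rho>' (gen (Lgen i)) w = \<zero>\<^bsub>W\<^esub> \<and> \<rho>' (gen (Mgen i)) w = \<zero>\<^bsub>W\<^esub> \<and> \<rho>' (gen (Qgen (i - 1))) w = \<zero>\<^bsub>W\<^esub>"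
    proof (intro exI allI impI)
      fix i assume i: "i \<ge> max (N KL) (max (N KM) (N KQ))"
      show "\<rho>' (gen (Lgen i)) w = \<zero>\<^bsub>W\<^esub> \<and> \<rho>' (gen (Mgen i)) w = \<zero>\<^bsub>W\<^esub> \<and> \<rho>' (gen (Qgen (i - 1))) w = \<zero>\<^bsub>W\<^esub>"
        using z[of "i + 1" KL] z[of "i + 1" KM] z[of i KQ] i by simp
    qed
  qed
  moreover have "central_charge W \<rho>' c1 c2"
    unfolding central_charge_def
  proof
    fix w assume w: "w \<in> carrier W"
    have "\<iota> (\<rho>' (gen C1gen) w) = \<iota> (c1 \<odot>\<^bsub>W\<^esub> w)" "\<iota> (\<rho>' (gen C2gen) w) = \<iota> (c2 \<odot>\<^bsub>W\<^esub> w)"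
      by (simp_all only: g w act_of.simps unit_\<iota> \<iota>_smult)
    then show "\<rho>' (gen C1gen) w = c1 \<odot>\<^bsub>W\<^esub> w \<and> \<rho>' (gen C2gen) w = c2 \<odot>\<^bsub>W\<^esub> w"
      using w by (simp only: \<iota>_inj cl smult_closed')
  qed
  moreover have "generating_fields c1 c2 W \<rho>' Y'"
    unfolding generating_fields_def vacuum_L_def vacuum_M_def vacuum_Q_def
    using mode[of _ KL] mode[of _ KM] mode[of _ KQ]
    by (simp add: vacuum_one_proj vacuum_act_gen vec_def)
  ultimately show ?thesis unfolding smooth_structures_def by blast
qed

end

text \<open>The generating fields fix every mode and the central charge fixes the central elements;
  linearity does the rest.\<close>

lemma smooth_structure_unique:
  assumes "\<rho> \<in> smooth_structures c1 c2 W" "\<sigma> \<in> smooth_structures c1 c2 W"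
    and "generating_fields c1 c2 W \<rho> Y'" "generating_fields c1 c2 W \<sigma> Y'"
  shows "\<rho> = \<sigma>"
proof
  interpret \<rho>: smooth_mod W \<rho> c1 c2 using assms(1) by (rule smooth_mod.intro)
  interpret \<sigma>: smooth_mod W \<sigma> c1 c2 using assms(2) by (rule smooth_mod.intro)
  fix x
  have cc: "\<rho> (gen C1gen) w = \<sigma> (gen C1gen) w" "\<rho> (gen C2gen) w = \<sigma> (gen C2gen) w" if "w \<in> carrier W" for w
    using assms(1,2) that by (simp_all add: smooth_structures_def central_charge_def)
  have g: "\<rho> (gen b) w = \<sigma> (gen b) w" if "w \<in> carrier W" for b w
    by (cases b rule: gen_cases)
      (simp_all only: cc that generating_fields_mode[OF assms(3), symmetric] generating_fields_mode[OF assms(4), symmetric])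
  show "\<rho> x = \<sigma> x"
  proof (rule \<rho>.cEnd_eqI[OF \<rho>.\<rho>_cEnd \<sigma>.\<rho>_cEnd])
    fix w assume w: "w \<in> carrier W"
    have "\<rho>.\<iota> (\<rho> x w) = \<rho>.\<iota> (\<sigma> x w)"
      unfolding \<rho>.\<iota>_\<rho>[OF w, of x] \<sigma>.\<iota>_\<rho>[OF w, of x] g[OF w] ..
    then show "\<rho> x w = \<sigma> x w" by (simp only: \<rho>.\<iota>_inj \<rho>.\<rho>_closed \<sigma>.\<rho>_closed w)
  qed
qed

section \<open>Parity\<close>

locale graded_smooth_mod = smooth_mod +
  fixes P
  assumes superspace: "superspace W P"
begin

lemma P_csubspace: "csubspace W (P q)"
  using superspace by (simp add: superspace_def direct_sum_def)

lemma P_closed: "w \<in> P q \<Longrightarrow> w \<in> carrier W"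
  using csubspace_subset[OF P_csubspace] by blast

definition S :: "bool \<Rightarrow> ('a \<Rightarrow>\<^sub>0 complex) set" where
  "S q = \<iota> ` P q"

lemma S_zero: "0 \<in> S q"
  using csubspace_zero[OF P_csubspace] unfolding S_def by (metis \<iota>_zero imageI)

lemma S_add: "u \<in> S q \<Longrightarrow> v \<in> S q \<Longrightarrow> u + v \<in> S q"
  using csubspace_add[OF P_csubspace] unfolding S_def by (auto simp: P_closed simp flip: \<iota>_add)

lemma S_scale: "u \<in> S q \<Longrightarrow> a *\<^sub>C u \<in> S q"
  using csubspace_smult[OF P_csubspace] unfolding S_def by (auto simp: P_closed simp flip: \<iota>_smult)

lemma S_sum: "(\<And>i. i \<in> A \<Longrightarrow> f i \<in> S q) \<Longrightarrow> sum f A \<in> S q"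
  by (induction A rule: infinite_finite_induct) (simp_all add: S_zero S_add)

lemma S_xpd: "(\<And>i j. F i j \<in> S q) \<Longrightarrow> xpd k F m n \<in> S q"
  unfolding xpd_def Sum_any.expand_set by (intro S_sum S_scale)

lemma S_cross: "(\<And>i j. a i (b j w) \<in> S q) \<Longrightarrow> (\<And>i j. b j (a i w) \<in> S q) \<Longrightarrow> cross s a b k m n w \<in> S q"
  unfolding cross_def diff_conv_add_uminus cv.scale_minus_left[symmetric] by (intro S_add S_scale S_xpd)

lemma S_\<iota>: "w \<in> carrier W \<Longrightarrow> \<iota> w \<in> S q \<longleftrightarrow> w \<in> P q"
  unfolding S_def by (auto simp: \<iota>_inj P_closed)

text \<open>Every term of \<open>nprod\<close> applies one mode of X k and one mode of the shorter
  word, in either order, and both orders shift the parity equally.\<close>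

lemma Phi_parity:
  assumes "parity_preserving_action P \<rho>" "u \<in> S q"
  shows "Phi ws n u \<in> S (wodd ws \<noteq> q)"
  using assms(2)
proof (induction ws arbitrary: n u q)
  case Nil
  then have "unit u \<in> S q" unfolding S_def by (auto simp: unit_\<iota> P_closed)
  then show ?case unfolding Phi.simps by (simp add: idf_def S_zero)
next
  case (Cons b ws)
  have X: "X k m v \<in> S (kodd k \<noteq> r)" if "v \<in> S r" for k m v r
  proof -
    from that obtain w where w: "w \<in> P r" "v = \<iota> w" unfolding S_def by blast
    have "\<rho> (gen (mode k m)) w \<in> P (gen_odd (mode k m) \<noteq> r)"
      using assms(1) gen_in_part[of "mode k m"] w(1) unfolding parity_preserving_action_def by blast
    then show ?thesis unfolding w(2) X_def R_\<iota>[OF P_closed[OF w(1)]] gen_odd_mode S_def by (rule imageI)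
  qed
  show ?case
  proof (cases b rule: gen_cases)
    case (mode k m)
    have p: "(wodd (b # ws) \<noteq> q) = (kodd k \<noteq> (wodd ws \<noteq> q))" "(wodd (b # ws) \<noteq> q) = (wodd ws \<noteq> (kodd k \<noteq> q))"
      by (auto simp: mode)
    have "X k i (Phi ws j u) \<in> S (wodd (b # ws) \<noteq> q)" for i j
      unfolding p(1) by (intro X Cons)
    moreover have "Phi ws j (X k i u) \<in> S (wodd (b # ws) \<noteq> q)" for i j
      unfolding p(2) by (intro X Cons)
    ultimately show ?thesis
      unfolding Phi.simps unfolding mode act_mode nprod_def
      unfolding mode[symmetric] by (intro S_cross)
  next
    case C1
    then show ?thesis using S_scale[OF Cons.IH[OF Cons.prems]] by simp
  next
    case C2
    then show ?thesis using S_scale[OF Cons.IH[OF Cons.prems]] by simp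
  qed
qed

text \<open>Vertex operators are built from modes of the generating fields, which gives one
  direction. Conversely the generators are modes of homogeneous states or scalars, and a homogeneous
  element combines generators of one parity.\<close>

theorem parity_preserving_iff:
  "parity_preserving_action P \<rho> \<longleftrightarrow> parity_preserving_fields (vacuum c1 c2) (vacuum_grading c1 c2) P Y"
proof
  assume act: "parity_preserving_action P \<rho>"
  show "parity_preserving_fields (vacuum c1 c2) (vacuum_grading c1 c2) P Y"
    unfolding parity_preserving_fields_def
  proof (intro allI ballI)
    fix p q v w n
    assume "v \<in> parity_part (vacuum c1 c2) (vacuum_grading c1 c2) p" and w: "w \<in> P q"
    then obtain t where t: "v = proj c1 c2 t" "hom_word p t" unfolding parity_part_vacuum by blast
    have "lookup t ws *\<^sub>C Phi ws n (\<iota> w) \<in> S (p \<noteq> q)" if "ws \<in> keys t" for ws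
    proof -
      have "wodd ws = p" using t(2) that by (simp add: hom_word_def)
      moreover have "\<iota> w \<in> S q" using w unfolding S_def by (rule imageI)
      ultimately show ?thesis using S_scale[OF Phi_parity[OF act, of "\<iota> w" q ws n]] by (simp only:)
    qed
    then have "PhiT t n (\<iota> w) \<in> S (p \<noteq> q)"
      unfolding PhiT_def lc_apply unfolding lc_def by (rule S_sum)
    then have "\<iota> (Y v n w) \<in> S (p \<noteq> q)" unfolding t(1) \<iota>_Y[OF P_closed[OF w]] .
    then show "Y v n w \<in> P (p \<noteq> q)" by (subst (asm) S_\<iota>) (simp_all add: Y_closed t(1) P_closed[OF w])
  qed
next
  assume flds: "parity_preserving_fields (vacuum c1 c2) (vacuum_grading c1 c2) P Y"
  show "parity_preserving_action P \<rho>"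
    unfolding parity_preserving_action_def
  proof (intro allI ballI)
    fix p q x w
    assume x: "x \<in> bms_part p" and w: "w \<in> P q"
    note wc = P_closed[OF w]
    have "\<rho> (gen b) w \<in> P (gen_odd b \<noteq> q)" for b
    proof (cases b rule: gen_cases)
      case (mode k n)
      have "proj c1 c2 (word [mode k (- 1)]) \<in> parity_part (vacuum c1 c2) (vacuum_grading c1 c2) (kodd k)"
        using hom_word_word[of "[mode k (- 1)]"] unfolding parity_part_vacuum by auto
      then have "Y (proj c1 c2 (word [mode k (- 1)])) n w \<in> P (kodd k \<noteq> q)"
        using flds w unfolding parity_preserving_fields_def by blast
      then show ?thesis unfolding mode gen_odd_mode Y_generator[OF wc] .
    next
      case C1
      then show ?thesis
        using smooth_structure csubspace_smult[OF P_csubspace w] wc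
        by (simp add: smooth_structures_def central_charge_def)
    next
      case C2
      then show ?thesis
        using smooth_structure csubspace_smult[OF P_csubspace w] wc
        by (simp add: smooth_structures_def central_charge_def)
    qed
    then have gens: "\<iota> (\<rho> (gen b) w) \<in> S (gen_odd b \<noteq> q)" for b unfolding S_def by (rule imageI)
    have "lookup x b *\<^sub>C \<iota> (\<rho> (gen b) w) \<in> S (p \<noteq> q)" if "b \<in> keys x" for b
    proof -
      have "gen_odd b = p" using x that by (simp add: bms_part_def)
      then show ?thesis using S_scale[OF gens[of b]] by (simp only:)
    qed
    then have "\<iota> (\<rho> x w) \<in> S (p \<noteq> q)" unfolding \<iota>_\<rho>[OF wc, of x] unfolding lc_def by (rule S_sum)
    then show "\<rho> x w \<in> P (p \<noteq> q)" by (simp only: S_\<iota> \<rho>_closed wc)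
  qed
qed

end

text \<open>The bijection is expressed through its graph, the relation
  \<open>generating_fields\<close> over a fixed space. Since both notions of module admit operators
  that do not respect P, compatibility with parity is a separate equivalence.\<close>

theorem proposition5p2:
  fixes c1 c2 :: complex
  shows "(\<exists>!S. vacuum_vertex_structure c1 c2 (fst S) (snd S)) \<and>
    (\<forall>D Y. vacuum_vertex_structure c1 c2 D Y \<longrightarrow>
      (\<forall>(W :: (complex, 'w) module) P. superspace W P \<longrightarrow>
        (\<forall>\<rho> \<in> smooth_structures c1 c2 W.
          \<exists>!Y'. Y' \<in> vertex_module_structures c1 c2 D Y W P \<and> generating_fields c1 c2 W \<rho> Y') \<and>
        (\<forall>Y' \<in> vertex_module_structures c1 c2 D Y W P.
          \<exists>!\<rho>. \<rho> \<in> smooth_structures c1 c2 W \<and> generating_fields c1 c2 W \<rho> Y') \<and>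
        (\<forall>\<rho> \<in> smooth_structures c1 c2 W. \<forall>Y' \<in> vertex_module_structures c1 c2 D Y W P.
          generating_fields c1 c2 W \<rho> Y' \<longrightarrow>
            vertex_module (vacuum c1 c2) (vacuum_grading c1 c2) (vacuum_one c1 c2) D Y
              W P (\<rho> (gen (Lgen (- 1)))) Y' \<and>
            (parity_preserving_action P \<rho> \<longleftrightarrow>
              parity_preserving_fields (vacuum c1 c2) (vacuum_grading c1 c2) P Y'))))"
proof (intro conjI allI impI)
  interpret V: smooth_mod "vacuum c1 c2" "vacuum_act c1 c2" c1 c2
    by (rule smooth_mod_vacuum)
  show "\<exists>!S. vacuum_vertex_structure c1 c2 (fst S) (snd S)"
  proof
    show "vacuum_vertex_structure c1 c2 (fst (vacuum_act c1 c2 (gen (Lgen (- 1))), V.Y))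
        (snd (vacuum_act c1 c2 (gen (Lgen (- 1))), V.Y))"
      unfolding fst_conv snd_conv by (rule vacuum_vertex_structure_Y)
    show "S = (vacuum_act c1 c2 (gen (Lgen (- 1))), V.Y)" if "vacuum_vertex_structure c1 c2 (fst S) (snd S)" for S
      using vacuum_vertex_structure_unique[OF that] by (simp only: prod_eq_iff fst_conv snd_conv)
  qed
  fix D Y and W :: "(complex, 'w) module" and P
  assume "vacuum_vertex_structure c1 c2 D Y" and WP: "superspace W P"
  \<comment> \<open>By uniqueness the arbitrary structure is the constructed one, so the results
    about the constructed operators apply to it.\<close>
  then have D: "D = vacuum_act c1 c2 (gen (Lgen (- 1)))" and Y: "Y = V.Y"
    using vacuum_vertex_structure_unique by blast+
  have W: "cvspace W" using WP by (simp add: superspace_def)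
  have unique: "Y' = smooth_mod.Y W \<rho> c1 c2"
    if \<rho>: "\<rho> \<in> smooth_structures c1 c2 W" and Y': "Y' \<in> vertex_module_structures c1 c2 D Y W P"
      "generating_fields c1 c2 W \<rho> Y'" for \<rho> Y'
  proof -
    interpret smooth_mod W \<rho> c1 c2 by (rule smooth_mod.intro) (rule \<rho>)
    show ?thesis
      using Y' V.linear_fields_Y V.generating_Y
      unfolding vertex_module_structures_def vertex_module_def Y
      by (intro Y_unique[of Y' V.Y]) blast+
  qed
  have module: "vertex_module (vacuum c1 c2) (vacuum_grading c1 c2) (vacuum_one c1 c2) D Y
      W P (\<rho> (gen (Lgen (- 1)))) (smooth_mod.Y W \<rho> c1 c2)" if "\<rho> \<in> smooth_structures c1 c2 W" for \<rho>
    unfolding D Y by (rule smooth_mod.vertex_module_Y[OF smooth_mod.intro[OF that] WP])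
  show "\<forall>\<rho> \<in> smooth_structures c1 c2 W.
      \<exists>!Y'. Y' \<in> vertex_module_structures c1 c2 D Y W P \<and> generating_fields c1 c2 W \<rho> Y'"
  proof
    fix \<rho> assume \<rho>: "\<rho> \<in> smooth_structures c1 c2 W"
    show "\<exists>!Y'. Y' \<in> vertex_module_structures c1 c2 D Y W P \<and> generating_fields c1 c2 W \<rho> Y'"
    proof (intro ex1I conjI)
      show "smooth_mod.Y W \<rho> c1 c2 \<in> vertex_module_structures c1 c2 D Y W P"
        unfolding vertex_module_structures_def using module[OF \<rho>] by blast
      show "generating_fields c1 c2 W \<rho> (smooth_mod.Y W \<rho> c1 c2)"
        by (rule smooth_mod.generating_Y[OF smooth_mod.intro[OF \<rho>]])
    qed (use unique[OF \<rho>] in blast)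
  qed
  show "\<forall>Y' \<in> vertex_module_structures c1 c2 D Y W P.
      \<exists>!\<rho>. \<rho> \<in> smooth_structures c1 c2 W \<and> generating_fields c1 c2 W \<rho> Y'"
  proof
    fix Y' assume "Y' \<in> vertex_module_structures c1 c2 D Y W P"
    then obtain d where "vertex_module (vacuum c1 c2) (vacuum_grading c1 c2) (vacuum_one c1 c2)
        (vacuum_act c1 c2 (gen (Lgen (- 1)))) V.Y W P d Y'"
      unfolding vertex_module_structures_def D Y by blast
    then have "vertex_mod W Y' c1 c2"
      unfolding vertex_module_def derivative_property_def
      by (intro vertex_mod.intro cvs.intro vertex_mod_axioms.intro W) blast+
    from vertex_mod.smooth_structure_exists[OF this] smooth_structure_unique[of _ c1 c2 W _ Y']
    show "\<exists>!\<rho>. \<rho> \<in> smooth_structures c1 c2 W \<and> generating_fields c1 c2 W \<rho> Y'" by blast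
  qed
  show "\<forall>\<rho> \<in> smooth_structures c1 c2 W. \<forall>Y' \<in> vertex_module_structures c1 c2 D Y W P.
      generating_fields c1 c2 W \<rho> Y' \<longrightarrow>
        vertex_module (vacuum c1 c2) (vacuum_grading c1 c2) (vacuum_one c1 c2) D Y W P (\<rho> (gen (Lgen (- 1)))) Y' \<and>
        (parity_preserving_action P \<rho> \<longleftrightarrow>
          parity_preserving_fields (vacuum c1 c2) (vacuum_grading c1 c2) P Y')"
  proof (intro ballI impI)
    fix \<rho> Y'
    assume \<rho>: "\<rho> \<in> smooth_structures c1 c2 W"
      and Y': "Y' \<in> vertex_module_structures c1 c2 D Y W P" "generating_fields c1 c2 W \<rho> Y'"
    have "graded_smooth_mod W \<rho> c1 c2 P"
      by (intro graded_smooth_mod.intro smooth_mod.intro graded_smooth_mod_axioms.intro \<rho> WP)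
    from graded_smooth_mod.parity_preserving_iff[OF this]
    show "vertex_module (vacuum c1 c2) (vacuum_grading c1 c2) (vacuum_one c1 c2) D Y W P (\<rho> (gen (Lgen (- 1)))) Y' \<and>
        (parity_preserving_action P \<rho> \<longleftrightarrow>
          parity_preserving_fields (vacuum c1 c2) (vacuum_grading c1 c2) P Y')"
      unfolding unique[OF \<rho> Y'] using module[OF \<rho>] by (intro conjI)
  qed
qed

end
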